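(* Let $R=\Pi'\boxtimes U$ be an irreducible (finite-dimensional) $\mathfrak d'\oplus\mathfrak{sp}\,\mathfrak d$-module. If $U$ is neither trivial nor isomorphic to one of the fundamental representations $R(\pi_i)$, $i=1,\dots,N$, then the $H(\mathfrak d,\chi,\omega)$-tensor module $\mathcal V(\Pi',U)$ is irreducible.
   Context: Let $\mathbf k$ be an algebraically closed field of characteristic $0$; vector spaces and tensor products are over $\mathbf k$ unless indicated. Let $\mathfrak d$ be a Lie algebra of dimension $2N$, $N\ge 1$, and $H=U(\mathfrak d)$ with its standard cocommutative Hopf algebra structure (coproduct $\Delta$). Let $\chi\in\mathfrak d^*$ satisfy $\chi([\mathfrak d,\mathfrak d])=0$ (a "trace form"), and let $\omega\in\bigwedge^2\mathfrak d^*$ be non-degenerate with $\bigl(\omega([a_1,a_2]\wedge a_3)-\chi(a_1)\omega(a_2\wedge a_3)\bigr)+\text{cyclic}=0$ for all $a_1,a_2,a_3\in\mathfrak d$. Fix a basis $\partial_1,\dots,\partial_{2N}$ of $\mathfrak d$ with dual basis $x^1,\dots,x^{2N}$ of $\mathfrak d^*$; put $\omega_{ij}=\omega(\partial_i\wedge\partial_j)$, let $(r^{ij})$ be the inverse matrix of $(\omega_{ij})$, $\partial^i=\sum_k r^{ik}\partial_k$ (so $\omega(\partial^i\wedge\partial_j)=\delta^i_j$), and $\bar\partial=\partial-\chi(\partial)\in H$ for $\partial\in\mathfrak d$. The Lie pseudoalgebra $L=H(\mathfrak d,\chi,\omega)$ is the free $H$-module $He$ with pseudobracket determined by $[e*e]=\sum_i(\bar\partial_i\otimes\bar\partial^i)\otimes_H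 e\in(H\otimes H)\otimes_H He$ ($H$ acts on $H\otimes H$ on the right via $\Delta$), extended $H$-bilinearly. An $L$-module is a left $H$-module $V$ with a map $L\otimes V\to(H\otimes H)\otimes_HV$, $a\otimes v\mapsto a*v$, which is $H$-bilinear ($(fa)*(gv)=((f\otimes g)\otimes_H1)(a*v)$) and satisfies $[a*b]*v=a*(b*v)-((\sigma\otimes\mathrm{id})\otimes_H\mathrm{id})(b*(a*v))$, $\sigma$ the flip, where iterated products lie in $H^{\otimes3}\otimes_HV$ and are given by $(h\otimes_Ha)*v=\sum_i(h\otimes1)(\Delta\otimes\mathrm{id})(g_i)\otimes_Hv_i$ and $b*(h\otimes_Hv)=\sum_i(1\otimes h)(\mathrm{id}\otimes\Delta)(g_i)\otimes_Hv_i$ when $a*v$, resp. $b*v$, equals $\sum_ig_i\otimes_Hv_i$. A submodule is an $H$-submodule $W$ with $L*W\subset(H\otimes H)\otimes_HW$; $V$ is irreducible if it has no non-zero proper submodules and $L*V\ne0$. Let $\mathfrak{sp}\,\mathfrak d=\{A\in\mathfrak{gl}\,\mathfrak d:\omega(Aa\wedge b)+\omega(a\wedge Ab)=0\}$. Identify $\mathrm{End}\,\mathfrak d=\mathfrak d\otimes\mathfrak d^*$, put $e^{ij}=\partial^i\otimes x^j$ and $f^{ij}=-\frac12(e^{ij}+e^{ji})\in\mathfrak{sp}\,\mathfrak d$. For $\partial\in\mathfrak d$, $\mathrm{ad}^{\mathfrak{sp}}\partial\in\mathfrak{sp}\,\mathfrak d$ is the image of $\mathrm{ad}\,\partial+\partial\otimes\chi$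 under the projection $\mathfrak{gl}\,\mathfrak d\to\mathfrak{sp}\,\mathfrak d$, $e^{ij}\mapsto-f^{ij}$. $R(\pi_n)$ is the irreducible $\mathfrak{sp}\,\mathfrak d$-module whose highest weight is the $n$-th fundamental weight $\pi_n$. Let $\mathfrak d'=\{\hat a:a\in\mathfrak d\}\oplus\mathbf kc$ be the Lie algebra with $[\hat a,c]=\chi(a)c$, $[\hat a,\hat b]=\widehat{[a,b]}+\omega(a\wedge b)c$. For a finite-dimensional $\mathfrak d'\oplus\mathfrak{sp}\,\mathfrak d$-module $R$, the tensor module $\mathcal V(R)$ is $H\otimes R$ with $H$ acting by left multiplication and, for $v\in R$, $$e*(1\otimes v)=\sum_{i,j}(\bar\partial_i\bar\partial_j\otimes1)\otimes_H(1\otimes f^{ij}v)-\sum_k(\bar\partial_k\otimes1)\otimes_H\bigl(1\otimes(\widehat{\partial^k}+\mathrm{ad}^{\mathfrak{sp}}\partial^k)v-\partial^k\otimes v\bigr)+(1\otimes1)\otimes_H(1\otimes cv).$$ For a $\mathfrak d'$-module $\Pi'$ and an $\mathfrak{sp}\,\mathfrak d$-module $U$, $\mathcal V(\Pi',U)=\mathcal V(\Pi'\boxtimes U)$. *)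

theory Defs
  imports
    "HOL-Library.Poly_Mapping"
    "HOL-Library.Function_Algebras"
    "HOL-Library.Product_Plus"
    "HOL-Computational_Algebra.Polynomial"
begin

section \<open>Generators and relations, tensor products\<close>

text \<open>
  Quotients such as \<open>U(d)\<close>, \<open>A \<otimes> B\<close> or \<open>(H \<otimes> H) \<otimes>\<^sub>H V\<close> depend on structure maps and therefore
  cannot be introduced as types.  They appear instead as arbitrary types together with the proof
  that they are the quotient of the free vector space on the usual symbols by the usual relations;
  this determines them up to unique isomorphism.
\<close>

definition gen :: "'x \<Rightarrow> ('x \<Rightarrow>\<^sub>0 'k::field)" where
  "gen x = Poly_Mapping.single x 1"

definition free_scale :: "'k::field \<Rightarrow> ('x \<Rightarrow>\<^sub>0 'k) \<Rightarrow> ('x \<Rightarrow>\<^sub>0 'k)" where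
  "free_scale c p = Poly_Mapping.map ((*) c) p"

definition lin_ext :: "('k::field \<Rightarrow> 'c::ab_group_add \<Rightarrow> 'c) \<Rightarrow> ('x \<Rightarrow> 'c) \<Rightarrow> ('x \<Rightarrow>\<^sub>0 'k) \<Rightarrow> 'c" where
  "lin_ext s g p = (\<Sum>x\<in>Poly_Mapping.keys p. s (Poly_Mapping.lookup p x) (g x))"

definition presented_by ::
  "('k::field \<Rightarrow> 'c::ab_group_add \<Rightarrow> 'c) \<Rightarrow> ('x \<Rightarrow> 'c) \<Rightarrow> ('x \<Rightarrow>\<^sub>0 'k) set \<Rightarrow> bool" where
  "presented_by s g K \<longleftrightarrow>
     vector_space s \<and> surj (lin_ext s g) \<and> {p. lin_ext s g p = 0} = module.span free_scale K"

definition tensor_rels ::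
  "('k::field \<Rightarrow> 'a::ab_group_add \<Rightarrow> 'a) \<Rightarrow> ('k \<Rightarrow> 'b::ab_group_add \<Rightarrow> 'b) \<Rightarrow> ('a \<times> 'b \<Rightarrow>\<^sub>0 'k) set" where
  "tensor_rels sA sB =
     {gen (a + a', b) - gen (a, b) - gen (a', b) | a a' b. True} \<union>
     {gen (a, b + b') - gen (a, b) - gen (a, b') | a b b'. True} \<union>
     {gen (sA c a, b) - free_scale c (gen (a, b)) | c a b. True} \<union>
     {gen (a, sB c b) - free_scale c (gen (a, b)) | c a b. True}"

definition tensor_product ::
  "('k::field \<Rightarrow> 'a::ab_group_add \<Rightarrow> 'a) \<Rightarrow> ('k \<Rightarrow> 'b::ab_group_add \<Rightarrow> 'b) \<Rightarrow>
   ('k \<Rightarrow> 'c::ab_group_add \<Rightarrow> 'c) \<Rightarrow> ('a \<Rightarrow> 'b \<Rightarrow> 'c) \<Rightarrow> bool" where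
  "tensor_product sA sB sC t \<longleftrightarrow>
     vector_space sA \<and> vector_space sB \<and> presented_by sC (\<lambda>(a, b). t a b) (tensor_rels sA sB)"

text \<open>\<open>M \<otimes>\<^sub>H V\<close> for a right \<open>H\<close>-action \<open>r\<close> on \<open>M\<close> and a left \<open>H\<close>-action \<open>l\<close> on \<open>V\<close>.\<close>

definition balanced_tensor_product ::
  "('k::field \<Rightarrow> 'm::ab_group_add \<Rightarrow> 'm) \<Rightarrow> ('m \<Rightarrow> 'h \<Rightarrow> 'm) \<Rightarrow>
   ('k \<Rightarrow> 'v::ab_group_add \<Rightarrow> 'v) \<Rightarrow> ('h \<Rightarrow> 'v \<Rightarrow> 'v) \<Rightarrow>
   ('k \<Rightarrow> 'w::ab_group_add \<Rightarrow> 'w) \<Rightarrow> ('m \<Rightarrow> 'v \<Rightarrow> 'w) \<Rightarrow> bool" where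
  "balanced_tensor_product sM r sV l sW t \<longleftrightarrow>
     vector_space sM \<and> vector_space sV \<and>
     presented_by sW (\<lambda>(m, v). t m v)
       (tensor_rels sM sV \<union> {gen (r m h, v) - gen (m, l h v) | m h v. True})"

text \<open>The linear map out of a tensor product with prescribed values on pure tensors.  It is only
  used for prescriptions that respect the defining relations, so that it exists and is unique.\<close>

definition tensor_lift ::
  "('k::field \<Rightarrow> 'c::ab_group_add \<Rightarrow> 'c) \<Rightarrow> ('k \<Rightarrow> 'z::ab_group_add \<Rightarrow> 'z) \<Rightarrow>
   ('a \<Rightarrow> 'b \<Rightarrow> 'c) \<Rightarrow> ('a \<Rightarrow> 'b \<Rightarrow> 'z) \<Rightarrow> 'c \<Rightarrow> 'z" where
  "tensor_lift sC sZ t \<phi> = (THE F. Vector_Spaces.linear sC sZ F \<and> (\<forall>a b. F (t a b) = \<phi> a b))"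

definition algebra_over :: "('k::field \<Rightarrow> 'a::ring_1 \<Rightarrow> 'a) \<Rightarrow> bool" where
  "algebra_over s \<longleftrightarrow>
     vector_space s \<and> (\<forall>c x y. s c x * y = s c (x * y) \<and> x * s c y = s c (x * y))"

definition tensor_algebra ::
  "('k::field \<Rightarrow> 'a::ring_1 \<Rightarrow> 'a) \<Rightarrow> ('k \<Rightarrow> 'b::ring_1 \<Rightarrow> 'b) \<Rightarrow>
   ('k \<Rightarrow> 'c::ring_1 \<Rightarrow> 'c) \<Rightarrow> ('a \<Rightarrow> 'b \<Rightarrow> 'c) \<Rightarrow> bool" where
  "tensor_algebra sA sB sC t \<longleftrightarrow>
     algebra_over sA \<and> algebra_over sB \<and> algebra_over sC \<and> tensor_product sA sB sC t \<and>
     t 1 1 = 1 \<and> (\<forall>a b a' b'. t a b * t a' b' = t (a * a') (b * b'))"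

definition finite_dim :: "('k::field \<Rightarrow> 'v::ab_group_add \<Rightarrow> 'v) \<Rightarrow> bool" where
  "finite_dim s \<longleftrightarrow> vector_space s \<and> (\<exists>B. finite B \<and> module.span s B = UNIV)"

section \<open>Lie algebras and their modules\<close>

record ('k, 'g) lie =
  lcarr :: "'g set"
  lscale :: "'k \<Rightarrow> 'g \<Rightarrow> 'g"
  lbr :: "'g \<Rightarrow> 'g \<Rightarrow> 'g"

definition lie_algebra :: "('k::field, 'g::ab_group_add) lie \<Rightarrow> bool" where
  "lie_algebra G \<longleftrightarrow>
     vector_space (lscale G) \<and> module.subspace (lscale G) (lcarr G) \<and>
     (\<forall>x\<in>lcarr G. \<forall>y\<in>lcarr G. lbr G x y \<in> lcarr G) \<and>
     (\<forall>x\<in>lcarr G. \<forall>y\<in>lcarr G. \<forall>z\<in>lcarr G.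
        lbr G (x + y) z = lbr G x z + lbr G y z \<and> lbr G z (x + y) = lbr G z x + lbr G z y) \<and>
     (\<forall>c. \<forall>x\<in>lcarr G. \<forall>y\<in>lcarr G.
        lbr G (lscale G c x) y = lscale G c (lbr G x y) \<and>
        lbr G x (lscale G c y) = lscale G c (lbr G x y)) \<and>
     (\<forall>x\<in>lcarr G. lbr G x x = 0) \<and>
     (\<forall>x\<in>lcarr G. \<forall>y\<in>lcarr G. \<forall>z\<in>lcarr G.
        lbr G (lbr G x y) z + lbr G (lbr G y z) x + lbr G (lbr G z x) y = 0)"

definition lie_sum ::
  "('k, 'g::ab_group_add) lie \<Rightarrow> ('k, 'f::ab_group_add) lie \<Rightarrow> ('k, 'g \<times> 'f) lie" where
  "lie_sum G F =
     \<lparr> lcarr = lcarr G \<times> lcarr F,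
       lscale = (\<lambda>c (x, y). (lscale G c x, lscale F c y)),
       lbr = (\<lambda>(x, y) (x', y'). (lbr G x x', lbr F y y')) \<rparr>"

definition lie_module ::
  "('k::field, 'g::ab_group_add) lie \<Rightarrow> ('k \<Rightarrow> 'm::ab_group_add \<Rightarrow> 'm) \<Rightarrow> ('g \<Rightarrow> 'm \<Rightarrow> 'm) \<Rightarrow> bool" where
  "lie_module G s \<rho> \<longleftrightarrow>
     vector_space s \<and>
     (\<forall>x\<in>lcarr G. Vector_Spaces.linear s s (\<rho> x)) \<and>
     (\<forall>x\<in>lcarr G. \<forall>y\<in>lcarr G. \<forall>m. \<rho> (x + y) m = \<rho> x m + \<rho> y m) \<and>
     (\<forall>c. \<forall>x\<in>lcarr G. \<forall>m. \<rho> (lscale G c x) m = s c (\<rho> x m)) \<and>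
     (\<forall>x\<in>lcarr G. \<forall>y\<in>lcarr G. \<forall>m. \<rho> (lbr G x y) m = \<rho> x (\<rho> y m) - \<rho> y (\<rho> x m))"

definition irreducible_lie_module ::
  "('k::field, 'g::ab_group_add) lie \<Rightarrow> ('k \<Rightarrow> 'm::ab_group_add \<Rightarrow> 'm) \<Rightarrow> ('g \<Rightarrow> 'm \<Rightarrow> 'm) \<Rightarrow> bool" where
  "irreducible_lie_module G s \<rho> \<longleftrightarrow>
     lie_module G s \<rho> \<and> (\<exists>m::'m. m \<noteq> 0) \<and>
     (\<forall>W. module.subspace s W \<and> (\<forall>x\<in>lcarr G. \<forall>m\<in>W. \<rho> x m \<in> W) \<longrightarrow> W = {0} \<or> W = UNIV)"

definition trivial_lie_module ::
  "('k, 'g) lie \<Rightarrow> ('g \<Rightarrow> 'm::ab_group_add \<Rightarrow> 'm) \<Rightarrow> bool" where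
  "trivial_lie_module G \<rho> \<longleftrightarrow> (\<forall>x\<in>lcarr G. \<forall>m. \<rho> x m = 0)"

text \<open>The action of \<open>G \<oplus> F\<close> on \<open>P \<boxtimes> U\<close>, where \<open>(sR, t)\<close> is a tensor product of \<open>P\<close> and \<open>U\<close>.\<close>

definition box_action ::
  "('k::field \<Rightarrow> 'r::ab_group_add \<Rightarrow> 'r) \<Rightarrow> ('p \<Rightarrow> 'u \<Rightarrow> 'r) \<Rightarrow>
   ('g \<Rightarrow> 'p \<Rightarrow> 'p) \<Rightarrow> ('f \<Rightarrow> 'u \<Rightarrow> 'u) \<Rightarrow> 'g \<times> 'f \<Rightarrow> 'r \<Rightarrow> 'r" where
  "box_action sR t \<pi> \<rho> = (\<lambda>(x, A). tensor_lift sR sR t (\<lambda>p u. t (\<pi> x p) u + t p (\<rho> A u)))"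

section \<open>The data \<open>(d, \<chi>, \<omega>)\<close> with a basis\<close>

text \<open>\<open>om S a b\<close> is \<open>\<omega>(a \<and> b)\<close>; the basis vectors \<open>dl S i\<close> and the matrix entries \<open>rr S i j\<close> are
  meaningful for indices in \<open>{1..2 * half S}\<close>.\<close>

record ('k, 'd) symplectic =
  half :: nat
  dscale :: "'k \<Rightarrow> 'd \<Rightarrow> 'd"
  dbr :: "'d \<Rightarrow> 'd \<Rightarrow> 'd"
  chi :: "'d \<Rightarrow> 'k"
  om :: "'d \<Rightarrow> 'd \<Rightarrow> 'k"
  dl :: "nat \<Rightarrow> 'd"
  rr :: "nat \<Rightarrow> nat \<Rightarrow> 'k"

abbreviation idx :: "('k, 'd) symplectic \<Rightarrow> nat set" where
  "idx S \<equiv> {1..2 * half S}"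

definition lie_d :: "('k, 'd) symplectic \<Rightarrow> ('k, 'd) lie" where
  "lie_d S = \<lparr> lcarr = UNIV, lscale = dscale S, lbr = dbr S \<rparr>"

definition symplectic_data :: "('k::field, 'd::ab_group_add) symplectic \<Rightarrow> bool" where
  "symplectic_data S \<longleftrightarrow>
     half S \<ge> 1 \<and> lie_algebra (lie_d S) \<and>
     inj_on (dl S) (idx S) \<and> \<not> module.dependent (dscale S) (dl S ` idx S) \<and>
     module.span (dscale S) (dl S ` idx S) = UNIV \<and>
     Vector_Spaces.linear (dscale S) (*) (chi S) \<and> (\<forall>a b. chi S (dbr S a b) = 0) \<and>
     (\<forall>b. Vector_Spaces.linear (dscale S) (*) (\<lambda>a. om S a b)) \<and>
     (\<forall>a. Vector_Spaces.linear (dscale S) (*) (om S a)) \<and>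
     (\<forall>a. om S a a = 0) \<and>
     (\<forall>a. (\<forall>b. om S a b = 0) \<longrightarrow> a = 0) \<and>
     (\<forall>a1 a2 a3.
        (om S (dbr S a1 a2) a3 - chi S a1 * om S a2 a3) +
        (om S (dbr S a2 a3) a1 - chi S a2 * om S a3 a1) +
        (om S (dbr S a3 a1) a2 - chi S a3 * om S a1 a2) = 0) \<and>
     (\<forall>i\<in>idx S. \<forall>j\<in>idx S.
        (\<Sum>k\<in>idx S. rr S i k * om S (dl S k) (dl S j)) = (if i = j then 1 else 0) \<and>
        (\<Sum>k\<in>idx S. om S (dl S i) (dl S k) * rr S k j) = (if i = j then 1 else 0))"

definition coord :: "('k::field, 'd::ab_group_add) symplectic \<Rightarrow> nat \<Rightarrow> 'd \<Rightarrow> 'k" where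
  "coord S j v = module.representation (dscale S) (dl S ` idx S) v (dl S j)"

definition du :: "('k::field, 'd::ab_group_add) symplectic \<Rightarrow> nat \<Rightarrow> 'd" where
  "du S i = (\<Sum>k\<in>idx S. dscale S (rr S i k) (dl S k))"

definition e_op :: "('k::field, 'd::ab_group_add) symplectic \<Rightarrow> nat \<Rightarrow> nat \<Rightarrow> 'd \<Rightarrow> 'd" where
  "e_op S i j = (\<lambda>v. dscale S (coord S j v) (du S i))"

definition f_op :: "('k::field, 'd::ab_group_add) symplectic \<Rightarrow> nat \<Rightarrow> nat \<Rightarrow> 'd \<Rightarrow> 'd" where
  "f_op S i j = (\<lambda>v. dscale S (- 1 / 2) (e_op S i j v + e_op S j i v))"

definition sp :: "('k::field, 'd::ab_group_add) symplectic \<Rightarrow> ('d \<Rightarrow> 'd) set" where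
  "sp S = {A. Vector_Spaces.linear (dscale S) (dscale S) A \<and>
              (\<forall>a b. om S (A a) b + om S a (A b) = 0)}"

definition lie_sp :: "('k::field, 'd::ab_group_add) symplectic \<Rightarrow> ('k, 'd \<Rightarrow> 'd) lie" where
  "lie_sp S = \<lparr> lcarr = sp S, lscale = (\<lambda>c A v. dscale S c (A v)),
                lbr = (\<lambda>A B v. A (B v) - B (A v)) \<rparr>"

text \<open>The projection \<open>e\<^sup>i\<^sup>j \<mapsto> - f\<^sup>i\<^sup>j\<close>.  The coefficient of \<open>e\<^sup>i\<^sup>j\<close> in an endomorphism \<open>A\<close> is the
  coefficient of \<open>\<partial>\<^sup>i\<close> in \<open>A \<partial>\<^sub>j\<close>, that is \<open>\<omega>(A \<partial>\<^sub>j \<and> \<partial>\<^sub>i)\<close>.\<close>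

definition sp_proj :: "('k::field, 'd::ab_group_add) symplectic \<Rightarrow> ('d \<Rightarrow> 'd) \<Rightarrow> 'd \<Rightarrow> 'd" where
  "sp_proj S A = (\<lambda>v. \<Sum>i\<in>idx S. \<Sum>j\<in>idx S.
     dscale S (om S (A (dl S j)) (dl S i)) (- f_op S i j v))"

definition ad_sp :: "('k::field, 'd::ab_group_add) symplectic \<Rightarrow> 'd \<Rightarrow> 'd \<Rightarrow> 'd" where
  "ad_sp S a = sp_proj S (\<lambda>v. dbr S a v + dscale S (chi S v) a)"

text \<open>\<open>d'\<close> is realised on \<open>'d \<times> 'k\<close>, the pair \<open>(a, t)\<close> standing for \<open>hat a + t c\<close>.\<close>

definition lie_d' :: "('k::field, 'd::ab_group_add) symplectic \<Rightarrow> ('k, 'd \<times> 'k) lie" where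
  "lie_d' S =
     \<lparr> lcarr = UNIV,
       lscale = (\<lambda>z (a, t). (dscale S z a, z * t)),
       lbr = (\<lambda>(a, s) (b, t). (dbr S a b, om S a b + t * chi S a - s * chi S b)) \<rparr>"

definition hat :: "'d \<Rightarrow> 'd \<times> 'k::field" where "hat a = (a, 0)"

definition cc :: "'d::ab_group_add \<times> 'k::field" where "cc = (0, 1)"

abbreviation lie_d'_sp ::
  "('k::field, 'd::ab_group_add) symplectic \<Rightarrow> ('k, ('d \<times> 'k) \<times> ('d \<Rightarrow> 'd)) lie" where
  "lie_d'_sp S \<equiv> lie_sum (lie_d' S) (lie_sp S)"

lemma sp_proj_e_op:
  fixes S :: "('k::field, 'd::ab_group_add) symplectic"
  assumes S: "symplectic_data S" and ij: "i \<in> idx S" "j \<in> idx S"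
  shows "sp_proj S (e_op S i j) = - f_op S i j"
proof
  fix v
  from S interpret vector_space "dscale S"
    by (simp add: symplectic_data_def lie_algebra_def lie_d_def)
  have ind: "independent (dl S ` idx S)" and inj: "inj_on (dl S) (idx S)"
    using S by (auto simp: symplectic_data_def)
  have lin: "Vector_Spaces.linear (dscale S) (*) (\<lambda>a. om S a b)" for b
    using S by (simp add: symplectic_data_def)
  have c: "coord S j (dl S k) = (if k = j then 1 else 0)" if "k \<in> idx S" for k
    using that ij inj representation_basis[OF ind, of "dl S k"]
    by (auto simp: coord_def inj_on_eq_iff)
  have o: "om S (dscale S z a) b = z * om S a b" for z a b
    using lin[of b] by (simp add: Vector_Spaces.linear_iff)
  have "om S (du S i) b = (\<Sum>k\<in>idx S. rr S i k * om S (dl S k) b)" for b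
  proof -
    interpret l: Vector_Spaces.linear "dscale S" "(*)" "\<lambda>a. om S a b" by (rule lin)
    show ?thesis by (simp add: du_def l.sum o)
  qed
  then have d: "om S (du S i) (dl S k) = (if i = k then 1 else 0)" if "k \<in> idx S" for k
    using S that ij by (simp add: symplectic_data_def)
  have "sp_proj S (e_op S i j) v =
      (\<Sum>k\<in>idx S. \<Sum>l\<in>idx S. if k = i then if l = j then - f_op S i j v else 0 else 0)"
    unfolding sp_proj_def
    by (intro sum.cong refl) (auto simp: e_op_def o c d)
  also have "\<dots> = - f_op S i j v"
    using ij by (simp add: sum.If_cases if_distrib[of "sum _"] sum.delta cong: if_cong)
  finally show "sp_proj S (e_op S i j) v = (- f_op S i j) v" by simp
qed

section \<open>Fundamental representations of \<open>sp d\<close>\<close>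

text \<open>A symplectic basis \<open>p\<^sub>1, \<dots>, p\<^sub>N, q\<^sub>1, \<dots>, q\<^sub>N\<close> fixes the Cartan subalgebra of the elements of
  \<open>sp d\<close> that are diagonal in it and, with \<open>p\<^sub>i\<close> of weight \<open>\<epsilon>\<^sub>i\<close>, the simple roots
  \<open>\<epsilon>\<^sub>i - \<epsilon>\<^sub>i\<^sub>+\<^sub>1\<close> (\<open>i < N\<close>) and \<open>2 \<epsilon>\<^sub>N\<close>.  All such choices are conjugate, and they give isomorphic
  representations for each dominant weight.\<close>

definition symplectic_basis ::
  "('k::field, 'd::ab_group_add) symplectic \<Rightarrow> (nat \<Rightarrow> 'd) \<Rightarrow> (nat \<Rightarrow> 'd) \<Rightarrow> bool" where
  "symplectic_basis S p q \<longleftrightarrow>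
     (\<forall>i\<in>{1..half S}. \<forall>j\<in>{1..half S}.
        om S (p i) (p j) = 0 \<and> om S (q i) (q j) = 0 \<and> om S (p i) (q j) = (if i = j then 1 else 0))"

text \<open>The span of the positive root spaces: the elements of \<open>sp d\<close> that are strictly upper
  triangular in the ordered basis \<open>p\<^sub>1, \<dots>, p\<^sub>N, q\<^sub>N, \<dots>, q\<^sub>1\<close>.\<close>

definition sp_pos ::
  "('k::field, 'd::ab_group_add) symplectic \<Rightarrow> (nat \<Rightarrow> 'd) \<Rightarrow> (nat \<Rightarrow> 'd) \<Rightarrow> ('d \<Rightarrow> 'd) set" where
  "sp_pos S p q = {A \<in> sp S. \<forall>i\<in>{1..half S}.
     A (p i) \<in> module.span (dscale S) (p ` {1..<i}) \<and>
     A (q i) \<in> module.span (dscale S) (p ` {1..half S} \<union> q ` {i<..half S})}"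

text \<open>\<open>sp_diag S p q i\<close> sends \<open>p\<^sub>i\<close> to \<open>p\<^sub>i\<close>, \<open>q\<^sub>i\<close> to \<open>- q\<^sub>i\<close>, and the other basis vectors to \<open>0\<close>.\<close>

definition sp_diag ::
  "('k::field, 'd::ab_group_add) symplectic \<Rightarrow> (nat \<Rightarrow> 'd) \<Rightarrow> (nat \<Rightarrow> 'd) \<Rightarrow> nat \<Rightarrow> 'd \<Rightarrow> 'd" where
  "sp_diag S p q i = (\<lambda>v. dscale S (om S v (q i)) (p i) + dscale S (om S v (p i)) (q i))"

definition simple_coroot ::
  "('k::field, 'd::ab_group_add) symplectic \<Rightarrow> (nat \<Rightarrow> 'd) \<Rightarrow> (nat \<Rightarrow> 'd) \<Rightarrow> nat \<Rightarrow> 'd \<Rightarrow> 'd" where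
  "simple_coroot S p q i =
     (if i < half S then sp_diag S p q i - sp_diag S p q (Suc i) else sp_diag S p q i)"

text \<open>\<open>(sU, \<rho>)\<close> is (a copy of) \<open>R(\<pi>\<^sub>n)\<close>: it is irreducible with a highest weight vector on which the
  \<open>j\<close>-th simple coroot acts by \<open>\<pi>\<^sub>n(\<alpha>\<^sub>j\<^sup>\<or>) = \<delta>\<^sub>n\<^sub>j\<close>; the simple coroots span the Cartan
  subalgebra.\<close>

definition fundamental_representation ::
  "('k::field, 'd::ab_group_add) symplectic \<Rightarrow> nat \<Rightarrow>
   ('k \<Rightarrow> 'u::ab_group_add \<Rightarrow> 'u) \<Rightarrow> (('d \<Rightarrow> 'd) \<Rightarrow> 'u \<Rightarrow> 'u) \<Rightarrow> bool" where
  "fundamental_representation S n sU \<rho> \<longleftrightarrow>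
     irreducible_lie_module (lie_sp S) sU \<rho> \<and> finite_dim sU \<and>
     (\<exists>p q u. symplectic_basis S p q \<and> u \<noteq> 0 \<and> (\<forall>A\<in>sp_pos S p q. \<rho> A u = 0) \<and>
        (\<forall>j\<in>{1..half S}. \<rho> (simple_coroot S p q j) u = (if j = n then u else 0)))"

section \<open>Enveloping algebras\<close>

text \<open>\<open>H\<close>, the structure map \<open>d \<rightarrow> H\<close>, and the algebras \<open>H \<otimes> H\<close> and
  \<open>H \<otimes> H \<otimes> H = (H \<otimes> H) \<otimes> H\<close>.\<close>

record ('k, 'd, 'h, 'hh, 'hhh) env =
  hscale :: "'k \<Rightarrow> 'h \<Rightarrow> 'h"
  iota :: "'d \<Rightarrow> 'h"
  hhscale :: "'k \<Rightarrow> 'hh \<Rightarrow> 'hh"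
  htens :: "'h \<Rightarrow> 'h \<Rightarrow> 'hh"
  hhhscale :: "'k \<Rightarrow> 'hhh \<Rightarrow> 'hhh"
  hhtens :: "'hh \<Rightarrow> 'h \<Rightarrow> 'hhh"

text \<open>Words over \<open>d\<close> span the free algebra on \<open>d\<close>; the span of these elements is the two-sided ideal
  that identifies the operations of the vector space \<open>d\<close> and sets \<open>x y - y x = [x, y]\<close>.\<close>

definition env_rels :: "('k::field, 'd::ab_group_add) lie \<Rightarrow> ('d list \<Rightarrow>\<^sub>0 'k) set" where
  "env_rels G =
     {gen (u @ [x + y] @ w) - gen (u @ [x] @ w) - gen (u @ [y] @ w) | u w x y. True} \<union>
     {gen (u @ [lscale G c x] @ w) - free_scale c (gen (u @ [x] @ w)) | u w c x. True} \<union>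
     {gen (u @ [x, y] @ w) - gen (u @ [y, x] @ w) - gen (u @ [lbr G x y] @ w) | u w x y. True}"

definition enveloping_algebra ::
  "('k::field, 'd::ab_group_add) lie \<Rightarrow>
   ('k, 'd, 'h::ring_1, 'hh::ring_1, 'hhh::ring_1) env \<Rightarrow> bool" where
  "enveloping_algebra G E \<longleftrightarrow>
     algebra_over (hscale E) \<and>
     presented_by (hscale E) (\<lambda>w. prod_list (map (iota E) w)) (env_rels G) \<and>
     tensor_algebra (hscale E) (hscale E) (hhscale E) (htens E) \<and>
     tensor_algebra (hhscale E) (hscale E) (hhhscale E) (hhtens E)"

definition coprod ::
  "('k::field, 'd, 'h::ring_1, 'hh::ring_1, 'hhh::ring_1) env \<Rightarrow> 'h \<Rightarrow> 'hh" where
  "coprod E = (THE F. Vector_Spaces.linear (hscale E) (hhscale E) F \<and>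
     F 1 = 1 \<and> (\<forall>x y. F (x * y) = F x * F y) \<and>
     (\<forall>a. F (iota E a) = htens E (iota E a) 1 + htens E 1 (iota E a)))"

definition flip ::
  "('k::field, 'd, 'h::ring_1, 'hh::ring_1, 'hhh::ring_1) env \<Rightarrow> 'hh \<Rightarrow> 'hh" where
  "flip E = tensor_lift (hhscale E) (hhscale E) (htens E) (\<lambda>f g. htens E g f)"

text \<open>\<open>x \<mapsto> 1 \<otimes> x\<close>, from \<open>H \<otimes> H\<close> to \<open>H \<otimes> H \<otimes> H\<close>.\<close>

definition one_tens ::
  "('k::field, 'd, 'h::ring_1, 'hh::ring_1, 'hhh::ring_1) env \<Rightarrow> 'hh \<Rightarrow> 'hhh" where
  "one_tens E = tensor_lift (hhscale E) (hhhscale E) (htens E) (\<lambda>f g. hhtens E (htens E 1 f) g)"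

definition coprod_id ::
  "('k::field, 'd, 'h::ring_1, 'hh::ring_1, 'hhh::ring_1) env \<Rightarrow> 'hh \<Rightarrow> 'hhh" where
  "coprod_id E = tensor_lift (hhscale E) (hhhscale E) (htens E) (\<lambda>f g. hhtens E (coprod E f) g)"

definition id_coprod ::
  "('k::field, 'd, 'h::ring_1, 'hh::ring_1, 'hhh::ring_1) env \<Rightarrow> 'hh \<Rightarrow> 'hhh" where
  "id_coprod E = tensor_lift (hhscale E) (hhhscale E) (htens E)
     (\<lambda>f g. hhtens E (htens E f 1) 1 * one_tens E (coprod E g))"

definition flip_id ::
  "('k::field, 'd, 'h::ring_1, 'hh::ring_1, 'hhh::ring_1) env \<Rightarrow> 'hhh \<Rightarrow> 'hhh" where
  "flip_id E = tensor_lift (hhhscale E) (hhhscale E) (hhtens E) (\<lambda>x g. hhtens E (flip E x) g)"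

section \<open>Modules over Lie pseudoalgebras\<close>

text \<open>A left \<open>H\<close>-module \<open>M\<close> bundled with \<open>(H \<otimes> H) \<otimes>\<^sub>H M\<close> (\<open>scale2\<close>, \<open>tens2\<close>) and
  \<open>(H \<otimes> H \<otimes> H) \<otimes>\<^sub>H M\<close> (\<open>scale3\<close>, \<open>tens3\<close>).\<close>

record ('k, 'h, 'hh, 'hhh, 'm, 'm2, 'm3) hmod =
  scale1 :: "'k \<Rightarrow> 'm \<Rightarrow> 'm"
  hact :: "'h \<Rightarrow> 'm \<Rightarrow> 'm"
  scale2 :: "'k \<Rightarrow> 'm2 \<Rightarrow> 'm2"
  tens2 :: "'hh \<Rightarrow> 'm \<Rightarrow> 'm2"
  scale3 :: "'k \<Rightarrow> 'm3 \<Rightarrow> 'm3"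
  tens3 :: "'hhh \<Rightarrow> 'm \<Rightarrow> 'm3"

definition h_module ::
  "('k::field, 'd, 'h::ring_1, 'hh::ring_1, 'hhh::ring_1) env \<Rightarrow>
   ('k, 'h, 'hh, 'hhh, 'm::ab_group_add, 'm2::ab_group_add, 'm3::ab_group_add) hmod \<Rightarrow> bool" where
  "h_module E M \<longleftrightarrow>
     vector_space (scale1 M) \<and>
     (\<forall>h. Vector_Spaces.linear (scale1 M) (scale1 M) (hact M h)) \<and>
     (\<forall>m. Vector_Spaces.linear (hscale E) (scale1 M) (\<lambda>h. hact M h m)) \<and>
     (\<forall>m. hact M 1 m = m) \<and> (\<forall>g h m. hact M (g * h) m = hact M g (hact M h m)) \<and>
     balanced_tensor_product (hhscale E) (\<lambda>x h. x * coprod E h)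
       (scale1 M) (hact M) (scale2 M) (tens2 M) \<and>
     balanced_tensor_product (hhhscale E) (\<lambda>x h. x * coprod_id E (coprod E h))
       (scale1 M) (hact M) (scale3 M) (tens3 M)"

definition free_generator ::
  "('k, 'h, 'hh, 'hhh, 'm, 'm2, 'm3) hmod \<Rightarrow> 'm \<Rightarrow> bool" where
  "free_generator M e \<longleftrightarrow> (\<forall>m. \<exists>!h. m = hact M h e)"

text \<open>Left multiplication by \<open>g \<otimes>\<^sub>H 1\<close> on \<open>(H \<otimes> H) \<otimes>\<^sub>H M\<close>.\<close>

definition lmult2 ::
  "('k::field, 'h, 'hh::ring_1, 'hhh, 'm, 'm2::ab_group_add, 'm3) hmod \<Rightarrow> 'hh \<Rightarrow> 'm2 \<Rightarrow> 'm2" where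
  "lmult2 M g = tensor_lift (scale2 M) (scale2 M) (tens2 M) (\<lambda>g' m. tens2 M (g * g') m)"

text \<open>An \<open>H\<close>-bilinear map \<open>L \<otimes> M \<rightarrow> (H \<otimes> H) \<otimes>\<^sub>H M\<close>.\<close>

definition h_bilinear ::
  "('k::field, 'd, 'h::ring_1, 'hh::ring_1, 'hhh::ring_1) env \<Rightarrow>
   ('k, 'h, 'hh, 'hhh, 'l::ab_group_add, 'l2::ab_group_add, 'l3::ab_group_add) hmod \<Rightarrow>
   ('k, 'h, 'hh, 'hhh, 'm::ab_group_add, 'm2::ab_group_add, 'm3::ab_group_add) hmod \<Rightarrow>
   ('l \<Rightarrow> 'm \<Rightarrow> 'm2) \<Rightarrow> bool" where
  "h_bilinear E L M act \<longleftrightarrow>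
     (\<forall>a. Vector_Spaces.linear (scale1 M) (scale2 M) (act a)) \<and>
     (\<forall>m. Vector_Spaces.linear (scale1 L) (scale2 M) (\<lambda>a. act a m)) \<and>
     (\<forall>f g a m. act (hact L f a) (hact M g m) = lmult2 M (htens E f g) (act a m))"

text \<open>\<open>X * m\<close> for \<open>X \<in> (H \<otimes> H) \<otimes>\<^sub>H L\<close>, and \<open>b * Y\<close> for \<open>Y \<in> (H \<otimes> H) \<otimes>\<^sub>H M\<close>.\<close>

definition act_left ::
  "('k::field, 'd, 'h::ring_1, 'hh::ring_1, 'hhh::ring_1) env \<Rightarrow>
   ('k, 'h, 'hh, 'hhh, 'l::ab_group_add, 'l2::ab_group_add, 'l3::ab_group_add) hmod \<Rightarrow>
   ('k, 'h, 'hh, 'hhh, 'm::ab_group_add, 'm2::ab_group_add, 'm3::ab_group_add) hmod \<Rightarrow>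
   ('l \<Rightarrow> 'm \<Rightarrow> 'm2) \<Rightarrow> 'l2 \<Rightarrow> 'm \<Rightarrow> 'm3" where
  "act_left E L M act X m =
     tensor_lift (scale2 L) (scale3 M) (tens2 L)
       (\<lambda>h a. tensor_lift (scale2 M) (scale3 M) (tens2 M)
          (\<lambda>g m'. tens3 M (hhtens E h 1 * coprod_id E g) m') (act a m)) X"

definition act_right ::
  "('k::field, 'd, 'h::ring_1, 'hh::ring_1, 'hhh::ring_1) env \<Rightarrow>
   ('k, 'h, 'hh, 'hhh, 'm::ab_group_add, 'm2::ab_group_add, 'm3::ab_group_add) hmod \<Rightarrow>
   ('l \<Rightarrow> 'm \<Rightarrow> 'm2) \<Rightarrow> 'l \<Rightarrow> 'm2 \<Rightarrow> 'm3" where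
  "act_right E M act b Y =
     tensor_lift (scale2 M) (scale3 M) (tens2 M)
       (\<lambda>h m. tensor_lift (scale2 M) (scale3 M) (tens2 M)
          (\<lambda>g m'. tens3 M (one_tens E h * id_coprod E g) m') (act b m)) Y"

definition flip3 ::
  "('k::field, 'd, 'h::ring_1, 'hh::ring_1, 'hhh::ring_1) env \<Rightarrow>
   ('k, 'h, 'hh, 'hhh, 'm::ab_group_add, 'm2::ab_group_add, 'm3::ab_group_add) hmod \<Rightarrow>
   'm3 \<Rightarrow> 'm3" where
  "flip3 E M = tensor_lift (scale3 M) (scale3 M) (tens3 M) (\<lambda>x m. tens3 M (flip_id E x) m)"

definition pseudo_module ::
  "('k::field, 'd, 'h::ring_1, 'hh::ring_1, 'hhh::ring_1) env \<Rightarrow>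
   ('k, 'h, 'hh, 'hhh, 'l::ab_group_add, 'l2::ab_group_add, 'l3::ab_group_add) hmod \<Rightarrow>
   ('l \<Rightarrow> 'l \<Rightarrow> 'l2) \<Rightarrow>
   ('k, 'h, 'hh, 'hhh, 'm::ab_group_add, 'm2::ab_group_add, 'm3::ab_group_add) hmod \<Rightarrow>
   ('l \<Rightarrow> 'm \<Rightarrow> 'm2) \<Rightarrow> bool" where
  "pseudo_module E L br M act \<longleftrightarrow>
     h_module E M \<and> h_bilinear E L M act \<and>
     (\<forall>a b m. act_left E L M act (br a b) m =
        act_right E M act a (act b m) - flip3 E M (act_right E M act b (act a m)))"

definition pseudo_submodule ::
  "('k::field, 'h, 'hh, 'hhh, 'm::ab_group_add, 'm2::ab_group_add, 'm3) hmod \<Rightarrow>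
   ('l \<Rightarrow> 'm \<Rightarrow> 'm2) \<Rightarrow> 'm set \<Rightarrow> bool" where
  "pseudo_submodule M act W \<longleftrightarrow>
     module.subspace (scale1 M) W \<and> (\<forall>h. \<forall>w\<in>W. hact M h w \<in> W) \<and>
     (\<forall>a. \<forall>w\<in>W. act a w \<in> module.span (scale2 M) {tens2 M g w' | g w'. w' \<in> W})"

definition irreducible_pseudo_module ::
  "('k::field, 'd, 'h::ring_1, 'hh::ring_1, 'hhh::ring_1) env \<Rightarrow>
   ('k, 'h, 'hh, 'hhh, 'l::ab_group_add, 'l2::ab_group_add, 'l3::ab_group_add) hmod \<Rightarrow>
   ('l \<Rightarrow> 'l \<Rightarrow> 'l2) \<Rightarrow>
   ('k, 'h, 'hh, 'hhh, 'm::ab_group_add, 'm2::ab_group_add, 'm3::ab_group_add) hmod \<Rightarrow>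
   ('l \<Rightarrow> 'm \<Rightarrow> 'm2) \<Rightarrow> bool" where
  "irreducible_pseudo_module E L br M act \<longleftrightarrow>
     pseudo_module E L br M act \<and>
     (\<forall>W. pseudo_submodule M act W \<longrightarrow> W = {0} \<or> W = UNIV) \<and>
     (\<exists>a m. act a m \<noteq> 0)"

section \<open>\<open>H(d, \<chi>, \<omega>)\<close> and its tensor modules\<close>

definition bar ::
  "('k::field, 'd::ab_group_add) symplectic \<Rightarrow>
   ('k, 'd, 'h::ring_1, 'hh::ring_1, 'hhh::ring_1) env \<Rightarrow> 'd \<Rightarrow> 'h" where
  "bar S E a = iota E a - hscale E (chi S a) 1"

definition pseudoalgebra_H ::
  "('k::field, 'd::ab_group_add) symplectic \<Rightarrow>
   ('k, 'd, 'h::ring_1, 'hh::ring_1, 'hhh::ring_1) env \<Rightarrow>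
   ('k, 'h, 'hh, 'hhh, 'l::ab_group_add, 'l2::ab_group_add, 'l3::ab_group_add) hmod \<Rightarrow>
   'l \<Rightarrow> ('l \<Rightarrow> 'l \<Rightarrow> 'l2) \<Rightarrow> bool" where
  "pseudoalgebra_H S E L e br \<longleftrightarrow>
     h_module E L \<and> free_generator L e \<and> h_bilinear E L L br \<and>
     br e e = (\<Sum>i\<in>idx S. tens2 L (htens E (bar S E (dl S i)) (bar S E (du S i))) e)"

text \<open>\<open>V = H \<otimes> R\<close> with pure tensors \<open>t h v\<close>, for a \<open>d' \<oplus> sp d\<close>-module \<open>(sR, \<rho>)\<close>.\<close>

definition tensor_module ::
  "('k::field, 'd::ab_group_add) symplectic \<Rightarrow>
   ('k, 'd, 'h::ring_1, 'hh::ring_1, 'hhh::ring_1) env \<Rightarrow>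
   ('k, 'h, 'hh, 'hhh, 'l::ab_group_add, 'l2::ab_group_add, 'l3::ab_group_add) hmod \<Rightarrow> 'l \<Rightarrow>
   ('k \<Rightarrow> 'r::ab_group_add \<Rightarrow> 'r) \<Rightarrow> (('d \<times> 'k) \<times> ('d \<Rightarrow> 'd) \<Rightarrow> 'r \<Rightarrow> 'r) \<Rightarrow>
   ('k, 'h, 'hh, 'hhh, 'm::ab_group_add, 'm2::ab_group_add, 'm3::ab_group_add) hmod \<Rightarrow>
   ('h \<Rightarrow> 'r \<Rightarrow> 'm) \<Rightarrow> ('l \<Rightarrow> 'm \<Rightarrow> 'm2) \<Rightarrow> bool" where
  "tensor_module S E L e sR \<rho> V t act \<longleftrightarrow>
     h_module E V \<and> tensor_product (hscale E) sR (scale1 V) t \<and>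
     (\<forall>h g v. hact V h (t g v) = t (h * g) v) \<and>
     h_bilinear E L V act \<and>
     (\<forall>v. act e (t 1 v) =
        (\<Sum>i\<in>idx S. \<Sum>j\<in>idx S.
           tens2 V (htens E (bar S E (dl S i) * bar S E (dl S j)) 1) (t 1 (\<rho> (0, f_op S i j) v)))
        - (\<Sum>k\<in>idx S.
             tens2 V (htens E (bar S E (dl S k)) 1)
               (t 1 (\<rho> (hat (du S k), ad_sp S (du S k)) v) - t (iota E (du S k)) v))
        + tens2 V (htens E 1 1) (t 1 (\<rho> (cc, 0) v)))"

end

theory Submission
  imports Defs
begin

text \<open>
  The Jacobi identity of the pseudoaction reduces by \<open>H\<close>-trilinearity to the elements \<open>e, e, 1 \<otimes> v\<close>,
  where it splits into commutation rules in \<open>H \<otimes> H \<otimes> H\<close> for \<open>P = \<Sum> \<partial>\<^sub>i \<otimes> \<partial>\<^sup>i \<otimes> 1\<close> (bars omitted): for its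
  products with \<open>(\<Delta> \<otimes> id)(x)\<close>, where \<open>x\<close> runs over the coefficients of the \<open>sp\<close>-part and of the
  \<open>d'\<close>-part of the action.

  For irreducibility, pairing \<open>e * w\<close> with functionals of \<open>H\<close> gives operators that preserve every
  submodule \<open>W\<close>.  If \<open>W\<close> contains some \<open>1 \<otimes> v \<noteq> 0\<close>, they produce the whole orbit of \<open>v\<close> under
  \<open>d' \<oplus> sp\<close>, and \<open>W\<close> is everything.  Otherwise take \<open>w \<noteq> 0\<close> in \<open>W\<close> of minimal degree \<open>n \<ge> 1\<close> with respect
  to the filtration of \<open>H\<close>.  Functionals of order \<open>n + 2\<close> and \<open>n + 1\<close> see only the symbol of \<open>w\<close>, a
  homogeneous polynomial map from \<open>d\<close> (identified with its dual) to \<open>R\<close>.  Writing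
  \<open>q(x, z) v = \<omega>(x, v) z + \<omega>(z, v) x\<close> for the generators of \<open>sp\<close>, minimality yields for \<open>n \<ge> 2\<close> a vector \<open>r \<noteq> 0\<close>
  with \<open>q(x, z) r = \<omega>(z, x) r\<close> for all \<open>z\<close>, and for \<open>n = 1\<close> a linear map \<open>P \<noteq> 0\<close> with
  \<open>q(x, x) P(z) + 2 q(x, z) P(x) = 0\<close>.  Both conditions pass to \<open>U\<close> along maps \<open>f \<otimes> id\<close> and force the
  highest weight of \<open>U\<close> to be fundamental or zero.
\<close>

section \<open>Linear algebra with explicit scalar multiplications\<close>

section \<open>Linear and bilinear maps\<close>

text \<open>\<open>H\<close> is given by generators and relations only, so functionals with a
  prescribed leading symbol exist only by the Poincare--Birkhoff--Witt theorem, which is therefore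
  proved. Write \<open>P(x)\<close> for the symbol of the minimal \<open>w\<close> and
  \<open>D(x, z)\<close> for its derivative at \<open>x\<close> along \<open>z\<close>. As
  \<open>e\<close> acts by second order expressions, a functional of order \<open>k\<close> sends
  degree \<open>n\<close> to degree at most \<open>n + 2 - k\<close>. Order \<open>n + 2\<close>
  lands in \<open>1 \<otimes> R\<close>, which meets \<open>W\<close> in zero; this gives
  \<open>q(x, x) D(x, z) + 2 q(x, z) P(x) = 0\<close>. Order \<open>n + 1\<close> lands in degree at
  most 1, and minimality makes the result zero only if \<open>n \<ge> 2\<close>; its degree 1 part
  then gives \<open>2 \<omega>(z, x) P(x) + q(x, x) D(x, z) = 0\<close>. The difference is the
  eigenvector equation for \<open>r = P(x)\<close>. For \<open>n = 1\<close> only the first equation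
  is left, with \<open>D(x, z) = P(z)\<close>; this is the origin of the two cases. In the standard
  representation \<open>d\<close> the vector \<open>r = x\<close> itself satisfies the eigenvector
  equation; in general the equation makes the first coordinate of the highest weight equal to 1,
  which characterises the fundamental weights.\<close>

abbreviation lin :: "('k::field \<Rightarrow> 'a::ab_group_add \<Rightarrow> 'a) \<Rightarrow> ('k \<Rightarrow> 'b::ab_group_add \<Rightarrow> 'b) \<Rightarrow> ('a \<Rightarrow> 'b) \<Rightarrow> bool"
  where "lin \<equiv> Vector_Spaces.linear"

lemma linI:
  assumes "vector_space s" "vector_space t"
    and "\<And>x y. f (x + y) = f x + f y" "\<And>c x. f (s c x) = t c (f x)"
  shows "lin s t f"
  using assms by (simp add: Vector_Spaces.linear_iff)

lemma lin_vs1: "lin s t f \<Longrightarrow> vector_space s"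
  and lin_vs2: "lin s t f \<Longrightarrow> vector_space t"
  and lin_add: "lin s t f \<Longrightarrow> f (x + y) = f x + f y"
  and lin_scale: "lin s t f \<Longrightarrow> f (s c x) = t c (f x)"
  by (simp_all add: Vector_Spaces.linear_iff)

lemma lin_zero: "lin s t f \<Longrightarrow> f 0 = 0"
  using lin_add[of s t f 0 0] by simp

lemma lin_neg: "lin s t f \<Longrightarrow> f (- x) = - f x"
  using lin_add[of s t f x "- x"] lin_zero[of s t f] by (simp add: eq_neg_iff_add_eq_0 add.commute)

lemma lin_diff: "lin s t f \<Longrightarrow> f (x - y) = f x - f y"
  using lin_add[of s t f x "- y"] lin_neg[of s t f y] by simp

lemma lin_sum: "lin s t f \<Longrightarrow> f (sum g A) = (\<Sum>x\<in>A. f (g x))"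
  by (induction A rule: infinite_finite_induct) (auto simp: lin_zero lin_add)

lemma lin_comp: "lin s t f \<Longrightarrow> lin t u g \<Longrightarrow> lin s u (\<lambda>x. g (f x))"
  by (simp add: Vector_Spaces.linear_iff)

lemma lin_id: "vector_space s \<Longrightarrow> lin s s (\<lambda>x. x)"
  by (simp add: Vector_Spaces.linear_iff)

lemma vs_scale:
  assumes "vector_space s"
  shows vs_add: "s c (x + y) = s c x + s c y" and vs_add_left: "s (c + d) x = s c x + s d x"
    and vs_mult: "s c (s d x) = s (c * d) x" and vs_one: "s 1 x = x"
    and vs_zero: "s c 0 = 0" and vs_zero_left: "s 0 x = 0"
    and vs_minus: "s c (- x) = - s c x" and vs_minus_left: "s (- c) x = - s c x"
    and vs_diff: "s c (x - y) = s c x - s c y" and vs_diff_left: "s (c - d) x = s c x - s d x"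
    and vs_sum: "s c (sum f A) = (\<Sum>a\<in>A. s c (f a))"
    and vs_sum_left: "s (sum h A) x = (\<Sum>a\<in>A. s (h a) x)"
proof -
  interpret vector_space s by fact
  show "s c (x + y) = s c x + s c y" "s (c + d) x = s c x + s d x" "s c (s d x) = s (c * d) x"
    "s 1 x = x" "s c 0 = 0" "s 0 x = 0" "s c (- x) = - s c x" "s (- c) x = - s c x"
    "s c (x - y) = s c x - s c y" "s (c - d) x = s c x - s d x"
    "s c (sum f A) = (\<Sum>a\<in>A. s c (f a))" "s (sum h A) x = (\<Sum>a\<in>A. s (h a) x)"
    by (simp_all add: scale_right_distrib scale_left_distrib scale_right_diff_distrib
        scale_left_diff_distrib scale_sum_right scale_sum_left)
qed

lemma lin_const0: "vector_space s \<Longrightarrow> vector_space t \<Longrightarrow> lin s t (\<lambda>x. 0)"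
  by (simp add: Vector_Spaces.linear_iff vs_zero)

lemma lin_plus: "lin s t f \<Longrightarrow> lin s t g \<Longrightarrow> lin s t (\<lambda>x. f x + g x)"
  by (auto simp: Vector_Spaces.linear_iff vs_add algebra_simps)

lemma lin_uminus: "lin s t f \<Longrightarrow> lin s t (\<lambda>x. - f x)"
  by (auto simp: Vector_Spaces.linear_iff vs_minus)

lemma lin_minus: "lin s t f \<Longrightarrow> lin s t g \<Longrightarrow> lin s t (\<lambda>x. f x - g x)"
  using lin_plus[of s t f "\<lambda>x. - g x"] lin_uminus[of s t g] by simp

lemma lin_smult: "lin s t f \<Longrightarrow> lin s t (\<lambda>x. t c (f x))"
  by (auto simp: Vector_Spaces.linear_iff vs_add vs_mult mult.commute)

lemma lin_sumI: "vector_space s \<Longrightarrow> vector_space t \<Longrightarrow> (\<And>a. a \<in> A \<Longrightarrow> lin s t (f a)) \<Longrightarrow> lin s t (\<lambda>x. \<Sum>a\<in>A. f a x)"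
  by (induction A rule: infinite_finite_induct) (auto intro: lin_const0 lin_plus)

lemma vs_field: "vector_space ((*) :: 'k::field \<Rightarrow> 'k \<Rightarrow> 'k)"
  by unfold_locales (auto simp: algebra_simps)

lemma lin_scale_left: "vector_space s \<Longrightarrow> lin (*) s (\<lambda>c. s c x)"
  by (simp add: Vector_Spaces.linear_iff vs_field vs_add_left vs_mult)

lemma vs_pointwise: "vector_space s \<Longrightarrow> vector_space (\<lambda>c (f :: 'x \<Rightarrow> 'a::ab_group_add) x. s c (f x))"
  by unfold_locales (auto simp: fun_eq_iff vs_add vs_add_left vs_mult vs_one)

definition bilin where
  "bilin sA sB sC \<phi> \<longleftrightarrow> (\<forall>b. lin sA sC (\<lambda>a. \<phi> a b)) \<and> (\<forall>a. lin sB sC (\<phi> a))"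

lemma bilinI: "(\<And>b. lin sA sC (\<lambda>a. \<phi> a b)) \<Longrightarrow> (\<And>a. lin sB sC (\<phi> a)) \<Longrightarrow> bilin sA sB sC \<phi>"
  by (simp add: bilin_def)

lemma bilin_l: "bilin sA sB sC \<phi> \<Longrightarrow> lin sA sC (\<lambda>a. \<phi> a b)"
  and bilin_r: "bilin sA sB sC \<phi> \<Longrightarrow> lin sB sC (\<phi> a)"
  by (simp_all add: bilin_def)

lemma bilin_simps:
  assumes "bilin sA sB sC \<phi>"
  shows "\<phi> (a + a') b = \<phi> a b + \<phi> a' b" "\<phi> a (b + b') = \<phi> a b + \<phi> a b'"
    "\<phi> (sA c a) b = sC c (\<phi> a b)" "\<phi> a (sB c b) = sC c (\<phi> a b)" "\<phi> 0 b = 0" "\<phi> a 0 = 0"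
    "\<phi> (- a) b = - \<phi> a b" "\<phi> a (- b) = - \<phi> a b"
    "\<phi> (a - a') b = \<phi> a b - \<phi> a' b" "\<phi> a (b - b') = \<phi> a b - \<phi> a b'"
    "\<phi> (sum f A) b = (\<Sum>i\<in>A. \<phi> (f i) b)" "\<phi> a (sum g B) = (\<Sum>i\<in>B. \<phi> a (g i))"
  using bilin_l[OF assms, of b] bilin_r[OF assms, of a]
  by (simp_all add: lin_add lin_scale lin_zero lin_neg lin_diff lin_sum
      lin_add[of sA sC "\<lambda>a. \<phi> a b"] lin_scale[of sA sC "\<lambda>a. \<phi> a b"] lin_zero[of sA sC "\<lambda>a. \<phi> a b"]
      lin_neg[of sA sC "\<lambda>a. \<phi> a b"] lin_diff[of sA sC "\<lambda>a. \<phi> a b"] lin_sum[of sA sC "\<lambda>a. \<phi> a b"])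

lemma lin_eq_on_span:
  assumes "lin s t f" "lin s t g" "\<And>x. x \<in> B \<Longrightarrow> f x = g x" "x \<in> module.span s B"
  shows "f x = g x"
proof -
  interpret vector_space s using assms(1) by (rule lin_vs1)
  have "subspace {x. f x = g x}"
    by (rule subspaceI) (use assms(1,2) in \<open>auto simp: lin_zero lin_add lin_scale\<close>)
  then show ?thesis using assms(3) span_minimal[of B "{x. f x = g x}"] assms(4) by auto
qed

lemma lin_in_subspace:
  assumes "lin s t f" "module.subspace t W" "\<And>x. x \<in> B \<Longrightarrow> f x \<in> W" "x \<in> module.span s B"
  shows "f x \<in> W"
proof -
  interpret S: vector_space s using assms(1) by (rule lin_vs1)
  interpret T: vector_space t using assms(1) by (rule lin_vs2)
  have "S.subspace {x. f x \<in> W}"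
    by (rule S.subspaceI)
      (use assms(1,2) in \<open>auto simp: lin_zero lin_add lin_scale T.subspace_0 T.subspace_add T.subspace_scale\<close>)
  then show ?thesis using assms(3) S.span_minimal[of B "{x. f x \<in> W}"] assms(4) by auto
qed

section \<open>Maps out of presented spaces, tensor products and tensor products over
  \<open>H\<close>\<close>

section \<open>Universal properties\<close>

lemma lookup_free_scale: "Poly_Mapping.lookup (free_scale c p) x = c * Poly_Mapping.lookup p x"
  by (simp add: free_scale_def Poly_Mapping.map.rep_eq when_def)

lemma vs_free: "vector_space (free_scale :: 'k::field \<Rightarrow> ('x \<Rightarrow>\<^sub>0 'k) \<Rightarrow> _)"
  by unfold_locales (auto intro!: poly_mapping_eqI simp: lookup_free_scale lookup_add algebra_simps)

lemma lin_ext_superset: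
  assumes "vector_space s" "finite A" "Poly_Mapping.keys p \<subseteq> A"
  shows "lin_ext s g p = (\<Sum>x\<in>A. s (Poly_Mapping.lookup p x) (g x))"
  unfolding lin_ext_def
  by (rule sum.mono_neutral_left) (use assms in \<open>auto simp: in_keys_iff vs_zero_left\<close>)

lemma lin_lin_ext:
  fixes g :: "'x \<Rightarrow> 'b::ab_group_add" and s :: "'k::field \<Rightarrow> 'b \<Rightarrow> 'b"
  assumes s: "vector_space s" shows "lin free_scale s (lin_ext s g)"
proof (rule linI)
  fix p q :: "'x \<Rightarrow>\<^sub>0 'k" and c
  let ?A = "Poly_Mapping.keys p \<union> Poly_Mapping.keys q"
  have "Poly_Mapping.keys (p + q) \<subseteq> ?A" by (rule Poly_Mapping.keys_add)
  then show "lin_ext s g (p + q) = lin_ext s g p + lin_ext s g q"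
    using s lin_ext_superset[OF s, of ?A p g] lin_ext_superset[OF s, of ?A q g]
      lin_ext_superset[OF s, of ?A "p + q" g]
    by (simp add: lookup_add vs_add_left sum.distrib)
  have "Poly_Mapping.keys (free_scale c p) \<subseteq> Poly_Mapping.keys p"
    by (auto simp: in_keys_iff lookup_free_scale)
  then show "lin_ext s g (free_scale c p) = s c (lin_ext s g p)"
    using s lin_ext_superset[OF s, of "Poly_Mapping.keys p" "free_scale c p" g]
    by (simp add: lookup_free_scale vs_sum vs_mult lin_ext_def)
qed (use s vs_free in auto)

lemma lin_ext_gen: "vector_space s \<Longrightarrow> lin_ext s g (gen x) = g x"
  by (simp add: lin_ext_def gen_def vs_one)

lemma presented_rel: "presented_by s g K \<Longrightarrow> r \<in> K \<Longrightarrow> lin_ext s g r = 0"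
  using module.span_base[of free_scale r K] vs_free
  unfolding presented_by_def module_iff_vector_space by blast

lemma presented_span:
  assumes "presented_by s g K" shows "x \<in> module.span s (range g)"
proof -
  have s: "vector_space s" using assms by (simp add: presented_by_def)
  interpret vector_space s by fact
  obtain p where "x = lin_ext s g p" using assms by (auto simp: presented_by_def surj_def)
  moreover have "lin_ext s g p \<in> span (range g)"
    unfolding lin_ext_def by (intro span_sum span_scale span_base rangeI)
  ultimately show ?thesis by simp
qed

lemma presented_eqI:
  assumes "presented_by s g K" "lin s t F" "lin s t G" "\<And>x. F (g x) = G (g x)"
  shows "F x = G x"
  by (rule lin_eq_on_span[OF assms(2,3) _ presented_span[OF assms(1)]]) (use assms(4) in auto)

text \<open>A prescription that kills the relations kills their span, which is the whole kernel of
  \<open>lin_ext s g\<close>. Hence the value at an arbitrarily chosen preimage does not depend on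
  the choice.\<close>

lemma presented_lift:
  assumes p: "presented_by s g K" and t: "vector_space t"
    and K: "\<And>r. r \<in> K \<Longrightarrow> lin_ext t \<phi> r = 0"
  shows "\<exists>F. lin s t F \<and> (\<forall>x. F (g x) = \<phi> x)"
proof -
  have s: "vector_space s" and sj: "surj (lin_ext s g)"
    and k: "{p. lin_ext s g p = 0} = module.span free_scale K"
    using p by (auto simp: presented_by_def)
  note l1 = lin_lin_ext[OF s, of g] and l2 = lin_lin_ext[OF t, of \<phi>]
  have z: "lin_ext t \<phi> p = 0" if "lin_ext s g p = 0" for p
    by (rule lin_eq_on_span[OF l2 lin_const0[OF vs_free t], of K])
      (use K k that in auto)
  define F where "F x = lin_ext t \<phi> (SOME p. lin_ext s g p = x)" for x
  have F: "F (lin_ext s g p) = lin_ext t \<phi> p" for p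
  proof -
    have "lin_ext s g (SOME q. lin_ext s g q = lin_ext s g p) = lin_ext s g p"
      by (rule someI) simp
    then have "lin_ext t \<phi> ((SOME q. lin_ext s g q = lin_ext s g p) - p) = 0"
      by (intro z) (simp add: lin_diff[OF l1])
    then show ?thesis by (simp add: lin_diff[OF l2] F_def)
  qed
  have "lin s t F"
  proof (rule linI[OF s t])
    fix x y c
    obtain p q where pq: "x = lin_ext s g p" "y = lin_ext s g q" using sj by (metis surjD)
    show "F (x + y) = F x + F y"
      unfolding pq by (simp add: F lin_add[OF l1, symmetric] lin_add[OF l2])
    show "F (s c x) = t c (F x)"
      unfolding pq by (simp add: F lin_scale[OF l1, symmetric] lin_scale[OF l2])
  qed
  moreover have "F (g x) = \<phi> x" for x
    using F[of "gen x"] by (simp add: lin_ext_gen[OF s] lin_ext_gen[OF t])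
  ultimately show ?thesis by blast
qed

lemma bilin_lin_ext_rels:
  assumes b: "bilin sA sB sC \<phi>" and r: "r \<in> tensor_rels sA sB"
  shows "lin_ext sC (\<lambda>(a, b). \<phi> a b) r = 0"
proof -
  have s: "vector_space sC" using bilin_l[OF b] by (rule lin_vs2)
  note l = lin_lin_ext[OF s, of "\<lambda>(a, b). \<phi> a b"]
  show ?thesis using r b s
    by (auto simp: tensor_rels_def lin_diff[OF l] lin_scale[OF l] lin_ext_gen[OF s] bilin_simps[OF b])
qed

text \<open>Converse of \<open>bilin_lin_ext_rels\<close>. It is applied to the structure map
  \<open>t\<close> of a tensor product, where the relations hold because they lie in the
  kernel.\<close>

lemma rels_bilin:
  assumes A: "vector_space sA" and B: "vector_space sB" and C: "vector_space sC"
    and r: "\<And>r. r \<in> tensor_rels sA sB \<Longrightarrow> lin_ext sC (\<lambda>(a, b). \<phi> a b) r = 0"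
  shows "bilin sA sB sC \<phi>"
proof -
  note l = lin_lin_ext[OF C, of "\<lambda>(a, b). \<phi> a b"]
  note e = lin_diff[OF l] lin_scale[OF l] lin_ext_gen[OF C]
  have 1: "\<phi> (a + a') b = \<phi> a b + \<phi> a' b" for a a' b
  proof -
    have "lin_ext sC (\<lambda>(a, b). \<phi> a b) (gen (a + a', b) - gen (a, b) - gen (a', b)) = 0"
      by (rule r) (unfold tensor_rels_def, blast)
    then show ?thesis by (simp add: e diff_eq_eq add.commute)
  qed
  have 2: "\<phi> a (b + b') = \<phi> a b + \<phi> a b'" for a b b'
  proof -
    have "lin_ext sC (\<lambda>(a, b). \<phi> a b) (gen (a, b + b') - gen (a, b) - gen (a, b')) = 0"
      by (rule r) (unfold tensor_rels_def, blast)
    then show ?thesis by (simp add: e diff_eq_eq add.commute)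
  qed
  have 3: "\<phi> (sA c a) b = sC c (\<phi> a b)" for a b c
  proof -
    have "lin_ext sC (\<lambda>(a, b). \<phi> a b) (gen (sA c a, b) - free_scale c (gen (a, b))) = 0"
      by (rule r) (unfold tensor_rels_def, blast)
    then show ?thesis by (simp add: e diff_eq_eq add.commute)
  qed
  have 4: "\<phi> a (sB c b) = sC c (\<phi> a b)" for a b c
  proof -
    have "lin_ext sC (\<lambda>(a, b). \<phi> a b) (gen (a, sB c b) - free_scale c (gen (a, b))) = 0"
      by (rule r) (unfold tensor_rels_def, blast)
    then show ?thesis by (simp add: e diff_eq_eq add.commute)
  qed
  show ?thesis by (intro bilinI linI A B C 1 2 3 4)
qed

lemma tensor_bilin:
  assumes "tensor_product sA sB sC t" shows "bilin sA sB sC t"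
proof (rule rels_bilin)
  have p: "presented_by sC (\<lambda>(a, b). t a b) (tensor_rels sA sB)"
    and "vector_space sA" "vector_space sB"
    using assms by (simp_all add: tensor_product_def)
  then show "vector_space sA" "vector_space sB" "vector_space sC"
    by (simp_all add: presented_by_def)
  show "lin_ext sC (\<lambda>(a, b). t a b) r = 0" if "r \<in> tensor_rels sA sB" for r
    by (rule presented_rel[OF p that])
qed

lemma tensor_exists:
  assumes T: "tensor_product sA sB sC t" and b: "bilin sA sB sZ \<phi>"
  shows "\<exists>F. lin sC sZ F \<and> (\<forall>a b. F (t a b) = \<phi> a b)"
proof -
  have "\<exists>F. lin sC sZ F \<and> (\<forall>x. F (case x of (a, b) \<Rightarrow> t a b) = (case x of (a, b) \<Rightarrow> \<phi> a b))"
    by (rule presented_lift[where K = "tensor_rels sA sB"])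
      (use T b bilin_lin_ext_rels[OF b] in \<open>auto simp: tensor_product_def intro: lin_vs2 bilin_l\<close>)
  then show ?thesis by auto
qed

lemma tensor_span:
  assumes T: "tensor_product sA sB sC t" shows "x \<in> module.span sC {t a b | a b. True}"
proof -
  have "range (\<lambda>(a, b). t a b) = {t a b | a b. True}" by auto
  then show ?thesis using presented_span[of sC "\<lambda>(a, b). t a b" _ x] T by (auto simp: tensor_product_def)
qed

lemma tensor_eqI:
  assumes T: "tensor_product sA sB sC t" and "lin sC sZ F" "lin sC sZ G" "\<And>a b. F (t a b) = G (t a b)"
  shows "F x = G x"
  by (rule lin_eq_on_span[OF assms(2,3) _ tensor_span[OF T]]) (use assms(4) in auto)

text \<open>\<open>tensor_lift\<close> is a definite description, so nothing can be said about it
  before existence and uniqueness are known. Later proofs about ordinary tensor products use only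
  these two facts.\<close>

lemma tensor_lift:
  assumes T: "tensor_product sA sB sC t" and b: "bilin sA sB sZ \<phi>"
  shows tensor_lift_lin: "lin sC sZ (tensor_lift sC sZ t \<phi>)"
    and tensor_lift_eq: "tensor_lift sC sZ t \<phi> (t a b) = \<phi> a b"
proof -
  have "\<exists>!F. lin sC sZ F \<and> (\<forall>a b. F (t a b) = \<phi> a b)"
  proof (rule ex_ex1I)
    show "\<exists>F. lin sC sZ F \<and> (\<forall>a b. F (t a b) = \<phi> a b)"
      by (rule tensor_exists[OF T b])
    show "F = G" if "lin sC sZ F \<and> (\<forall>a b. F (t a b) = \<phi> a b)" "lin sC sZ G \<and> (\<forall>a b. G (t a b) = \<phi> a b)"
      for F G
      by (rule ext, rule tensor_eqI[OF T, of sZ]) (use that in auto)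
  qed
  from theI'[OF this] show "lin sC sZ (tensor_lift sC sZ t \<phi>)" "tensor_lift sC sZ t \<phi> (t a b) = \<phi> a b"
    by (auto simp: tensor_lift_def)
qed

lemma balanced_bilin:
  assumes "balanced_tensor_product sM r sV l sW t"
  shows "bilin sM sV sW t" and "t (r m h) v = t m (l h v)"
proof -
  have W: "vector_space sW" using assms by (simp add: balanced_tensor_product_def presented_by_def)
  have p: "presented_by sW (\<lambda>(m, v). t m v)
      (tensor_rels sM sV \<union> {gen (r m h, v) - gen (m, l h v) | m h v. True})"
    and M: "vector_space sM" and V: "vector_space sV"
    using assms by (simp_all add: balanced_tensor_product_def)
  show "bilin sM sV sW t"
    by (rule rels_bilin[OF M V W]) (use presented_rel[OF p] in blast)
  have "lin_ext sW (\<lambda>(m, v). t m v) (gen (r m h, v) - gen (m, l h v)) = 0"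
    by (rule presented_rel[OF p]) blast
  then show "t (r m h) v = t m (l h v)"
    by (simp add: lin_diff[OF lin_lin_ext[OF W]] lin_ext_gen[OF W])
qed

lemma balanced_exists:
  assumes T: "balanced_tensor_product sM r sV l sW t" and b: "bilin sM sV sZ \<phi>"
    and bal: "\<And>m h v. \<phi> (r m h) v = \<phi> m (l h v)"
  shows "\<exists>F. lin sW sZ F \<and> (\<forall>a b. F (t a b) = \<phi> a b)"
proof -
  have Z: "vector_space sZ" using bilin_l[OF b] by (rule lin_vs2)
  have "\<exists>F. lin sW sZ F \<and> (\<forall>x. F (case x of (a, b) \<Rightarrow> t a b) = (case x of (a, b) \<Rightarrow> \<phi> a b))"
  proof (rule presented_lift)
    show "presented_by sW (\<lambda>(m, v). t m v) (tensor_rels sM sV \<union> {gen (r m h, v) - gen (m, l h v) | m h v. True})"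
      using T by (simp add: balanced_tensor_product_def)
    fix x assume "x \<in> tensor_rels sM sV \<union> {gen (r m h, v) - gen (m, l h v) | m h v. True}"
    then show "lin_ext sZ (\<lambda>(m, v). \<phi> m v) x = 0"
      using bilin_lin_ext_rels[OF b]
      by (auto simp: lin_diff[OF lin_lin_ext[OF Z]] lin_ext_gen[OF Z] bal)
  qed fact
  then show ?thesis by auto
qed

lemma balanced_span:
  assumes T: "balanced_tensor_product sM r sV l sW t" shows "x \<in> module.span sW {t a b | a b. True}"
proof -
  have "range (\<lambda>(a, b). t a b) = {t a b | a b. True}" by auto
  then show ?thesis using presented_span[of sW "\<lambda>(a, b). t a b" _ x] T by (auto simp: balanced_tensor_product_def)
qed

lemma balanced_eqI:
  assumes T: "balanced_tensor_product sM r sV l sW t" and "lin sW sZ F" "lin sW sZ G"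
    "\<And>a b. F (t a b) = G (t a b)"
  shows "F x = G x"
  by (rule lin_eq_on_span[OF assms(2,3) _ balanced_span[OF T]]) (use assms(4) in auto)

text \<open>The analogue over \<open>H\<close>. The hypothesis \<open>bal\<close> is the content of
  each later application: it says that the prescription lets \<open>h\<close> pass from one factor
  to the other.\<close>

lemma balanced_lift:
  assumes T: "balanced_tensor_product sM r sV l sW t" and b: "bilin sM sV sZ \<phi>"
    and bal: "\<And>m h v. \<phi> (r m h) v = \<phi> m (l h v)"
  shows balanced_lift_lin: "lin sW sZ (tensor_lift sW sZ t \<phi>)"
    and balanced_lift_eq: "tensor_lift sW sZ t \<phi> (t a b) = \<phi> a b"
proof -
  have "\<exists>!F. lin sW sZ F \<and> (\<forall>a b. F (t a b) = \<phi> a b)"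
  proof (rule ex_ex1I)
    show "\<exists>F. lin sW sZ F \<and> (\<forall>a b. F (t a b) = \<phi> a b)"
      by (rule balanced_exists[OF T b]) (rule bal)
    show "F = G" if "lin sW sZ F \<and> (\<forall>a b. F (t a b) = \<phi> a b)" "lin sW sZ G \<and> (\<forall>a b. G (t a b) = \<phi> a b)"
      for F G
      by (rule ext, rule balanced_eqI[OF T, of sZ]) (use that in auto)
  qed
  from theI'[OF this] show "lin sW sZ (tensor_lift sW sZ t \<phi>)" "tensor_lift sW sZ t \<phi> (t a b) = \<phi> a b"
    by (auto simp: tensor_lift_def)
qed

text \<open>The contraction \<open>f \<otimes> id\<close>. It serves to read off symbols in
  \<open>H \<otimes> R\<close> and to pass from \<open>R\<close> to its right factor
  \<open>U\<close>.\<close>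

definition slice where
  "slice sA sB sC t f = tensor_lift sC sB t (\<lambda>a b. sB (f a) b)"

lemma slice:
  assumes T: "tensor_product sA sB sC t" and f: "lin sA (*) f"
  shows slice_lin: "lin sC sB (slice sA sB sC t f)"
    and slice_eq: "slice sA sB sC t f (t a b) = sB (f a) b"
proof -
  have B: "vector_space sB" using T by (auto simp: tensor_product_def)
  have "bilin sA sB sB (\<lambda>a b. sB (f a) b)"
    by (rule bilinI) (use lin_comp[OF f lin_scale_left[OF B]] lin_smult[OF lin_id[OF B]] in simp_all)
  from tensor_lift[OF T this]
  show "lin sC sB (slice sA sB sC t f)" "slice sA sB sC t f (t a b) = sB (f a) b"
    by (auto simp: slice_def)
qed

text \<open>Written over a basis of the left factor, \<open>x\<close> is a finite sum of tensors
  \<open>t b (u b)\<close>, and the coordinate functional of \<open>b\<close> has slice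
  \<open>u b\<close>. So if all slices vanish, \<open>x\<close> does.\<close>

lemma slice_separates:
  assumes T: "tensor_product sA sB sC t" and x: "x \<noteq> 0"
  shows "\<exists>f. lin sA (*) f \<and> slice sA sB sC t f x \<noteq> 0"
proof (rule ccontr)
  assume n: "\<not> ?thesis"
  have A: "vector_space sA" and B: "vector_space sB" and C: "vector_space sC"
    using T by (auto simp: tensor_product_def presented_by_def)
  interpret A: vector_space sA by fact
  interpret C: vector_space sC by fact
  interpret AF: vector_space_pair sA "(*) :: 'a \<Rightarrow> 'a \<Rightarrow> 'a" by (intro vector_space_pair.intro A vs_field)
  define X where "X = A.extend_basis {}"
  have X: "A.independent X" "A.span X = UNIV"
    unfolding X_def by (auto intro!: A.independent_extend_basis A.span_extend_basis A.independent_empty)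
  note tb = tensor_bilin[OF T]
  have "\<exists>G u. finite G \<and> G \<subseteq> X \<and> y = (\<Sum>b\<in>G. t b (u b))" for y
  proof -
    have "y \<in> C.span {t a b | a b. True}" by (rule tensor_span[OF T])
    then show ?thesis
    proof (induction rule: C.span_induct_alt)
      case base show ?case by (rule exI[of _ "{}"]) auto
    next
      case (step c w y)
      then obtain a b where w: "w = t a b" by auto
      from step obtain G u where G: "finite G" "G \<subseteq> X" "y = (\<Sum>b\<in>G. t b (u b))" by auto
      have "a \<in> A.span X" using X by auto
      then obtain K r where K: "finite K" "K \<subseteq> X" "a = (\<Sum>k\<in>K. sA (r k) k)"
        unfolding A.span_explicit by auto
      let ?u = "\<lambda>k. (if k \<in> K then sB (c * r k) b else 0) + (if k \<in> G then u k else 0)"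
      have t0: "t k (if P then v else 0) = (if P then t k v else 0)" for k P v
        by (simp add: lin_zero[OF bilin_r[OF tb]])
      have *: "sC c (t (sA (r k) k) b) = t k (sB (c * r k) b)" for k
        by (simp add: lin_scale[OF bilin_r[OF tb]] lin_scale[OF bilin_l[OF tb]] vs_mult[OF C])
      have "sC c w = (\<Sum>k\<in>K. sC c (t (sA (r k) k) b))"
        unfolding w K(3) by (simp add: lin_sum[OF bilin_l[OF tb]] vs_sum[OF C])
      also have "\<dots> = (\<Sum>k\<in>K. t k (sB (c * r k) b))" by (simp only: *)
      finally have "sC c w + y = (\<Sum>k\<in>K \<union> G. t k (?u k))"
        using K(1) G(1,3)
        by (simp add: lin_add[OF bilin_r[OF tb]] sum.distrib t0 sum.If_cases Int_absorb1 Int_absorb2)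
      then show ?case using G K by (intro exI[of _ "K \<union> G"] exI[of _ ?u]) auto
    qed
  qed
  then obtain G u where G: "finite G" "G \<subseteq> X" "x = (\<Sum>b\<in>G. t b (u b))" by blast
  have "u b = 0" if b: "b \<in> G" for b
  proof -
    obtain f where f: "lin sA (*) f" "\<forall>y\<in>X. f y = (if y = b then 1 else 0)"
      using AF.linear_independent_extend[OF X(1), of "\<lambda>y. if y = b then 1 else 0"] by auto
    have "slice sA sB sC t f x = 0" using n f by auto
    then have "(\<Sum>y\<in>G. sB (f y) (u y)) = 0"
      using G(3) by (simp add: lin_sum[OF slice_lin[OF T f(1)]] slice_eq[OF T f(1)])
    also have "(\<Sum>y\<in>G. sB (f y) (u y)) = (\<Sum>y\<in>G. if y = b then u y else 0)"
      by (rule sum.cong) (use f(2) G(2) B in \<open>auto simp: vs_one vs_zero_left\<close>)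
    finally show ?thesis using b G(1) by simp
  qed
  then have "x = 0" using G by (simp add: lin_zero[OF bilin_r[OF tb]])
  then show False using x by simp
qed

section \<open>Universal property of \<open>U(d)\<close>, its coproduct, and homomorphisms into the
  triple tensor product\<close>

section \<open>Enveloping algebras\<close>

lemma algebra_vs: "algebra_over s \<Longrightarrow> vector_space s"
  by (simp add: algebra_over_def)

lemma algebra_mult_l: "algebra_over s \<Longrightarrow> lin s s (\<lambda>x. x * y)"
  and algebra_mult_r: "algebra_over s \<Longrightarrow> lin s s (\<lambda>x. y * x)"
  by (auto simp: algebra_over_def Vector_Spaces.linear_iff distrib_left distrib_right)

lemma algebra_scale: "algebra_over s \<Longrightarrow> s c x * y = s c (x * y)" "algebra_over s \<Longrightarrow> x * s c y = s c (x * y)"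
  by (auto simp: algebra_over_def)

definition alg_hom where
  "alg_hom s t F \<longleftrightarrow> lin s t F \<and> F 1 = (1 :: 'b::ring_1) \<and> (\<forall>x y :: 'a::ring_1. F (x * y) = F x * F y)"

lemma alg_homD: "alg_hom s t F \<Longrightarrow> lin s t F" "alg_hom s t F \<Longrightarrow> F 1 = 1"
  "alg_hom s t F \<Longrightarrow> F (x * y) = F x * F y"
  by (auto simp: alg_hom_def)

lemma alg_hom_comp: "alg_hom s t F \<Longrightarrow> alg_hom t u G \<Longrightarrow> alg_hom s u (\<lambda>x. G (F x))"
  by (auto simp: alg_hom_def intro: lin_comp)

lemma tensor_algebraD:
  assumes "tensor_algebra sA sB sC t"
  shows "algebra_over sA" "algebra_over sB" "algebra_over sC" "tensor_product sA sB sC t"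
    "t 1 1 = 1" "t a b * t a' b' = t (a * a') (b * b')"
  using assms by (auto simp: tensor_algebra_def)

lemma tensor_hom_l: assumes T: "tensor_algebra sA sB sC t" shows "alg_hom sA sC (\<lambda>a. t a 1)"
  using bilin_l[OF tensor_bilin[OF tensor_algebraD(4)[OF T]]] tensor_algebraD[OF T]
  by (simp add: alg_hom_def)

lemma tensor_hom_r: assumes T: "tensor_algebra sA sB sC t" shows "alg_hom sB sC (\<lambda>b. t 1 b)"
  using bilin_r[OF tensor_bilin[OF tensor_algebraD(4)[OF T]]] tensor_algebraD[OF T]
  by (simp add: alg_hom_def)

text \<open>Homomorphisms with commuting images combine to a homomorphism. The flips and the
  coproducts applied to one tensor factor are of this kind, so their identities can be checked on
  generators.\<close>

lemma tensor_lift_hom: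
  assumes T: "tensor_algebra sA sB sC t" and D: "algebra_over sD"
    and f: "alg_hom sA sD f" and g: "alg_hom sB sD g" and comm: "\<And>a b. f a * g b = g b * f a"
    and \<phi>: "\<And>a b. \<phi> a b = f a * g b"
  shows "alg_hom sC sD (tensor_lift sC sD t \<phi>)" and "tensor_lift sC sD t \<phi> (t a b) = f a * g b"
proof -
  have "\<phi> = (\<lambda>a b. f a * g b)" by (simp add: fun_eq_iff \<phi>)
  moreover have "bilin sA sB sD (\<lambda>a b. f a * g b)"
    by (intro bilinI lin_comp[OF alg_homD(1)[OF f] algebra_mult_l[OF D]] lin_comp[OF alg_homD(1)[OF g] algebra_mult_r[OF D]])
  ultimately have b: "bilin sA sB sD \<phi>" by simp
  note tp = tensor_algebraD(4)[OF T]
  let ?F = "tensor_lift sC sD t \<phi>"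
  note l = tensor_lift_lin[OF tp b] and e = tensor_lift_eq[OF tp b]
  show "?F (t a b) = f a * g b" by (simp add: e \<phi>)
  note C = tensor_algebraD(3)[OF T]
  have m: "?F (t a b * y) = ?F (t a b) * ?F y" for a b y
  proof (rule tensor_eqI[OF tp lin_comp[OF algebra_mult_r[OF C] l] lin_comp[OF l algebra_mult_r[OF D]]])
    fix a' b'
    have "f a * f a' * (g b * g b') = f a * (f a' * g b) * g b'" by (simp only: mult.assoc)
    also have "\<dots> = f a * g b * (f a' * g b')" by (simp only: comm[of a' b] mult.assoc)
    finally have "f a * f a' * (g b * g b') = f a * g b * (f a' * g b')" .
    then show "?F (t a b * t a' b') = ?F (t a b) * ?F (t a' b')"
      by (simp add: tensor_algebraD(6)[OF T] e \<phi> alg_homD(3)[OF f] alg_homD(3)[OF g])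
  qed
  have "?F (x * y) = ?F x * ?F y" for x y
    by (rule tensor_eqI[OF tp lin_comp[OF algebra_mult_l[OF C] l] lin_comp[OF l algebra_mult_l[OF D]]])
      (rule m)
  moreover have "?F 1 = 1"
    using e[of 1 1] by (simp add: tensor_algebraD(5)[OF T] \<phi> alg_homD(2)[OF f] alg_homD(2)[OF g])
  ultimately show "alg_hom sC sD ?F" using l by (simp add: alg_hom_def)
qed

locale enveloping =
  fixes G :: "('k::field, 'd::ab_group_add) lie"
    and E :: "('k, 'd, 'h::ring_1, 'hh::ring_1, 'hhh::ring_1) env"
  assumes env: "enveloping_algebra G E" and vsG: "vector_space (lscale G)"
begin

abbreviation hs where "hs \<equiv> hscale E"
abbreviation hhs where "hhs \<equiv> hhscale E"
abbreviation hhhs where "hhhs \<equiv> hhhscale E"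
abbreviation \<iota> where "\<iota> \<equiv> iota E"
abbreviation tns (infixr \<open>\<otimes>\<close> 72) where "f \<otimes> g \<equiv> htens E f g"

definition wp :: "'d list \<Rightarrow> 'h" where "wp ws = prod_list (map \<iota> ws)"

lemma wp_simps [simp]: "wp [] = 1" "wp (a # ws) = \<iota> a * wp ws" "wp (us @ ws) = wp us * wp ws"
  by (simp_all add: wp_def)

lemma H_alg: "algebra_over hs"
  and H_pres: "presented_by hs wp (env_rels G)"
  and HH: "tensor_algebra hs hs hhs (htens E)"
  and HHH: "tensor_algebra hhs hs hhhs (hhtens E)"
  using env by (auto simp: enveloping_algebra_def wp_def[abs_def])

lemma HH_alg: "algebra_over hhs" and HHH_alg: "algebra_over hhhs"
  using tensor_algebraD(3)[OF HH] tensor_algebraD(3)[OF HHH] by auto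

lemma vs_H: "vector_space hs" and vs_HH: "vector_space hhs" and vs_HHH: "vector_space hhhs"
  using algebra_vs H_alg HH_alg HHH_alg by auto

lemma HH_tp: "tensor_product hs hs hhs (htens E)" and HHH_tp: "tensor_product hhs hs hhhs (hhtens E)"
  using tensor_algebraD(4) HH HHH by auto

lemma tns_simps:
  "1 \<otimes> 1 = 1" "hhtens E 1 1 = 1" "(a \<otimes> b) * (a' \<otimes> b') = (a * a') \<otimes> (b * b')"
  "hhtens E x b * hhtens E x' b' = hhtens E (x * x') (b * b')"
  using tensor_algebraD(5,6)[OF HH] tensor_algebraD(5,6)[OF HHH] by auto

lemmas HH_bilin = tensor_bilin[OF HH_tp] and HHH_bilin = tensor_bilin[OF HHH_tp]

lemma H_eqI:
  "lin hs s F \<Longrightarrow> lin hs s F' \<Longrightarrow> (\<And>ws. F (wp ws) = F' (wp ws)) \<Longrightarrow> F h = F' h"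
  by (rule presented_eqI[OF H_pres])

lemma H_span: "h \<in> module.span hs (range wp)"
  by (rule presented_span[OF H_pres])

lemma iota_add: "\<iota> (a + b) = \<iota> a + \<iota> b"
  and iota_scale: "\<iota> (lscale G c a) = hs c (\<iota> a)"
  and iota_br: "\<iota> (lbr G a b) = \<iota> a * \<iota> b - \<iota> b * \<iota> a"
proof -
  note l = lin_lin_ext[OF vs_H, of wp]
  note e = lin_diff[OF l] lin_scale[OF l] lin_ext_gen[OF vs_H]
  have "lin_ext hs wp (gen ([] @ [a + b] @ []) - gen ([] @ [a] @ []) - gen ([] @ [b] @ [])) = 0"
    by (rule presented_rel[OF H_pres], unfold env_rels_def, blast)
  then show "\<iota> (a + b) = \<iota> a + \<iota> b" by (simp add: e diff_eq_eq add.commute)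
  have "lin_ext hs wp (gen ([] @ [lscale G c a] @ []) - free_scale c (gen ([] @ [a] @ []))) = 0"
    by (rule presented_rel[OF H_pres], unfold env_rels_def, blast)
  then show "\<iota> (lscale G c a) = hs c (\<iota> a)" by (simp add: e)
  have "lin_ext hs wp (gen ([] @ [a, b] @ []) - gen ([] @ [b, a] @ []) - gen ([] @ [lbr G a b] @ [])) = 0"
    by (rule presented_rel[OF H_pres], unfold env_rels_def, blast)
  then show "\<iota> (lbr G a b) = \<iota> a * \<iota> b - \<iota> b * \<iota> a" by (simp add: e)
qed

lemma iota_lin: "lin (lscale G) hs \<iota>"
  by (intro linI vsG vs_H iota_add iota_scale)

lemma foldr_lin: "vector_space s \<Longrightarrow> (\<And>a. lin s s (\<tau> a)) \<Longrightarrow> lin s s (foldr \<tau> ws)"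
proof (induction ws)
  case Nil then show ?case using lin_id by (simp add: id_def)
next
  case (Cons a ws) then show ?case using lin_comp[of s s "foldr \<tau> ws" s "\<tau> a"] by (simp add: o_def)
qed

text \<open>The relations are required on \<open>Y\<close> only: the operators \<open>Tau\<close> below satisfy them only on functions
  that are linear in the functional.\<close>

lemma action_extends:
  assumes s: "vector_space s" and l: "\<And>a. lin s s (\<tau> a)" and Y: "\<And>a y. y \<in> Y \<Longrightarrow> \<tau> a y \<in> Y"
    and add: "\<And>a b y. y \<in> Y \<Longrightarrow> \<tau> (a + b) y = \<tau> a y + \<tau> b y"
    and sc: "\<And>c a y. y \<in> Y \<Longrightarrow> \<tau> (lscale G c a) y = s c (\<tau> a y)"
    and br: "\<And>a b y. y \<in> Y \<Longrightarrow> \<tau> (lbr G a b) y = \<tau> a (\<tau> b y) - \<tau> b (\<tau> a y)"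
    and x: "x \<in> Y"
  shows "\<exists>F. lin hs s F \<and> (\<forall>ws. F (wp ws) = foldr \<tau> ws x)"
proof (rule presented_lift[OF H_pres s])
  fix r assume "r \<in> env_rels G"
  note le = lin_lin_ext[OF s, of "\<lambda>ws. foldr \<tau> ws x"]
  note e = lin_diff[OF le] lin_scale[OF le] lin_ext_gen[OF s]
  have Yw: "foldr \<tau> ws x \<in> Y" for ws by (induction ws) (auto simp: x Y)
  note lf = foldr_lin[OF s l]
  from \<open>r \<in> env_rels G\<close> show "lin_ext s (\<lambda>ws. foldr \<tau> ws x) r = 0"
    unfolding env_rels_def
    by (auto simp: e add[OF Yw] sc[OF Yw] br[OF Yw] lin_add[OF lf] lin_scale[OF lf] lin_diff[OF lf])
qed

text \<open>The letters act on the target by left multiplication, and the orbit of 1 gives the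
  linear map. Left multiplications commute with right ones, which makes this map
  multiplicative.\<close>

lemma alg_extends:
  assumes A: "algebra_over s" and th: "lin (lscale G) s \<theta>"
    and br: "\<And>a b. \<theta> (lbr G a b) = \<theta> a * \<theta> b - \<theta> b * \<theta> a"
  shows "\<exists>F. alg_hom hs s F \<and> (\<forall>a. F (\<iota> a) = \<theta> a)"
proof -
  have "\<exists>F. lin hs s F \<and> (\<forall>ws. F (wp ws) = foldr (\<lambda>a x. \<theta> a * x) ws 1)"
    by (rule action_extends[where Y = UNIV])
      (use A th in \<open>auto simp: algebra_vs algebra_mult_r lin_add lin_scale br algebra_scale algebra_simps\<close>)
  then obtain F where F: "lin hs s F" "\<And>ws. F (wp ws) = foldr (\<lambda>a x. \<theta> a * x) ws 1" by auto
  have f: "foldr (\<lambda>a x. \<theta> a * x) ws y = foldr (\<lambda>a x. \<theta> a * x) ws 1 * y" for ws y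
    by (induction ws) (auto simp: mult.assoc)
  have m: "F (wp us * y) = F (wp us) * F y" for us y
  proof (rule H_eqI[OF lin_comp[OF algebra_mult_r[OF H_alg] F(1)] lin_comp[OF F(1) algebra_mult_r[OF A]]])
    fix ws show "F (wp us * wp ws) = F (wp us) * F (wp ws)"
      using F(2)[of "us @ ws"] by (simp add: F(2) f[of us "foldr (\<lambda>a. (*) (\<theta> a)) ws 1"])
  qed
  have "F (x * y) = F x * F y" for x y
    by (rule H_eqI[OF lin_comp[OF algebra_mult_l[OF H_alg] F(1)] lin_comp[OF F(1) algebra_mult_l[OF A]]])
      (rule m)
  then show ?thesis using F(1) F(2)[of "[]"] F(2)[of "[a]" for a] by (auto simp: alg_hom_def)
qed

lemma hom_eqI:
  assumes F: "alg_hom hs s F" and F': "alg_hom hs s F'" and i: "\<And>a. F (\<iota> a) = F' (\<iota> a)"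
  shows "F h = F' h"
proof (rule H_eqI[OF alg_homD(1)[OF F] alg_homD(1)[OF F']])
  fix ws show "F (wp ws) = F' (wp ws)"
    by (induction ws) (auto simp: alg_homD(2,3)[OF F] alg_homD(2,3)[OF F'] i)
qed

lemma coprod_ex1:
  "\<exists>!F. Vector_Spaces.linear hs hhs F \<and> F 1 = 1 \<and> (\<forall>x y. F (x * y) = F x * F y) \<and>
     (\<forall>a. F (\<iota> a) = \<iota> a \<otimes> 1 + 1 \<otimes> \<iota> a)"
proof (rule ex_ex1I)
  have "\<exists>F. alg_hom hs hhs F \<and> (\<forall>a. F (\<iota> a) = \<iota> a \<otimes> 1 + 1 \<otimes> \<iota> a)"
  proof (rule alg_extends[OF HH_alg])
    show "lin (lscale G) hhs (\<lambda>a. \<iota> a \<otimes> 1 + 1 \<otimes> \<iota> a)"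
      by (intro lin_plus lin_comp[OF iota_lin bilin_l[OF HH_bilin]] lin_comp[OF iota_lin bilin_r[OF HH_bilin]])
  qed (simp add: iota_br bilin_simps[OF HH_bilin] tns_simps algebra_simps)
  then show "\<exists>F. Vector_Spaces.linear hs hhs F \<and> F 1 = 1 \<and> (\<forall>x y. F (x * y) = F x * F y) \<and>
     (\<forall>a. F (\<iota> a) = \<iota> a \<otimes> 1 + 1 \<otimes> \<iota> a)"
    by (auto simp: alg_hom_def)
next
  fix F F' assume F: "Vector_Spaces.linear hs hhs F \<and> F 1 = 1 \<and> (\<forall>x y. F (x * y) = F x * F y) \<and>
     (\<forall>a. F (\<iota> a) = \<iota> a \<otimes> 1 + 1 \<otimes> \<iota> a)"
    and F': "Vector_Spaces.linear hs hhs F' \<and> F' 1 = 1 \<and> (\<forall>x y. F' (x * y) = F' x * F' y) \<and>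
     (\<forall>a. F' (\<iota> a) = \<iota> a \<otimes> 1 + 1 \<otimes> \<iota> a)"
  show "F = F'"
    by (rule ext, rule hom_eqI[of hhs]) (use F F' in \<open>auto simp: alg_hom_def\<close>)
qed

abbreviation \<Delta> where "\<Delta> \<equiv> coprod E"

lemma coprod_hom: "alg_hom hs hhs \<Delta>" and coprod_iota: "\<Delta> (\<iota> a) = \<iota> a \<otimes> 1 + 1 \<otimes> \<iota> a"
  using theI'[OF coprod_ex1] by (auto simp: coprod_def alg_hom_def)

lemmas coprod_lin = alg_homD(1)[OF coprod_hom] and coprod_mult = alg_homD(3)[OF coprod_hom]
  and coprod_1 = alg_homD(2)[OF coprod_hom]

text \<open>The three slots of \<open>H \<otimes> H \<otimes> H\<close>. The images of
  \<open>s1\<close>, \<open>s2\<close> and \<open>s3\<close> commute, so every expression there can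
  be sorted by slot.\<close>

definition s1 where "s1 h = hhtens E (h \<otimes> 1) 1"
definition s2 where "s2 h = hhtens E (1 \<otimes> h) 1"
definition s3 where "s3 h = hhtens E 1 h"

lemma s_hom: "alg_hom hs hhhs s1" "alg_hom hs hhhs s2" "alg_hom hs hhhs s3"
  unfolding s1_def[abs_def] s2_def[abs_def] s3_def[abs_def]
  by (intro alg_hom_comp[OF tensor_hom_l[OF HH] tensor_hom_l[OF HHH]]
      alg_hom_comp[OF tensor_hom_r[OF HH] tensor_hom_l[OF HHH]] tensor_hom_r[OF HHH])+

lemma s_comm: "s2 g * s1 h = s1 h * s2 g" "s3 g * s1 h = s1 h * s3 g" "s3 g * s2 h = s2 h * s3 g"
  by (simp_all add: s1_def s2_def s3_def tns_simps)

lemmas s_lin = s_hom[THEN alg_homD(1)] and s_1 [simp] = s_hom[THEN alg_homD(2)]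
  and s_mult = s_hom[THEN alg_homD(3)]

lemma hhtens_s: "hhtens E (f \<otimes> g) h = s1 f * s2 g * s3 h"
  by (simp add: s1_def s2_def s3_def tns_simps)

lemma flip_hom: "alg_hom hhs hhs (flip E)" and flip_tns: "flip E (f \<otimes> g) = g \<otimes> f"
proof -
  show "alg_hom hhs hhs (flip E)"
    unfolding flip_def
    by (rule tensor_lift_hom(1)[OF HH HH_alg tensor_hom_r[OF HH] tensor_hom_l[OF HH]])
      (simp_all add: tns_simps)
  have "flip E (f \<otimes> g) = (1 \<otimes> f) * (g \<otimes> 1)"
    unfolding flip_def
    by (rule tensor_lift_hom(2)[OF HH HH_alg tensor_hom_r[OF HH] tensor_hom_l[OF HH]])
      (simp_all add: tns_simps)
  then show "flip E (f \<otimes> g) = g \<otimes> f" by (simp add: tns_simps)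
qed

lemma one_tens_hom: "alg_hom hhs hhhs (one_tens E)" and one_tens_tns: "one_tens E (f \<otimes> g) = s2 f * s3 g"
proof -
  show "alg_hom hhs hhhs (one_tens E)"
    unfolding one_tens_def
    by (rule tensor_lift_hom(1)[OF HH HHH_alg s_hom(2) s_hom(3)])
      (simp_all add: hhtens_s s_comm)
  have "one_tens E (f \<otimes> g) = s2 f * s3 g"
    unfolding one_tens_def
    by (rule tensor_lift_hom(2)[OF HH HHH_alg s_hom(2) s_hom(3)])
      (simp_all add: hhtens_s s_comm)
  then show "one_tens E (f \<otimes> g) = s2 f * s3 g" by (simp add: tns_simps)
qed

lemma coprod_id_hom: "alg_hom hhs hhhs (coprod_id E)"
  and coprod_id_tns: "coprod_id E (f \<otimes> g) = hhtens E (\<Delta> f) 1 * s3 g"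
proof -
  show "alg_hom hhs hhhs (coprod_id E)"
    unfolding coprod_id_def
    by (rule tensor_lift_hom(1)[OF HH HHH_alg alg_hom_comp[OF coprod_hom tensor_hom_l[OF HHH]] s_hom(3)])
      (simp_all add: s3_def tns_simps)
  have "coprod_id E (f \<otimes> g) = hhtens E (\<Delta> f) 1 * s3 g"
    unfolding coprod_id_def
    by (rule tensor_lift_hom(2)[OF HH HHH_alg alg_hom_comp[OF coprod_hom tensor_hom_l[OF HHH]] s_hom(3)])
      (simp_all add: s3_def tns_simps)
  then show "coprod_id E (f \<otimes> g) = hhtens E (\<Delta> f) 1 * s3 g" by (simp add: tns_simps)
qed

lemma one_tens_comm: "s1 f * one_tens E x = one_tens E x * s1 f"
proof (rule tensor_eqI[OF HH_tp lin_comp[OF alg_homD(1)[OF one_tens_hom] algebra_mult_r[OF HHH_alg]]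
      lin_comp[OF alg_homD(1)[OF one_tens_hom] algebra_mult_l[OF HHH_alg]]])
  fix a b show "s1 f * one_tens E (a \<otimes> b) = one_tens E (a \<otimes> b) * s1 f"
    by (simp add: one_tens_tns s_comm mult.assoc) (simp add: s_comm mult.assoc[symmetric])
qed

lemma id_coprod_hom: "alg_hom hhs hhhs (id_coprod E)"
  and id_coprod_tns: "id_coprod E (f \<otimes> g) = s1 f * one_tens E (\<Delta> g)"
proof -
  show "alg_hom hhs hhhs (id_coprod E)"
    unfolding id_coprod_def
    by (rule tensor_lift_hom(1)[OF HH HHH_alg s_hom(1) alg_hom_comp[OF coprod_hom one_tens_hom]])
      (simp_all add: s1_def[symmetric] one_tens_comm)
  have "id_coprod E (f \<otimes> g) = s1 f * one_tens E (\<Delta> g)"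
    unfolding id_coprod_def
    by (rule tensor_lift_hom(2)[OF HH HHH_alg s_hom(1) alg_hom_comp[OF coprod_hom one_tens_hom]])
      (simp_all add: s1_def[symmetric] one_tens_comm)
  then show "id_coprod E (f \<otimes> g) = s1 f * one_tens E (\<Delta> g)" by (simp add: tns_simps)
qed

lemma flip_id_hom: "alg_hom hhhs hhhs (flip_id E)"
  and flip_id_tns: "flip_id E (hhtens E x g) = hhtens E (flip E x) 1 * s3 g"
proof -
  show "alg_hom hhhs hhhs (flip_id E)"
    unfolding flip_id_def
    by (rule tensor_lift_hom(1)[OF HHH HHH_alg alg_hom_comp[OF flip_hom tensor_hom_l[OF HHH]] s_hom(3)])
      (simp_all add: s3_def tns_simps)
  have "flip_id E (hhtens E x g) = hhtens E (flip E x) 1 * s3 g"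
    unfolding flip_id_def
    by (rule tensor_lift_hom(2)[OF HHH HHH_alg alg_hom_comp[OF flip_hom tensor_hom_l[OF HHH]] s_hom(3)])
      (simp_all add: s3_def tns_simps)
  then show "flip_id E (hhtens E x g) = hhtens E (flip E x) 1 * s3 g" by (simp add: tns_simps)
qed

lemma flip_id_s: "flip_id E (s1 h) = s2 h" "flip_id E (s2 h) = s1 h" "flip_id E (s3 h) = s3 h"
  by (simp_all add: s1_def s2_def s3_def flip_id_tns flip_tns alg_homD(2)[OF flip_hom] tns_simps)

lemma hhtens_coprod_iota: "hhtens E (\<Delta> (\<iota> a)) 1 = s1 (\<iota> a) + s2 (\<iota> a)"
  by (simp add: coprod_iota bilin_simps[OF HHH_bilin] s1_def s2_def)

text \<open>The triple product over \<open>H\<close> is balanced through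
  \<open>(\<Delta> \<otimes> id) \<Delta>\<close>, whereas \<open>act_right\<close> produces
  \<open>(id \<otimes> \<Delta>) \<Delta>\<close>; this identifies the two. Both sides are
  homomorphisms, so generators suffice.\<close>

lemma coassoc: "id_coprod E (\<Delta> h) = coprod_id E (\<Delta> h)"
proof (rule hom_eqI[OF alg_hom_comp[OF coprod_hom id_coprod_hom] alg_hom_comp[OF coprod_hom coprod_id_hom]])
  fix a
  have "\<Delta> (\<iota> a) = \<iota> a \<otimes> 1 + 1 \<otimes> \<iota> a" by (rule coprod_iota)
  then show "id_coprod E (\<Delta> (\<iota> a)) = coprod_id E (\<Delta> (\<iota> a))"
    by (simp add: lin_add[OF alg_homD(1)[OF id_coprod_hom]] lin_add[OF alg_homD(1)[OF coprod_id_hom]]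
        id_coprod_tns coprod_id_tns hhtens_coprod_iota coprod_1 tns_simps
        lin_add[OF alg_homD(1)[OF one_tens_hom]] one_tens_tns alg_homD(2)[OF one_tens_hom])
      (simp add: coprod_iota bilin_simps[OF HHH_bilin] s1_def s2_def
        lin_add[OF alg_homD(1)[OF one_tens_hom]] one_tens_tns tns_simps s3_def)
qed

lemma flip_coprod: "flip E (\<Delta> h) = \<Delta> h"
  by (rule hom_eqI[OF alg_hom_comp[OF coprod_hom flip_hom] coprod_hom])
    (simp add: coprod_iota lin_add[OF alg_homD(1)[OF flip_hom]] flip_tns)

text \<open>Consequence of cocommutativity. It makes the flip of the first two slots well defined on
  the triple product over \<open>H\<close>.\<close>

lemma flip_coprod_id: "flip_id E (coprod_id E x) = coprod_id E x"
  by (rule tensor_eqI[OF HH_tp lin_comp[OF alg_homD(1)[OF coprod_id_hom] alg_homD(1)[OF flip_id_hom]]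
        alg_homD(1)[OF coprod_id_hom]])
    (simp add: coprod_id_tns alg_homD(3)[OF flip_id_hom] flip_id_s flip_id_tns flip_coprod)

end

section \<open>Straightening of words in the basis letters, with confluence from the Jacobi
  identity\<close>

section \<open>The Poincare--Birkhoff--Witt theorem\<close>

fun inversions :: "nat list \<Rightarrow> nat" where
  "inversions [] = 0"
| "inversions (x # xs) = length (filter (\<lambda>y. y < x) xs) + inversions xs"

lemma inversions_swap:
  assumes "j < i" shows "inversions (u @ i # j # v) = Suc (inversions (u @ j # i # v))"
  using assms by (induction u) auto

lemma first_descent:
  "\<not> sorted (w :: nat list) \<Longrightarrow> \<exists>u i j v. w = u @ i # j # v \<and> j < i \<and> sorted (u @ [i])"
proof (induction w rule: rev_induct)
  case (snoc x w)
  show ?case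
  proof (cases "sorted w")
    case True
    with snoc.prems have "w \<noteq> []" by auto
    then obtain u i where w: "w = u @ [i]" by (metis rev_exhaust)
    with True snoc.prems have "x < i" by (auto simp: sorted_append)
    then show ?thesis using w True by (intro exI[of _ u] exI[of _ i] exI[of _ x] exI[of _ "[]"]) auto
  next
    case False
    then obtain u i j v where "w = u @ i # j # v \<and> j < i \<and> sorted (u @ [i])" using snoc.IH by blast
    then show ?thesis by (intro exI[of _ u] exI[of _ i] exI[of _ j] exI[of _ "v @ [x]"]) auto
  qed
qed simp

locale structure_constants =
  fixes I :: "nat set" and c :: "nat \<Rightarrow> nat \<Rightarrow> nat \<Rightarrow> 'k::field_char_0"
  assumes fin: "finite I" and anti: "c i j k = - c j i k"
    and jacobi: "(\<Sum>m\<in>I. c i j m * c m k l + c j k m * c m i l + c k i m * c m j l) = 0"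
begin

lemma c_diag: "c i i k = 0"
  using anti[of i i k] by simp

text \<open>Since \<open>u @ [i]\<close> is sorted, this is the leftmost descent, and the choice is
  in fact unique.\<close>

definition descent :: "nat list \<Rightarrow> nat list \<times> nat \<times> nat \<times> nat list" where
  "descent w = (SOME (u, i, j, v). w = u @ i # j # v \<and> j < i \<and> sorted (u @ [i]))"

lemma descent:
  assumes "\<not> sorted w" "descent w = (u, i, j, v)"
  shows "w = u @ i # j # v" "j < i" "sorted (u @ [i])"
proof -
  have "case descent w of (u, i, j, v) \<Rightarrow> w = u @ i # j # v \<and> j < i \<and> sorted (u @ [i])"
    unfolding descent_def by (rule someI_ex) (use first_descent[OF assms(1)] in auto)
  then show "w = u @ i # j # v" "j < i" "sorted (u @ [i])" using assms(2) by auto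
qed

lemma descent_less:
  "\<not> sorted w \<Longrightarrow> descent w = (u, i, j, v) \<Longrightarrow>
    length w = length u + length v + 2 \<and> inversions (u @ j # i # v) < inversions w"
  using descent[of w u i j v] inversions_swap[of j i u v] by auto

text \<open>\<open>straighten b w\<close> is the value on the word \<open>w\<close> of the linear functional on \<open>U(d)\<close> that takes
  the value \<open>b\<close> on ordered monomials: the first descent of \<open>w\<close> is rewritten.\<close>

function straighten :: "(nat list \<Rightarrow> 'k) \<Rightarrow> nat list \<Rightarrow> 'k" where
  "straighten b w = (if sorted w then b w else
     (case descent w of (u, i, j, v) \<Rightarrow>
        straighten b (u @ j # i # v) + (\<Sum>k\<in>I. c i j k * straighten b (u @ k # v))))"
  by pat_completeness auto
termination
  by (relation "measures [\<lambda>(b, w). length w, \<lambda>(b, w). inversions w]") (auto dest: descent_less[OF _ sym])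

declare straighten.simps [simp del]

lemma straighten_sorted: "sorted w \<Longrightarrow> straighten b w = b w"
  by (subst straighten.simps) simp

abbreviation contr where "contr b u i j v \<equiv> (\<Sum>k\<in>I. c i j k * straighten b (u @ k # v))"

lemma contr_anti: "contr b u i j v = - contr b u j i v"
  by (simp add: sum_negf[symmetric] anti[of i j])

text \<open>This is the diamond lemma for the rewriting of descents.\<close>

lemma straighten_descent:
  "w = u @ i # j # v \<Longrightarrow> j < i \<Longrightarrow> straighten b w = straighten b (u @ j # i # v) + contr b u i j v"
proof (induction w arbitrary: u i j v rule: wf_induct_rule[OF wf_measures[of "[length, inversions]"]])
  case (1 w u i j v)
  let ?N = "straighten b"
  have IH: "?N (x @ p # q # y) = ?N (x @ q # p # y) + contr b x p q y"
    if "length (x @ p # q # y) < length w \<or> length (x @ p # q # y) = length w \<and> inversions (x @ p # q # y) < inversions w" "q < p"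
    for x p q y
    using 1(1)[of "x @ p # q # y" x p q y] that by auto
  have sw: "?N (x @ p # q # y) = ?N (x @ q # p # y) + contr b x p q y"
    if "length (x @ p # q # y) < length w" for x p q y
  proof (cases p q rule: linorder_cases)
    case less
    then show ?thesis using IH[of x q p y] that contr_anti[of p q b x y] by simp
  next
    case equal
    then show ?thesis by (simp add: c_diag)
  next
    case greater
    then show ?thesis using IH[of x p q y] that by simp
  qed
  have ns: "\<not> sorted w" using 1(2,3) by (auto simp: sorted_append)
  obtain u0 i0 j0 v0 where d0: "descent w = (u0, i0, j0, v0)" by (metis prod_cases4)
  note d = descent[OF ns d0]
  have N: "?N w = ?N (u0 @ j0 # i0 # v0) + contr b u0 i0 j0 v0"
    by (subst straighten.simps) (simp add: ns d0)
  consider "length u0 > length u" | "length u0 = length u" | "length u = Suc (length u0)"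
    | "length u \<ge> length u0 + 2" by linarith
  then show ?case
  proof cases
    \<comment> \<open>Impossible case: the sorted prefix up to the first descent would contain
      \<open>i\<close> followed by the smaller \<open>j\<close>.\<close>
    case 1
    then have "take (length u + 2) (u0 @ [i0]) = take (length u + 2) (u0 @ i0 # j0 # v0)"
      by (cases "length u0 = Suc (length u)") auto
    also have "\<dots> = take (length u + 2) w" using d(1) by simp
    also have "\<dots> = u @ [i, j]" using \<open>w = u @ i # j # v\<close> by simp
    finally have "sorted (u @ [i, j])" using d(3) sorted_wrt_take by metis
    then show ?thesis using \<open>j < i\<close> by (simp add: sorted_append)
  next
    case 2
    then show ?thesis using d(1) \<open>w = u @ i # j # v\<close> N by auto
  next
    \<comment> \<open>The overlap \<open>i0 > i > j\<close>. Both orders of rewriting are carried on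
      to the sorted order \<open>j, i, i0\<close>; they differ by the three double contractions
      \<open>?c\<close>, whose sum vanishes by the Jacobi identity.\<close>
    case 3
    then obtain a where u: "u = take (length u0) u @ [a]"
      by (metis append_take_drop_id take_all_iff length_Suc_conv_rev append_eq_conv_conj)
    then have "w = take (length u0) u @ a # i # j # v" using \<open>w = u @ i # j # v\<close>
      by (metis append.assoc append_Cons append_Nil)
    then have e: "u = u0 @ [i0]" "j0 = i" "v0 = j # v" using d(1) u 3 by auto
    let ?c = "\<lambda>p q r. \<Sum>m\<in>I. \<Sum>l\<in>I. c p q m * c m r l * ?N (u0 @ l # v)"
    have len: "length w = length u0 + length v + 3" using \<open>w = u @ i # j # v\<close> e by simp
    have inv1: "inversions (u0 @ i # i0 # j # v) < inversions w"
      using \<open>w = u @ i # j # v\<close> e inversions_swap[OF d(2), of u0 "j # v"] by simp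
    have inv2: "inversions (u0 @ i0 # j # i # v) < inversions w"
      using \<open>w = u @ i # j # v\<close> e inversions_swap[OF \<open>j < i\<close>, of "u0 @ [i0]" v] by simp
    have ji0: "j < i0" using d(2) e \<open>j < i\<close> by simp
    have inv3: "inversions (u0 @ i # j # i0 # v) < inversions w"
      using inv1 inversions_swap[OF ji0, of "u0 @ [i]" v] by simp
    have inv4: "inversions (u0 @ j # i0 # i # v) < inversions w"
      using inv2 inversions_swap[OF ji0, of "u0" "i # v"] by simp
    have ii0: "i < i0" using d(2) e by simp
    have s1: "(\<Sum>m\<in>I. c p q m * ?N (u0 @ m # r # v)) = (\<Sum>m\<in>I. c p q m * ?N (u0 @ r # m # v)) + ?c p q r" for p q r
    proof -
      have "?N (u0 @ m # r # v) = ?N (u0 @ r # m # v) + contr b u0 m r v" for m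
        by (rule sw) (simp add: len)
      then show ?thesis by (simp add: algebra_simps sum.distrib sum_distrib_left)
    qed
    have A: "?N w = ?N (u0 @ j # i # i0 # v) + contr b u0 i j (i0 # v) + contr b (u0 @ [i]) i0 j v + contr b u0 i0 i (j # v)"
      using N e IH[of "u0 @ [i]" i0 j v] IH[of u0 i j "i0 # v"] inv1 inv3 \<open>j < i\<close> ji0 by (simp add: len)
    have B: "?N (u @ j # i # v) = ?N (u0 @ j # i # i0 # v) + contr b (u0 @ [j]) i0 i v + contr b u0 i0 j (i # v)"
      using e IH[of u0 i0 j "i # v"] IH[of "u0 @ [j]" i0 i v] inv2 inv4 ii0 ji0 by (simp add: len)
    have J: "?c i j i0 + ?c j i0 i + ?c i0 i j = 0"
    proof -
      have "?c i j i0 + ?c j i0 i + ?c i0 i j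
        = (\<Sum>l\<in>I. (\<Sum>m\<in>I. c i j m * c m i0 l + c j i0 m * c m i l + c i0 i m * c m j l) * ?N (u0 @ l # v))"
        by (subst (1 2 3) sum.swap)
            (simp add: sum.distrib[symmetric] sum_distrib_right sum_distrib_left algebra_simps)
      also have "\<dots> = 0" by (simp add: jacobi)
      finally show ?thesis .
    qed
    have cn: "?c i0 j i = - ?c j i0 i" by (simp add: sum_negf[symmetric] anti[of i0 j])
    have "?N w - (?N (u @ j # i # v) + contr b u i j v) = ?c i j i0 + ?c j i0 i + ?c i0 i j"
      unfolding A B by (simp add: e s1[of i j i0] s1[of i0 j i] s1[of i0 i j] cn)
    then show ?thesis by (simp add: J)
  next
    \<comment> \<open>The two descents are disjoint, so the rewritings commute; \<open>9\<close>
      exchanges the two contractions.\<close>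
    case 4
    define x where "x = drop (length u0 + 2) u"
    have "u = take (length u0 + 2) u @ x" by (simp add: x_def)
    moreover have "take (length u0 + 2) u = take (length u0 + 2) w"
      using \<open>w = u @ i # j # v\<close> 4 by simp
    moreover have "take (length u0 + 2) w = u0 @ [i0, j0]" using d(1) by simp
    ultimately have u: "u = u0 @ i0 # j0 # x" by simp
    then have v0: "v0 = x @ i # j # v" using d(1) \<open>w = u @ i # j # v\<close> by simp
    have len: "length w = length u0 + length x + length v + 4" using \<open>w = u @ i # j # v\<close> u by simp
    have inv1: "inversions (u0 @ j0 # i0 # x @ i # j # v) < inversions w"
      using d(1) inversions_swap[OF d(2), of u0 v0] by (simp add: v0)
    have inv2: "inversions (u0 @ i0 # j0 # x @ j # i # v) < inversions w"
      using \<open>w = u @ i # j # v\<close> inversions_swap[OF \<open>j < i\<close>, of u v] by (simp add: u)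
    have 5: "?N (u0 @ j0 # i0 # x @ i # j # v) = ?N (u0 @ j0 # i0 # x @ j # i # v) + contr b (u0 @ j0 # i0 # x) i j v"
      using IH[of "u0 @ j0 # i0 # x" i j v] inv1 \<open>j < i\<close> by (simp add: len)
    have 6: "?N (u0 @ k # x @ i # j # v) = ?N (u0 @ k # x @ j # i # v) + contr b (u0 @ k # x) i j v" for k
      using sw[of "u0 @ k # x" i j v] by (simp add: len)
    have 7: "?N (u0 @ i0 # j0 # x @ j # i # v) = ?N (u0 @ j0 # i0 # x @ j # i # v) + contr b u0 i0 j0 (x @ j # i # v)"
      using IH[of u0 i0 j0 "x @ j # i # v"] inv2 d(2) by (simp add: len)
    have 8: "?N (u0 @ i0 # j0 # x @ k # v) = ?N (u0 @ j0 # i0 # x @ k # v) + contr b u0 i0 j0 (x @ k # v)" for k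
      using sw[of u0 i0 j0 "x @ k # v"] by (simp add: len)
    have 9: "(\<Sum>k\<in>I. c i0 j0 k * (\<Sum>l\<in>I. c i j l * ?N (u0 @ k # x @ l # v))) = (\<Sum>k\<in>I. c i j k * contr b u0 i0 j0 (x @ k # v))"
      by (simp add: sum_distrib_left mult.left_commute) (rule sum.swap)
    show ?thesis using N
      by (simp add: u v0 5 6 7 8 distrib_left sum.distrib 9)
  qed
qed

lemma straighten_swap:
  "straighten b (u @ i # j # v) = straighten b (u @ j # i # v) + contr b u i j v"
proof (cases i j rule: linorder_cases)
  case less
  then show ?thesis using straighten_descent[OF refl less, of b u v] contr_anti[of i j b u v] by simp
next
  case equal
  then show ?thesis by (simp add: c_diag)
next
  case greater
  then show ?thesis using straighten_descent[OF refl greater] by simp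
qed

text \<open>Rewriting permutes letters up to words that are one letter shorter, where the functional
  is zero. Thus every symmetric prescription in degree \<open>n\<close> extends by zero to lower
  degrees.\<close>

lemma straighten_symbol:
  assumes "\<And>v w. mset v = mset w \<Longrightarrow> \<mu> v = \<mu> w"
  shows "length w \<le> n \<Longrightarrow> straighten (\<lambda>w. if length w = n then \<mu> w else 0) w = (if length w = n then \<mu> w else 0)"
proof (induction w rule: wf_induct_rule[OF wf_measures[of "[length, inversions]"]])
  case (1 w)
  show ?case
  proof (cases "sorted w")
    case True
    then show ?thesis by (simp add: straighten_sorted)
  next
    case False
    obtain u i j v where d0: "descent w = (u, i, j, v)" by (metis prod_cases4)
    note d = descent[OF False d0]
    let ?b = "\<lambda>w. if length w = n then \<mu> w else 0"
    have "straighten ?b w = straighten ?b (u @ j # i # v) + contr ?b u i j v"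
      by (subst straighten.simps) (simp add: False d0)
    moreover have "straighten ?b (u @ j # i # v) = ?b (u @ j # i # v)"
      using 1(1)[of "u @ j # i # v"] 1(2) d inversions_swap[OF d(2), of u v] by simp
    moreover have "?b (u @ j # i # v) = ?b w"
      using assms[of "u @ j # i # v" w] d(1) by (simp add: add_mset_commute)
    moreover have "straighten ?b (u @ k # v) = 0" for k
      using 1(1)[of "u @ k # v"] 1(2) d(1) by simp
    ultimately show ?thesis by simp
  qed
qed

end

lemma sum_rotate:
  "(\<Sum>i\<in>A. \<Sum>j\<in>B. \<Sum>k\<in>C. f i j k) = (\<Sum>k\<in>C. \<Sum>i\<in>A. \<Sum>j\<in>B. f i j k)"
proof -
  have "(\<Sum>j\<in>B. \<Sum>k\<in>C. f i j k) = (\<Sum>k\<in>C. \<Sum>j\<in>B. f i j k)" for i by (rule sum.swap)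
  then show ?thesis by (simp only:) (rule sum.swap)
qed

section \<open>Basis expansions and structure constants of \<open>d\<close>\<close>

section \<open>The data \<open>(d, \<chi>, \<omega>)\<close>\<close>

locale sympl =
  fixes S :: "('k::field_char_0, 'd::ab_group_add) symplectic"
  assumes sd: "symplectic_data S"
begin

abbreviation "ds \<equiv> dscale S"
abbreviation "dbrk \<equiv> dbr S"
abbreviation "\<omega> \<equiv> om S"
abbreviation "\<chi> \<equiv> chi S"
abbreviation "I \<equiv> idx S"
abbreviation "dd \<equiv> dl S"
abbreviation "du' \<equiv> du S"

lemma lie: "lie_algebra (lie_d S)" and vs_d: "vector_space ds" and half_pos: "half S \<ge> 1"
  using sd by (auto simp: symplectic_data_def lie_algebra_def lie_d_def)

lemma lie_d_simps [simp]: "lcarr (lie_d S) = UNIV" "lscale (lie_d S) = ds" "lbr (lie_d S) = dbrk"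
  by (simp_all add: lie_d_def)

lemma br_bilin: "bilin ds ds ds dbrk"
  using lie vs_d by (auto simp: bilin_def lie_algebra_def intro!: linI)

lemma br_self [simp]: "dbrk a a = 0"
  and br_jacobi: "dbrk (dbrk x y) z + dbrk (dbrk y z) x + dbrk (dbrk z x) y = 0"
  using lie by (auto simp: lie_algebra_def)

lemma br_anti: "dbrk a b = - dbrk b a"
proof -
  have "dbrk (a + b) (a + b) = dbrk a a + dbrk b b + (dbrk a b + dbrk b a)"
    by (simp add: bilin_simps[OF br_bilin] del: br_self)
  then show ?thesis by (simp add: eq_neg_iff_add_eq_0)
qed

lemma chi_lin: "lin ds (*) \<chi>" and chi_br [simp]: "\<chi> (dbrk a b) = 0"
  and om_bilin: "bilin ds ds (*) \<omega>" and om_self [simp]: "\<omega> a a = 0"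
  and om_nondeg: "(\<And>b. \<omega> a b = 0) \<Longrightarrow> a = 0"
  and om_cocycle: "(\<omega> (dbrk a1 a2) a3 - \<chi> a1 * \<omega> a2 a3) + (\<omega> (dbrk a2 a3) a1 - \<chi> a2 * \<omega> a3 a1) +
        (\<omega> (dbrk a3 a1) a2 - \<chi> a3 * \<omega> a1 a2) = 0"
  using sd by (auto simp: symplectic_data_def bilin_def)

lemma om_anti: "\<omega> a b = - \<omega> b a"
proof -
  have "\<omega> (a + b) (a + b) = \<omega> a a + \<omega> b b + (\<omega> a b + \<omega> b a)"
    by (simp add: bilin_simps[OF om_bilin] del: om_self)
  then show ?thesis by (simp add: eq_neg_iff_add_eq_0)
qed

lemma basis_ind: "\<not> module.dependent ds (dd ` I)" and basis_span: "module.span ds (dd ` I) = UNIV"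
  and basis_inj: "inj_on dd I"
  using sd by (auto simp: symplectic_data_def)

lemma coord_lin: "lin ds (*) (coord S k)"
proof -
  interpret vector_space ds by (rule vs_d)
  show ?thesis
    using basis_ind basis_span unfolding coord_def
    by (intro linI vs_d vs_field) (auto simp: representation_add representation_scale)
qed

lemma coord_basis: "k \<in> I \<Longrightarrow> j \<in> I \<Longrightarrow> coord S j (dd k) = (if k = j then 1 else 0)"
proof -
  interpret vector_space ds by (rule vs_d)
  show "k \<in> I \<Longrightarrow> j \<in> I \<Longrightarrow> ?thesis"
    using basis_inj representation_basis[OF basis_ind, of "dd k"]
    by (auto simp: coord_def inj_on_eq_iff)
qed

lemma coord_sum: "(\<Sum>k\<in>I. ds (coord S k a) (dd k)) = a"
proof -
  interpret vector_space ds by (rule vs_d)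
  have "(\<Sum>b\<in>dd ` I. ds (representation (dd ` I) a b) b) = a"
    by (rule sum_representation_eq) (use basis_ind basis_span in auto)
  then show ?thesis using basis_inj by (simp add: sum.reindex coord_def)
qed

lemma lin_coord: "lin ds s f \<Longrightarrow> f a = (\<Sum>k\<in>I. s (coord S k a) (f (dd k)))"
  by (subst coord_sum[of a, symmetric]) (simp only: lin_sum lin_scale)

lemma bilin_coord:
  assumes "bilin ds ds s \<beta>"
  shows "\<beta> a b = (\<Sum>i\<in>I. \<Sum>j\<in>I. s (coord S i a * coord S j b) (\<beta> (dd i) (dd j)))"
proof -
  have s: "vector_space s" using bilin_l[OF assms] by (rule lin_vs2)
  have "\<beta> a b = (\<Sum>i\<in>I. s (coord S i a) (\<beta> (dd i) b))"
    by (rule lin_coord) (rule bilin_l[OF assms])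
  also have "\<dots> = (\<Sum>i\<in>I. s (coord S i a) (\<Sum>j\<in>I. s (coord S j b) (\<beta> (dd i) (dd j))))"
    by (subst lin_coord[OF bilin_r[OF assms], of _ b]) (rule refl)
  finally show ?thesis by (simp add: vs_sum[OF s] vs_mult[OF s])
qed

definition cst :: "nat \<Rightarrow> nat \<Rightarrow> nat \<Rightarrow> 'k" where "cst i j k = coord S k (dbrk (dd i) (dd j))"

lemma cst_structure: "structure_constants I cst"
proof
  show "cst i j k = - cst j i k" for i j k
    unfolding cst_def by (subst br_anti) (rule lin_neg[OF coord_lin])
  show "(\<Sum>m\<in>I. cst i j m * cst m k l + cst j k m * cst m i l + cst k i m * cst m j l) = 0" for i j k l
  proof -
    have *: "coord S l (dbrk (dbrk (dd i) (dd j)) (dd k)) = (\<Sum>m\<in>I. cst i j m * cst m k l)" for i j k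
      unfolding cst_def
      by (rule lin_coord) (rule lin_comp[OF bilin_l[OF br_bilin] coord_lin])
    have "coord S l (dbrk (dbrk (dd i) (dd j)) (dd k) + dbrk (dbrk (dd j) (dd k)) (dd i)
        + dbrk (dbrk (dd k) (dd i)) (dd j)) = 0"
      by (simp only: br_jacobi lin_zero[OF coord_lin])
    then show ?thesis by (simp add: lin_add[OF coord_lin] * sum.distrib)
  qed
qed simp

end

locale sympl_env = sympl S + enveloping "lie_d S" E
  for S :: "('k::field_char_0, 'd::ab_group_add) symplectic"
    and E :: "('k, 'd, 'h::ring_1, 'hh::ring_1, 'hhh::ring_1) env"
begin

interpretation sc: structure_constants I cst by (rule cst_structure)

text \<open>A letter acts on functions of index words by appending its basis expansion
  (\<open>\<tau>\<close>). On the functions that obey the swapping rule (\<open>Y\<close>) this is a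
  Lie action, so it extends to \<open>H\<close>; the orbit of \<open>straighten b\<close>, evaluated
  at the empty word, is the functional. As \<open>b\<close> is arbitrary, ordered monomials are
  independent.\<close>

lemma pbw_functional:
  "\<exists>\<phi>. lin hs (*) \<phi> \<and> (\<forall>ks. set ks \<subseteq> I \<longrightarrow> \<phi> (wp (map dd ks)) = sc.straighten b ks)"
proof -
  let ?s = "\<lambda>c (F :: nat list \<Rightarrow> 'k) w. c * F w"
  define \<tau> where "\<tau> a F w = (\<Sum>k\<in>I. coord S k a * F (w @ [k]))" for a and F :: "nat list \<Rightarrow> 'k" and w
  define Y where "Y = {F :: nat list \<Rightarrow> 'k. \<forall>u i j v. F (u @ i # j # v) = F (u @ j # i # v) + (\<Sum>k\<in>I. cst i j k * F (u @ k # v))}"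
  have vs: "vector_space ?s" by (rule vs_pointwise[OF vs_field])
  have lt: "lin ?s ?s (\<tau> a)" for a
    by (intro linI vs) (auto simp: \<tau>_def fun_eq_iff algebra_simps sum.distrib sum_distrib_left)
  have "\<exists>F. lin hs ?s F \<and> (\<forall>ws. F (wp ws) = foldr \<tau> ws (sc.straighten b))"
  proof (rule action_extends[OF vs lt])
    fix a b y assume y: "y \<in> Y"
    show "\<tau> a y \<in> Y"
      unfolding Y_def
    proof (intro CollectI allI)
      fix u i j v
      have e: "y (u @ i # j # v @ [k]) = y (u @ j # i # v @ [k]) + (\<Sum>m\<in>I. cst i j m * y (u @ m # v @ [k]))" for k
        using y unfolding Y_def by blast
      show "\<tau> a y (u @ i # j # v) = \<tau> a y (u @ j # i # v) + (\<Sum>k\<in>I. cst i j k * \<tau> a y (u @ k # v))"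
        unfolding \<tau>_def by (simp add: e distrib_left sum.distrib sum_distrib_left mult.left_commute)
          (rule sum.swap)
    qed
    show "\<tau> (a + b) y = \<tau> a y + \<tau> b y"
      by (simp add: \<tau>_def fun_eq_iff lin_add[OF coord_lin] distrib_right sum.distrib)
    show "\<tau> (lbr (lie_d S) a b) y = \<tau> a (\<tau> b y) - \<tau> b (\<tau> a y)"
    proof
      fix w
      have r: "y (w @ [i, j]) = y (w @ [j, i]) + (\<Sum>k\<in>I. cst i j k * y (w @ [k]))" for i j
        using y unfolding Y_def by blast
      have cb: "coord S k (dbrk a b) = (\<Sum>i\<in>I. \<Sum>j\<in>I. coord S i a * coord S j b * cst i j k)" for k
        unfolding cst_def
        by (rule bilin_coord, rule bilinI)
          (rule lin_comp[OF bilin_l[OF br_bilin] coord_lin] lin_comp[OF bilin_r[OF br_bilin] coord_lin])+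
      have "(\<Sum>i\<in>I. \<Sum>j\<in>I. coord S i a * coord S j b * y (w @ [i, j])) =
         (\<Sum>i\<in>I. \<Sum>j\<in>I. coord S i a * coord S j b * y (w @ [j, i])) + (\<Sum>k\<in>I. coord S k (dbrk a b) * y (w @ [k]))"
      proof -
        have "(\<Sum>i\<in>I. \<Sum>j\<in>I. coord S i a * coord S j b * (\<Sum>k\<in>I. cst i j k * y (w @ [k]))) =
          (\<Sum>k\<in>I. coord S k (dbrk a b) * y (w @ [k]))"
          unfolding cb sum_distrib_left sum_distrib_right
          by (subst sum_rotate) (simp only: mult.assoc)
        moreover have "(\<Sum>i\<in>I. \<Sum>j\<in>I. coord S i a * coord S j b * y (w @ [i, j])) =
            (\<Sum>i\<in>I. \<Sum>j\<in>I. coord S i a * coord S j b * y (w @ [j, i]) +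
              coord S i a * coord S j b * (\<Sum>k\<in>I. cst i j k * y (w @ [k])))"
          by (intro sum.cong refl) (subst r, rule distrib_left)
        ultimately show ?thesis by (simp only: sum.distrib)
      qed
      moreover have "\<tau> a (\<tau> b y) w = (\<Sum>i\<in>I. \<Sum>j\<in>I. coord S i a * coord S j b * y (w @ [i, j]))"
        by (simp add: \<tau>_def sum_distrib_left mult.assoc)
      moreover have "\<tau> b (\<tau> a y) w = (\<Sum>i\<in>I. \<Sum>j\<in>I. coord S i a * coord S j b * y (w @ [j, i]))"
        by (simp add: \<tau>_def sum_distrib_left) (subst sum.swap, simp add: ac_simps)
      ultimately show "\<tau> (lbr (lie_d S) a b) y w = (\<tau> a (\<tau> b y) - \<tau> b (\<tau> a y)) w"
        by (simp add: \<tau>_def)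
    qed
  next
    fix c a y
    show "\<tau> (lscale (lie_d S) c a) y = (\<lambda>w. c * \<tau> a y w)"
      by (simp add: \<tau>_def fun_eq_iff lin_scale[OF coord_lin] sum_distrib_left mult.assoc)
  next
    show "sc.straighten b \<in> Y" unfolding Y_def using sc.straighten_swap by blast
  qed
  then obtain F where F: "lin hs ?s F" "\<And>ws. F (wp ws) = foldr \<tau> ws (sc.straighten b)" by auto
  have ev: "foldr \<tau> (map dd ks) f u = f (u @ ks)" if "set ks \<subseteq> I" for ks f u
    using that
  proof (induction ks arbitrary: u)
    case (Cons k ks)
    have k: "k \<in> I" and IH: "foldr \<tau> (map dd ks) f u = f (u @ ks)" for u
      using Cons by auto
    have "foldr \<tau> (map dd (k # ks)) f u = (\<Sum>m\<in>I. coord S m (dd k) * foldr \<tau> (map dd ks) f (u @ [m]))"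
      by (simp add: \<tau>_def)
    also have "\<dots> = (\<Sum>m\<in>I. if m = k then f (u @ k # ks) else 0)"
      by (rule sum.cong[OF refl]) (simp add: IH coord_basis[OF k])
    also have "\<dots> = f (u @ k # ks)" using k by simp
    finally show ?case .
  qed simp
  have "lin hs (*) (\<lambda>h. F h [])"
    by (rule linI[OF vs_H vs_field]) (simp_all add: lin_add[OF F(1)] lin_scale[OF F(1)])
  moreover have "F (wp (map dd ks)) [] = sc.straighten b ks" if "set ks \<subseteq> I" for ks
    using ev[OF that, of "sc.straighten b" "[]"] by (simp add: F(2))
  ultimately show ?thesis by (intro exI[of _ "\<lambda>h. F h []"]) auto
qed

text \<open>\<open>pr \<xi>\<close> is the value at \<open>\<xi>\<close> of the symbol of a word, \<open>dpr \<xi> \<eta>\<close> its derivative in the direction \<open>\<eta>\<close>.\<close>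

definition pr :: "('d \<Rightarrow> 'k) \<Rightarrow> 'd list \<Rightarrow> 'k" where "pr \<xi> ws = prod_list (map \<xi> ws)"

fun dpr :: "('d \<Rightarrow> 'k) \<Rightarrow> ('d \<Rightarrow> 'k) \<Rightarrow> 'd list \<Rightarrow> 'k" where
  "dpr \<xi> \<eta> [] = 0"
| "dpr \<xi> \<eta> (a # ws) = \<eta> a * pr \<xi> ws + \<xi> a * dpr \<xi> \<eta> ws"

lemma pr_simps [simp]: "pr \<xi> [] = 1" "pr \<xi> (a # ws) = \<xi> a * pr \<xi> ws" "pr \<xi> (us @ ws) = pr \<xi> us * pr \<xi> ws"
  by (simp_all add: pr_def)

lemma dpr_append [simp]: "dpr \<xi> \<eta> (us @ ws) = dpr \<xi> \<eta> us * pr \<xi> ws + pr \<xi> us * dpr \<xi> \<eta> ws"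
  by (induction us) (auto simp: algebra_simps)

lemma pr_rev [simp]: "pr \<xi> (rev ws) = pr \<xi> ws" "dpr \<xi> \<eta> (rev ws) = dpr \<xi> \<eta> ws"
  by (induction ws) (auto simp: algebra_simps)

lemma pr_mset: "mset ws = mset us \<Longrightarrow> pr \<xi> ws = pr \<xi> us"
  unfolding pr_def by (metis mset_map prod_mset_prod_list)

lemma dpr_mset: "mset ws = mset us \<Longrightarrow> dpr \<xi> \<eta> ws = dpr \<xi> \<eta> us"
proof (induction ws arbitrary: us)
  case (Cons a ws)
  then obtain x y where us: "us = x @ a # y" by (metis list.set_intros(1) mset_eq_setD split_list)
  then have m: "mset ws = mset (x @ y)" using Cons.prems by simp
  show ?case using Cons.IH[OF m] pr_mset[OF m] by (simp add: us algebra_simps)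
qed simp

text \<open>Value and derivative are kept together because shifting a functional by a letter mixes
  them: \<open>symbol_shift\<close> sends the pair \<open>\<alpha>, \<beta>\<close> at a letter
  \<open>a\<close> to
  \<open>\<alpha> * \<xi> a + \<beta> * \<eta> a, \<beta> * \<xi> a\<close>.\<close>

definition symbol_functional where
  "symbol_functional \<phi> n \<alpha> \<beta> \<xi> \<eta> \<longleftrightarrow> lin hs (*) \<phi> \<and> (\<forall>ws. length ws < n \<longrightarrow> \<phi> (wp ws) = 0) \<and>
    (\<forall>ws. length ws = n \<longrightarrow> \<phi> (wp ws) = \<alpha> * pr \<xi> ws + \<beta> * dpr \<xi> \<eta> ws)"

lemma symbol_functional_exists:
  assumes \<xi>: "lin ds (*) \<xi>" and \<eta>: "lin ds (*) \<eta>"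
  shows "\<exists>\<phi>. symbol_functional \<phi> n \<alpha> \<beta> \<xi> \<eta>"
proof -
  define \<mu> where "\<mu> ws = \<alpha> * pr \<xi> ws + \<beta> * dpr \<xi> \<eta> ws" for ws
  define f where "f ws = (if length ws = n then \<mu> ws else 0)" for ws
  have mm: "\<mu> (map dd v) = \<mu> (map dd w)" if "mset v = mset w" for v w
    using pr_mset[of "map dd v" "map dd w"] dpr_mset[of "map dd v" "map dd w"] that by (simp add: \<mu>_def)
  obtain \<phi> where \<phi>: "lin hs (*) \<phi>" "\<And>ks. set ks \<subseteq> I \<Longrightarrow> \<phi> (wp (map dd ks)) =
      sc.straighten (\<lambda>w. if length w = n then \<mu> (map dd w) else 0) ks"
    using pbw_functional by blast
  have b: "\<phi> (wp (map dd ks)) = f (map dd ks)" if "set ks \<subseteq> I" "length ks \<le> n" for ks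
    using \<phi>(2)[OF that(1)] sc.straighten_symbol[of "\<lambda>w. \<mu> (map dd w)", OF mm that(2)] by (simp add: f_def)
  have fl: "f (us @ a # ws) = (\<Sum>k\<in>I. coord S k a * f (us @ dd k # ws))" for us a ws
  proof -
    have "lin ds (*) (\<lambda>a. f (us @ a # ws))"
      by (rule linI[OF vs_d vs_field])
        (auto simp: f_def \<mu>_def lin_add[OF \<xi>] lin_add[OF \<eta>] lin_scale[OF \<xi>] lin_scale[OF \<eta>] algebra_simps)
    then show ?thesis by (rule lin_coord)
  qed
  \<comment> \<open>Passage from basis letters to arbitrary ones: both sides are linear in each
    letter, and the letters are replaced from left to right.\<close>
  have c: "\<phi> (wp (map dd ks @ ws)) = f (map dd ks @ ws)" if "set ks \<subseteq> I" "length ks + length ws \<le> n" for ks ws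
    using that
  proof (induction ws arbitrary: ks)
    case Nil then show ?case using b by simp
  next
    case (Cons a ws)
    have "lin ds (*) (\<lambda>a. \<phi> (wp (map dd ks) * \<iota> a * wp ws))"
      using iota_lin
      by (intro lin_comp[OF _ \<phi>(1)] lin_comp[OF _ algebra_mult_l[OF H_alg]] lin_comp[OF _ algebra_mult_r[OF H_alg]]) simp
    from lin_coord[OF this, of a]
    have "\<phi> (wp (map dd ks @ a # ws)) = (\<Sum>k\<in>I. coord S k a * \<phi> (wp (map dd (ks @ [k]) @ ws)))"
      by (simp add: mult.assoc)
    also have "\<dots> = (\<Sum>k\<in>I. coord S k a * f (map dd (ks @ [k]) @ ws))"
    proof (rule sum.cong[OF refl])
      fix k assume "k \<in> I"
      then have "\<phi> (wp (map dd (ks @ [k]) @ ws)) = f (map dd (ks @ [k]) @ ws)"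
        using Cons.prems by (intro Cons.IH) auto
      then show "coord S k a * \<phi> (wp (map dd (ks @ [k]) @ ws)) = coord S k a * f (map dd (ks @ [k]) @ ws)"
        by simp
    qed
    also have "\<dots> = f (map dd ks @ a # ws)" by (simp add: fl[of "map dd ks" a ws])
    finally show ?case .
  qed
  have "symbol_functional \<phi> n \<alpha> \<beta> \<xi> \<eta>"
    unfolding symbol_functional_def using \<phi>(1) c[of "[]"] by (auto simp: f_def \<mu>_def)
  then show ?thesis by blast
qed

end

section \<open>Elements of the product over \<open>H\<close> as functions of functionals of
  \<open>H\<close>\<close>

section \<open>Fourier coefficients of a pseudoaction\<close>

locale hmodule = enveloping G E
  for G :: "('k::field, 'd::ab_group_add) lie"
    and E :: "('k, 'd, 'h::ring_1, 'hh::ring_1, 'hhh::ring_1) env" +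
  fixes M :: "('k, 'h, 'hh, 'hhh, 'm::ab_group_add, 'm2::ab_group_add, 'm3::ab_group_add) hmod"
  assumes hm: "h_module E M"
begin

abbreviation "ms \<equiv> scale1 M"
abbreviation "m2s \<equiv> scale2 M"
abbreviation "m3s \<equiv> scale3 M"

lemma vs_M: "vector_space ms" and hact_lin: "lin ms ms (hact M h)" and hact_lin_l: "lin hs ms (\<lambda>h. hact M h m)"
  and hact_1: "hact M 1 m = m" and hact_mult: "hact M (g * h) m = hact M g (hact M h m)"
  and tp2: "balanced_tensor_product hhs (\<lambda>x h. x * \<Delta> h) ms (hact M) m2s (tens2 M)"
  and tp3: "balanced_tensor_product hhhs (\<lambda>x h. x * coprod_id E (\<Delta> h)) ms (hact M) m3s (tens3 M)"
  using hm by (simp_all add: h_module_def)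

lemmas tens2_bilin = balanced_bilin(1)[OF tp2] and tens3_bilin = balanced_bilin(1)[OF tp3]

lemma tens2_bal: "tens2 M (x * \<Delta> h) m = tens2 M x (hact M h m)"
  by (rule balanced_bilin(2)[OF tp2])

lemma tens3_bal: "tens3 M (x * coprod_id E (\<Delta> h)) m = tens3 M x (hact M h m)"
  by (rule balanced_bilin(2)[OF tp3])

lemma vs_M2: "vector_space m2s" and vs_M3: "vector_space m3s"
  using bilin_l[OF tens2_bilin] bilin_l[OF tens3_bilin] by (auto intro: lin_vs2)

lemma lmult2_lin: "lin m2s m2s (lmult2 M g)" and lmult2_tens2: "lmult2 M g (tens2 M x m) = tens2 M (g * x) m"
proof -
  have b: "bilin hhs ms m2s (\<lambda>x m. tens2 M (g * x) m)"
    by (intro bilinI lin_comp[OF algebra_mult_r[OF HH_alg] bilin_l[OF tens2_bilin]] bilin_r[OF tens2_bilin])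
  have bal: "tens2 M (g * (x * \<Delta> h)) m = tens2 M (g * x) (hact M h m)" for x h m
    using tens2_bal[of "g * x" h m] by (simp add: mult.assoc)
  show "lin m2s m2s (lmult2 M g)"
    unfolding lmult2_def by (rule balanced_lift_lin[OF tp2 b]) (rule bal)
  show "lmult2 M g (tens2 M x m) = tens2 M (g * x) m"
    unfolding lmult2_def by (rule balanced_lift_eq[OF tp2 b]) (rule bal)
qed

lemma tp2_span: "X \<in> module.span m2s {tens2 M (f \<otimes> g) m | f g m. True}"
proof -
  interpret vector_space m2s by (rule vs_M2)
  have *: "tens2 M x m \<in> span {tens2 M (f \<otimes> g) m | f g m. True}" for x m
    by (rule lin_in_subspace[OF bilin_l[OF tens2_bilin] subspace_span _ tensor_span[OF HH_tp, of x]])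
      (auto intro!: span_base)
  show ?thesis
    by (rule lin_in_subspace[OF lin_id[OF vs_M2] subspace_span _ balanced_span[OF tp2, of X]]) (use * in auto)
qed

text \<open>An element \<open>\<Sum> (f\<^sub>i \<otimes> 1) \<otimes>\<^sub>H m\<^sub>i\<close> of \<open>(H \<otimes> H) \<otimes>\<^sub>H M\<close> is determined by the map
  \<open>\<phi> \<mapsto> \<Sum> \<phi>(f\<^sub>i) m\<^sub>i\<close> on functionals \<open>\<phi>\<close> of \<open>H\<close>.  This map is the extension to \<open>H\<close> of the following
  Lie action on functions of \<open>\<phi>\<close>, which avoids the antipode; the functions vanish on
  nonlinear \<open>\<phi>\<close>.\<close>

definition fs :: "'k \<Rightarrow> (('h \<Rightarrow> 'k) \<Rightarrow> 'm) \<Rightarrow> ('h \<Rightarrow> 'k) \<Rightarrow> 'm" where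
  "fs c F = (\<lambda>\<phi>. ms c (F \<phi>))"

definition shift :: "('h \<Rightarrow> 'k) \<Rightarrow> 'd \<Rightarrow> 'h \<Rightarrow> 'k" where "shift \<phi> a = (\<lambda>f. \<phi> (f * \<iota> a))"

definition Tau :: "'d \<Rightarrow> (('h \<Rightarrow> 'k) \<Rightarrow> 'm) \<Rightarrow> ('h \<Rightarrow> 'k) \<Rightarrow> 'm" where
  "Tau a F = (\<lambda>\<phi>. if lin hs (*) \<phi> then hact M (\<iota> a) (F \<phi>) - F (shift \<phi> a) else 0)"

definition seed :: "'h \<Rightarrow> 'm \<Rightarrow> ('h \<Rightarrow> 'k) \<Rightarrow> 'm" where
  "seed f m = (\<lambda>\<phi>. if lin hs (*) \<phi> then ms (\<phi> f) m else 0)"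

definition LF :: "(('h \<Rightarrow> 'k) \<Rightarrow> 'm) set" where
  "LF = {F. (\<forall>\<phi> \<psi>. lin hs (*) \<phi> \<longrightarrow> lin hs (*) \<psi> \<longrightarrow> F (\<lambda>x. \<phi> x + \<psi> x) = F \<phi> + F \<psi>) \<and>
            (\<forall>\<phi> c. lin hs (*) \<phi> \<longrightarrow> F (\<lambda>x. c * \<phi> x) = ms c (F \<phi>))}"

lemma vs_fs: "vector_space fs"
  unfolding fs_def[abs_def] by (rule vs_pointwise[OF vs_M])

lemma shift_lin: "lin hs (*) \<phi> \<Longrightarrow> lin hs (*) (shift \<phi> a)"
  unfolding shift_def by (rule lin_comp[OF algebra_mult_l[OF H_alg]])

lemma Tau_lin: "lin fs fs (Tau a)"
  by (rule linI[OF vs_fs vs_fs])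
    (auto simp: Tau_def fs_def fun_eq_iff lin_add[OF hact_lin] lin_scale[OF hact_lin] vs_diff[OF vs_M] vs_zero[OF vs_M])

lemma LF_D:
  assumes "F \<in> LF" "lin hs (*) \<phi>"
  shows LF_add: "lin hs (*) \<psi> \<Longrightarrow> F (\<lambda>x. \<phi> x + \<psi> x) = F \<phi> + F \<psi>"
    and LF_scale: "F (\<lambda>x. c * \<phi> x) = ms c (F \<phi>)"
  using assms by (auto simp: LF_def)

lemma LF_diff:
  assumes F: "F \<in> LF" and p: "lin hs (*) \<phi>" "lin hs (*) \<psi>"
  shows "F (\<lambda>x. \<phi> x - \<psi> x) = F \<phi> - F \<psi>"
proof -
  have "lin hs (*) (\<lambda>x. (- 1) * \<psi> x)" using lin_smult[OF p(2)] by blast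
  from LF_add[OF F p(1) this] LF_scale[OF F p(2), of "- 1"] show ?thesis
    by (simp add: vs_minus_left[OF vs_M] vs_one[OF vs_M])
qed

lemma Tau_LF: "F \<in> LF \<Longrightarrow> Tau a F \<in> LF"
proof -
  assume F: "F \<in> LF"
  have s: "shift (\<lambda>x. \<phi> x + \<psi> x) a = (\<lambda>x. shift \<phi> a x + shift \<psi> a x)" "shift (\<lambda>x. c * \<phi> x) a = (\<lambda>x. c * shift \<phi> a x)"
    for \<phi> \<psi> c by (simp_all add: shift_def)
  show ?thesis
    unfolding LF_def
    by (auto simp: Tau_def s LF_add[OF F] LF_scale[OF F] shift_lin lin_plus lin_smult
        lin_add[OF hact_lin] lin_scale[OF hact_lin] vs_diff[OF vs_M])
qed

lemma seed_LF: "seed f m \<in> LF"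
  by (auto simp: LF_def seed_def lin_plus lin_smult vs_add_left[OF vs_M] vs_mult[OF vs_M])

text \<open>This is the rule \<open>(f \<otimes> a) \<otimes>\<^sub>H m = (f \<otimes> 1)
  \<otimes>\<^sub>H a m - (f a \<otimes> 1) \<otimes>\<^sub>H m\<close>, a consequence of the form
  of \<open>\<Delta>\<close> on letters, and the reason for the definition of
  \<open>Tau\<close>.\<close>

lemma Tau_seed: "Tau a (seed f m) = seed f (hact M (\<iota> a) m) - seed (f * \<iota> a) m"
  by (auto simp: Tau_def seed_def fun_eq_iff shift_lin lin_scale[OF hact_lin]) (simp add: shift_def)

lemma LF_subspace: "F \<in> LF \<Longrightarrow> F' \<in> LF \<Longrightarrow> F + F' \<in> LF" "F \<in> LF \<Longrightarrow> fs c F \<in> LF"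
  by (auto simp: LF_def fs_def vs_add[OF vs_M] vs_mult[OF vs_M] mult.commute)

lemma ext_exists:
  assumes x: "x \<in> LF" shows "\<exists>F. lin hs fs F \<and> (\<forall>ws. F (wp ws) = foldr Tau ws x)"
proof (rule action_extends[OF vs_fs Tau_lin, of LF])
  fix a b y c assume y: "y \<in> LF"
  have sh: "shift \<phi> (a + b) = (\<lambda>f. shift \<phi> a f + shift \<phi> b f)"
    "shift \<phi> (lscale G c a) = (\<lambda>f. c * shift \<phi> a f)"
    "shift \<phi> (lbr G a b) = (\<lambda>f. shift (shift \<phi> b) a f - shift (shift \<phi> a) b f)" if "lin hs (*) \<phi>" for \<phi> a b c
    by (simp_all add: shift_def fun_eq_iff iota_add iota_scale iota_br distrib_left right_diff_distrib
        lin_add[OF that] lin_diff[OF that] lin_scale[OF that] algebra_scale[OF H_alg] mult.assoc)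
  show "Tau a y \<in> LF" by (rule Tau_LF[OF y])
  show "Tau (a + b) y = Tau a y + Tau b y"
    by (auto simp: Tau_def fun_eq_iff sh LF_add[OF y] shift_lin iota_add lin_add[OF hact_lin_l])
  show "Tau (lscale G c a) y = fs c (Tau a y)"
    by (auto simp: Tau_def fun_eq_iff sh LF_scale[OF y] shift_lin iota_scale lin_scale[OF hact_lin_l] fs_def
        vs_diff[OF vs_M] vs_zero[OF vs_M])
  show "Tau (lbr G a b) y = Tau a (Tau b y) - Tau b (Tau a y)"
    by (auto simp: Tau_def fun_eq_iff sh LF_diff[OF y] shift_lin iota_br lin_diff[OF hact_lin_l] lin_diff[OF hact_lin] hact_mult)
qed (rule x)

definition ext where "ext x = (SOME F. lin hs fs F \<and> (\<forall>ws. F (wp ws) = foldr Tau ws x))"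

lemma ext: assumes "x \<in> LF" shows ext_lin: "lin hs fs (ext x)" and ext_wp: "ext x (wp ws) = foldr Tau ws x"
  using someI_ex[OF ext_exists[OF assms]] by (auto simp: ext_def)

lemma ext_eqI:
  assumes "x \<in> LF" "lin hs fs F" "\<And>ws. F (wp ws) = foldr Tau ws x" shows "ext x h = F h"
  by (rule H_eqI[OF ext_lin[OF assms(1)] assms(2)]) (simp add: ext_wp assms)

lemmas foldr_Tau_lin = foldr_lin[OF vs_fs Tau_lin]

lemma ext_add: assumes "x \<in> LF" "y \<in> LF" shows "ext (x + y) h = ext x h + ext y h"
  by (rule ext_eqI[OF LF_subspace(1)[OF assms] lin_plus[OF ext_lin[OF assms(1)] ext_lin[OF assms(2)]]])
    (simp only: ext_wp[OF assms(1)] ext_wp[OF assms(2)] lin_add[OF foldr_Tau_lin])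

lemma ext_scale: assumes "x \<in> LF" shows "ext (fs c x) h = fs c (ext x h)"
  by (rule ext_eqI[OF LF_subspace(2)[OF assms] lin_smult[OF ext_lin[OF assms]]])
    (simp only: ext_wp[OF assms] lin_scale[OF foldr_Tau_lin])

lemma ext_diff: assumes "x \<in> LF" "x - y \<in> LF" "y \<in> LF" shows "ext (x - y) h = ext x h - ext y h"
  using ext_add[OF assms(2,3), of h] by simp

lemma ext_mult_r: assumes x: "x \<in> LF" shows "ext x (h * \<iota> a) = ext (Tau a x) h"
proof (rule ext_eqI[symmetric])
  show "lin hs fs (\<lambda>h. ext x (h * \<iota> a))"
    by (rule lin_comp[OF algebra_mult_l[OF H_alg] ext_lin[OF x]])
  show "ext x (wp ws * \<iota> a) = foldr Tau ws (Tau a x)" for ws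
    using ext_wp[OF x, of "ws @ [a]"] by simp
qed (rule Tau_LF[OF x])

lemma ext_mult_l: assumes x: "x \<in> LF" shows "ext x (\<iota> a * h) = Tau a (ext x h)"
  by (rule H_eqI[OF lin_comp[OF algebra_mult_r[OF H_alg] ext_lin[OF x]] lin_comp[OF ext_lin[OF x] Tau_lin]])
    (use ext_wp[OF x, of "a # _"] in \<open>simp add: ext_wp[OF x]\<close>)

lemma seed_simps: "seed (f + f') m = seed f m + seed f' m" "seed (hs c f) m = fs c (seed f m)"
  "seed f (m + m') = seed f m + seed f m'" "seed f (ms c m) = fs c (seed f m)"
  by (auto simp: seed_def fs_def fun_eq_iff lin_add lin_scale vs_add_left[OF vs_M] vs_add[OF vs_M] vs_mult[OF vs_M]
      vs_zero[OF vs_M] mult.commute)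

lemma seed_bilin: "bilin hs hs fs (\<lambda>f g. ext (seed f m) g)"
  by (rule bilinI) (auto intro!: linI vs_H vs_fs ext_lin simp: seed_LF seed_simps ext_add ext_scale)

definition Psi0 where "Psi0 x m = tensor_lift hhs fs (htens E) (\<lambda>f g. ext (seed f m) g) x"

lemma Psi0_lin: "lin hhs fs (\<lambda>x. Psi0 x m)" and Psi0_tns: "Psi0 (f \<otimes> g) m = ext (seed f m) g"
  unfolding Psi0_def by (rule tensor_lift_lin[OF HH_tp seed_bilin] tensor_lift_eq[OF HH_tp seed_bilin])+

lemma Psi0_bilin: "bilin hhs ms fs Psi0"
proof (rule bilinI[OF Psi0_lin])
  fix x
  have "Psi0 x (m + m') = Psi0 x m + Psi0 x m'" for m m'
    by (rule tensor_eqI[OF HH_tp Psi0_lin lin_plus[OF Psi0_lin Psi0_lin]])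
      (simp add: Psi0_tns seed_simps ext_add seed_LF)
  moreover have "Psi0 x (ms c m) = fs c (Psi0 x m)" for c m
    by (rule tensor_eqI[OF HH_tp Psi0_lin lin_smult[OF Psi0_lin]])
      (simp add: Psi0_tns seed_simps ext_scale seed_LF)
  ultimately show "lin ms fs (Psi0 x)" by (intro linI vs_M vs_fs)
qed

text \<open>For a single letter this is \<open>Tau_seed\<close>, and words follow because
  \<open>\<Delta>\<close> is multiplicative. It makes \<open>Psi\<close> well defined.\<close>

lemma Psi0_bal: "Psi0 (x * \<Delta> h) m = Psi0 x (hact M h m)"
proof -
  have 1: "Psi0 (x * \<Delta> (\<iota> a)) m = Psi0 x (hact M (\<iota> a) m)" for x a m
  proof (rule tensor_eqI[OF HH_tp lin_comp[OF algebra_mult_l[OF HH_alg] Psi0_lin] Psi0_lin])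
    fix f g
    have "ext (seed f m) (g * \<iota> a) = ext (seed f (hact M (\<iota> a) m)) g - ext (seed (f * \<iota> a) m) g"
      using ext_diff[OF seed_LF[of f "hact M (\<iota> a) m"] _ seed_LF[of "f * \<iota> a" m]] Tau_LF[OF seed_LF[of f m], of a]
      by (simp add: ext_mult_r seed_LF Tau_seed)
    then show "Psi0 ((f \<otimes> g) * \<Delta> (\<iota> a)) m = Psi0 (f \<otimes> g) (hact M (\<iota> a) m)"
      by (simp add: coprod_iota distrib_left tns_simps lin_add[OF Psi0_lin] Psi0_tns)
  qed
  have 2: "Psi0 (x * \<Delta> (wp ws)) m = Psi0 x (hact M (wp ws) m)" for ws x
  proof (induction ws arbitrary: x)
    case Nil then show ?case by (simp add: coprod_1 hact_1)
  next
    case (Cons a ws)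
    then show ?case by (simp add: coprod_mult mult.assoc[symmetric] 1 hact_mult)
  qed
  show ?thesis
    by (rule H_eqI[OF lin_comp[OF coprod_lin lin_comp[OF algebra_mult_r[OF HH_alg] Psi0_lin]]
          lin_comp[OF hact_lin_l bilin_r[OF Psi0_bilin]]]) (rule 2)
qed

definition Psi where "Psi = tensor_lift m2s fs (tens2 M) Psi0"

lemma Psi_lin: "lin m2s fs Psi" and Psi_tens2: "Psi (tens2 M x m) = Psi0 x m"
proof -
  show "lin m2s fs Psi" unfolding Psi_def
    by (rule balanced_lift_lin[OF tp2 Psi0_bilin]) (rule Psi0_bal)
  show "Psi (tens2 M x m) = Psi0 x m" unfolding Psi_def
    by (rule balanced_lift_eq[OF tp2 Psi0_bilin]) (rule Psi0_bal)
qed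

lemma Psi_simple: "lin hs (*) \<phi> \<Longrightarrow> Psi (tens2 M (f \<otimes> 1) m) \<phi> = ms (\<phi> f) m"
  using ext_wp[OF seed_LF, of f m "[]"] by (simp add: Psi_tens2 Psi0_tns seed_def)

lemma Psi_lmult2: "Psi (lmult2 M (1 \<otimes> \<iota> a) X) = Tau a (Psi X)"
  by (rule lin_eq_on_span[OF lin_comp[OF lmult2_lin Psi_lin] lin_comp[OF Psi_lin Tau_lin] _ tp2_span])
    (auto simp: lmult2_tens2 Psi_tens2 tns_simps Psi0_tns ext_mult_l seed_LF)

text \<open>Seeds with values in \<open>W\<close> stay in \<open>W\<close> under \<open>Tau\<close>,
  since \<open>W\<close> is an \<open>H\<close>-submodule. This replaces stability under a
  pseudoaction by stability under ordinary operators.\<close>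

lemma Psi_stable:
  assumes W: "module.subspace ms W" "\<And>h w. w \<in> W \<Longrightarrow> hact M h w \<in> W"
    and X: "X \<in> module.span m2s {tens2 M g w | g w. w \<in> W}"
  shows "Psi X \<phi> \<in> W"
proof -
  interpret M: vector_space ms by (rule vs_M)
  interpret X: vector_space fs by (rule vs_fs)
  let ?W = "{F. \<forall>\<phi>. F \<phi> \<in> W}"
  have sW: "X.subspace ?W"
    by (rule X.subspaceI) (auto simp: fs_def W(1) M.subspace_0 M.subspace_add M.subspace_scale)
  have Tau: "Tau a F \<in> ?W" if "F \<in> ?W" for a F
    using that W by (auto simp: Tau_def M.subspace_0 intro!: M.subspace_diff)
  have seed: "seed f w \<in> ?W" if "w \<in> W" for f w
    using that W(1) by (auto simp: seed_def M.subspace_0 M.subspace_scale)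
  have f: "foldr Tau ws F \<in> ?W" if "F \<in> ?W" for ws F
    by (induction ws) (use that Tau in auto)
  have e: "ext (seed f w) g \<in> ?W" if "w \<in> W" for f g w
    by (rule lin_in_subspace[OF ext_lin[OF seed_LF] sW _ H_span]) (use f[OF seed[OF that]] in \<open>auto simp: ext_wp[OF seed_LF]\<close>)
  have P: "Psi0 x w \<in> ?W" if "w \<in> W" for x w
    by (rule lin_in_subspace[OF Psi0_lin sW _ tensor_span[OF HH_tp]]) (use e[OF that] in \<open>auto simp: Psi0_tns\<close>)
  have "Psi X \<in> ?W"
    by (rule lin_in_subspace[OF Psi_lin sW _ X]) (use P in \<open>auto simp: Psi_tens2\<close>)
  then show ?thesis by auto
qed

end

section \<open>Dual bases and the symmetric square of \<open>d\<close> as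
  \<open>sp d\<close>\<close>

section \<open>Symplectic linear algebra\<close>

context sympl
begin

lemma om_simps:
  "\<omega> (a + a') b = \<omega> a b + \<omega> a' b" "\<omega> a (b + b') = \<omega> a b + \<omega> a b'"
  "\<omega> (ds c a) b = c * \<omega> a b" "\<omega> a (ds c b) = c * \<omega> a b" "\<omega> 0 b = 0" "\<omega> a 0 = 0"
  "\<omega> (- a) b = - \<omega> a b" "\<omega> a (- b) = - \<omega> a b"
  "\<omega> (a - a') b = \<omega> a b - \<omega> a' b" "\<omega> a (b - b') = \<omega> a b - \<omega> a b'"
  "\<omega> (sum f A) b = (\<Sum>i\<in>A. \<omega> (f i) b)" "\<omega> a (sum g B) = (\<Sum>i\<in>B. \<omega> a (g i))"
  by (rule bilin_simps[OF om_bilin])+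

lemma om_lin: "lin ds (*) (\<omega> x)"
  by (rule bilin_r[OF om_bilin])

lemma du_dual: "i \<in> I \<Longrightarrow> j \<in> I \<Longrightarrow> \<omega> (du' i) (dd j) = (if i = j then 1 else 0)"
  using sd by (auto simp: du_def om_simps symplectic_data_def)

lemma coord_om: "k \<in> I \<Longrightarrow> coord S k w = \<omega> (du' k) w"
proof -
  assume k: "k \<in> I"
  have "\<omega> (du' k) w = (\<Sum>j\<in>I. coord S j w * \<omega> (du' k) (dd j))"
    by (rule lin_coord) (rule om_lin)
  also have "\<dots> = (\<Sum>j\<in>I. if j = k then coord S j w else 0)"
    by (rule sum.cong) (use k in \<open>auto simp: du_dual\<close>)
  finally show ?thesis using k by simp
qed

lemma expand_dd: "(\<Sum>k\<in>I. ds (\<omega> (du' k) w) (dd k)) = w"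
  using coord_sum[of w] by (simp add: coord_om)

lemma expand_du: "(\<Sum>k\<in>I. ds (\<omega> w (dd k)) (du' k)) = w"
proof -
  have "\<omega> ((\<Sum>k\<in>I. ds (\<omega> w (dd k)) (du' k)) - w) b = 0" for b
  proof -
    have "(\<Sum>k\<in>I. \<omega> w (dd k) * \<omega> (du' k) b) = \<omega> w b"
      by (subst (2) expand_dd[of b, symmetric]) (simp add: om_simps mult.commute)
    then show ?thesis by (simp add: om_simps)
  qed
  from om_nondeg[OF this] show ?thesis by simp
qed

text \<open>The identification of the symmetric square of \<open>d\<close> with \<open>sp d\<close>;
  that these elements span is \<open>sp_q_sum\<close>. In these terms
  \<open>f\<^sup>i\<^sup>j\<close> is \<open>- 1 / 2\<close> times \<open>q\<close> of the dual
  basis vectors (\<open>f_op_q\<close>).\<close>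

definition q :: "'d \<Rightarrow> 'd \<Rightarrow> 'd \<Rightarrow> 'd" where
  "q x y = (\<lambda>v. ds (\<omega> x v) y + ds (\<omega> y v) x)"

lemma q_sym: "q x y = q y x"
  by (simp add: q_def fun_eq_iff add.commute)

lemma e_op_om: "j \<in> I \<Longrightarrow> e_op S i j = (\<lambda>v. ds (\<omega> (du' j) v) (du' i))"
  by (simp add: e_op_def coord_om)

lemma f_op_q: "i \<in> I \<Longrightarrow> j \<in> I \<Longrightarrow> f_op S i j = (\<lambda>v. ds (- 1 / 2) (q (du' i) (du' j) v))"
  by (simp add: f_op_def e_op_om q_def fun_eq_iff add.commute)

lemma spI: "lin ds ds A \<Longrightarrow> (\<And>a b. \<omega> (A a) b = - \<omega> a (A b)) \<Longrightarrow> A \<in> sp S"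
  by (simp add: sp_def)

lemma sp_lin: "A \<in> sp S \<Longrightarrow> lin ds ds A"
  by (simp add: sp_def)

lemma sp_om: "A \<in> sp S \<Longrightarrow> \<omega> (A a) b = - \<omega> a (A b)"
  by (simp add: sp_def eq_neg_iff_add_eq_0)

lemma q_lin: "lin ds ds (q x y)"
  unfolding q_def by (intro lin_plus lin_comp[OF om_lin lin_scale_left[OF vs_d]])

lemma q_sp: "q x y \<in> sp S"
  by (rule spI[OF q_lin]) (simp add: q_def om_simps om_anti[of x] om_anti[of y] algebra_simps)

lemma sp_add: assumes A: "A \<in> sp S" and B: "B \<in> sp S" shows "A + B \<in> sp S"
  using lin_plus[OF sp_lin[OF A] sp_lin[OF B]]
  by (intro spI) (simp_all add: plus_fun_def om_simps sp_om[OF A] sp_om[OF B])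

lemma sp_scale: assumes A: "A \<in> sp S" shows "(\<lambda>v. ds c (A v)) \<in> sp S"
  by (rule spI[OF lin_smult[OF sp_lin[OF A]]]) (simp add: om_simps sp_om[OF A])

lemma sp_0: "0 \<in> sp S"
  using lin_const0[OF vs_d vs_d] by (intro spI) (simp_all add: zero_fun_def om_simps)

lemma sp_uminus: assumes A: "A \<in> sp S" shows "- A \<in> sp S"
  using lin_uminus[OF sp_lin[OF A]] by (intro spI) (simp_all add: fun_Compl_def om_simps sp_om[OF A])

lemma sp_diff: "A \<in> sp S \<Longrightarrow> B \<in> sp S \<Longrightarrow> A - B \<in> sp S"
  using sp_add[of A "- B"] sp_uminus[of B] by simp

lemma sp_sum: "(\<And>i. i \<in> X \<Longrightarrow> A i \<in> sp S) \<Longrightarrow> (\<Sum>i\<in>X. A i) \<in> sp S"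
  by (induction X rule: infinite_finite_induct) (auto simp: sp_0 sp_add)

lemma f_op_sp: "i \<in> I \<Longrightarrow> j \<in> I \<Longrightarrow> f_op S i j \<in> sp S"
  by (simp add: f_op_q sp_scale q_sp)

lemma f_op_sym: "f_op S i j = f_op S j i"
  by (simp add: f_op_def add.commute)

text \<open>Equivariance: \<open>sp d\<close> acts on the symmetric square by the Leibniz rule.
  Commutators in \<open>sp d\<close> are computed from this below.\<close>

lemma q_bracket:
  assumes A: "A \<in> sp S"
  shows "(\<lambda>v. A (q x y v) - q x y (A v)) = q (A x) y + q x (A y)"
  by (simp add: q_def fun_eq_iff lin_add[OF sp_lin[OF A]] lin_scale[OF sp_lin[OF A]] sp_om[OF A] vs_minus_left[OF vs_d])

lemma q_add: "q (x + x') y = q x y + q x' y" "q x (y + y') = q x y + q x y'"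
  and q_scale: "q (ds c x) y = (\<lambda>v. ds c (q x y v))" "q x (ds c y) = (\<lambda>v. ds c (q x y v))"
  by (auto simp: q_def fun_eq_iff om_simps vs_add[OF vs_d] vs_add_left[OF vs_d] vs_mult[OF vs_d] ac_simps)

end

locale sp_module = sympl S
  for S :: "('k::field_char_0, 'd::ab_group_add) symplectic" +
  fixes s :: "'k \<Rightarrow> 'u::ab_group_add \<Rightarrow> 'u" and \<rho> :: "('d \<Rightarrow> 'd) \<Rightarrow> 'u \<Rightarrow> 'u"
  assumes spm: "lie_module (lie_sp S) s \<rho>"
begin

lemma vs_s: "vector_space s" and rho_lin: "A \<in> sp S \<Longrightarrow> lin s s (\<rho> A)"
  and rho_add: "A \<in> sp S \<Longrightarrow> B \<in> sp S \<Longrightarrow> \<rho> (A + B) u = \<rho> A u + \<rho> B u"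
  and rho_scale: "A \<in> sp S \<Longrightarrow> \<rho> (\<lambda>v. ds c (A v)) u = s c (\<rho> A u)"
  and rho_br: "A \<in> sp S \<Longrightarrow> B \<in> sp S \<Longrightarrow> \<rho> (\<lambda>v. A (B v) - B (A v)) u = \<rho> A (\<rho> B u) - \<rho> B (\<rho> A u)"
  using spm by (auto simp: lie_module_def lie_sp_def)

lemma rho_0: "\<rho> 0 u = 0"
  using rho_add[OF sp_0 sp_0, of u] by simp

lemma rho_uminus: "A \<in> sp S \<Longrightarrow> \<rho> (- A) u = - \<rho> A u"
  using rho_add[of A "- A" u] sp_uminus[of A] rho_0[of u] by (simp add: eq_neg_iff_add_eq_0 add.commute)

lemma rho_diff: "A \<in> sp S \<Longrightarrow> B \<in> sp S \<Longrightarrow> \<rho> (A - B) u = \<rho> A u - \<rho> B u"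
  using rho_add[of A "- B" u] sp_uminus[of B] rho_uminus[of B u] by simp

lemma rho_sum: "(\<And>i. i \<in> X \<Longrightarrow> A i \<in> sp S) \<Longrightarrow> \<rho> (\<Sum>i\<in>X. A i) u = (\<Sum>i\<in>X. \<rho> (A i) u)"
  by (induction X rule: infinite_finite_induct) (auto simp: rho_0 rho_add sp_sum)

lemma rho_q_bilin: "bilin ds ds s (\<lambda>x y. \<rho> (q x y) u)"
  by (intro bilinI linI vs_d vs_s) (simp_all add: q_add q_scale rho_add rho_scale q_sp)

lemma rho_f_op: "i \<in> I \<Longrightarrow> j \<in> I \<Longrightarrow> \<rho> (f_op S i j) u = s (- 1 / 2) (\<rho> (q (du' i) (du' j)) u)"
  using rho_scale[OF q_sp, of "- 1 / 2" "du' i" "du' j" u] by (simp add: f_op_q)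

text \<open>The coefficients are what a functional with symbol \<open>\<omega> x\<close>,
  \<open>\<omega> y\<close> takes on the second order part of the action of \<open>e\<close>; in
  this way each \<open>q x y\<close> can be singled out.\<close>

lemma sum_f_op:
  "(\<Sum>i\<in>I. \<Sum>j\<in>I. s (\<omega> x (dd i) * \<omega> y (dd j)) (\<rho> (f_op S i j) u)) = s (- 1 / 2) (\<rho> (q x y) u)"
proof -
  note b = bilin_simps[OF rho_q_bilin]
  have "\<rho> (q x y) u = \<rho> (q (\<Sum>i\<in>I. ds (\<omega> x (dd i)) (du' i)) (\<Sum>j\<in>I. ds (\<omega> y (dd j)) (du' j))) u"
    by (simp only: expand_du)
  also have "\<dots> = (\<Sum>i\<in>I. \<Sum>j\<in>I. s (\<omega> x (dd i) * \<omega> y (dd j)) (\<rho> (q (du' i) (du' j)) u))"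
    by (simp only: b vs_sum[OF vs_s] vs_mult[OF vs_s]) (subst sum.swap, simp only: mult.commute)
  finally show ?thesis
    by (simp add: vs_sum[OF vs_s] vs_mult[OF vs_s] rho_f_op mult.commute)
qed

end

section \<open>The coefficient operators \<open>efc \<phi>\<close> and their behaviour on the degree
  filtration\<close>

section \<open>Tensor modules\<close>

locale tmod = sympl_env S E + L: hmodule "lie_d S" E L + V: hmodule "lie_d S" E V
  for S :: "('k::field_char_0, 'd::ab_group_add) symplectic"
    and E :: "('k, 'd, 'h::ring_1, 'hh::ring_1, 'hhh::ring_1) env"
    and L :: "('k, 'h, 'hh, 'hhh, 'l::ab_group_add, 'l2::ab_group_add, 'l3::ab_group_add) hmod"
    and V :: "('k, 'h, 'hh, 'hhh, 'm::ab_group_add, 'm2::ab_group_add, 'm3::ab_group_add) hmod" +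
  fixes e :: 'l and br :: "'l \<Rightarrow> 'l \<Rightarrow> 'l2"
    and sR :: "'k \<Rightarrow> 'r::ab_group_add \<Rightarrow> 'r" and rR :: "('d \<times> 'k) \<times> ('d \<Rightarrow> 'd) \<Rightarrow> 'r \<Rightarrow> 'r"
    and t :: "'h \<Rightarrow> 'r \<Rightarrow> 'm" and act :: "'l \<Rightarrow> 'm \<Rightarrow> 'm2"
  assumes psL: "pseudoalgebra_H S E L e br"
    and RR: "lie_module (lie_d'_sp S) sR rR"
    and TM: "tensor_module S E L e sR rR V t act"
begin

abbreviation y where "y k \<equiv> bar S E (dd k)"
abbreviation rsp where "rsp A \<equiv> rR (0, A)"

lemma vs_R: "vector_space sR"
  and rR_lin: "A \<in> sp S \<Longrightarrow> lin sR sR (rR ((a, z), A))"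
  and rR_add: "A \<in> sp S \<Longrightarrow> B \<in> sp S \<Longrightarrow> rR ((a, z) + (a', z'), A + B) r = rR ((a, z), A) r + rR ((a', z'), B) r"
  and rR_scale: "A \<in> sp S \<Longrightarrow> rR ((ds c a, c * z), \<lambda>v. ds c (A v)) r = sR c (rR ((a, z), A) r)"
  and rR_br: "A \<in> sp S \<Longrightarrow> B \<in> sp S \<Longrightarrow>
     rR ((dbrk a b, \<omega> a b + z' * \<chi> a - z * \<chi> b), \<lambda>v. A (B v) - B (A v)) r =
     rR ((a, z), A) (rR ((b, z'), B) r) - rR ((b, z'), B) (rR ((a, z), A) r)"
  using RR unfolding lie_module_def lie_sum_def lie_d'_def lie_sp_def by auto

lemma sp_module_R: "sp_module S sR rsp"
proof
  show "lie_module (lie_sp S) sR rsp"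
    unfolding lie_module_def lie_sp_def
  proof (simp, safe)
    fix A B c r assume A: "A \<in> sp S"
    show "lin sR sR (rsp A)" using rR_lin[OF A, of 0 0] by (simp add: zero_prod_def)
    show "rsp (\<lambda>v. ds c (A v)) r = sR c (rsp A r)"
      using rR_scale[OF A, of c 0 0 r] by (simp add: zero_prod_def vs_zero[OF vs_d])
    assume B: "B \<in> sp S"
    show "rsp (A + B) r = rsp A r + rsp B r"
      using rR_add[OF A B, of 0 0 0 0 r] by (simp add: zero_prod_def)
    show "rsp (\<lambda>v. A (B v) - B (A v)) r = rsp A (rsp B r) - rsp B (rsp A r)"
      using rR_br[OF A B, of 0 0 0 0 r] by (simp add: zero_prod_def)
  qed (rule vs_R)
qed

sublocale R: sp_module S sR rsp by (rule sp_module_R)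

lemma tpV: "tensor_product hs sR V.ms t" and hact_t: "hact V h (t g v) = t (h * g) v"
  and act_bil: "h_bilinear E L V act"
  using TM by (auto simp: tensor_module_def)

lemma act_e: "act e (t 1 v) =
        (\<Sum>i\<in>I. \<Sum>j\<in>I. tens2 V ((y i * y j) \<otimes> 1) (t 1 (rsp (f_op S i j) v)))
        - (\<Sum>k\<in>I. tens2 V (y k \<otimes> 1) (t 1 (rR (hat (du' k), ad_sp S (du' k)) v) - t (\<iota> (du' k)) v))
        + tens2 V (1 \<otimes> 1) (t 1 (rR (cc, 0) v))"
  using TM by (auto simp: tensor_module_def)

lemmas t_bilin = tensor_bilin[OF tpV]
lemmas t_simps = bilin_simps[OF t_bilin]

lemma act_lin: "lin V.ms V.m2s (act a)" and act_lin_l: "lin L.ms V.m2s (\<lambda>a. act a m)"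
  and act_hact: "act (hact L f a) (hact V g m) = lmult2 V (f \<otimes> g) (act a m)"
  using act_bil by (auto simp: h_bilinear_def)

lemma act_mult: "act a (hact V g m) = lmult2 V (1 \<otimes> g) (act a m)"
  using act_hact[of 1 a g m] by (simp add: L.hact_1)

definition efc :: "('h \<Rightarrow> 'k) \<Rightarrow> 'm \<Rightarrow> 'm" where "efc \<phi> w = V.Psi (act e w) \<phi>"

lemma efc_lin: "lin V.ms V.ms (efc \<phi>)"
  unfolding efc_def
  by (rule linI[OF V.vs_M V.vs_M])
    (simp_all add: lin_add[OF act_lin] lin_scale[OF act_lin] lin_add[OF V.Psi_lin] lin_scale[OF V.Psi_lin] V.fs_def)

text \<open>The recursion behind all degree arguments: a letter either stays outside or is absorbed,
  with a minus sign, by the functional, whose order then drops by one.\<close>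

lemma efc_mult:
  "lin hs (*) \<phi> \<Longrightarrow> efc \<phi> (t (\<iota> a * g) v) = hact V (\<iota> a) (efc \<phi> (t g v)) - efc (V.shift \<phi> a) (t g v)"
  unfolding efc_def using act_mult[of e "\<iota> a" "t g v"] by (simp add: hact_t V.Psi_lmult2 V.Tau_def)

lemma efc_1:
  assumes p: "lin hs (*) \<phi>"
  shows "efc \<phi> (t 1 v) = t 1 (\<Sum>i\<in>I. \<Sum>j\<in>I. sR (\<phi> (y i * y j)) (rsp (f_op S i j) v))
    - (\<Sum>k\<in>I. V.ms (\<phi> (y k)) (t 1 (rR (hat (du' k), ad_sp S (du' k)) v) - t (\<iota> (du' k)) v))
    + t 1 (sR (\<phi> 1) (rR (cc, 0) v))"
proof -
  have s: "(sum f X :: ('h \<Rightarrow> 'k) \<Rightarrow> 'm) \<phi> = (\<Sum>x\<in>X. f x \<phi>)" for f and X :: "nat set"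
    by (induction X rule: infinite_finite_induct) auto
  show ?thesis
    unfolding efc_def act_e
    by (simp only: lin_add[OF V.Psi_lin] lin_diff[OF V.Psi_lin] lin_sum[OF V.Psi_lin] plus_fun_apply
        fun_diff_def s V.Psi_simple[OF p] t_simps)
qed

lemma bar_word: "y k = wp [dd k] - hs (\<chi> (dd k)) (wp [])"
  and bar_word2: "y i * y j = wp [dd i, dd j] - hs (\<chi> (dd i)) (wp [dd j]) - hs (\<chi> (dd j)) (wp [dd i])
     + hs (\<chi> (dd i) * \<chi> (dd j)) (wp [])"
  by (simp_all add: bar_def algebra_simps algebra_scale[OF H_alg] vs_mult[OF vs_H] vs_diff[OF vs_H])

definition kills :: "('h \<Rightarrow> 'k) \<Rightarrow> nat \<Rightarrow> bool" where "kills \<phi> n \<longleftrightarrow> (\<forall>ws. length ws < n \<longrightarrow> \<phi> (wp ws) = 0)"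

text \<open>The bars change a product of letters only by shorter words, so a functional of the right
  order does not see them.\<close>

lemma kills_bar:
  assumes "lin hs (*) \<phi>" 
  shows "kills \<phi> 1 \<Longrightarrow> \<phi> 1 = 0" "kills \<phi> 2 \<Longrightarrow> \<phi> (y k) = 0" "kills \<phi> 3 \<Longrightarrow> \<phi> (y i * y j) = 0"
    "kills \<phi> 1 \<Longrightarrow> \<phi> (y k) = \<phi> (wp [dd k])" "kills \<phi> 2 \<Longrightarrow> \<phi> (y i * y j) = \<phi> (wp [dd i, dd j])"
proof -
  show "kills \<phi> 1 \<Longrightarrow> \<phi> 1 = 0" unfolding kills_def using wp_simps(1) by (metis length_0_conv less_one)
  show "kills \<phi> 2 \<Longrightarrow> \<phi> (y k) = 0" "kills \<phi> 3 \<Longrightarrow> \<phi> (y i * y j) = 0"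
    "kills \<phi> 1 \<Longrightarrow> \<phi> (y k) = \<phi> (wp [dd k])" "kills \<phi> 2 \<Longrightarrow> \<phi> (y i * y j) = \<phi> (wp [dd i, dd j])"
    unfolding bar_word2 unfolding bar_word kills_def
    by (simp_all add: lin_add[OF assms] lin_diff[OF assms] lin_scale[OF assms] del: wp_simps)
qed

lemma kills_mono: "kills \<phi> n \<Longrightarrow> m \<le> n \<Longrightarrow> kills \<phi> m"
  by (auto simp: kills_def)

lemma kills_shift: "kills \<phi> (Suc n) \<Longrightarrow> kills (V.shift \<phi> a) n"
proof -
  assume k: "kills \<phi> (Suc n)"
  have "\<phi> (wp ws * \<iota> a) = \<phi> (wp (ws @ [a]))" for ws by simp
  then show ?thesis using k by (auto simp: kills_def V.shift_def simp del: wp_simps)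
qed

lemma symbol_functionalD:
  assumes "symbol_functional \<phi> n \<alpha> \<beta> \<xi> \<eta>"
  shows "lin hs (*) \<phi>" "kills \<phi> n" "length ws = n \<Longrightarrow> \<phi> (wp ws) = \<alpha> * pr \<xi> ws + \<beta> * dpr \<xi> \<eta> ws"
  using assms by (auto simp: symbol_functional_def kills_def)

lemma symbol_shift:
  assumes f: "symbol_functional \<phi> (Suc n) \<alpha> \<beta> \<xi> \<eta>"
  shows "symbol_functional (V.shift \<phi> a) n (\<alpha> * \<xi> a + \<beta> * \<eta> a) (\<beta> * \<xi> a) \<xi> \<eta>"
proof -
  have "V.shift \<phi> a (wp ws) = \<phi> (wp (ws @ [a]))" for ws by (simp add: V.shift_def)
  then show ?thesis
    using f V.shift_lin[of \<phi> a]
    by (auto simp: symbol_functional_def algebra_simps simp del: wp_simps)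
qed

text \<open>The coefficients of \<open>e * (1 \<otimes> v)\<close> are words of at most two letters,
  and each letter of \<open>ws\<close> costs the functional at most one order.\<close>

lemma efc_zero: "lin hs (*) \<phi> \<Longrightarrow> kills \<phi> (length ws + 3) \<Longrightarrow> efc \<phi> (t (wp ws) v) = 0"
proof (induction ws arbitrary: \<phi>)
  case Nil
  have k: "kills \<phi> 1" "kills \<phi> 2" "kills \<phi> 3" using Nil(2) by (auto intro: kills_mono)
  show ?case
    by (simp add: efc_1[OF Nil(1)] kills_bar(1)[OF Nil(1) k(1)] kills_bar(2)[OF Nil(1) k(2)] kills_bar(3)[OF Nil(1) k(3)] vs_zero_left[OF vs_R] vs_zero_left[OF V.vs_M] t_simps)
next
  case (Cons a ws)
  have "kills \<phi> (length ws + 3)" using Cons.prems(2) by (rule kills_mono) simp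
  moreover have "kills (V.shift \<phi> a) (length ws + 3)" using Cons.prems(2) by (intro kills_shift) simp
  ultimately show ?case
    using Cons.IH[OF Cons.prems(1)] Cons.IH[OF V.shift_lin[OF Cons.prems(1)]]
    by (simp add: efc_mult[OF Cons.prems(1)] lin_zero[OF V.hact_lin])
qed

text \<open>For \<open>\<phi>\<close> of order \<open>n + 2\<close> the operator \<open>efc \<phi>\<close> maps degree \<open>n\<close> to degree \<open>0\<close> and depends only on
  symbols.\<close>

lemma efc_top:
  "symbol_functional \<phi> (length ws + 2) \<alpha> \<beta> (\<omega> x) (\<omega> z) \<Longrightarrow>
   efc \<phi> (t (wp ws) v) = t 1 (sR ((- 1) ^ length ws * (- 1 / 2))
     (sR (\<alpha> * pr (\<omega> x) ws + \<beta> * dpr (\<omega> x) (\<omega> z) ws) (rsp (q x x) v) + sR (2 * \<beta> * pr (\<omega> x) ws) (rsp (q x z) v)))"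
proof (induction ws arbitrary: \<phi> \<alpha> \<beta>)
  case Nil
  note f = symbol_functionalD[OF Nil]
  have k: "kills \<phi> 1" "kills \<phi> 2" using f(2) by (auto intro: kills_mono)
  have "(\<Sum>i\<in>I. \<Sum>j\<in>I. sR (\<phi> (y i * y j)) (rsp (f_op S i j) v)) =
     (\<Sum>i\<in>I. \<Sum>j\<in>I. sR \<alpha> (sR (\<omega> x (dd i) * \<omega> x (dd j)) (rsp (f_op S i j) v)) +
       (sR \<beta> (sR (\<omega> z (dd i) * \<omega> x (dd j)) (rsp (f_op S i j) v))
       + sR \<beta> (sR (\<omega> x (dd i) * \<omega> z (dd j)) (rsp (f_op S i j) v))))"
    using f(3)[of "[_, _]"]
    by (simp add: kills_bar(5)[OF f(1) k(2)] vs_mult[OF vs_R] vs_add_left[OF vs_R, symmetric] algebra_simps del: wp_simps)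
  also have "\<dots> = sR (- 1 / 2) (sR \<alpha> (rsp (q x x) v) + sR (2 * \<beta>) (rsp (q x z) v))"
    by (simp only: sum.distrib vs_sum[OF vs_R, symmetric] R.sum_f_op q_sym[of z x])
      (simp add: vs_mult[OF vs_R] vs_add[OF vs_R] vs_add_left[OF vs_R, symmetric])
  finally show ?case
    by (simp add: efc_1[OF f(1)] kills_bar(1)[OF f(1) k(1)] kills_bar(2)[OF f(1) k(2)] vs_zero_left[OF vs_R] vs_zero_left[OF V.vs_M] t_simps)
next
  case (Cons a ws)
  note f = symbol_functionalD[OF Cons.prems]
  \<comment> \<open>On the shorter word the order of \<open>\<phi>\<close> exceeds the critical one,
    so only the shifted functional contributes.\<close>
  have "efc \<phi> (t (wp ws) v) = 0" by (rule efc_zero[OF f(1)]) (use f(2) in \<open>simp add: numeral_3_eq_3\<close>)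
  moreover have "symbol_functional (V.shift \<phi> a) (length ws + 2) (\<alpha> * \<omega> x a + \<beta> * \<omega> z a) (\<beta> * \<omega> x a) (\<omega> x) (\<omega> z)"
    by (rule symbol_shift) (use Cons.prems in simp)
  ultimately show ?case
    using Cons.IH[of "V.shift \<phi> a"]
    by (simp add: efc_mult[OF f(1)] lin_zero[OF V.hact_lin] t_simps(8)[symmetric] vs_minus_left[OF vs_R] algebra_simps)
qed

end

section \<open>Monomials as vector valued polynomial functions in characteristic 0\<close>

section \<open>Independence of monomials\<close>

text \<open>A functional that is 1 on \<open>g k\<close> would turn the sum into a nonzero
  polynomial vanishing at every point of an infinite field.\<close>

lemma powers_independent:
  fixes s :: "'k::field_char_0 \<Rightarrow> 'v::ab_group_add \<Rightarrow> 'v"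
  assumes s: "vector_space s" and K: "finite K" and z: "\<And>t. (\<Sum>k\<in>K. s (t ^ k) (g k)) = 0" and k: "k \<in> K"
  shows "g k = 0"
proof (rule ccontr)
  assume n: "g k \<noteq> 0"
  interpret vector_space s by fact
  interpret P: vector_space_pair s "(*) :: 'k \<Rightarrow> 'k \<Rightarrow> 'k" by (intro vector_space_pair.intro s vs_field)
  obtain f where f: "lin s (*) f" "f (g k) = 1"
    using P.linear_independent_extend[of "{g k}" "\<lambda>_. 1"] n by auto
  define p where "p = (\<Sum>k\<in>K. monom (f (g k)) k)"
  have "poly p t = f (\<Sum>k\<in>K. s (t ^ k) (g k))" for t
    by (simp add: p_def poly_sum poly_monom lin_sum[OF f(1)] lin_scale[OF f(1)] mult.commute)
  then have "p = 0" using lin_zero[OF f(1)] by (simp add: z poly_all_0_iff_0[symmetric])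
  moreover have "coeff p k = f (g k)"
    unfolding p_def coeff_sum using K k by (simp add: if_distrib cong: if_cong)
  ultimately show False using f(2) by simp
qed

text \<open>Induction on the variables: the sum is grouped by the exponent of the new variable, and
  each group vanishes by \<open>powers_independent\<close>.\<close>

lemma monomials_independent:
  fixes s :: "'k::field_char_0 \<Rightarrow> 'v::ab_group_add \<Rightarrow> 'v" and ex :: "'a \<Rightarrow> 'i \<Rightarrow> nat"
  assumes s: "vector_space s" and J: "finite J"
  shows "finite A \<Longrightarrow> (\<And>a b. a \<in> A \<Longrightarrow> b \<in> A \<Longrightarrow> (\<And>i. i \<in> J \<Longrightarrow> ex a i = ex b i) \<Longrightarrow> a = b) \<Longrightarrow>
    (\<And>c. (\<Sum>a\<in>A. s (\<Prod>i\<in>J. c i ^ ex a i) (v a)) = 0) \<Longrightarrow> a \<in> A \<Longrightarrow> v a = 0"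
  using J
proof (induction J arbitrary: A a)
  case empty
  then have "A = {a}" by auto
  then show ?case using empty(3) by (simp add: vs_one[OF s])
next
  case (insert i J)
  let ?B = "\<lambda>k. {a \<in> A. ex a i = k}"
  define g where "g c k = (\<Sum>a\<in>?B k. s (\<Prod>i\<in>J. c i ^ ex a i) (v a))" for c k
  have "g c k = 0" if k: "k \<in> (\<lambda>a. ex a i) ` A" for c k
  proof (rule powers_independent[OF s _ _ k])
    fix t
    have "(\<Sum>k\<in>(\<lambda>a. ex a i) ` A. s (t ^ k) (g c k)) =
      (\<Sum>k\<in>(\<lambda>a. ex a i) ` A. \<Sum>a\<in>?B k. s (t ^ ex a i * (\<Prod>i\<in>J. c i ^ ex a i)) (v a))"
      by (auto simp: g_def vs_sum[OF s] vs_mult[OF s] intro!: sum.cong)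
    also have "\<dots> = (\<Sum>a\<in>A. s (t ^ ex a i * (\<Prod>i\<in>J. c i ^ ex a i)) (v a))"
      by (rule sum.image_gen[OF insert.prems(1), symmetric])
    also have "\<dots> = (\<Sum>a\<in>A. s (\<Prod>j\<in>insert i J. (c(i := t)) j ^ ex a j) (v a))"
    proof (rule sum.cong[OF refl])
      fix a
      have "(\<Prod>j\<in>J. (c(i := t)) j ^ ex a j) = (\<Prod>j\<in>J. c j ^ ex a j)"
        by (rule prod.cong) (use insert.hyps in auto)
      then show "s (t ^ ex a i * (\<Prod>i\<in>J. c i ^ ex a i)) (v a) = s (\<Prod>j\<in>insert i J. (c(i := t)) j ^ ex a j) (v a)"
        using insert.hyps by simp
    qed
    finally show "(\<Sum>k\<in>(\<lambda>a. ex a i) ` A. s (t ^ k) (g c k)) = 0" by (simp add: insert.prems(3))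
  qed (use insert.prems in auto)
  then have g0: "(\<Sum>b\<in>?B (ex a i). s (\<Prod>i\<in>J. c i ^ ex b i) (v b)) = 0" for c
    using insert.prems(4) by (auto simp: g_def)
  show ?case
  proof (rule insert.IH[of "?B (ex a i)"])
    show "b = c" if "b \<in> ?B (ex a i)" "c \<in> ?B (ex a i)" "\<And>j. j \<in> J \<Longrightarrow> ex b j = ex c j" for b c
      using that by (intro insert.prems(2)) auto
  qed (use insert.prems(1,4) g0 in auto)
qed

section \<open>Symbols, the degree filtration, and the two equations for an element of minimal
  degree\<close>

section \<open>Symbols of elements of a submodule\<close>

context tmod
begin

text \<open>Two sources of degree 1: the summands \<open>\<partial>\<^sup>k \<otimes> v\<close> in
  the action of \<open>e\<close>, which contract to \<open>x\<close>, and single letters left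
  outside while the second order term acts. Summing over the letter left outside gives the
  derivative \<open>dpr\<close>.\<close>

lemma efc_subtop:
  assumes ps: "symbol_functional \<psi> 1 1 0 (\<omega> z) (\<omega> z)"
  shows "symbol_functional \<phi> (length ws + 1) \<alpha> 0 (\<omega> x) (\<omega> x) \<Longrightarrow>
   slice hs sR V.ms t \<psi> (efc \<phi> (t (wp ws) v)) = sR ((- 1) ^ length ws * \<alpha>)
     (sR (\<omega> z x * pr (\<omega> x) ws) v + sR (1 / 2 * dpr (\<omega> x) (\<omega> z) ws) (rsp (q x x) v))"
proof (induction ws arbitrary: \<phi> \<alpha>)
  note p = symbol_functionalD[OF ps]
  note sl = slice_lin[OF tpV p(1)] and sle = slice_eq[OF tpV p(1)]
  have p1: "\<psi> 1 = 0" using kills_bar(1)[OF p(1,2)] .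
  have pi: "\<psi> (\<iota> a) = \<omega> z a" for a using p(3)[of "[a]"] by simp
  {
    case Nil
    note f = symbol_functionalD[OF Nil]
    have k: "kills \<phi> 1" using f(2) by simp
    have y1: "\<phi> (y k) = \<alpha> * \<omega> x (dd k)" for k
      using kills_bar(4)[OF f(1) k] f(3)[of "[dd k]"] by simp
    have "(\<Sum>k\<in>I. \<omega> x (dd k) * \<omega> z (du' k)) = \<omega> z x"
      by (subst (2) expand_du[of x, symmetric]) (simp add: om_simps)
    then have "(\<Sum>k\<in>I. sR (\<alpha> * \<omega> x (dd k) * \<omega> z (du' k)) v) = sR (\<alpha> * \<omega> z x) v"
      by (simp add: vs_sum_left[OF vs_R, symmetric] sum_distrib_left[symmetric] mult.assoc)
    then show ?case
      by (simp add: efc_1[OF f(1)] lin_add[OF sl] lin_diff[OF sl] lin_sum[OF sl] lin_scale[OF sl] sle p1 pi y1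
          vs_zero_left[OF vs_R] vs_mult[OF vs_R] vs_zero[OF vs_R] vs_minus[OF vs_R] sum_negf)
  next
    case (Cons a ws)
    note f = symbol_functionalD[OF Cons.prems]
    have "efc \<phi> (t (wp ws) v) = t 1 (sR ((- 1) ^ length ws * (- 1 / 2)) (sR (\<alpha> * pr (\<omega> x) ws) (rsp (q x x) v)))"
      using efc_top[of \<phi> ws \<alpha> 0 x x v] Cons.prems by (simp add: vs_zero_left[OF vs_R])
    moreover have "symbol_functional (V.shift \<phi> a) (length ws + 1) (\<alpha> * \<omega> x a) 0 (\<omega> x) (\<omega> x)"
      using symbol_shift[of \<phi> "length ws + 1" \<alpha> 0 "\<omega> x" "\<omega> x" a] Cons.prems by simp
    ultimately show ?case
      using Cons.IH[of "V.shift \<phi> a"]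
      by (simp add: efc_mult[OF f(1)] hact_t lin_diff[OF sl] sle pi vs_mult[OF vs_R] vs_add[OF vs_R]
          vs_add_left[OF vs_R] vs_minus_left[OF vs_R] vs_minus[OF vs_R] algebra_simps)
  }
qed

text \<open>The inequality is strict: \<open>FF 0\<close> is zero, \<open>FF 1\<close> is
  \<open>1 \<otimes> R\<close>, and degree at most \<open>n\<close> is
  \<open>FF (Suc n)\<close>.\<close>

definition FF :: "nat \<Rightarrow> 'm set" where
  "FF n = module.span V.ms {t (wp ws) v | ws v. length ws < n}"

lemma FF_subspace: "module.subspace V.ms (FF n)"
proof -
  interpret vector_space V.ms by (rule V.vs_M)
  show ?thesis by (simp add: FF_def)
qed

lemma FF_facts:
  shows FF_gen: "length ws < n \<Longrightarrow> t (wp ws) v \<in> FF n" and FF_0: "0 \<in> FF n"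
    and FF_add: "a \<in> FF n \<Longrightarrow> b \<in> FF n \<Longrightarrow> a + b \<in> FF n"
    and FF_diff: "a \<in> FF n \<Longrightarrow> b \<in> FF n \<Longrightarrow> a - b \<in> FF n"
    and FF_scale: "a \<in> FF n \<Longrightarrow> V.ms c a \<in> FF n"
    and FF_sum: "(\<And>x. x \<in> X \<Longrightarrow> g x \<in> FF n) \<Longrightarrow> sum g X \<in> FF n"
    and FF_mono: "n \<le> n' \<Longrightarrow> FF n \<subseteq> FF n'"
proof -
  interpret vector_space V.ms by (rule V.vs_M)
  show "length ws < n \<Longrightarrow> t (wp ws) v \<in> FF n" "0 \<in> FF n"
    "a \<in> FF n \<Longrightarrow> b \<in> FF n \<Longrightarrow> a + b \<in> FF n" "a \<in> FF n \<Longrightarrow> b \<in> FF n \<Longrightarrow> a - b \<in> FF n"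
    "a \<in> FF n \<Longrightarrow> V.ms c a \<in> FF n" "(\<And>x. x \<in> X \<Longrightarrow> g x \<in> FF n) \<Longrightarrow> sum g X \<in> FF n"
    unfolding FF_def by (auto intro: span_base span_zero span_add span_diff span_scale span_sum)
  show "n \<le> n' \<Longrightarrow> FF n \<subseteq> FF n'"
    unfolding FF_def by (rule span_mono) auto
qed

lemma FF_eqI:
  assumes "lin V.ms s F" "lin V.ms s G" "\<And>ws v. length ws < n \<Longrightarrow> F (t (wp ws) v) = G (t (wp ws) v)" "w \<in> FF n"
  shows "F w = G w"
  by (rule lin_eq_on_span[OF assms(1,2) _ assms(4)[unfolded FF_def]]) (use assms(3) in auto)

lemma hact_FF: "w \<in> FF n \<Longrightarrow> hact V (\<iota> a) w \<in> FF (Suc n)"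
  unfolding FF_def[of n]
  by (rule lin_in_subspace[OF V.hact_lin FF_subspace]) (use FF_gen[of "a # _" "Suc n"] in \<open>auto simp: hact_t\<close>)

text \<open>Order \<open>m\<close> lowers the degree bound \<open>length ws + 2\<close> by
  \<open>m\<close>. The truncated subtraction is harmless: where it gives 0, \<open>efc_zero\<close>
  applies.\<close>

lemma efc_FF: "lin hs (*) \<phi> \<Longrightarrow> kills \<phi> m \<Longrightarrow> efc \<phi> (t (wp ws) v) \<in> FF (length ws + 3 - m)"
proof (induction ws arbitrary: \<phi> m)
  case Nil
  have g: "t 1 u \<in> FF n" if "0 < n" for u n using FF_gen[of "[]" n u] that by simp
  have g1: "t (\<iota> a) u \<in> FF n" if "1 < n" for a u n using FF_gen[of "[a]" n u] that by simp
  consider "m = 0 \<or> m = 1" | "m = 2" | "3 \<le> m" by linarith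
  then show ?case
  proof cases
    case 1
    then show ?thesis unfolding wp_simps(1) efc_1[OF Nil(1)]
      by (intro FF_add FF_diff FF_sum FF_scale g g1) auto
  next
    case 2
    then have "kills \<phi> 2" using Nil(2) by simp
    then show ?thesis unfolding wp_simps(1) efc_1[OF Nil(1)]
      using 2 by (simp add: kills_bar(2)[OF Nil(1)] vs_zero_left[OF V.vs_M]) (intro FF_add g, auto)
  next
    case 3
    then show ?thesis using efc_zero[OF Nil(1), of "[]" v] kills_mono[OF Nil(2) 3] FF_0 by simp
  qed
next
  case (Cons a ws)
  have 1: "hact V (\<iota> a) (efc \<phi> (t (wp ws) v)) \<in> FF (length (a # ws) + 3 - m)"
  proof (cases "m \<le> length ws + 3")
    case True
    then have "Suc (length ws + 3 - m) = length (a # ws) + 3 - m" by simp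
    then show ?thesis using hact_FF[OF Cons.IH[OF Cons.prems], of a] by simp
  next
    case False
    then have "kills \<phi> (length ws + 3)" using kills_mono[OF Cons.prems(2)] by simp
    then show ?thesis using efc_zero[OF Cons.prems(1)] FF_0 by (simp add: lin_zero[OF V.hact_lin])
  qed
  have "kills (V.shift \<phi> a) (m - 1)"
    using Cons.prems(2) by (cases m) (auto simp: kills_shift, simp add: kills_def)
  from Cons.IH[OF V.shift_lin[OF Cons.prems(1)] this]
  have "efc (V.shift \<phi> a) (t (wp ws) v) \<in> FF (length ws + 3 - (m - 1))" .
  moreover have "length ws + 3 - (m - 1) \<le> length (a # ws) + 3 - m" by simp
  ultimately have "efc (V.shift \<phi> a) (t (wp ws) v) \<in> FF (length (a # ws) + 3 - m)" using FF_mono by blast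
  with 1 show ?case by (simp add: efc_mult[OF Cons.prems(1)] FF_diff)
qed

lemma FF_exhausts: "\<exists>n. w \<in> FF n"
proof -
  interpret vector_space V.ms by (rule V.vs_M)
  let ?U = "{w. \<exists>n. w \<in> FF n}"
  have U: "subspace ?U"
  proof (rule subspaceI)
    fix a b assume "a \<in> ?U" "b \<in> ?U"
    then obtain m n where "a \<in> FF m" "b \<in> FF n" by auto
    then have "a \<in> FF (max m n)" "b \<in> FF (max m n)" using FF_mono[of m "max m n"] FF_mono[of n "max m n"] by auto
    then show "a + b \<in> ?U" using FF_add by blast
  next
    fix a c assume "a \<in> ?U"
    then show "V.ms c a \<in> ?U" using FF_scale by blast
  qed (use FF_0 in auto)
  have g: "t h v \<in> ?U" for h v
    by (rule lin_in_subspace[OF bilin_l[OF t_bilin] U _ H_span]) (use FF_gen in blast)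
  have "w \<in> ?U"
    by (rule lin_in_subspace[OF lin_id[OF V.vs_M] U _ tensor_span[OF tpV]]) (use g in blast)
  then show ?thesis by simp
qed

text \<open>Moving a letter past another costs a bracket, that is, a word with one letter
  less.\<close>

lemma FF_perm: "mset ws = mset us \<Longrightarrow> t (wp ws) v - t (wp us) v \<in> FF (length ws)"
proof (induction ws arbitrary: us)
  case (Cons a ws)
  have mv: "t (wp (a # x @ y)) v - t (wp (x @ a # y)) v \<in> FF (Suc (length x + length y))" for x y
  proof (induction x)
    case (Cons b x)
    have "hact V (\<iota> b) (t (wp (a # x @ y)) v - t (wp (x @ a # y)) v) \<in> FF (Suc (Suc (length x + length y)))"
      by (rule hact_FF[OF Cons])
    moreover have "t (wp (dbrk a b # x @ y)) v \<in> FF (Suc (Suc (length x + length y)))"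
      by (rule FF_gen) simp
    ultimately have "hact V (\<iota> b) (t (wp (a # x @ y)) v - t (wp (x @ a # y)) v) + t (wp (dbrk a b # x @ y)) v
       \<in> FF (Suc (Suc (length x + length y)))" by (rule FF_add)
    also have "hact V (\<iota> b) (t (wp (a # x @ y)) v - t (wp (x @ a # y)) v) + t (wp (dbrk a b # x @ y)) v
      = t (wp (a # (b # x) @ y)) v - t (wp ((b # x) @ a # y)) v"
    proof -
      have "\<iota> (dbrk a b) = \<iota> a * \<iota> b - \<iota> b * \<iota> a" using iota_br[of a b] by simp
      then have "\<iota> a * \<iota> b * z = \<iota> b * \<iota> a * z + \<iota> (dbrk a b) * z" for z
        by (simp add: left_diff_distrib)
      then have "wp (a # (b # x) @ y) = \<iota> b * wp (a # x @ y) + wp (dbrk a b # x @ y)"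
        by (simp add: mult.assoc)
      then show ?thesis by (simp add: lin_diff[OF V.hact_lin] hact_t t_simps(1))
    qed
    finally show ?case by simp
  qed (simp add: FF_0)
  obtain x y where us: "us = x @ a # y" using Cons.prems by (metis list.set_intros(1) mset_eq_setD split_list)
  then have m: "mset ws = mset (x @ y)" using Cons.prems by simp
  then have l: "length ws = length x + length y" using mset_eq_length by fastforce
  have "hact V (\<iota> a) (t (wp ws) v - t (wp (x @ y)) v) \<in> FF (Suc (length ws))"
    by (rule hact_FF[OF Cons.IH[OF m]])
  from FF_add[OF this mv[of x y, folded l]] show ?case
    by (simp add: us lin_diff[OF V.hact_lin] hact_t)
qed (simp add: FF_0)

definition KK :: "nat \<Rightarrow> nat list set" where "KK n = {ks. sorted ks \<and> set ks \<subseteq> I \<and> length ks = n}"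

lemma KK_finite: "finite (KK n)"
  by (rule finite_subset[OF _ finite_lists_length_eq[of I n]]) (auto simp: KK_def)

text \<open>The spanning half of the Poincare--Birkhoff--Witt theorem, with coefficients in
  \<open>R\<close>: letters are expanded in the basis and sorted by \<open>FF_perm\<close>.\<close>

lemma FF_decompose:
  assumes "w \<in> FF (Suc n)" shows "\<exists>u. w - (\<Sum>ks\<in>KK n. t (wp (map dd ks)) (u ks)) \<in> FF n"
proof -
  interpret vector_space V.ms by (rule V.vs_M)
  let ?Z = "{w. \<exists>u. w - (\<Sum>ks\<in>KK n. t (wp (map dd ks)) (u ks)) \<in> FF n}"
  have Z: "subspace ?Z"
  proof (rule subspaceI)
    show "0 \<in> ?Z" by (auto simp: t_simps FF_0 intro!: exI[of _ "\<lambda>_. 0"])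
  next
    fix a b assume "a \<in> ?Z" "b \<in> ?Z"
    then obtain u u' where "a - (\<Sum>ks\<in>KK n. t (wp (map dd ks)) (u ks)) \<in> FF n"
      "b - (\<Sum>ks\<in>KK n. t (wp (map dd ks)) (u' ks)) \<in> FF n" by auto
    from FF_add[OF this] show "a + b \<in> ?Z"
      by (auto intro!: exI[of _ "\<lambda>ks. u ks + u' ks"] simp: t_simps sum.distrib algebra_simps)
  next
    fix a c assume "a \<in> ?Z"
    then obtain u where "a - (\<Sum>ks\<in>KK n. t (wp (map dd ks)) (u ks)) \<in> FF n" by auto
    from FF_scale[OF this, of c] show "V.ms c a \<in> ?Z"
      by (auto intro!: exI[of _ "\<lambda>ks. sR c (u ks)"] simp: t_simps scale_right_diff_distrib scale_sum_right)
  qed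
  have idx: "t (wp (map dd ks)) v \<in> ?Z" if "set ks \<subseteq> I" "length ks = n" for ks v
  proof -
    have "(\<Sum>js\<in>KK n. t (wp (map dd js)) (if js = sort ks then v else 0)) = t (wp (map dd (sort ks))) v"
      using that KK_finite by (simp add: if_distrib[of "t _"] t_simps KK_def sum.delta' cong: if_cong)
    moreover have "t (wp (map dd ks)) v - t (wp (map dd (sort ks))) v \<in> FF n"
      using FF_perm[of "map dd ks" "map dd (sort ks)" v] that by simp
    ultimately show ?thesis by (auto intro!: exI[of _ "\<lambda>js. if js = sort ks then v else 0"])
  qed
  have "t (wp (map dd ks @ ws)) v \<in> ?Z" if "set ks \<subseteq> I" "length ks + length ws = n" for ks ws v
    using that
  proof (induction ws arbitrary: ks)
    case Nil then show ?case using idx by simp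
  next
    case (Cons a ws)
    have "lin ds V.ms (\<lambda>a. t (wp (map dd ks) * \<iota> a * wp ws) v)"
      using iota_lin
      by (intro lin_comp[OF _ bilin_l[OF t_bilin]] lin_comp[OF _ algebra_mult_l[OF H_alg]] lin_comp[OF _ algebra_mult_r[OF H_alg]]) simp
    from lin_coord[OF this, of a]
    have "t (wp (map dd ks @ a # ws)) v = (\<Sum>k\<in>I. V.ms (coord S k a) (t (wp (map dd (ks @ [k]) @ ws)) v))"
      by (simp add: mult.assoc)
    also have "\<dots> \<in> ?Z"
      by (intro subspace_sum[OF Z] subspace_scale[OF Z] Cons.IH) (use Cons.prems in auto)
    finally show ?case .
  qed
  from this[of "[]"] have top: "t (wp ws) v \<in> ?Z" if "length ws = n" for ws v using that by simp
  have low: "t (wp ws) v \<in> ?Z" if "length ws < n" for ws v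
    using FF_gen[OF that, of v] by (auto intro!: exI[of _ "\<lambda>_. 0"] simp: t_simps)
  have "w \<in> ?Z"
    by (rule lin_in_subspace[OF lin_id[OF V.vs_M] Z _ assms[unfolded FF_def]])
      (use top low in \<open>auto simp: less_Suc_eq\<close>)
  then show ?thesis by simp
qed

text \<open>\<open>sym n \<alpha> \<beta> x z w\<close> is \<open>\<alpha>\<close> times the value at \<open>\<omega>(x, _)\<close> of the degree \<open>n\<close> symbol of \<open>w\<close>, plus \<open>\<beta>\<close> times its
  derivative in the direction \<open>\<omega>(z, _)\<close>.\<close>

definition sfun where "sfun n \<alpha> \<beta> x z = (SOME \<phi>. symbol_functional \<phi> n \<alpha> \<beta> (\<omega> x) (\<omega> z))"

definition sym where "sym n \<alpha> \<beta> x z = slice hs sR V.ms t (sfun n \<alpha> \<beta> x z)"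

lemma sfun: "symbol_functional (sfun n \<alpha> \<beta> x z) n \<alpha> \<beta> (\<omega> x) (\<omega> z)"
  unfolding sfun_def by (rule someI_ex[OF symbol_functional_exists[OF om_lin om_lin]])

lemma sym_lin: "lin V.ms sR (sym n \<alpha> \<beta> x z)"
  unfolding sym_def by (rule slice_lin[OF tpV symbol_functionalD(1)[OF sfun]])

lemma sym_word: "length ws < Suc n \<Longrightarrow> sym n \<alpha> \<beta> x z (t (wp ws) v) =
    (if length ws = n then sR (\<alpha> * pr (\<omega> x) ws + \<beta> * dpr (\<omega> x) (\<omega> z) ws) v else 0)"
  unfolding sym_def slice_eq[OF tpV symbol_functionalD(1)[OF sfun]]
  using symbol_functionalD(2,3)[OF sfun] by (auto simp: kills_def vs_zero_left[OF vs_R])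

text \<open>If the symbol vanishes at every point, the coefficients of the ordered monomials of
  degree \<open>n\<close> are zero by \<open>monomials_independent\<close>, and only lower degree is
  left.\<close>

lemma sym_separates:
  assumes w: "w \<in> FF (Suc n)" "w \<notin> FF n" shows "\<exists>x. sym n 1 0 x x w \<noteq> 0"
proof (rule ccontr)
  assume n: "\<not> ?thesis"
  obtain u where u: "w - (\<Sum>ks\<in>KK n. t (wp (map dd ks)) (u ks)) \<in> FF n" using FF_decompose[OF w(1)] by blast
  have lower: "sym n 1 0 x x w' = 0" if "w' \<in> FF n" for x w'
    by (rule FF_eqI[OF sym_lin lin_const0[OF V.vs_M vs_R] _ that]) (simp add: sym_word)
  have s0: "(\<Sum>ks\<in>KK n. sR (pr (\<omega> x) (map dd ks)) (u ks)) = 0" for x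
  proof -
    have "0 = sym n 1 0 x x (w - (\<Sum>ks\<in>KK n. t (wp (map dd ks)) (u ks)))" using lower[OF u] by simp
    also have "\<dots> = - (\<Sum>ks\<in>KK n. sym n 1 0 x x (t (wp (map dd ks)) (u ks)))"
      using n by (simp add: lin_diff[OF sym_lin] lin_sum[OF sym_lin])
    also have "(\<Sum>ks\<in>KK n. sym n 1 0 x x (t (wp (map dd ks)) (u ks))) = (\<Sum>ks\<in>KK n. sR (pr (\<omega> x) (map dd ks)) (u ks))"
      by (rule sum.cong) (auto simp: KK_def sym_word)
    finally show ?thesis by simp
  qed
  have "u ks = 0" if "ks \<in> KK n" for ks
  proof (rule monomials_independent[OF vs_R finite_atLeastAtMost KK_finite _ _ that])
    fix ks js assume "ks \<in> KK n" "js \<in> KK n" "\<And>i. i \<in> I \<Longrightarrow> count (mset ks) i = count (mset js) i"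
    moreover from this have "count (mset ks) i = count (mset js) i" if "i \<notin> I" for i
      using that by (metis (mono_tags, lifting) KK_def count_mset_0_iff mem_Collect_eq subset_iff)
    ultimately have "mset ks = mset js" by (intro multiset_eqI) blast
    then show "ks = js" using \<open>ks \<in> KK n\<close> \<open>js \<in> KK n\<close> by (metis (mono_tags, lifting) KK_def mem_Collect_eq sorted_sort_id properties_for_sort)
  next
    fix c :: "nat \<Rightarrow> 'k"
    \<comment> \<open>Nondegeneracy lets \<open>\<omega> x\<close> take arbitrary values
      \<open>c\<close> on the basis, so the symbol is tested at every point.\<close>
    define x where "x = (\<Sum>k\<in>I. ds (c k) (du' k))"
    have x: "\<omega> x (dd j) = c j" if j: "j \<in> I" for j
    proof -
      have "\<omega> x (dd j) = (\<Sum>k\<in>I. if k = j then c k else 0)"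
        unfolding x_def om_simps by (rule sum.cong) (use j in \<open>auto simp: du_dual\<close>)
      then show ?thesis using j by simp
    qed
    have "pr (\<omega> x) (map dd ks) = (\<Prod>i\<in>I. c i ^ count (mset ks) i)" if "set ks \<subseteq> I" for ks
      using that
    proof (induction ks)
      case (Cons k ks)
      have "(\<Prod>i\<in>I. c i ^ count (mset (k # ks)) i) = (\<Prod>i\<in>I. (if i = k then c i else 1) * c i ^ count (mset ks) i)"
        by (rule prod.cong) auto
      also have "\<dots> = c k * (\<Prod>i\<in>I. c i ^ count (mset ks) i)"
        using Cons.prems by (simp add: prod.distrib)
      finally show ?case using Cons x by simp
    qed simp
    then have "(\<Sum>ks\<in>KK n. sR (\<Prod>i\<in>I. c i ^ count (mset ks) i) (u ks)) = (\<Sum>ks\<in>KK n. sR (pr (\<omega> x) (map dd ks)) (u ks))"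
      by (intro sum.cong) (auto simp: KK_def)
    then show "(\<Sum>ks\<in>KK n. sR (\<Prod>i\<in>I. c i ^ count (mset ks) i) (u ks)) = 0" by (simp add: s0)
  qed
  then have "(\<Sum>ks\<in>KK n. t (wp (map dd ks)) (u ks)) = 0" by (simp add: t_simps)
  then show False using u w(2) by simp
qed

lemma efc_W:
  assumes W: "pseudo_submodule V act W" and w: "w \<in> W" shows "efc \<phi> w \<in> W"
  unfolding efc_def
  by (rule V.Psi_stable) (use assms in \<open>auto simp: pseudo_submodule_def\<close>)

text \<open>The operators \<open>efc \<phi>\<close> map an element \<open>w\<close> of minimal
  degree into parts of \<open>W\<close> that minimality or \<open>W0\<close> forces to be zero.
  \<open>?P\<close> and \<open>?D\<close> are the symbol of \<open>w\<close> and its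
  derivative.\<close>

lemma symbol_dichotomy:
  assumes W: "pseudo_submodule V act W" and W0: "\<And>v. t 1 v \<in> W \<Longrightarrow> v = 0" and nz: "W \<noteq> {0}"
  shows "(\<exists>x r. x \<noteq> 0 \<and> r \<noteq> 0 \<and> (\<forall>z. rsp (q x z) r = sR (\<omega> z x) r)) \<or>
    (\<exists>P. lin ds sR P \<and> (\<exists>x. P x \<noteq> 0) \<and> (\<forall>x z. rsp (q x x) (P z) + sR 2 (rsp (q x z) (P x)) = 0))"
proof -
  interpret V': vector_space V.ms by (rule V.vs_M)
  have sW: "V'.subspace W" using W by (simp add: pseudo_submodule_def)
  let ?Q = "\<lambda>n. \<exists>w\<in>W. w \<in> FF n \<and> w \<noteq> 0"
  have "\<exists>n. ?Q n" using nz FF_exhausts V'.subspace_0[OF sW] by blast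
  define n where "n = (LEAST n. ?Q n)"
  from LeastI_ex[OF \<open>\<exists>n. ?Q n\<close>] obtain w where w: "w \<in> W" "w \<in> FF n" "w \<noteq> 0" unfolding n_def by blast
  have min: "w' = 0" if "w' \<in> W" "w' \<in> FF k" "k < n" for w' k
    using not_less_Least[of k ?Q] that unfolding n_def by blast
  have FF1: "\<exists>v. w' = t 1 v" if "w' \<in> FF 1" for w'
  proof -
    have "V'.subspace (range (t 1))"
      by (rule V'.subspaceI)
        (auto simp: t_simps(2,4)[symmetric] intro: image_eqI[of 0 "t 1" 0] simp: t_simps(6))
    then have "w' \<in> range (t 1)"
      using that V'.span_minimal[of "{t (wp ws) v | ws v. length ws < 1}" "range (t 1)"] by (auto simp: FF_def)
    then show ?thesis by auto
  qed
  have t10: "v = 0" if "t 1 v = 0" for v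
    using W0[of v] that V'.subspace_0[OF sW] by simp
  have "n \<noteq> 0" using w by (intro notI) (simp add: FF_def)
  moreover have "n \<noteq> 1"
  proof
    assume "n = 1"
    then obtain v where v: "w = t 1 v" using w FF1[of w] by auto
    then have "v = 0" using W0 w(1) by blast
    then show False using v w(3) by (simp add: t_simps)
  qed
  \<comment> \<open>Since \<open>FF\<close> is strict, the degree of \<open>w\<close> is
    \<open>m\<close>, one less than \<open>n\<close>.\<close>
  ultimately obtain m where m: "n = Suc m" "1 \<le> m" by (metis One_nat_def Suc_leI not0_implies_Suc gr0I)
  have wm: "w \<in> FF (Suc m)" "w \<notin> FF m" using w m min[of w m] by auto
  let ?P = "\<lambda>x. sym m 1 0 x x w" and ?D = "\<lambda>x z. sym m 0 1 x z w"
  obtain x0 where x0: "?P x0 \<noteq> 0" using sym_separates[OF wm] by blast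
  have rl: "lin V.ms sR (\<lambda>w. rsp (q x z) (sym m \<alpha> \<beta> x' z' w))" for x z \<alpha> \<beta> x' z'
    by (rule lin_comp[OF sym_lin R.rho_lin[OF q_sp]])
  \<comment> \<open>A functional of order \<open>m + 2\<close> with parameters \<open>0, 1\<close>:
    the value lies in \<open>1 \<otimes> R\<close> and in \<open>W\<close>, hence is zero, and the
    factor in front is invertible.\<close>
  have E1: "rsp (q x x) (?D x z) + sR 2 (rsp (q x z) (?P x)) = 0" for x z
  proof -
    let ?f = "sfun (m + 2) 0 1 x z"
    have "efc ?f w = t 1 (sR ((- 1) ^ m * (- 1 / 2)) (rsp (q x x) (?D x z) + sR 2 (rsp (q x z) (?P x))))"
    proof (rule FF_eqI[OF efc_lin _ _ wm(1)])
      show "lin V.ms V.ms (\<lambda>w. t 1 (sR ((- 1) ^ m * (- 1 / 2)) (rsp (q x x) (sym m 0 1 x z w) + sR 2 (rsp (q x z) (sym m 1 0 x x w)))))"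
        by (intro lin_comp[OF _ bilin_r[OF t_bilin]] lin_smult lin_plus rl)
      fix ws :: "'d list" and v assume l: "length ws < Suc m"
      show "efc ?f (t (wp ws) v) = t 1 (sR ((- 1) ^ m * (- 1 / 2)) (rsp (q x x) (sym m 0 1 x z (t (wp ws) v)) + sR 2 (rsp (q x z) (sym m 1 0 x x (t (wp ws) v)))))"
      proof (cases "length ws = m")
        case True
        then show ?thesis
          using efc_top[of ?f ws 0 1 x z v] sfun[of "m + 2" 0 1 x z] 
          by (simp add: sym_word lin_scale[OF R.rho_lin[OF q_sp]] vs_mult[OF vs_R])
      next
        case False
        then have "efc ?f (t (wp ws) v) = 0"
          by (intro efc_zero symbol_functionalD(1)[OF sfun] kills_mono[OF symbol_functionalD(2)[OF sfun]]) (use l in simp)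
        then show ?thesis using False l
          by (simp add: sym_word lin_zero[OF R.rho_lin[OF q_sp]] vs_zero[OF vs_R] t_simps)
      qed
    qed
    then have "sR ((- 1) ^ m * (- 1 / 2)) (rsp (q x x) (?D x z) + sR 2 (rsp (q x z) (?P x))) = 0"
      using W0 efc_W[OF W w(1), of ?f] by simp
    then show ?thesis using vector_space.scale_eq_0_iff[OF vs_R] by simp
  qed
  show ?thesis
  proof (cases "m = 1")
    case True
    have gen: "ws = [] \<or> (\<exists>a. ws = [a])" if "length ws < Suc m" for ws :: "'d list"
      using that True by (cases ws) auto
    have w0: "sym (Suc 0) \<alpha> \<beta> x z (t 1 v) = 0"
      and w1: "sym (Suc 0) \<alpha> \<beta> x z (t (\<iota> a) v) = sR (\<alpha> * \<omega> x a + \<beta> * \<omega> z a) v" for \<alpha> \<beta> x z v a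
      using sym_word[of "[]" 1 \<alpha> \<beta> x z v] sym_word[of "[a]" 1 \<alpha> \<beta> x z v] by simp_all
    have ad: "sym m 1 0 (a + b) (a + b) w = sym m 1 0 a a w + sym m 1 0 b b w" for a b
      by (rule FF_eqI[OF sym_lin lin_plus[OF sym_lin sym_lin] _ wm(1)])
        (drule gen, elim disjE exE; simp add: True w0 w1 om_simps vs_add_left[OF vs_R])
    have sc: "sym m 1 0 (ds c a) (ds c a) w = sR c (sym m 1 0 a a w)" for a c
      by (rule FF_eqI[OF sym_lin lin_smult[OF sym_lin] _ wm(1)])
        (drule gen, elim disjE exE; simp add: True w0 w1 om_simps vs_mult[OF vs_R] vs_zero[OF vs_R])
    \<comment> \<open>A symbol of degree 1 is linear, so its derivative along \<open>z\<close> is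
      its value at \<open>z\<close>.\<close>
    have D: "?D x z = ?P z" for x z
      by (rule FF_eqI[OF sym_lin sym_lin _ wm(1)]) (drule gen, elim disjE exE; simp add: True w0 w1)
    have "lin ds sR ?P" by (rule linI[OF vs_d vs_R]) (simp_all only: ad sc)
    moreover have "rsp (q x x) (?P z) + sR 2 (rsp (q x z) (?P x)) = 0" for x z
      using E1[of x z] by (simp only: D)
    ultimately show ?thesis using x0 by (intro disjI2 exI[of _ ?P]) blast
  next
    case False
    have "rsp (q x z) (?P x) = sR (\<omega> z x) (?P x)" for x z
    proof -
      let ?f = "sfun (m + 1) 1 0 x x" and ?g = "sfun 1 1 0 z z"
      let ?sl = "slice hs sR V.ms t ?g"
      note sl = slice_lin[OF tpV symbol_functionalD(1)[OF sfun]]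
      have inF: "efc ?f w \<in> FF 2"
      proof -
        have g: "efc ?f (t (wp ws) v) \<in> FF 2" if "length ws < Suc m" for ws v
        proof -
          have "length ws + 3 - (m + 1) \<le> 2" using that by simp
          from FF_mono[OF this] show ?thesis
            using efc_FF[OF symbol_functionalD(1,2)[OF sfun[of "m + 1" 1 0 x x]], of ws v] by blast
        qed
        show ?thesis
          by (rule lin_in_subspace[OF efc_lin FF_subspace _ wm(1)[unfolded FF_def]]) (use g in blast)
      qed
      \<comment> \<open>Here \<open>m \<ge> 2\<close> enters: the result has degree at most 1, below
        the minimal degree.\<close>
      then have "efc ?f w = 0" using min[OF efc_W[OF W w(1)], of ?f 2] m False by simp
      moreover have "?sl (efc ?f w) = sR ((- 1) ^ m) (sR (\<omega> z x) (?P x) + sR (1 / 2) (rsp (q x x) (?D x z)))"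
      proof (rule FF_eqI[OF lin_comp[OF efc_lin sl] _ _ wm(1)])
        show "lin V.ms sR (\<lambda>w. sR ((- 1) ^ m) (sR (\<omega> z x) (sym m 1 0 x x w) + sR (1 / 2) (rsp (q x x) (sym m 0 1 x z w))))"
          by (intro lin_smult lin_plus rl sym_lin)
        fix ws :: "'d list" and v assume l: "length ws < Suc m"
        show "?sl (efc ?f (t (wp ws) v)) = sR ((- 1) ^ m) (sR (\<omega> z x) (sym m 1 0 x x (t (wp ws) v)) + sR (1 / 2) (rsp (q x x) (sym m 0 1 x z (t (wp ws) v))))"
        proof (cases "length ws = m")
          case True
          then show ?thesis
            using efc_subtop[OF sfun[of 1 1 0 z z], of ?f ws 1 x v] sfun[of "m + 1" 1 0 x x]
            by (simp add: sym_word lin_scale[OF R.rho_lin[OF q_sp]] vs_mult[OF vs_R])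
        next
          case False
          then have "length ws + 3 - (m + 1) \<le> 1" using l by simp
          from FF_mono[OF this] have "efc ?f (t (wp ws) v) \<in> FF 1"
            using efc_FF[OF symbol_functionalD(1,2)[OF sfun[of "m + 1" 1 0 x x]], of ws v] by blast
          \<comment> \<open>Shorter words end up in degree 0, which the order 1 functional
            \<open>?g\<close> does not see.\<close>
          from FF1[OF this] have "?sl (efc ?f (t (wp ws) v)) = 0"
            using kills_bar(1)[OF symbol_functionalD(1,2)[OF sfun[of 1 1 0 z z]]]
            by (auto simp: slice_eq[OF tpV symbol_functionalD(1)[OF sfun]] vs_zero_left[OF vs_R])
          then show ?thesis using False l
            by (simp add: sym_word lin_zero[OF R.rho_lin[OF q_sp]] vs_zero[OF vs_R])
        qed
      qed
      ultimately have "sR ((- 1) ^ m) (sR (\<omega> z x) (?P x) + sR (1 / 2) (rsp (q x x) (?D x z))) = 0"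
        by (simp add: lin_zero[OF sl])
      then have "sR (\<omega> z x) (?P x) + sR (1 / 2) (rsp (q x x) (?D x z)) = 0"
        using vector_space.scale_eq_0_iff[OF vs_R] by simp
      moreover have "rsp (q x x) (?D x z) = - sR 2 (rsp (q x z) (?P x))"
        using E1[of x z] by (simp add: eq_neg_iff_add_eq_0)
      ultimately show ?thesis by (simp add: vs_minus[OF vs_R] vs_mult[OF vs_R] vs_one[OF vs_R])
    qed
    moreover have "x0 \<noteq> 0"
    proof
      assume "x0 = 0"
      \<comment> \<open>A homogeneous symbol of positive degree vanishes at the origin.\<close>
      have "?P 0 = 0"
      proof (rule FF_eqI[OF sym_lin lin_const0[OF V.vs_M vs_R] _ wm(1)])
        fix ws :: "'d list" and v assume "length ws < Suc m"
        then show "sym m 1 0 0 0 (t (wp ws) v) = 0"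
          using m(2) by (cases ws) (auto simp: sym_word om_simps vs_zero_left[OF vs_R] simp del: wp_simps)
      qed
      then show False using x0 \<open>x0 = 0\<close> by simp
    qed
    ultimately show ?thesis using x0 by blast
  qed
qed

end

section \<open>Eigenvectors over an algebraically closed field and the basic lemma on
  \<open>sl2\<close>\<close>

section \<open>Eigenvectors and highest weight vectors\<close>

definition poly_op :: "('k::field \<Rightarrow> 'v::ab_group_add \<Rightarrow> 'v) \<Rightarrow> ('v \<Rightarrow> 'v) \<Rightarrow> 'k poly \<Rightarrow> 'v \<Rightarrow> 'v" where
  "poly_op s T p w = (\<Sum>i\<le>degree p. s (coeff p i) ((T ^^ i) w))"

lemma poly_op_le:
  assumes "vector_space s" "degree p \<le> n"
  shows "poly_op s T p w = (\<Sum>i\<le>n. s (coeff p i) ((T ^^ i) w))"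
  unfolding poly_op_def
  by (rule sum.mono_neutral_left) (use assms in \<open>auto simp: coeff_eq_0 vs_zero_left\<close>)

lemma poly_op_factor:
  assumes s: "vector_space s" and T: "lin s s T"
  shows "poly_op s T ([:- c, 1:] * r) w = poly_op s T r (T w - s c w)"
proof -
  let ?n = "degree r"
  have Tn: "(T ^^ i) (s c w) = s c ((T ^^ i) w)" "(T ^^ i) (x - z) = (T ^^ i) x - (T ^^ i) z" for i x z
    by (induction i) (simp_all add: lin_scale[OF T] lin_diff[OF T])
  have TS: "(T ^^ Suc i) w = (T ^^ i) (T w)" for i by (simp add: funpow_swap1)
  have d: "degree ([:- c, 1:] * r) \<le> Suc ?n" using degree_mult_le[of "[:- c, 1:]" r] by simp
  have co: "coeff ([:- c, 1:] * r) i = (case i of 0 \<Rightarrow> 0 | Suc j \<Rightarrow> coeff r j) - c * coeff r i" for i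
    by (cases i) auto
  have "poly_op s T ([:- c, 1:] * r) w =
     (\<Sum>i\<le>Suc ?n. s (case i of 0 \<Rightarrow> 0 | Suc j \<Rightarrow> coeff r j) ((T ^^ i) w)) - (\<Sum>i\<le>Suc ?n. s (coeff r i) (s c ((T ^^ i) w)))"
    unfolding poly_op_le[OF s d] co
    by (simp add: vs_diff_left[OF s] sum_subtractf vs_mult[OF s] mult.commute del: sum.atMost_Suc)
  also have "(\<Sum>i\<le>Suc ?n. s (case i of 0 \<Rightarrow> 0 | Suc j \<Rightarrow> coeff r j) ((T ^^ i) w)) = (\<Sum>i\<le>?n. s (coeff r i) ((T ^^ i) (T w)))"
    by (subst sum.atMost_Suc_shift) (simp add: vs_zero_left[OF s] funpow_swap1)
  also have "(\<Sum>i\<le>Suc ?n. s (coeff r i) (s c ((T ^^ i) w))) = (\<Sum>i\<le>?n. s (coeff r i) ((T ^^ i) (s c w)))"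
    by (simp add: coeff_eq_0 vs_zero_left[OF s] Tn)
  finally show ?thesis
    by (simp add: poly_op_def Tn vs_diff[OF s] sum_subtractf)
qed

text \<open>Some polynomial in \<open>T\<close> kills \<open>v\<close>; its roots are split off one
  by one. Only \<open>Y\<close> is required to lie in a finitely generated span, because the lemma
  is also applied inside the space of all functions from \<open>d\<close> to
  \<open>U\<close>.\<close>

lemma eigenvector_exists:
  fixes s :: "'k::alg_closed_field \<Rightarrow> 'v::ab_group_add \<Rightarrow> 'v"
  assumes T: "lin s s T" and Y: "module.subspace s Y" and B: "finite B" "Y \<subseteq> module.span s B"
    and st: "\<And>v. v \<in> Y \<Longrightarrow> T v \<in> Y" and v: "v \<in> Y" "v \<noteq> 0"
  shows "\<exists>c u. u \<in> Y \<and> u \<noteq> 0 \<and> T u = s c u"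
proof -
  note s = lin_vs1[OF T]
  interpret vector_space s by (rule s)
  have "\<exists>p. p \<noteq> 0 \<and> poly_op s T p v = 0"
  proof -
    let ?n = "card B" and ?f = "\<lambda>i. (T ^^ i) v"
    have fY: "?f i \<in> Y" for i by (induction i) (auto simp: v st)
    show ?thesis
    proof (cases "inj_on ?f {..?n}")
      \<comment> \<open>A repetition among the powers already gives the polynomial
        \<open>x^i - x^j\<close>. It is treated apart because dependence below is a property of
        sets.\<close>
      case False
      then obtain i j where ij: "?f i = ?f j" "i \<noteq> j" "i \<le> ?n" "j \<le> ?n" by (auto simp: inj_on_def)
      let ?p = "monom 1 i - monom 1 j :: 'k poly"
      have "degree ?p \<le> ?n" using ij by (intro degree_diff_le) (auto simp: degree_monom_eq)
      then have "poly_op s T ?p v = (\<Sum>k\<le>?n. (if k = i then ?f i else 0) - (if k = j then ?f j else 0))"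
        using ij(2) by (auto simp: poly_op_le[OF s] vs_diff_left[OF s] vs_one[OF s] vs_zero_left[OF s]
            vs_minus_left[OF s] intro!: sum.cong)
      also have "\<dots> = 0" using ij by (simp add: sum_subtractf)
      finally have z: "poly_op s T ?p v = 0" .
      have "coeff ?p i = 1" using ij(2) by simp
      then have "?p \<noteq> 0" by (metis coeff_0 one_neq_zero)
      with z show ?thesis by (intro exI[of _ ?p] conjI)
    next
      case True
      have "dependent (?f ` {..?n})"
      proof (rule ccontr)
        assume "\<not> dependent (?f ` {..?n})"
        then have "card (?f ` {..?n}) \<le> card B"
          using independent_span_bound[OF B(1), of "?f ` {..?n}"] fY B(2) by blast
        then show False using True by (simp add: card_image)
      qed
      then obtain u where u: "\<exists>x\<in>?f ` {..?n}. u x \<noteq> 0" "(\<Sum>x\<in>?f ` {..?n}. s (u x) x) = 0"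
        using dependent_finite[of "?f ` {..?n}"] by auto
      define p where "p = (\<Sum>i\<le>?n. monom (u (?f i)) i)"
      have co: "coeff p k = (if k \<le> ?n then u (?f k) else 0)" for k
        by (simp add: p_def coeff_sum if_distrib cong: if_cong)
      have "degree p \<le> ?n" unfolding p_def
        by (rule degree_sum_le) (auto intro: order_trans[OF degree_monom_le])
      then have "poly_op s T p v = (\<Sum>i\<le>?n. s (u (?f i)) (?f i))" by (simp add: poly_op_le[OF s] co)
      also have "\<dots> = 0" using u(2) True by (simp add: sum.reindex)
      finally have z: "poly_op s T p v = 0" .
      obtain k where "k \<le> ?n" "u (?f k) \<noteq> 0" using u(1) by auto
      then have "coeff p k \<noteq> 0" by (simp add: co)
      then have "p \<noteq> 0" by (metis coeff_0)
      with z show ?thesis by (intro exI[of _ p] conjI)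
    qed
  qed
  then obtain p where "p \<noteq> 0" "poly_op s T p v = 0" by blast
  then show ?thesis using v
  proof (induction "degree p" arbitrary: p v)
    case 0
    then obtain c where "p = [:c:]" by (metis degree_0_id)
    then show ?case using 0 by (simp add: poly_op_def)
  next
    \<comment> \<open>With a root \<open>c\<close>, either \<open>v\<close> is an eigenvector or the
      cofactor \<open>r\<close> kills the nonzero vector \<open>T v - s c v\<close>.\<close>
    case (Suc n)
    then obtain c where "poly p c = 0" using alg_closed_imp_poly_has_root[of p] by auto
    then obtain r where r: "p = [:- c, 1:] * r" using poly_eq_0_iff_dvd by (metis dvdE)
    show ?case
    proof (cases "T v - s c v = 0")
      case True
      then show ?thesis using Suc.prems by auto
    next
      case False
      have "r \<noteq> 0" using Suc.prems(1) r by auto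
      then have "degree p = Suc (degree r)" unfolding r by (subst degree_mult_eq) auto
      then show ?thesis
        using Suc.hyps(2) Suc.prems(3) False \<open>r \<noteq> 0\<close> Suc.prems(2)[unfolded r poly_op_factor[OF s T]]
        by (intro Suc.hyps(1)[of r "T v - s c v"]) (auto intro!: subspace_diff[OF Y] subspace_scale[OF Y] st)
    qed
  qed
qed

lemma eigenvectors_sum_0:
  assumes T: "lin s s T"
  shows "finite A \<Longrightarrow> (\<And>a. a \<in> A \<Longrightarrow> T (x a) = s a (x a)) \<Longrightarrow> (\<Sum>a\<in>A. x a) = 0 \<Longrightarrow> a \<in> A \<Longrightarrow> x a = 0"
proof (induction A arbitrary: x a rule: finite_induct)
  case (insert b A)
  note s = lin_vs1[OF T]
  have sA: "(\<Sum>a\<in>A. x a) = - x b" using insert by (simp add: eq_neg_iff_add_eq_0 add.commute)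
  have "(\<Sum>a\<in>A. s (a - b) (x a)) = T (\<Sum>a\<in>A. x a) - s b (\<Sum>a\<in>A. x a)"
    using insert.prems(1) by (simp add: lin_sum[OF T] vs_sum[OF s] vs_diff_left[OF s] sum_subtractf)
  also have "\<dots> = 0" unfolding sA using insert.prems(1)[of b] by (simp add: lin_neg[OF T] vs_minus[OF s])
  finally have z: "(\<Sum>a\<in>A. s (a - b) (x a)) = 0" .
  have "s (a - b) (x a) = 0" if "a \<in> A" for a
    by (rule insert.IH[of "\<lambda>a. s (a - b) (x a)", OF _ z that])
      (use insert.prems(1) in \<open>simp add: lin_scale[OF T] vs_mult[OF s] mult.commute\<close>)
  then have A0: "x a = 0" if "a \<in> A" for a
    using that insert.hyps vector_space.scale_eq_0_iff[OF s] by (metis right_minus_eq)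
  then have "x b = 0" using insert by simp
  then show ?case using A0 insert.prems(3) by auto
qed simp

lemma eigenvalues_card:
  assumes T: "lin s s T" and B: "finite B" and A: "finite A"
    and x: "\<And>a. a \<in> A \<Longrightarrow> T (x a) = s a (x a)" "\<And>a. a \<in> A \<Longrightarrow> x a \<noteq> 0" "\<And>a. a \<in> A \<Longrightarrow> x a \<in> module.span s B"
  shows "card A \<le> card B"
proof -
  note s = lin_vs1[OF T]
  interpret vector_space s by (rule s)
  have inj: "inj_on x A"
  proof (rule inj_onI)
    fix a b assume ab: "a \<in> A" "b \<in> A" "x a = x b"
    then have "s a (x a) = s b (x a)" using x(1)[of a] x(1)[of b] by metis
    then show "a = b" using x(2)[OF ab(1)] by simp
  qed
  have "independent (x ` A)"
  proof (rule independent_if_scalars_zero)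
    fix f y assume f: "(\<Sum>v\<in>x ` A. s (f v) v) = 0" and y: "y \<in> x ` A"
    then obtain a where a: "a \<in> A" "y = x a" by auto
    have "s (f (x a)) (x a) = 0"
      by (rule eigenvectors_sum_0[OF T A _ _ a(1), of "\<lambda>a. s (f (x a)) (x a)"])
        (use f inj x(1) in \<open>simp_all add: sum.reindex lin_scale[OF T] mult.commute\<close>)
    then show "f y = 0" using x(2)[OF a(1)] a(2) by simp
  qed (use A in simp)
  then have "card (x ` A) \<le> card B"
    using independent_span_bound[OF B, of "x ` A"] x(3) by auto
  then show ?thesis using inj by (simp add: card_image)
qed

lemma eigenvalues_stop:
  assumes T: "lin s s T" and B: "finite B"
    and x: "\<And>n::nat. T (x n) = s (\<alpha> n) (x n)" "\<And>n. x n \<in> module.span s B" and inj: "inj \<alpha>"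
  shows "\<exists>n. x n = 0"
proof (rule ccontr)
  assume n: "\<nexists>n. x n = 0"
  let ?A = "\<alpha> ` {..card B}"
  have "card ?A \<le> card B"
    by (rule eigenvalues_card[OF T B, of ?A "\<lambda>a. x (inv \<alpha> a)"])
      (use x n inj in \<open>auto simp: inv_f_f\<close>)
  then show False using inj by (simp add: card_image inj_on_subset)
qed

text \<open>The identity \<open>ex\<close> at the last nonzero power forces \<open>c = k\<close> in
  characteristic 0. The second conclusion matters for \<open>k = 0\<close>, where it says that
  \<open>f\<close> kills \<open>u\<close>.\<close>

lemma sl2_highest_weight:
  fixes s :: "'k::field_char_0 \<Rightarrow> 'v::ab_group_add \<Rightarrow> 'v"
  assumes e: "lin s s e" and f: "lin s s f" and h: "lin s s h"
    and fd: "finite B" "module.span s B = UNIV"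
    and hf: "\<And>w. h (f w) = f (h w) - s 2 (f w)" and ef: "\<And>w. e (f w) = f (e w) + h w"
    and u: "e u = 0" "h u = s c u" "u \<noteq> 0"
  shows "\<exists>k::nat. c = of_nat k \<and> (f ^^ Suc k) u = 0"
proof -
  note s = lin_vs1[OF e]
  have hx: "h ((f ^^ n) u) = s (c - 2 * of_nat n) ((f ^^ n) u)" for n
    by (induction n) (simp_all add: u hf lin_scale[OF f] vs_diff_left[OF s, symmetric] algebra_simps)
  have "\<exists>n. (f ^^ n) u = 0"
    by (rule eigenvalues_stop[OF h fd(1) hx]) (auto simp: fd(2) inj_def)
  define n where "n = (LEAST n. (f ^^ n) u = 0)"
  have n0: "(f ^^ n) u = 0" unfolding n_def by (rule LeastI_ex) fact
  then obtain k where nk: "n = Suc k" using u(3) by (cases n) auto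
  have "(f ^^ k) u \<noteq> 0" using not_less_Least[of k "\<lambda>n. (f ^^ n) u = 0"] nk n_def by auto
  with n0 nk have k: "(f ^^ Suc k) u = 0" "(f ^^ k) u \<noteq> 0" by auto
  have ex: "e ((f ^^ Suc n) u) = s (of_nat (Suc n) * (c - of_nat n)) ((f ^^ n) u)" for n
  proof (induction n)
    case 0 then show ?case by (simp add: ef u lin_zero[OF f])
  next
    case (Suc n)
    have "e ((f ^^ Suc (Suc n)) u) = f (e ((f ^^ Suc n) u)) + h ((f ^^ Suc n) u)" by (simp add: ef)
    also have "\<dots> = s (of_nat (Suc n) * (c - of_nat n) + (c - 2 * of_nat (Suc n))) ((f ^^ Suc n) u)"
      unfolding Suc hx by (simp add: lin_scale[OF f] vs_add_left[OF s])
    also have "of_nat (Suc n) * (c - of_nat n) + (c - 2 * of_nat (Suc n)) = of_nat (Suc (Suc n)) * (c - of_nat (Suc n))"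
      by (simp add: algebra_simps)
    finally show ?case .
  qed
  have "s (of_nat (Suc k) * (c - of_nat k)) ((f ^^ k) u) = 0"
    using ex[of k] k(1) by (simp only: lin_zero[OF e])
  then have "of_nat (Suc k) * (c - of_nat k) = 0"
    using k(2) vector_space.scale_eq_0_iff[OF s] by blast
  then have "c = of_nat k" by (simp only: mult_eq_0_iff of_nat_eq_0_iff) auto
  then show ?thesis using k(1) by blast
qed

section \<open>Symplectic bases\<close>

context sympl
begin

definition sbasis :: "nat \<Rightarrow> (nat \<Rightarrow> 'd) \<Rightarrow> (nat \<Rightarrow> 'd) \<Rightarrow> bool" where
  "sbasis k a b \<longleftrightarrow> (\<forall>i\<in>{1..k}. \<forall>j\<in>{1..k}. \<omega> (a i) (a j) = 0 \<and> \<omega> (b i) (b j) = 0 \<and>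
     \<omega> (a i) (b j) = (if i = j then 1 else 0))"

lemma sbasisD:
  assumes "sbasis k a b" "i \<in> {1..k}" "j \<in> {1..k}"
  shows "\<omega> (a i) (a j) = 0" "\<omega> (b i) (b j) = 0" "\<omega> (a i) (b j) = (if i = j then 1 else 0)"
    "\<omega> (b i) (a j) = (if i = j then - 1 else 0)"
proof -
  show "\<omega> (a i) (a j) = 0" "\<omega> (b i) (b j) = 0" and *: "\<omega> (a i) (b j) = (if i = j then 1 else 0)"
    using assms unfolding sbasis_def by blast+
  have "\<omega> (a j) (b i) = (if i = j then 1 else 0)" using assms unfolding sbasis_def by auto
  then show "\<omega> (b i) (a j) = (if i = j then - 1 else 0)" using om_anti[of "b i" "a j"] by simp
qed

text \<open>Pairing with the \<open>g i\<close> shows that the \<open>f i\<close> are independent.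
  This bounds the length of partial symplectic bases without orthogonal complements.\<close>

lemma dual_family_card:
  assumes X: "finite X" and d: "\<And>i j. i \<in> X \<Longrightarrow> j \<in> X \<Longrightarrow> \<omega> (g i) (f j) = (if i = j then 1 else 0)"
  shows "card X \<le> 2 * half S"
proof -
  interpret vector_space ds by (rule vs_d)
  have inj: "inj_on f X" using d by (intro inj_onI) (metis zero_neq_one)
  have "independent (f ` X)"
  proof (rule independent_if_scalars_zero)
    fix c y assume c: "(\<Sum>v\<in>f ` X. ds (c v) v) = 0" and "y \<in> f ` X"
    then obtain i where i: "i \<in> X" "y = f i" by auto
    have "0 = \<omega> (g i) (\<Sum>j\<in>X. ds (c (f j)) (f j))" using c inj by (simp add: sum.reindex om_simps)
    also have "\<dots> = (\<Sum>j\<in>X. if j = i then c (f j) else 0)"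
      unfolding om_simps by (rule sum.cong) (use d i in auto)
    finally show "c y = 0" using i X by simp
  qed (use X in simp)
  then have "card (f ` X) \<le> card (dd ` I)"
    using independent_span_bound[of "dd ` I" "f ` X"] basis_span by auto
  then show ?thesis using inj card_image_le[of I dd] by (simp add: card_image)
qed

lemma sbasis_card:
  assumes s: "sbasis k a b" shows "k \<le> half S"
proof -
  let ?X = "{1..k} \<times> (UNIV :: bool set)"
  have "card ?X \<le> 2 * half S"
  \<comment> \<open>The partner of \<open>b i\<close> is \<open>a i\<close>, and that of
    \<open>a i\<close> is \<open>- b i\<close>, since
    \<open>\<omega> (b i) (a i) = - 1\<close>.\<close>
  proof (rule dual_family_card[of _ "\<lambda>(i, z). if z then - b i else a i" "\<lambda>(i, z). if z then a i else b i"])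
    fix x y assume xy: "x \<in> ?X" "y \<in> ?X"
    obtain i z j z' where e: "x = (i, z)" "y = (j, z')" by (metis surj_pair)
    show "\<omega> (case x of (i, z) \<Rightarrow> if z then - b i else a i) (case y of (i, z) \<Rightarrow> if z then a i else b i) = (if x = y then 1 else 0)"
      using xy unfolding e by (cases z; cases z') (auto simp: om_simps sbasisD[OF s])
  qed simp
  then show ?thesis by (simp add: card_cartesian_product)
qed

text \<open>The projection to the span of a partial symplectic basis along its
  \<open>\<omega>\<close>-orthogonal complement.\<close>

definition sproj where "sproj k a b v = (\<Sum>i\<in>{1..k}. ds (\<omega> v (b i)) (a i) - ds (\<omega> v (a i)) (b i))"

lemma sproj_orth:
  assumes s: "sbasis k a b" and j: "j \<in> {1..k}"
  shows "\<omega> (v - sproj k a b v) (a j) = 0" "\<omega> (v - sproj k a b v) (b j) = 0"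
proof -
  have "\<omega> (sproj k a b v) (a j) = (\<Sum>i\<in>{1..k}. if i = j then \<omega> v (a i) else 0)"
    unfolding sproj_def om_simps by (rule sum.cong) (use j in \<open>auto simp: sbasisD[OF s]\<close>)
  then show "\<omega> (v - sproj k a b v) (a j) = 0" using j by (simp add: om_simps)
  have "\<omega> (sproj k a b v) (b j) = (\<Sum>i\<in>{1..k}. if i = j then \<omega> v (b i) else 0)"
    unfolding sproj_def om_simps by (rule sum.cong) (use j in \<open>auto simp: sbasisD[OF s]\<close>)
  then show "\<omega> (v - sproj k a b v) (b j) = 0" using j by (simp add: om_simps)
qed

lemma sbasis_extend:
  assumes s: "sbasis k a b" and v: "v \<noteq> 0" "\<And>j. j \<in> {1..k} \<Longrightarrow> \<omega> v (a j) = 0" "\<And>j. j \<in> {1..k} \<Longrightarrow> \<omega> v (b j) = 0"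
  shows "\<exists>w. sbasis (Suc k) (a(Suc k := v)) (b(Suc k := w))"
proof -
  obtain w0 where "\<omega> v w0 \<noteq> 0" using om_nondeg v(1) by blast
  then have w1: "\<omega> v (ds (1 / \<omega> v w0) w0) = 1" by (simp add: om_simps)
  define w1 where "w1 = ds (1 / \<omega> v w0) w0"
  define w where "w = w1 - sproj k a b w1"
  have "\<omega> v (sproj k a b w1) = 0" unfolding sproj_def om_simps using v(2,3) by simp
  then have vw: "\<omega> v w = 1" using w1 by (simp add: w_def w1_def om_simps)
  note o = sproj_orth[OF s, of _ w1, folded w_def]
  have o': "\<omega> (a j) w = 0" "\<omega> (b j) w = 0" "\<omega> (a j) v = 0" "\<omega> (b j) v = 0" if "j \<in> {1..k}" for j
    using o[OF that] v(2,3)[OF that] om_anti[of "a j" w] om_anti[of "b j" w] om_anti[of "a j" v] om_anti[of "b j" v] by auto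
  have "sbasis (Suc k) (a(Suc k := v)) (b(Suc k := w))"
    unfolding sbasis_def atLeastAtMostSuc_conv[of 1 k, simplified]
    using sbasisD[OF s] o o' v(2,3) vw by auto
  then show ?thesis ..
qed

text \<open>Symplectic Gram--Schmidt started at \<open>x\<close>. Prescribing \<open>a 1 = x\<close>
  turns a condition at \<open>x\<close> into one at the vector of highest weight in
  \<open>d\<close>.\<close>

lemma sbasis_exists:
  assumes x: "x \<noteq> 0" shows "\<exists>a b. sbasis (half S) a b \<and> a 1 = x"
proof -
  have "\<exists>a b. sbasis k a b \<and> a 1 = x" if "1 \<le> k" "k \<le> half S" for k
    using that
  proof (induction k rule: dec_induct)
    case base
    have "sbasis 0 (\<lambda>_. 0) (\<lambda>_. 0)" by (simp add: sbasis_def)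
    from sbasis_extend[OF this x] show ?case by fastforce
  next
    case (step k)
    then obtain a b where ab: "sbasis k a b" "a 1 = x" by auto
    have "\<exists>v. v - sproj k a b v \<noteq> 0"
    proof (rule ccontr)
      interpret vector_space ds by (rule vs_d)
      assume "\<nexists>v. v - sproj k a b v \<noteq> 0"
      then have v: "v = sproj k a b v" for v by simp
      have "v \<in> span (a ` {1..k} \<union> b ` {1..k})" for v
        by (subst v, unfold sproj_def) (intro span_sum span_diff span_scale span_base, auto)
      then have "card (dd ` I) \<le> card (a ` {1..k} \<union> b ` {1..k})"
        using independent_span_bound[of "a ` {1..k} \<union> b ` {1..k}" "dd ` I"] basis_ind by auto
      also have "\<dots> \<le> k + k"
        using card_Un_le[of "a ` {1..k}" "b ` {1..k}"] card_image_le[of "{1..k}" a] card_image_le[of "{1..k}" b] by simp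
      finally show False using step card_image[OF basis_inj] by simp
    qed
    then obtain v where v: "v - sproj k a b v \<noteq> 0" by blast
    from sbasis_extend[OF ab(1) v sproj_orth[OF ab(1)]] obtain w
      where "sbasis (Suc k) (a(Suc k := v - sproj k a b v)) (b(Suc k := w))" by blast
    moreover have "(a(Suc k := v - sproj k a b v)) 1 = x" using ab(2) step by simp
    ultimately show ?case by blast
  qed
  from this[OF half_pos] show ?thesis by simp
qed

text \<open>Otherwise the complement of the span would contain a nonzero vector, and the basis could
  be made longer than \<open>sbasis_card\<close> permits.\<close>

lemma sbasis_expand:
  assumes s: "sbasis (half S) a b" shows "sproj (half S) a b v = v"
proof (rule ccontr)
  assume "sproj (half S) a b v \<noteq> v"
  then have "v - sproj (half S) a b v \<noteq> 0" by simp
  from sbasis_extend[OF s this sproj_orth[OF s]] obtain w where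
    "sbasis (Suc (half S)) (a(Suc (half S) := v - sproj (half S) a b v)) (b(Suc (half S) := w))" by blast
  from sbasis_card[OF this] show False by simp
qed

end

lemma common_eigenvector:
  fixes s :: "'k::alg_closed_field \<Rightarrow> 'v::ab_group_add \<Rightarrow> 'v"
  assumes s: "vector_space s" and T: "\<And>i. i \<in> K \<Longrightarrow> lin s s (T i)" and B: "finite B" and K: "finite K"
  shows "module.subspace s X \<Longrightarrow> X \<subseteq> module.span s B \<Longrightarrow> u \<in> X \<Longrightarrow> u \<noteq> 0 \<Longrightarrow>
    (\<And>i x. i \<in> K \<Longrightarrow> x \<in> X \<Longrightarrow> T i x \<in> X) \<Longrightarrow>
    (\<And>i j x. i \<in> K \<Longrightarrow> j \<in> K \<Longrightarrow> x \<in> X \<Longrightarrow> T i (T j x) = T j (T i x)) \<Longrightarrow>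
    \<exists>u\<in>X. u \<noteq> 0 \<and> (\<forall>i\<in>K. \<exists>c. T i u = s c u)"
  using K T
proof (induction K arbitrary: X u)
  case empty
  then show ?case by auto
next
  case (insert i K)
  interpret vector_space s by (rule s)
  have Ti: "lin s s (T i)" using insert.prems(7) by simp
  obtain c v where v: "v \<in> X" "v \<noteq> 0" "T i v = s c v"
    using eigenvector_exists[OF Ti insert.prems(1) B insert.prems(2) _ insert.prems(3,4)] insert.prems(5) by blast
  let ?X = "{x \<in> X. T i x = s c x}"
  have sX: "subspace ?X"
    by (rule subspaceI)
      (auto simp: lin_add[OF Ti] lin_scale[OF Ti] lin_zero[OF Ti] scale_right_distrib mult.commute
        intro: subspace_0[OF insert.prems(1)] subspace_add[OF insert.prems(1)] subspace_scale[OF insert.prems(1)])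
  have "\<exists>u\<in>?X. u \<noteq> 0 \<and> (\<forall>i\<in>K. \<exists>c. T i u = s c u)"
  proof (rule insert.IH[OF sX, of v])
    fix j x assume j: "j \<in> K" and x: "x \<in> ?X"
    then have "T i (T j x) = T j (T i x)" using insert.prems(6)[of i j x] by simp
    also have "\<dots> = s c (T j x)" using x lin_scale[OF insert.prems(7), of j c x] j by simp
    finally show "T j x \<in> ?X" using insert.prems(5)[of j x] j x by auto
  qed (use v insert.prems in auto)
  then show ?case by auto
qed

section \<open>Cartan subalgebra, positive roots, and existence of highest weight vectors\<close>

locale sympl_ac = sympl S
  for S :: "('k::{alg_closed_field, field_char_0}, 'd::ab_group_add) symplectic"

text \<open>A symplectic basis \<open>a, b\<close>; \<open>h0\<close> is a regular element of the Cartan subalgebra on which all positive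
  roots take positive integer values.\<close>

locale sympl_basis = sympl_ac S
  for S :: "('k::{alg_closed_field, field_char_0}, 'd::ab_group_add) symplectic" +
  fixes a b :: "nat \<Rightarrow> 'd"
  assumes sb: "sbasis (half S) a b"
begin

abbreviation "N \<equiv> half S"
abbreviation "J \<equiv> {1..N}"
abbreviation "H \<equiv> sp_diag S a b"

lemmas sbD = sbasisD[OF sb]

lemma J1: "1 \<in> J" using half_pos by simp

lemma H_q: "H i = - q (a i) (b i)"
  by (auto simp: sp_diag_def q_def fun_eq_iff om_anti[of _ "a i"] om_anti[of _ "b i"] vs_minus_left[OF vs_d])

lemma H_sp: "H i \<in> sp S"
  unfolding H_q by (intro sp_uminus q_sp)

lemma q_values:
  assumes "i \<in> J" "j \<in> J" "l \<in> J"
  shows "q (a i) (a j) (a l) = 0" "q (a i) (a j) (b l) = (if i = l then a j else 0) + (if j = l then a i else 0)"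
    "q (a i) (b j) (a l) = - (if j = l then a i else 0)" "q (a i) (b j) (b l) = (if i = l then b j else 0)"
    "q (b i) (b j) (a l) = - (if i = l then b j else 0) - (if j = l then b i else 0)"
  using assms by (auto simp: q_def sbD vs_zero_left[OF vs_d] vs_one[OF vs_d] vs_minus_left[OF vs_d])

lemma H_values:
  assumes "i \<in> J" "l \<in> J"
  shows "H i (a l) = (if i = l then a l else 0)" "H i (b l) = - (if i = l then b l else 0)"
  using assms by (auto simp: H_q q_values)

text \<open>The coefficients \<open>N, ..., 1\<close> are positive and decreasing: the root
  \<open>\<epsilon>\<^sub>i - \<epsilon>\<^sub>j\<close> takes the value \<open>j - i\<close>, and
  \<open>\<epsilon>\<^sub>i + \<epsilon>\<^sub>j\<close> the sum of two coefficients.\<close>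

definition h0 :: "'d \<Rightarrow> 'd" where "h0 = (\<lambda>v. \<Sum>i\<in>J. ds (of_nat (N + 1 - i)) (H i v))"

lemma h0_sum: "h0 = (\<Sum>i\<in>J. (\<lambda>v. ds (of_nat (N + 1 - i)) (H i v)))"
proof
  fix v
  have "(\<Sum>i\<in>X. (\<lambda>v. ds (of_nat (N + 1 - i)) (H i v))) v = (\<Sum>i\<in>X. ds (of_nat (N + 1 - i)) (H i v))" for X
    by (induction X rule: infinite_finite_induct) auto
  then show "h0 v = (\<Sum>i\<in>J. (\<lambda>v. ds (of_nat (N + 1 - i)) (H i v))) v" by (simp only: h0_def)
qed

lemma h0_sp: "h0 \<in> sp S"
  unfolding h0_sum by (intro sp_sum sp_scale H_sp)

lemma h0_values:
  assumes l: "l \<in> J"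
  shows "h0 (a l) = ds (of_nat (N + 1 - l)) (a l)" "h0 (b l) = - ds (of_nat (N + 1 - l)) (b l)"
proof -
  have "h0 (a l) = (\<Sum>i\<in>J. if i = l then ds (of_nat (N + 1 - i)) (a l) else 0)"
    unfolding h0_def by (rule sum.cong) (use l in \<open>auto simp: H_values vs_zero[OF vs_d]\<close>)
  then show "h0 (a l) = ds (of_nat (N + 1 - l)) (a l)" using l by simp
  have "h0 (b l) = (\<Sum>i\<in>J. if i = l then - ds (of_nat (N + 1 - i)) (b l) else 0)"
    unfolding h0_def by (rule sum.cong) (use l in \<open>auto simp: H_values vs_zero[OF vs_d] vs_minus[OF vs_d]\<close>)
  then show "h0 (b l) = - ds (of_nat (N + 1 - l)) (b l)" using l by simp
qed

text \<open>Pairs whose \<open>q\<close> is a positive root vector: of root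
  \<open>\<epsilon>\<^sub>i + \<epsilon>\<^sub>j\<close> in the first set and
  \<open>\<epsilon>\<^sub>i - \<epsilon>\<^sub>j\<close> in the second.\<close>

definition pos :: "('d \<times> 'd) set" where
  "pos = {(a i, a j) | i j. i \<in> J \<and> j \<in> J} \<union> {(a i, b j) | i j. i \<in> J \<and> j \<in> J \<and> i < j}"

lemma posI: "i \<in> J \<Longrightarrow> j \<in> J \<Longrightarrow> (a i, a j) \<in> pos" "i \<in> J \<Longrightarrow> j \<in> J \<Longrightarrow> i < j \<Longrightarrow> (a i, b j) \<in> pos"
  unfolding pos_def by blast+

lemma q_neg: "q (- x) z = (\<lambda>v. ds (- 1) (q x z v))" "q x (- z) = (\<lambda>v. ds (- 1) (q x z v))"
  by (auto simp: q_def fun_eq_iff om_simps vs_minus_left[OF vs_d] vs_minus[OF vs_d] vs_one[OF vs_d])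

lemma pos_weight:
  assumes "(x, z) \<in> pos"
  shows "\<exists>k::nat. 1 \<le> k \<and> (\<lambda>v. h0 (q x z v) - q x z (h0 v)) = (\<lambda>v. ds (of_nat k) (q x z v))"
proof -
  consider i j where "i \<in> J" "j \<in> J" "x = a i" "z = a j" | i j where "i \<in> J" "j \<in> J" "i < j" "x = a i" "z = b j"
    using assms by (auto simp: pos_def)
  then show ?thesis
  proof cases
    case 1
    then have e: "q (h0 x) z + q x (h0 z) = (\<lambda>v. ds (of_nat (N + 1 - i + (N + 1 - j))) (q x z v))"
      by (simp only: h0_values q_scale of_nat_add vs_add_left[OF vs_d] plus_fun_def)
    have "1 \<le> N + 1 - i" using 1 by auto
    then have "1 \<le> N + 1 - i + (N + 1 - j)" by linarith
    with e show ?thesis unfolding q_bracket[OF h0_sp] by blast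
  next
    case 2
    then have e: "of_nat (N + 1 - i) - of_nat (N + 1 - j) = (of_nat (j - i) :: 'k)"
      by (simp add: of_nat_diff Suc_diff_le)
    have "q (h0 x) z + q x (h0 z) = (\<lambda>v. ds (of_nat (N + 1 - i) - of_nat (N + 1 - j)) (q x z v))"
      using 2 by (simp only: h0_values q_neg q_scale) (simp add: fun_eq_iff vs_diff_left[OF vs_d] vs_minus_left[OF vs_d] vs_one[OF vs_d])
    then have "q (h0 x) z + q x (h0 z) = (\<lambda>v. ds (of_nat (j - i)) (q x z v))" by (simp only: e)
    moreover have "1 \<le> j - i" using 2 by simp
    ultimately show ?thesis unfolding q_bracket[OF h0_sp] by blast
  qed
qed

text \<open>The parabolic subalgebra fixing the line of \<open>a 1\<close>. The eigenvector
  condition at \<open>x = a 1\<close> is stable only under such elements, and they suffice for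
  highest weight vectors.\<close>

definition parab :: "('d \<Rightarrow> 'd) set" where "parab = {A \<in> sp S. \<exists>c. A (a 1) = ds c (a 1)}"

lemma parab_sp: "A \<in> parab \<Longrightarrow> A \<in> sp S"
  by (simp add: parab_def)

lemma H_parab: "i \<in> J \<Longrightarrow> H i \<in> parab"
  using J1 H_sp vs_one[OF vs_d] vs_zero_left[OF vs_d]
  by (auto simp: parab_def H_values intro: exI[of _ 1] exI[of _ 0])

lemma h0_parab: "h0 \<in> parab"
  using J1 h0_sp by (auto simp: parab_def h0_values)

lemma pos_parab: "(x, z) \<in> pos \<Longrightarrow> q x z \<in> parab"
  using J1 vs_zero_left[OF vs_d, of "a 1"] by (auto simp: pos_def parab_def q_sp q_values intro!: exI[of _ 0])

text \<open>Zero is written as a multiple of an element of \<open>parab\<close>, because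
  \<open>highest_weight_vector\<close> asks of \<open>T\<close> only compatibility with scalars and
  brackets.\<close>

lemma H_comm: "i \<in> J \<Longrightarrow> j \<in> J \<Longrightarrow> (\<lambda>v. H i (H j v) - H j (H i v)) = (\<lambda>v. ds 0 (H j v))"
proof -
  assume ij: "i \<in> J" "j \<in> J"
  have "q (H i (a j)) (b j) + q (a j) (H i (b j)) = 0"
    using ij by (auto simp: H_values q_neg fun_eq_iff vs_minus_left[OF vs_d] vs_one[OF vs_d])
      (auto simp: q_def om_simps vs_zero[OF vs_d] vs_zero_left[OF vs_d])
  then have "(\<lambda>v. H i (q (a j) (b j) v) - q (a j) (b j) (H i v)) = 0"
    by (simp only: q_bracket[OF H_sp])
  then show ?thesis
    using sp_lin[OF H_sp[of i]] by (simp add: H_q[of j] fun_eq_iff lin_neg vs_zero_left[OF vs_d])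
qed

lemma h0_H_comm: "i \<in> J \<Longrightarrow> (\<lambda>v. h0 (H i v) - H i (h0 v)) = (\<lambda>v. ds 0 (H i v))"
proof -
  assume i: "i \<in> J"
  have "H j (H i v) = H i (H j v)" if "j \<in> J" for j v
    using fun_cong[OF H_comm[OF that i], of v] by (simp add: vs_zero_left[OF vs_d])
  then show ?thesis
    by (simp add: h0_def lin_sum[OF sp_lin[OF H_sp]] lin_scale[OF sp_lin[OF H_sp]] vs_zero_left[OF vs_d])
qed

text \<open>On the largest eigenvalue of \<open>T h0\<close> in \<open>c + \<nat>\<close> the
  positive root vectors must vanish, as they would raise it; the commuting elements
  \<open>H i\<close> preserve this eigenspace and have a common eigenvector in it. \<open>T\<close>
  will be the action on \<open>U\<close> and the action on maps from \<open>d\<close> to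
  \<open>U\<close>.\<close>

lemma highest_weight_vector:
  assumes s: "vector_space s" and X: "module.subspace s X" "X \<subseteq> module.span s B" "finite B" and u0: "u0 \<in> X" "u0 \<noteq> 0"
    and T: "\<And>A. A \<in> parab \<Longrightarrow> lin s s (T A)" and st: "\<And>A x. A \<in> parab \<Longrightarrow> x \<in> X \<Longrightarrow> T A x \<in> X"
    and sc: "\<And>A c x. A \<in> parab \<Longrightarrow> x \<in> X \<Longrightarrow> T (\<lambda>v. ds c (A v)) x = s c (T A x)"
    and br: "\<And>A A' x. A \<in> parab \<Longrightarrow> A' \<in> parab \<Longrightarrow> x \<in> X \<Longrightarrow> T (\<lambda>v. A (A' v) - A' (A v)) x = T A (T A' x) - T A' (T A x)"
  shows "\<exists>u\<in>X. u \<noteq> 0 \<and> (\<forall>i\<in>J. \<exists>c. T (H i) u = s c u) \<and> (\<forall>x z. (x, z) \<in> pos \<longrightarrow> T (q x z) u = 0)"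
proof -
  interpret vector_space s by (rule s)
  note T0 = T[OF h0_parab]
  obtain c v where v: "v \<in> X" "v \<noteq> 0" "T h0 v = s c v"
    using eigenvector_exists[OF T0 X(1,3,2) st[OF h0_parab] u0] by blast
  let ?M = "{m::nat. \<exists>v\<in>X. v \<noteq> 0 \<and> T h0 v = s (c + of_nat m) v}"
  \<comment> \<open>In characteristic 0 the eigenvalues are distinct, and a finitely generated span
    has room for finitely many.\<close>
  have "finite ?M"
  proof (rule ccontr)
    assume "infinite ?M"
    then obtain F where F: "F \<subseteq> ?M" "finite F" "card F = Suc (card B)" by (meson infinite_arbitrarily_large)
    let ?A = "(\<lambda>m. c + of_nat m) ` F"
    have "\<forall>\<alpha>\<in>?A. \<exists>v. v \<in> X \<and> v \<noteq> 0 \<and> T h0 v = s \<alpha> v" using F(1) by auto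
    then obtain x where "\<forall>\<alpha>\<in>?A. x \<alpha> \<in> X \<and> x \<alpha> \<noteq> 0 \<and> T h0 (x \<alpha>) = s \<alpha> (x \<alpha>)" by metis
    then have "card ?A \<le> card B" using X(2) by (intro eigenvalues_card[OF T0 X(3), of ?A x]) (use F in auto)
    moreover have "card ?A = card F" by (rule card_image) (auto simp: inj_on_def)
    ultimately show False using F by simp
  qed
  note fM = this
  have "0 \<in> ?M" using v by auto
  then have M: "Max ?M \<in> ?M" using Max_in[OF fM] by blast
  define \<alpha> where "\<alpha> = c + of_nat (Max ?M)"
  obtain v1 where v1: "v1 \<in> X" "v1 \<noteq> 0" "T h0 v1 = s \<alpha> v1" using M unfolding \<alpha>_def by blast
  let ?X = "{x \<in> X. T h0 x = s \<alpha> x}"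
  have sX: "subspace ?X"
    by (rule subspaceI)
      (auto simp: lin_add[OF T0] lin_scale[OF T0] lin_zero[OF T0] scale_right_distrib mult.commute
        intro: subspace_0[OF X(1)] subspace_add[OF X(1)] subspace_scale[OF X(1)])
  have kill: "T (q x z) u = 0" if xz: "(x, z) \<in> pos" and u: "u \<in> ?X" for x z u
  proof (rule ccontr)
    assume n: "T (q x z) u \<noteq> 0"
    obtain k :: nat where k: "1 \<le> k" "(\<lambda>v. h0 (q x z v) - q x z (h0 v)) = (\<lambda>v. ds (of_nat k) (q x z v))"
      using pos_weight[OF xz] by blast
    have "T h0 (T (q x z) u) = T (q x z) (T h0 u) + s (of_nat k) (T (q x z) u)"
      using br[OF h0_parab pos_parab[OF xz], of u] sc[OF pos_parab[OF xz], of u "of_nat k"] u by (simp add: k(2))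
    also have "\<dots> = s (\<alpha> + of_nat k) (T (q x z) u)"
      using u by (simp add: lin_scale[OF T[OF pos_parab[OF xz]]] scale_left_distrib)
    finally have "T h0 (T (q x z) u) = s (c + of_nat (Max ?M + k)) (T (q x z) u)" by (simp add: \<alpha>_def add.assoc)
    then have "Max ?M + k \<in> ?M" using n st[OF pos_parab[OF xz]] u by blast
    from Max_ge[OF fM this] show False using k(1) by simp
  qed
  have "\<exists>u\<in>?X. u \<noteq> 0 \<and> (\<forall>i\<in>J. \<exists>c. T (H i) u = s c u)"
  proof (rule common_eigenvector[OF s T[OF H_parab] X(3) finite_atLeastAtMost sX, where u = v1])
    show "?X \<subseteq> span B" using X(2) by auto
    fix i assume i: "i \<in> J"
    {
      fix x assume x: "x \<in> ?X"
      then have "T h0 (T (H i) x) = T (H i) (T h0 x)"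
        using br[OF h0_parab H_parab[OF i], of x] sc[OF H_parab[OF i], of x 0] by (simp add: h0_H_comm[OF i])
      then show "T (H i) x \<in> ?X" using x st[OF H_parab[OF i]] lin_scale[OF T[OF H_parab[OF i]]] by auto
    }
    fix j x assume j: "j \<in> J" and x: "x \<in> ?X"
    then show "T (H i) (T (H j) x) = T (H j) (T (H i) x)"
      using br[OF H_parab[OF i] H_parab[OF j], of x] sc[OF H_parab[OF j], of x 0] by (simp add: H_comm[OF i j])
  qed (use v1 in auto)
  then show ?thesis using kill by blast
qed

end

section \<open>Weights of highest weight vectors and recognition of fundamental and trivial
  modules\<close>

section \<open>Irreducible modules of the symplectic Lie algebra\<close>

locale sp_module_basis = sympl_basis S a b + sp_module S s \<rho>
  for S :: "('k::{alg_closed_field, field_char_0}, 'd::ab_group_add) symplectic"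
    and a b :: "nat \<Rightarrow> 'd" and s :: "'k \<Rightarrow> 'u::ab_group_add \<Rightarrow> 'u" and \<rho>
begin

text \<open>Each \<open>A\<close> is half the sum of
  \<open>q (a i) (A (b i)) - q (b i) (A (a i))\<close>, because its matrix entries appear once
  through \<open>A\<close> and once through its negative adjoint.\<close>

lemma rho_expand:
  assumes A: "A \<in> sp S"
  shows "\<rho> A u = s (1 / 2) (\<Sum>i\<in>J. \<rho> (q (a i) (A (b i))) u - \<rho> (q (b i) (A (a i))) u)"
proof -
  let ?B = "\<Sum>i\<in>J. (q (a i) (A (b i)) - q (b i) (A (a i)))"
  have sB: "?B \<in> sp S" by (intro sp_sum sp_diff q_sp)
  have ev: "(\<Sum>i\<in>X. (q (a i) (A (b i)) - q (b i) (A (a i)))) v = (\<Sum>i\<in>X. q (a i) (A (b i)) v - q (b i) (A (a i)) v)" for X v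
    by (induction X rule: infinite_finite_induct) auto
  have "?B v = A v + A v" for v
  proof -
    have "q (a i) (A (b i)) v - q (b i) (A (a i)) v =
       A (ds (\<omega> v (b i)) (a i) - ds (\<omega> v (a i)) (b i)) + (ds (\<omega> (A v) (b i)) (a i) - ds (\<omega> (A v) (a i)) (b i))" for i
    proof -
      have e: "\<omega> (A x) v = \<omega> (A v) x" for x using sp_om[OF A, of x v] om_anti[of x "A v"] by simp
      show ?thesis
        by (simp add: q_def lin_diff[OF sp_lin[OF A]] lin_scale[OF sp_lin[OF A]] e[of "a i"] e[of "b i"]
            om_anti[of "a i" v] om_anti[of "b i" v] vs_minus_left[OF vs_d] algebra_simps)
    qed
    then have "?B v = A (sproj N a b v) + sproj N a b (A v)"
      unfolding ev sproj_def lin_sum[OF sp_lin[OF A]] by (simp add: sum.distrib)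
    then show ?thesis by (simp add: sbasis_expand[OF sb])
  qed
  then have "A = (\<lambda>v. ds (1 / 2) (?B v))"
    by (simp add: fun_eq_iff vs_add[OF vs_d] vs_add_left[OF vs_d, symmetric] vs_one[OF vs_d])
  then have "\<rho> A u = s (1 / 2) (\<rho> ?B u)" using rho_scale[OF sB, of "1 / 2" u] by simp
  also have "\<rho> ?B u = (\<Sum>i\<in>J. \<rho> (q (a i) (A (b i))) u - \<rho> (q (b i) (A (a i))) u)"
    by (subst rho_sum) (auto intro!: sp_diff q_sp simp: rho_diff q_sp)
  finally show ?thesis .
qed

definition hw :: "(nat \<Rightarrow> 'k) \<Rightarrow> 'u \<Rightarrow> bool" where
  "hw l u \<longleftrightarrow> u \<noteq> 0 \<and> (\<forall>i\<in>J. \<rho> (H i) u = s (l i) u) \<and> (\<forall>x z. (x, z) \<in> pos \<longrightarrow> \<rho> (q x z) u = 0)"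

lemma rho_q_span:
  assumes "\<And>w. w \<in> W \<Longrightarrow> \<rho> (q x w) u = 0" "z \<in> module.span ds W" shows "\<rho> (q x z) u = 0"
  by (rule lin_eq_on_span[OF bilin_r[OF rho_q_bilin] lin_const0[OF vs_d vs_s] assms])

text \<open>For strictly upper triangular \<open>A\<close> the expansion \<open>rho_expand\<close>
  contains only positive root vectors. This links \<open>hw\<close> to the definition of fundamental
  representations.\<close>

lemma hw_sp_pos:
  assumes u: "hw l u" and A: "A \<in> sp_pos S a b" shows "\<rho> A u = 0"
proof -
  have As: "A \<in> sp S" using A by (simp add: sp_pos_def)
  have p: "\<rho> (q x z) u = 0" if "(x, z) \<in> pos" for x z using u that by (auto simp: hw_def)
  have "\<rho> (q (a i) (A (b i))) u = 0" if i: "i \<in> J" for i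
  proof (rule rho_q_span)
    show "A (b i) \<in> module.span ds (a ` J \<union> b ` {i<..N})" using A i by (simp add: sp_pos_def)
    show "\<rho> (q (a i) w) u = 0" if "w \<in> a ` J \<union> b ` {i<..N}" for w
      using that
    proof (elim UnE imageE)
      fix j assume "w = b j" "j \<in> {i<..N}"
      then show ?thesis using i posI(2)[OF i, of j] by (auto intro: p)
    qed (use posI(1)[OF i] p in auto)
  qed
  moreover have "\<rho> (q (b i) (A (a i))) u = 0" if i: "i \<in> J" for i
  proof (rule rho_q_span)
    show "A (a i) \<in> module.span ds (a ` {1..<i})" using A i by (simp add: sp_pos_def)
    show "\<rho> (q (b i) w) u = 0" if "w \<in> a ` {1..<i}" for w
      using that
    proof (elim imageE)
      fix j assume "w = a j" "j \<in> {1..<i}"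
      then show ?thesis using i p[OF posI(2)[of j i]] by (simp add: q_sym[of "b i" "a j"])
    qed
  qed
  ultimately show ?thesis by (simp add: rho_expand[OF As] vs_zero[OF vs_s])
qed

text \<open>Of the vanishing of a power of \<open>F\<close> on \<open>u\<close> only the case
  \<open>k = 0\<close> is kept; it is what recognises the trivial module.\<close>

lemma sl2_rho:
  assumes fd: "finite_dim s" and sp: "A \<in> sp S" "F \<in> sp S" "D \<in> sp S"
    and AF: "(\<lambda>v. A (F v) - F (A v)) = D" and DF: "(\<lambda>v. D (F v) - F (D v)) = (\<lambda>v. ds (- 2) (F v))"
    and u: "\<rho> A u = 0" "\<rho> D u = s c u" "u \<noteq> 0"
  shows "\<exists>k::nat. c = of_nat k \<and> (k = 0 \<longrightarrow> \<rho> F u = 0)"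
proof -
  obtain B where B: "finite B" "module.span s B = UNIV" using fd by (auto simp: finite_dim_def)
  have "\<exists>k::nat. c = of_nat k \<and> (\<rho> F ^^ Suc k) u = 0"
  proof (rule sl2_highest_weight[OF rho_lin[OF sp(1)] rho_lin[OF sp(2)] rho_lin[OF sp(3)] B _ _ u])
    show "\<rho> D (\<rho> F w) = \<rho> F (\<rho> D w) - s 2 (\<rho> F w)" for w
      using rho_br[OF sp(3,2), of w] rho_scale[OF sp(2), of "- 2" w] unfolding DF
      by (simp add: vs_minus_left[OF vs_s] algebra_simps)
    show "\<rho> A (\<rho> F w) = \<rho> F (\<rho> A w) + \<rho> D w" for w
      using rho_br[OF sp(1,2), of w] unfolding AF by (simp add: algebra_simps)
  qed
  then show ?thesis by auto
qed

text \<open>The \<open>sl2\<close>-triple of the root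
  \<open>\<epsilon>\<^sub>i - \<epsilon>\<^sub>j\<close>.\<close>

lemma roots_ab:
  assumes fd: "finite_dim s" and u: "hw l u" and ij: "i \<in> J" "j \<in> J" "i < j"
  shows "\<exists>k::nat. l i - l j = of_nat k \<and> (k = 0 \<longrightarrow> \<rho> (q (a j) (b i)) u = 0)"
proof (rule sl2_rho[OF fd q_sp[of "a i" "b j"] q_sp sp_diff[OF H_sp[of i] H_sp[of j]]])
  show "(\<lambda>v. q (a i) (b j) (q (a j) (b i) v) - q (a j) (b i) (q (a i) (b j) v)) = H i - H j"
    using ij by (simp add: q_bracket[OF q_sp] q_values q_neg H_q fun_eq_iff vs_minus_left[OF vs_d] vs_one[OF vs_d])
  have "(H i - H j) (a j) = - a j" "(H i - H j) (b i) = - b i" using ij by (simp_all add: H_values)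
  then show "(\<lambda>v. (H i - H j) (q (a j) (b i) v) - q (a j) (b i) ((H i - H j) v)) = (\<lambda>v. ds (- 2) (q (a j) (b i) v))"
    using vs_add_left[OF vs_d, of "- 1" "- 1"]
    by (simp only: q_bracket[OF sp_diff[OF H_sp H_sp]] q_neg) (simp add: fun_eq_iff)
  show "\<rho> (q (a i) (b j)) u = 0" using u posI(2)[OF ij] by (simp add: hw_def)
  show "\<rho> (H i - H j) u = s (l i - l j) u"
    using u ij by (simp add: rho_diff H_sp hw_def vs_diff_left[OF vs_s])
qed (use u in \<open>simp add: hw_def\<close>)

text \<open>The \<open>sl2\<close>-triple of the root
  \<open>\<epsilon>\<^sub>i + \<epsilon>\<^sub>j\<close>; the sign of \<open>F\<close> comes from
  \<open>H i = - q (a i) (b i)\<close>.\<close>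

lemma roots_aa:
  assumes fd: "finite_dim s" and u: "hw l u" and ij: "i \<in> J" "j \<in> J" "i \<noteq> j"
  shows "\<exists>k::nat. l i + l j = of_nat k \<and> (k = 0 \<longrightarrow> \<rho> (- q (b j) (b i)) u = 0)"
proof (rule sl2_rho[OF fd q_sp[of "a i" "a j"] sp_uminus[OF q_sp] sp_add[OF H_sp[of i] H_sp[of j]]])
  have "q (a i) (a j) (b j) = a i" "q (a i) (a j) (b i) = a j" using ij by (auto simp: q_values)
  then have "(\<lambda>v. q (a i) (a j) (q (b j) (b i) v) - q (b j) (b i) (q (a i) (a j) v)) = - (H i + H j)"
    using ij by (simp add: q_bracket[OF q_sp] H_q q_sym[of "b j" "a j"])
  from fun_cong[OF this] have "q (a i) (a j) (q (b j) (b i) v) - q (b j) (b i) (q (a i) (a j) v) = - (H i + H j) v" for v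
    by (simp only: fun_Compl_def)
  then have "- (q (a i) (a j) (q (b j) (b i) v) - q (b j) (b i) (q (a i) (a j) v)) = (H i + H j) v" for v
    by (simp only: minus_minus)
  then show "(\<lambda>v. q (a i) (a j) ((- q (b j) (b i)) v) - (- q (b j) (b i)) (q (a i) (a j) v)) = H i + H j"
    by (simp add: fun_eq_iff lin_neg[OF q_lin])
  have "(H i + H j) (b j) = - b j" "(H i + H j) (b i) = - b i" using ij by (simp_all add: H_values)
  then have "(\<lambda>v. (H i + H j) (q (b j) (b i) v) - q (b j) (b i) ((H i + H j) v)) = (\<lambda>v. ds (- 2) (q (b j) (b i) v))"
    using vs_add_left[OF vs_d, of "- 1" "- 1"]
    by (simp only: q_bracket[OF sp_add[OF H_sp H_sp]] q_neg) (simp add: fun_eq_iff)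
  then have "(H i + H j) (q (b j) (b i) v) - q (b j) (b i) ((H i + H j) v) = ds (- 2) (q (b j) (b i) v)" for v
    by (rule fun_cong)
  then have "- ((H i + H j) (q (b j) (b i) v) - q (b j) (b i) ((H i + H j) v)) = ds (- 2) (- q (b j) (b i) v)" for v
    by (simp only: vs_minus[OF vs_d])
  then show "(\<lambda>v. (H i + H j) ((- q (b j) (b i)) v) - (- q (b j) (b i)) ((H i + H j) v)) = (\<lambda>v. ds (- 2) ((- q (b j) (b i)) v))"
    by (simp only: fun_Compl_def lin_neg[OF sp_lin[OF sp_add[OF H_sp H_sp]]] minus_diff_minus)
  show "\<rho> (q (a i) (a j)) u = 0" using u posI(1)[OF ij(1,2)] by (simp add: hw_def)
  show "\<rho> (H i + H j) u = s (l i + l j) u"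
    using u ij by (simp add: rho_add H_sp hw_def vs_add_left[OF vs_s])
qed (use u in \<open>simp add: hw_def\<close>)

text \<open>The \<open>sl2\<close>-triple of \<open>2 \<epsilon>\<^sub>i\<close>. The bracket of
  \<open>q (a i) (a i)\<close> and \<open>q (b i) (b i)\<close> is
  \<open>4 q (a i) (b i) = - 4 H i\<close>, whence the factor \<open>- 1 / 4\<close>.\<close>

lemma roots_long:
  assumes fd: "finite_dim s" and u: "hw l u" and i: "i \<in> J"
  shows "\<exists>k::nat. l i = of_nat k \<and> (k = 0 \<longrightarrow> \<rho> (\<lambda>v. ds (- 1 / 4) (q (b i) (b i) v)) u = 0)"
proof (rule sl2_rho[OF fd q_sp[of "a i" "a i"] sp_scale[OF q_sp] H_sp[of i]])
  have "q (a i) (a i) (b i) = a i + a i" using i by (simp add: q_values)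
  then have "(\<lambda>v. q (a i) (a i) (q (b i) (b i) v) - q (b i) (b i) (q (a i) (a i) v)) =
      q (a i) (b i) + q (a i) (b i) + (q (a i) (b i) + q (a i) (b i))"
    by (simp add: q_bracket[OF q_sp] q_add q_sym[of "b i" "a i"])
  from fun_cong[OF this] have e4: "q (a i) (a i) (q (b i) (b i) v) - q (b i) (b i) (q (a i) (a i) v) =
      q (a i) (b i) v + q (a i) (b i) v + (q (a i) (b i) v + q (a i) (b i) v)" for v
    by simp
  have "ds (1 + 1 + (1 + 1)) w = w + w + (w + w)" for w
    by (simp only: vs_add_left[OF vs_d] vs_one[OF vs_d])
  then have e: "q (a i) (a i) (q (b i) (b i) v) - q (b i) (b i) (q (a i) (a i) v) = ds (- 4) (H i v)" for v
    unfolding e4 by (simp add: H_q vs_minus_left[OF vs_d] vs_minus[OF vs_d])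
  have "ds (- 1 / 4) (q (a i) (a i) (q (b i) (b i) v) - q (b i) (b i) (q (a i) (a i) v)) = H i v" for v
    unfolding e by (simp add: vs_mult[OF vs_d] vs_one[OF vs_d])
  then show "(\<lambda>v. q (a i) (a i) (ds (- 1 / 4) (q (b i) (b i) v)) - ds (- 1 / 4) (q (b i) (b i) (q (a i) (a i) v))) = H i"
    by (simp only: lin_scale[OF q_lin] vs_diff[OF vs_d, symmetric])
  have "H i (b i) = - b i" using i by (simp add: H_values)
  then have "(\<lambda>v. H i (q (b i) (b i) v) - q (b i) (b i) (H i v)) = (\<lambda>v. ds (- 2) (q (b i) (b i) v))"
    using vs_add_left[OF vs_d, of "- 1" "- 1"]
    by (simp only: q_bracket[OF H_sp] q_neg) (simp add: fun_eq_iff)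
  then have "H i (q (b i) (b i) v) - q (b i) (b i) (H i v) = ds (- 2) (q (b i) (b i) v)" for v by (rule fun_cong)
  then have "ds (- 1 / 4) (H i (q (b i) (b i) v) - q (b i) (b i) (H i v)) = ds (- 2) (ds (- 1 / 4) (q (b i) (b i) v))" for v
    by (simp add: vs_mult[OF vs_d])
  then show "(\<lambda>v. H i (ds (- 1 / 4) (q (b i) (b i) v)) - ds (- 1 / 4) (q (b i) (b i) (H i v))) = (\<lambda>v. ds (- 2) (ds (- 1 / 4) (q (b i) (b i) v)))"
    by (simp only: lin_scale[OF sp_lin[OF H_sp]] vs_diff[OF vs_d, symmetric])
  show "\<rho> (q (a i) (a i)) u = 0" "\<rho> (H i) u = s (l i) u" using u i posI(1)[OF i i] by (simp_all add: hw_def)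
qed (use u in \<open>simp add: hw_def\<close>)

end

context sp_module_basis
begin

lemma hw_weights:
  assumes fd: "finite_dim s" and u: "hw l u"
  shows "\<exists>L :: nat \<Rightarrow> nat. (\<forall>i\<in>J. l i = of_nat (L i)) \<and> (\<forall>i\<in>J. \<forall>j\<in>J. i < j \<longrightarrow> L j \<le> L i)"
proof -
  obtain L :: "nat \<Rightarrow> nat" where L: "\<forall>i\<in>J. l i = of_nat (L i)"
    using roots_long[OF fd u] by metis
  have "L j \<le> L i" if ij: "i \<in> J" "j \<in> J" "i < j" for i j
  proof -
    obtain k :: nat where "l i - l j = of_nat k" using roots_ab[OF fd u ij] by blast
    then have "of_nat (L i) = (of_nat (L j + k) :: 'k)" using L ij by (simp add: diff_eq_eq add.commute)
    then have "L i = L j + k" by (simp only: of_nat_eq_iff)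
    then show ?thesis by simp
  qed
  then show ?thesis using L by blast
qed

text \<open>A decreasing sequence of naturals starting with 1 is a block of ones followed by zeros;
  \<open>n\<close> is the length of the block, and the coroots measure consecutive
  differences.\<close>

lemma fundamental_of_weight:
  assumes irr: "irreducible_lie_module (lie_sp S) s \<rho>" and fd: "finite_dim s" and u: "hw l u" and l1: "l 1 = 1"
  shows "\<exists>n\<in>J. fundamental_representation S n s \<rho>"
proof -
  obtain L :: "nat \<Rightarrow> nat" where L: "\<And>i. i \<in> J \<Longrightarrow> l i = of_nat (L i)" "\<And>i j. i \<in> J \<Longrightarrow> j \<in> J \<Longrightarrow> i < j \<Longrightarrow> L j \<le> L i"
    using hw_weights[OF fd u] by blast
  have "of_nat (L 1) = (of_nat 1 :: 'k)" using L(1)[OF J1] l1 by simp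
  then have L1: "L 1 = 1" by (simp only: of_nat_eq_iff)
  let ?M = "{i \<in> J. L i = 1}"
  define n where "n = Max ?M"
  have "n \<in> ?M" unfolding n_def by (rule Max_in) (use J1 L1 in auto)
  then have n: "n \<in> J" "L n = 1" by auto
  have Lj: "L j = (if j \<le> n then 1 else 0)" if j: "j \<in> J" for j
  proof -
    have le: "L j \<le> 1" using L(2)[OF J1 j] L1 j by (cases "j = 1") auto
    show ?thesis
    proof (cases "j \<le> n")
      case True
      then have "1 \<le> L j" using L(2)[OF j n(1)] n(2) by (cases "j = n") auto
      then show ?thesis using le True by simp
    next
      case False
      then have "j \<notin> ?M" using Max_ge[of ?M j] n_def by auto
      then show ?thesis using le j False by auto
    qed
  qed
  have "\<rho> (simple_coroot S a b j) u = (if j = n then u else 0)" if j: "j \<in> J" for j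
  proof (cases "j < N")
    case True
    then have j': "Suc j \<in> J" by simp
    have "\<rho> (simple_coroot S a b j) u = s (l j - l (Suc j)) u"
      using True u j j' by (simp add: simple_coroot_def rho_diff H_sp hw_def vs_diff_left[OF vs_s])
    then show ?thesis using Lj[OF j] Lj[OF j'] L(1)[OF j] L(1)[OF j'] by (auto simp: vs_one[OF vs_s] vs_zero_left[OF vs_s])
  next
    case False
    then have "j = N" using j by simp
    then show ?thesis using u j Lj[OF j] L(1)[OF j] n(1)
      by (auto simp: simple_coroot_def hw_def vs_one[OF vs_s] vs_zero_left[OF vs_s])
  qed
  then have "fundamental_representation S n s \<rho>"
    unfolding fundamental_representation_def
    using irr fd u hw_sp_pos[OF u] sb
    by (intro conjI exI[of _ a] exI[of _ b] exI[of _ u]) (auto simp: symplectic_basis_def sbasis_def hw_def)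
  then show ?thesis using n by blast
qed

text \<open>All weights are then zero, and the case \<open>k = 0\<close> of the three kinds of
  \<open>sl2\<close>-triples shows that negative root vectors kill \<open>u\<close> too. So
  \<open>u\<close> spans a submodule on which \<open>sp d\<close> acts by zero.\<close>

lemma trivial_of_weight:
  assumes irr: "irreducible_lie_module (lie_sp S) s \<rho>" and fd: "finite_dim s" and u: "hw l u" and l1: "l 1 = 0"
  shows "trivial_lie_module (lie_sp S) \<rho>"
proof -
  interpret D: vector_space ds by (rule vs_d)
  interpret U: vector_space s by (rule vs_s)
  obtain L :: "nat \<Rightarrow> nat" where L: "\<And>i. i \<in> J \<Longrightarrow> l i = of_nat (L i)" "\<And>i j. i \<in> J \<Longrightarrow> j \<in> J \<Longrightarrow> i < j \<Longrightarrow> L j \<le> L i"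
    using hw_weights[OF fd u] by blast
  have L1: "L 1 = 0" using L(1)[OF J1] l1 by simp
  have l0: "l j = 0" if j: "j \<in> J" for j
    using L(2)[OF J1 j] L(1)[OF j] L1 j by (cases "j = 1") auto
  have pos0: "\<rho> (q x z) u = 0" if "(x, z) \<in> pos" for x z using u that by (simp add: hw_def)
  have aa: "\<rho> (q (a i) (a j)) u = 0" if "i \<in> J" "j \<in> J" for i j by (rule pos0[OF posI(1)[OF that]])
  have ab: "\<rho> (q (a i) (b j)) u = 0" if ij: "i \<in> J" "j \<in> J" for i j
  proof (cases i j rule: linorder_cases)
    case less then show ?thesis by (rule pos0[OF posI(2)[OF ij]])
  next
    case equal
    have "\<rho> (H i) u = 0" using u ij l0[OF ij(1)] by (simp add: hw_def vs_zero_left[OF vs_s])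
    then show ?thesis using rho_uminus[OF q_sp, of "a i" "b i" u] equal by (simp add: H_q)
  next
    case greater
    then show ?thesis using roots_ab[OF fd u ij(2,1)] l0[OF ij(1)] l0[OF ij(2)] by auto
  qed
  have bb: "\<rho> (q (b i) (b j)) u = 0" if ij: "i \<in> J" "j \<in> J" for i j
  proof (cases "i = j")
    case True
    have "\<rho> (\<lambda>v. ds (- 1 / 4) (q (b i) (b i) v)) u = 0"
      using roots_long[OF fd u ij(1)] l0[OF ij(1)] by auto
    then show ?thesis using rho_scale[OF q_sp, of "- 1 / 4" "b i" "b i" u] True by simp
  next
    case False
    then have "\<rho> (- q (b i) (b j)) u = 0"
      using roots_aa[OF fd u ij(2,1)] l0[OF ij(1)] l0[OF ij(2)] by auto
    then show ?thesis using rho_uminus[OF q_sp, of "b i" "b j" u] by simp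
  qed
  let ?W = "a ` J \<union> b ` J"
  have "sproj N a b z \<in> D.span ?W" for z
    unfolding sproj_def by (intro D.span_sum D.span_diff D.span_scale D.span_base) auto
  then have sp: "z \<in> D.span ?W" for z by (simp only: sbasis_expand[OF sb])
  have "\<rho> (q (a i) z) u = 0" "\<rho> (q (b i) z) u = 0" if i: "i \<in> J" for i z
  proof -
    show "\<rho> (q (a i) z) u = 0"
      by (rule rho_q_span[OF _ sp]) (use aa[OF i] ab[OF i] in blast)
    have ba: "\<rho> (q (b i) (a j)) u = 0" if "j \<in> J" for j
      using ab[OF that i] by (simp add: q_sym[of "b i" "a j"])
    show "\<rho> (q (b i) z) u = 0"
      by (rule rho_q_span[OF _ sp]) (use ba bb[OF i] in blast)
  qed
  then have A0: "\<rho> A u = 0" if "A \<in> sp S" for A by (simp add: rho_expand[OF that] vs_zero[OF vs_s])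
  have z: "\<rho> A v = 0" if A: "A \<in> sp S" and v: "v \<in> U.span {u}" for A v
    by (rule lin_eq_on_span[OF rho_lin[OF A] lin_const0[OF vs_s vs_s] _ v]) (use A0[OF A] in simp)
  have "U.span {u} = {0} \<or> U.span {u} = UNIV"
    using irr z U.span_zero unfolding irreducible_lie_module_def by (simp add: lie_sp_def)
  moreover have "U.span {u} \<noteq> {0}" using u U.span_base[of u "{u}"] by (auto simp: hw_def)
  ultimately have "U.span {u} = UNIV" by blast
  then show ?thesis using z by (auto simp: trivial_lie_module_def lie_sp_def)
qed

end

section \<open>The two conditions coming from symbols, for irreducible \<open>U\<close>\<close>

locale sp_module_ac = sympl_ac S + sp_module S s \<rho>
  for S :: "('k::{alg_closed_field, field_char_0}, 'd::ab_group_add) symplectic"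
    and s :: "'k \<Rightarrow> 'u::ab_group_add \<Rightarrow> 'u" and \<rho> +
  assumes irr: "irreducible_lie_module (lie_sp S) s \<rho>" and fd: "finite_dim s"
begin

text \<open>The solutions \<open>r\<close> for fixed \<open>x\<close> form a
  \<open>parab\<close>-stable subspace. On a highest weight vector in it, \<open>z = b 1\<close>
  says that \<open>q (a 1) (b 1)\<close> acts by \<open>- 1\<close>, so the first weight is
  1.\<close>

lemma fundamental_if_stabilised:
  assumes x: "x \<noteq> 0" and u: "u \<noteq> 0" and eq: "\<And>z. \<rho> (q x z) u = s (\<omega> z x) u"
  shows "\<exists>n\<in>{1..half S}. fundamental_representation S n s \<rho>"
proof -
  obtain a b where ab: "sbasis (half S) a b" "a 1 = x" using sbasis_exists[OF x] by blast
  interpret sp_module_basis S a b s \<rho> by unfold_locales (rule ab)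
  interpret U: vector_space s by (rule vs_s)
  obtain B where B: "finite B" "U.span B = UNIV" using fd by (auto simp: finite_dim_def)
  let ?X = "{r. \<forall>z. \<rho> (q x z) r = s (\<omega> z x) r}"
  have sX: "U.subspace ?X"
    by (rule U.subspaceI)
      (auto simp: lin_add[OF rho_lin[OF q_sp]] lin_scale[OF rho_lin[OF q_sp]] lin_zero[OF rho_lin[OF q_sp]]
        U.scale_right_distrib mult.commute)
  have "\<exists>u\<in>?X. u \<noteq> 0 \<and> (\<forall>i\<in>J. \<exists>c. \<rho> (H i) u = s c u) \<and> (\<forall>x z. (x, z) \<in> pos \<longrightarrow> \<rho> (q x z) u = 0)"
  proof (rule highest_weight_vector[OF vs_s sX _ B(1), of u])
    fix A r assume "A \<in> parab" and r: "r \<in> ?X"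
    then obtain c where A: "A \<in> sp S" "A x = ds c x" using ab by (auto simp: parab_def)
    have "\<rho> (q x z) (\<rho> A r) = s (\<omega> z x) (\<rho> A r)" for z
    proof -
      have "\<rho> A (\<rho> (q x z) r) - \<rho> (q x z) (\<rho> A r) = \<rho> (q (A x) z + q x (A z)) r"
        using rho_br[OF A(1) q_sp, of x z r] by (simp only: q_bracket[OF A(1)])
      also have "\<dots> = s (c * \<omega> z x + \<omega> (A z) x) r"
        using r by (simp add: rho_add sp_scale[OF q_sp] q_sp A(2) q_scale rho_scale U.scale_left_distrib)
      \<comment> \<open>The two terms of the scalar cancel: \<open>A\<close> commutes with
        \<open>q x z\<close> on \<open>r\<close>.\<close>
      also have "\<omega> (A z) x = - (c * \<omega> z x)" by (simp add: sp_om[OF A(1)] A(2) om_simps)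
      finally show ?thesis using r by (simp add: lin_scale[OF rho_lin[OF A(1)]])
    qed
    then show "\<rho> A r \<in> ?X" by simp
  next
    show "\<rho> (\<lambda>v. ds c (A v)) r = s c (\<rho> A r)" if "A \<in> parab" for A c r
      by (rule rho_scale[OF parab_sp[OF that]])
    show "\<rho> (\<lambda>v. A (A' v) - A' (A v)) r = \<rho> A (\<rho> A' r) - \<rho> A' (\<rho> A r)" if "A \<in> parab" "A' \<in> parab" for A A' r
      by (rule rho_br[OF parab_sp[OF that(1)] parab_sp[OF that(2)]])
  qed (use u eq B in \<open>auto dest: parab_sp intro: rho_lin\<close>)
  then obtain u where u: "u \<in> ?X" "u \<noteq> 0" "\<forall>i\<in>J. \<exists>c. \<rho> (H i) u = s c u" "\<forall>x z. (x, z) \<in> pos \<longrightarrow> \<rho> (q x z) u = 0"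
    by blast
  from bchoice[OF u(3)] obtain l where l: "\<forall>i\<in>J. \<rho> (H i) u = s (l i) u" ..
  have hw: "hw l u" using u l by (simp add: hw_def)
  have "\<rho> (q (a 1) (b 1)) u = - u"
    using u(1) ab(2) sbD(4)[OF J1 J1] by (simp add: vs_minus_left[OF vs_s])
  then have "s (l 1) u = s 1 u" using bspec[OF l J1] rho_uminus[OF q_sp, of "a 1" "b 1" u] by (simp add: H_q)
  then have "l 1 = 1" using u(2) U.scale_cancel_right by blast
  from fundamental_of_weight[OF irr fd hw this] show ?thesis .
qed

text \<open>The polarised condition \<open>cyc\<close> cuts out an \<open>sp\<close>-stable space of
  linear maps from \<open>d\<close> to \<open>U\<close>. A highest weight vector \<open>w\<close> in
  it commutes with positive root vectors. At the first \<open>v\<close> among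
  \<open>a 1, ..., a N, b N, ..., b 1\<close> with \<open>w v\<close> nonzero, \<open>w v\<close> is
  a highest weight vector of \<open>U\<close>, and \<open>cyc\<close> at \<open>a 1, b 1, v\<close>
  computes its first weight: 1, or 0 for \<open>v = b 1\<close>.\<close>

lemma fundamental_or_trivial_if_linear:
  assumes P: "lin ds s P" "P x0 \<noteq> 0" and eq: "\<And>x z. \<rho> (q x x) (P z) + s 2 (\<rho> (q x z) (P x)) = 0"
  shows "(\<exists>n\<in>{1..half S}. fundamental_representation S n s \<rho>) \<or> trivial_lie_module (lie_sp S) \<rho>"
proof -
  have "x0 \<noteq> 0" using P lin_zero by blast
  then obtain a b where ab: "sbasis (half S) a b" using sbasis_exists by blast
  interpret sp_module_basis S a b s \<rho> by unfold_locales (rule ab)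
  interpret U: vector_space s by (rule vs_s)
  obtain B0 where B0: "finite B0" "U.span B0 = UNIV" using fd by (auto simp: finite_dim_def)
  define fs where "fs c w = (\<lambda>x :: 'd. s c (w x))" for c and w :: "'d \<Rightarrow> 'u"
  have vfs: "vector_space fs" unfolding fs_def[abs_def] by (rule vs_pointwise[OF vs_s])
  interpret F: vector_space fs by (rule vfs)
  define cyc where "cyc w x y z = \<rho> (q x y) (w z) + \<rho> (q y z) (w x) + \<rho> (q z x) (w y)" for w :: "'d \<Rightarrow> 'u" and x y z
  define X where "X = {w. lin ds s w \<and> (\<forall>x y z. cyc w x y z = 0)}"
  define T where "T A w = (\<lambda>x. \<rho> A (w x) - w (A x))" for A and w :: "'d \<Rightarrow> 'u"
  note rl = rho_lin[OF q_sp]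
  have two: "s 2 v = v + v" for v using vs_add_left[OF vs_s, of 1 1 v] by (simp add: vs_one[OF vs_s])
  have PX: "P \<in> X"
  proof -
    have "cyc P x y z = 0" for x y z
    proof -
      note b = bilin_simps(1,2)[OF rho_q_bilin]
      \<comment> \<open>Polarisation in the quadratic argument, from \<open>x + y\<close>,
        \<open>x\<close> and \<open>y\<close>.\<close>
      have "s 2 (cyc P x y z) = (\<rho> (q (x + y) (x + y)) (P z) + s 2 (\<rho> (q (x + y) z) (P (x + y))))
         - (\<rho> (q x x) (P z) + s 2 (\<rho> (q x z) (P x))) - (\<rho> (q y y) (P z) + s 2 (\<rho> (q y z) (P y)))"
        unfolding cyc_def
        by (simp add: b lin_add[OF P(1)] lin_add[OF rl] two q_sym[of y x] q_sym[of z x] algebra_simps)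
      then have "s 2 (cyc P x y z) = 0" by (simp only: eq) simp
      then show ?thesis by simp
    qed
    then show ?thesis using P(1) by (simp add: X_def)
  qed
  have sX: "F.subspace X"
  proof (rule F.subspaceI)
    show "0 \<in> X" using lin_const0[OF vs_d vs_s] by (simp add: X_def zero_fun_def cyc_def lin_zero[OF rl])
    show "w + w' \<in> X" if "w \<in> X" "w' \<in> X" for w w'
    proof -
      have "cyc (w + w') x y z = cyc w x y z + cyc w' x y z" for x y z
        by (simp add: cyc_def lin_add[OF rl] algebra_simps)
      then show ?thesis using that lin_plus[of ds s w w'] by (simp add: X_def plus_fun_def)
    qed
    show "fs c w \<in> X" if "w \<in> X" for c w
    proof -
      have "cyc (fs c w) x y z = s c (cyc w x y z)" for x y z
        by (simp add: cyc_def fs_def lin_scale[OF rl] U.scale_right_distrib)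
      then show ?thesis using that lin_smult[of ds s w c] by (simp add: X_def fs_def)
    qed
  qed
  \<comment> \<open>Coordinate forms times spanning vectors of \<open>U\<close>: finitely many
    generators for the linear maps inside the space of all functions.\<close>
  let ?B = "(\<lambda>(k, \<beta>) x. s (coord S k x) \<beta>) ` (I \<times> B0)"
  have XB: "X \<subseteq> F.span ?B"
  proof
    fix w assume "w \<in> X"
    then have w: "lin ds s w" by (simp add: X_def)
    have "(\<lambda>x. s (coord S k x) u) \<in> F.span ?B" if k: "k \<in> I" for k u
    proof (rule lin_in_subspace[OF _ F.subspace_span, of s "\<lambda>u x. s (coord S k x) u" B0])
      show "lin s fs (\<lambda>u x. s (coord S k x) u)"
        by (rule linI[OF vs_s vfs]) (simp_all add: fun_eq_iff fs_def U.scale_right_distrib mult.commute)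
      show "(\<lambda>x. s (coord S k x) \<beta>) \<in> F.span ?B" if "\<beta> \<in> B0" for \<beta>
        by (rule F.span_base) (use k that in force)
    qed (simp add: B0)
    then have "(\<Sum>k\<in>I. (\<lambda>x. s (coord S k x) (w (dd k)))) \<in> F.span ?B" by (rule F.span_sum)
    also have "(\<Sum>k\<in>K. (\<lambda>x. s (coord S k x) (w (dd k)))) = (\<lambda>x. \<Sum>k\<in>K. s (coord S k x) (w (dd k)))" for K
      by (induction K rule: infinite_finite_induct) (auto simp: fun_eq_iff)
    also have "(\<lambda>x. \<Sum>k\<in>I. s (coord S k x) (w (dd k))) = w"
      by (rule ext) (rule lin_coord[OF w, symmetric])
    finally show "w \<in> F.span ?B" .
  qed
  have "\<exists>w\<in>X. w \<noteq> 0 \<and> (\<forall>i\<in>J. \<exists>c. T (H i) w = fs c w) \<and> (\<forall>x z. (x, z) \<in> pos \<longrightarrow> T (q x z) w = 0)"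
  proof (rule highest_weight_vector[OF vfs sX XB, of P])
    show "finite ?B" using B0 by simp
    show "P \<noteq> 0" using P(2) by auto
    fix A assume "A \<in> parab"
    then have A: "A \<in> sp S" by (rule parab_sp)
    note Al = rho_lin[OF A] and Ad = sp_lin[OF A]
    show "lin fs fs (T A)"
      by (rule linI[OF vfs vfs]) (simp_all add: T_def fs_def fun_eq_iff lin_add[OF Al] lin_scale[OF Al] U.scale_right_diff_distrib)
    fix w assume "w \<in> X"
    then have w: "lin ds s w" and cw: "\<And>x y z. cyc w x y z = 0" by (auto simp: X_def)
    have "cyc (T A w) x y z = \<rho> A (cyc w x y z) - (cyc w (A x) y z + cyc w x (A y) z + cyc w x y (A z))" for x y z
    proof -
      have r: "\<rho> (q x y) (\<rho> A r) = \<rho> A (\<rho> (q x y) r) - \<rho> (q (A x) y) r - \<rho> (q x (A y)) r" for x y r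
        using rho_br[OF A q_sp, of x y r] by (simp add: q_bracket[OF A] rho_add q_sp algebra_simps)
      show ?thesis
        by (simp add: cyc_def T_def lin_diff[OF rl] r lin_add[OF Al])
    qed
    moreover have "lin ds s (T A w)"
      unfolding T_def by (intro lin_minus lin_comp[OF w Al] lin_comp[OF Ad w])
    ultimately show "T A w \<in> X" using cw by (simp add: X_def lin_zero[OF Al])
    show "T (\<lambda>v. ds c (A v)) w = fs c (T A w)" for c
      by (simp add: T_def fs_def fun_eq_iff rho_scale[OF A] lin_scale[OF w] U.scale_right_diff_distrib)
    fix A' assume "A' \<in> parab"
    then have A': "A' \<in> sp S" by (rule parab_sp)
    show "T (\<lambda>v. A (A' v) - A' (A v)) w = T A (T A' w) - T A' (T A w)"
      by (simp add: T_def fun_eq_iff rho_br[OF A A'] lin_diff[OF w] lin_diff[OF Al] lin_diff[OF rho_lin[OF A']])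
  qed (rule PX)
  then obtain w where w: "w \<in> X" "w \<noteq> 0" "\<forall>i\<in>J. \<exists>c. T (H i) w = fs c w" "\<And>x z. (x, z) \<in> pos \<Longrightarrow> T (q x z) w = 0"
    by blast
  from bchoice[OF w(3)] obtain c where c: "\<forall>i\<in>J. T (H i) w = fs (c i) w" ..
  have wl: "lin ds s w" and cw: "\<And>x y z. cyc w x y z = 0" using w(1) by (auto simp: X_def)
  have Hw: "\<rho> (H i) (w v) = s (c i) (w v) + w (H i v)" if "i \<in> J" for i v
    using fun_cong[OF bspec[OF c that], of v] by (simp add: T_def fs_def diff_eq_eq)
  have pw: "\<rho> (q x z) (w v) = w (q x z v)" if "(x, z) \<in> pos" for x z v
    using fun_cong[OF w(4)[OF that], of v] by (simp add: T_def)
  have w0: "w 0 = 0" by (rule lin_zero[OF wl])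
  \<comment> \<open>The assumptions on \<open>v\<close> make \<open>w v\<close> a highest weight
    vector, and \<open>t\<close> says that \<open>H 1\<close> has eigenvalue 1 or 0 on it.\<close>
  have concl: "?thesis" if v: "w v \<noteq> 0" and p: "\<And>x z. (x, z) \<in> pos \<Longrightarrow> w (q x z v) = 0"
    and h: "\<And>i. i \<in> J \<Longrightarrow> \<exists>e. H i v = ds e v" and t: "\<rho> (q (a 1) (b 1)) (w v) = - w v \<or> \<rho> (q (a 1) (b 1)) (w v) = 0" for v
  proof -
    have "\<forall>i\<in>J. \<exists>e. H i v = ds e v" using h by blast
    from bchoice[OF this] obtain e where e: "\<forall>i\<in>J. H i v = ds (e i) v" ..
    have hw: "hw (\<lambda>i. c i + e i) (w v)"
      unfolding hw_def using v p pw e by (simp add: Hw lin_scale[OF wl] U.scale_left_distrib)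
    have "\<rho> (H 1) (w v) = - \<rho> (q (a 1) (b 1)) (w v)" by (simp add: H_q rho_uminus q_sp)
    moreover have "\<rho> (H 1) (w v) = s (c 1 + e 1) (w v)" using hw J1 by (simp add: hw_def)
    ultimately have "s (c 1 + e 1) (w v) = s 1 (w v) \<or> s (c 1 + e 1) (w v) = 0" using t by auto
    then have "c 1 + e 1 = 1 \<or> c 1 + e 1 = 0" using v U.scale_cancel_right[of "c 1 + e 1" "w v" 1] by auto
    then show ?thesis
      using fundamental_of_weight[OF irr fd hw] trivial_of_weight[OF irr fd hw] by blast
  qed
  have Ha: "\<exists>e. H i (a j) = ds e (a j)" "\<exists>e. H i (b j) = ds e (b j)" if ij: "i \<in> J" "j \<in> J" for i j
    using vs_one[OF vs_d] vs_zero_left[OF vs_d] vs_minus_left[OF vs_d, of 1]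
    by (auto simp: H_values[OF ij] intro: exI[of _ 1] exI[of _ 0] exI[of _ "- 1"])
  have posE: "Q" if "(x, z) \<in> pos" "\<And>i j. i \<in> J \<Longrightarrow> j \<in> J \<Longrightarrow> x = a i \<Longrightarrow> z = a j \<Longrightarrow> Q"
    "\<And>i j. i \<in> J \<Longrightarrow> j \<in> J \<Longrightarrow> i < j \<Longrightarrow> x = a i \<Longrightarrow> z = b j \<Longrightarrow> Q" for x z Q
    using that unfolding pos_def by blast
  show ?thesis
  proof (cases "\<exists>i\<in>J. w (a i) \<noteq> 0")
    case True
    define i where "i = (LEAST i. i \<in> J \<and> w (a i) \<noteq> 0)"
    have i: "i \<in> J" "w (a i) \<noteq> 0" using LeastI_ex[of "\<lambda>i. i \<in> J \<and> w (a i) \<noteq> 0"] True unfolding i_def by blast+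
    have less: "w (a l) = 0" if "l \<in> J" "l < i" for l
      using not_less_Least[of l "\<lambda>i. i \<in> J \<and> w (a i) \<noteq> 0"] that unfolding i_def by blast
    show ?thesis
    proof (rule concl[OF i(2) _ Ha(1)[OF _ i(1)]])
      fix x z assume "(x, z) \<in> pos"
      then show "w (q x z (a i)) = 0"
        by (rule posE) (use i(1) less in \<open>auto simp: q_values w0 lin_neg[OF wl]\<close>)
    next
      have "\<rho> (q (a 1) (b 1)) (w (a i)) = - w (a i)"
      proof (cases "i = 1")
        case True
        have "w (q (a 1) (a 1) (b 1)) = w (a 1) + w (a 1)" by (simp only: q_values[OF J1 J1 J1] lin_add[OF wl]) simp
        moreover have "\<rho> (q (a 1) (a 1)) (w (b 1)) + \<rho> (q (a 1) (b 1)) (w (a 1)) + \<rho> (q (a 1) (b 1)) (w (a 1)) = 0"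
          using cw[of "a 1" "a 1" "b 1"] by (simp add: cyc_def q_sym[of "b 1" "a 1"] del: One_nat_def)
        ultimately have "s 2 (w (a 1) + \<rho> (q (a 1) (b 1)) (w (a 1))) = 0"
          using pw[OF posI(1)[OF J1 J1], of "b 1"] by (simp add: two algebra_simps del: One_nat_def)
        then show ?thesis using True by (simp add: eq_neg_iff_add_eq_0 add.commute)
      next
        case False
        then have "1 < i" using i(1) by simp
        then have "w (a 1) = 0" using less[OF J1] by simp
        moreover have "w (q (a i) (a 1) (b 1)) = w (a i)" using False by (simp add: q_values[OF i(1) J1 J1] del: One_nat_def)
        ultimately show ?thesis
          using cw[of "a 1" "b 1" "a i"] pw[OF posI(1)[OF i(1) J1], of "b 1"]
          by (simp add: cyc_def lin_zero[OF rl] eq_neg_iff_add_eq_0 del: One_nat_def)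
      qed
      then show "\<rho> (q (a 1) (b 1)) (w (a i)) = - w (a i) \<or> \<rho> (q (a 1) (b 1)) (w (a i)) = 0" by blast
    qed
  next
    case False
    then have a0: "w (a i) = 0" if "i \<in> J" for i using that by blast
    have "\<exists>i\<in>J. w (b i) \<noteq> 0"
    proof (rule ccontr)
      assume "\<not> ?thesis"
      then have "w (sproj N a b v) = 0" for v
        using a0 by (simp add: sproj_def lin_sum[OF wl] lin_diff[OF wl] lin_scale[OF wl])
      then show False using w(2) by (simp add: sbasis_expand[OF ab] fun_eq_iff)
    qed
    define M where "M = {i \<in> J. w (b i) \<noteq> 0}"
    have fM: "finite M" unfolding M_def by simp
    define i where "i = Max M"
    have "i \<in> M" unfolding i_def by (rule Max_in[OF fM]) (use \<open>\<exists>i\<in>J. w (b i) \<noteq> 0\<close> in \<open>auto simp: M_def\<close>)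
    then have i: "i \<in> J" "w (b i) \<noteq> 0" by (auto simp: M_def)
    have gr: "w (b l) = 0" if "l \<in> J" "i < l" for l
      using Max_ge[OF fM, of l] that unfolding i_def M_def by fastforce
    show ?thesis
    proof (rule concl[OF i(2) _ Ha(2)[OF _ i(1)]])
      fix x z assume "(x, z) \<in> pos"
      then show "w (q x z (b i)) = 0"
        by (rule posE) (use i(1) a0 gr in \<open>auto simp: q_values w0 lin_add[OF wl]\<close>)
    next
      show "\<rho> (q (a 1) (b 1)) (w (b i)) = - w (b i) \<or> \<rho> (q (a 1) (b 1)) (w (b i)) = 0"
      proof (cases "i = 1")
        \<comment> \<open>Only here does the weight become zero: \<open>cyc\<close> at
          \<open>b 1, b 1, a 1\<close> makes \<open>q (a 1) (b 1)\<close> kill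
          \<open>w (b 1)\<close>.\<close>
        case True
        have "\<rho> (q (b 1) (a 1)) (w (b 1)) + \<rho> (q (a 1) (b 1)) (w (b 1)) = 0"
          using cw[of "b 1" "b 1" "a 1"] a0[OF J1] by (simp add: cyc_def lin_zero[OF rl] del: One_nat_def)
        then have "s 2 (\<rho> (q (a 1) (b 1)) (w (b 1))) = 0" by (simp add: two q_sym[of "b 1" "a 1"] del: One_nat_def)
        then show ?thesis using True by simp
      next
        case False
        then have "1 < i" using i(1) by simp
        have "w (q (a 1) (b i) (b 1)) = w (b i)" using False by (simp add: q_values[OF J1 i(1) J1] del: One_nat_def)
        then show ?thesis
          using cw[of "a 1" "b 1" "b i"] pw[OF posI(2)[OF J1 i(1) \<open>1 < i\<close>], of "b 1"] a0[OF J1]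
          by (simp add: cyc_def lin_zero[OF rl] eq_neg_iff_add_eq_0 q_sym[of "b i" "a 1"] del: One_nat_def)
      qed
    qed
  qed
qed

end

section \<open>Contraction identities following from the cocycle condition\<close>

section \<open>Contractions with the inverse of the symplectic form\<close>

context sympl
begin

lemma lin_expand_dd: "lin ds s f \<Longrightarrow> f w = (\<Sum>k\<in>I. s (\<omega> (du' k) w) (f (dd k)))"
  by (subst expand_dd[of w, symmetric]) (simp only: lin_sum lin_scale)

lemma lin_expand_du: "lin ds s f \<Longrightarrow> f w = (\<Sum>k\<in>I. s (\<omega> w (dd k)) (f (du' k)))"
  by (subst expand_du[of w, symmetric]) (simp only: lin_sum lin_scale)

text \<open>Antisymmetry of the inverse matrix \<open>r\<close>, in basis free form.\<close>

lemma contract_anti: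
  assumes b: "bilin ds ds s \<beta>"
  shows "(\<Sum>k\<in>I. \<beta> (dd k) (du' k)) = - (\<Sum>k\<in>I. \<beta> (du' k) (dd k))"
proof -
  note s = lin_vs2[OF bilin_l[OF b]]
  have "(\<Sum>k\<in>I. \<beta> (dd k) (du' k)) = (\<Sum>k\<in>I. \<Sum>l\<in>I. s (\<omega> (du' l) (du' k)) (\<beta> (dd k) (dd l)))"
    by (rule sum.cong[OF refl]) (rule lin_expand_dd[OF bilin_r[OF b]])
  also have "\<dots> = (\<Sum>k\<in>I. \<Sum>l\<in>I. s (\<omega> (du' k) (du' l)) (\<beta> (dd l) (dd k)))"
    by (rule sum.swap)
  also have "\<dots> = (\<Sum>k\<in>I. \<Sum>l\<in>I. - s (\<omega> (du' l) (du' k)) (\<beta> (dd l) (dd k)))"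
    by (intro sum.cong refl) (subst om_anti, rule vs_minus_left[OF s])
  also have "\<dots> = - (\<Sum>k\<in>I. \<beta> (du' k) (dd k))"
    by (subst lin_expand_dd[OF bilin_l[OF b]]) (simp add: sum_negf)
  finally show ?thesis .
qed

text \<open>The vector that represents \<open>\<chi>\<close> through \<open>\<omega>\<close>
  (\<open>om_sv\<close>).\<close>

definition sv :: 'd where "sv = (\<Sum>k\<in>I. ds (\<chi> (du' k)) (dd k))"

lemma om_sv: "\<omega> w sv = \<chi> w"
  using lin_expand_du[OF chi_lin, of w] by (simp add: sv_def om_simps mult.commute)

lemma chi_sv: "\<chi> sv = 0"
  using om_sv[of sv] by simp

lemma lin_sv: "lin ds s f \<Longrightarrow> f sv = (\<Sum>k\<in>I. s (\<chi> (du' k)) (f (dd k)))"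
  unfolding sv_def by (simp add: lin_sum lin_scale)

text \<open>The left side is the adjoint action of \<open>x\<close> on the inverse of
  \<open>\<omega>\<close>. Everything is expanded in the values
  \<open>\<beta> (dd k) (dd l)\<close>; the coefficients agree by the cocycle condition, in the form
  \<open>c\<close>.\<close>

lemma contract_bracket:
  assumes b: "bilin ds ds s \<beta>"
  shows "(\<Sum>k\<in>I. \<beta> (dbrk x (dd k)) (du' k)) + (\<Sum>k\<in>I. \<beta> (dd k) (dbrk x (du' k))) =
     s (\<chi> x) (\<Sum>k\<in>I. \<beta> (dd k) (du' k)) + (\<Sum>k\<in>I. \<Sum>l\<in>I. s (\<omega> (dbrk (du' k) (du' l)) x) (\<beta> (dd k) (dd l)))
     - \<beta> sv x + \<beta> x sv"
proof -
  note s = lin_vs2[OF bilin_l[OF b]]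
  have "(\<Sum>k\<in>I. \<beta> (dbrk x (dd k)) (du' k)) = - (\<Sum>k\<in>I. \<beta> (dbrk x (du' k)) (dd k))"
    by (rule contract_anti, rule bilinI)
      (use lin_comp[OF bilin_r[OF br_bilin] bilin_l[OF b]] bilin_r[OF b] in auto)
  also have "(\<Sum>k\<in>I. \<beta> (dbrk x (du' k)) (dd k)) = (\<Sum>k\<in>I. \<Sum>l\<in>I. s (\<omega> (du' l) (dbrk x (du' k))) (\<beta> (dd l) (dd k)))"
    by (rule sum.cong[OF refl]) (rule lin_expand_dd[OF bilin_l[OF b]])
  also have "\<dots> = (\<Sum>k\<in>I. \<Sum>l\<in>I. s (\<omega> (du' k) (dbrk x (du' l))) (\<beta> (dd k) (dd l)))"
    by (rule sum.swap)
  finally have t1: "(\<Sum>k\<in>I. \<beta> (dbrk x (dd k)) (du' k)) =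
      - (\<Sum>k\<in>I. \<Sum>l\<in>I. s (\<omega> (du' k) (dbrk x (du' l))) (\<beta> (dd k) (dd l)))" .
  have t2: "(\<Sum>k\<in>I. \<beta> (dd k) (dbrk x (du' k))) = (\<Sum>k\<in>I. \<Sum>l\<in>I. s (\<omega> (du' l) (dbrk x (du' k))) (\<beta> (dd k) (dd l)))"
    by (rule sum.cong[OF refl]) (rule lin_expand_dd[OF bilin_r[OF b]])
  have "(\<Sum>k\<in>I. \<beta> (dd k) (du' k)) = (\<Sum>k\<in>I. \<Sum>l\<in>I. s (\<omega> (du' l) (du' k)) (\<beta> (dd k) (dd l)))"
    by (rule sum.cong[OF refl]) (rule lin_expand_dd[OF bilin_r[OF b]])
  then have t3: "s (\<chi> x) (\<Sum>k\<in>I. \<beta> (dd k) (du' k)) = (\<Sum>k\<in>I. \<Sum>l\<in>I. s (\<chi> x * \<omega> (du' l) (du' k)) (\<beta> (dd k) (dd l)))"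
    by (simp add: vs_sum[OF s] vs_mult[OF s])
  have "\<beta> sv x = (\<Sum>k\<in>I. s (\<chi> (du' k)) (\<beta> (dd k) x))" by (rule lin_sv[OF bilin_l[OF b]])
  also have "\<dots> = (\<Sum>k\<in>I. s (\<chi> (du' k)) (\<Sum>l\<in>I. s (\<omega> (du' l) x) (\<beta> (dd k) (dd l))))"
    by (intro sum.cong refl arg_cong[where f = "s _"] lin_expand_dd[OF bilin_r[OF b]])
  finally have t4: "\<beta> sv x = (\<Sum>k\<in>I. \<Sum>l\<in>I. s (\<chi> (du' k) * \<omega> (du' l) x) (\<beta> (dd k) (dd l)))"
    by (simp add: vs_sum[OF s] vs_mult[OF s])
  have "\<beta> x sv = (\<Sum>k\<in>I. s (\<omega> (du' k) x) (\<beta> (dd k) sv))" by (rule lin_expand_dd[OF bilin_l[OF b]])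
  also have "\<dots> = (\<Sum>k\<in>I. s (\<omega> (du' k) x) (\<Sum>l\<in>I. s (\<chi> (du' l)) (\<beta> (dd k) (dd l))))"
    by (intro sum.cong refl arg_cong[where f = "s _"] lin_sv[OF bilin_r[OF b]])
  finally have t5: "\<beta> x sv = (\<Sum>k\<in>I. \<Sum>l\<in>I. s (\<omega> (du' k) x * \<chi> (du' l)) (\<beta> (dd k) (dd l)))"
    by (simp add: vs_sum[OF s] vs_mult[OF s])
  have c: "\<omega> (du' l) (dbrk x (du' k)) - \<omega> (du' k) (dbrk x (du' l)) =
     \<chi> x * \<omega> (du' l) (du' k) + \<omega> (dbrk (du' k) (du' l)) x - \<chi> (du' k) * \<omega> (du' l) x + \<omega> (du' k) x * \<chi> (du' l)" for k l
    using om_cocycle[of "du' k" "du' l" x] om_anti[of x "du' k"] om_anti[of "du' k" "du' l"]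
      om_anti[of "dbrk x (du' k)" "du' l"] om_anti[of "dbrk x (du' l)" "du' k"] br_anti[of "du' l" x]
    by (simp add: om_simps algebra_simps)
  show ?thesis
    unfolding t1 t2 t3 t4 t5
    by (simp add: sum_subtractf[symmetric] sum.distrib[symmetric] vs_add_left[OF s, symmetric]
        vs_diff_left[OF s, symmetric] c[symmetric] del: sum_subtractf)
qed

text \<open>The trace of the commutator of \<open>ad x\<close> and \<open>ad z\<close>.\<close>

lemma trace_bracket: "(\<Sum>k\<in>I. \<omega> (du' k) (dbrk (dbrk x z) (dd k))) = 0"
proof -
  have tr: "(\<Sum>k\<in>I. \<omega> (du' k) (dbrk x (dbrk z (dd k)))) =
      (\<Sum>k\<in>I. \<Sum>l\<in>I. \<omega> (du' l) (dbrk z (dd k)) * \<omega> (du' k) (dbrk x (dd l)))" for x z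
    by (rule sum.cong[OF refl]) (rule lin_expand_dd[OF lin_comp[OF bilin_r[OF br_bilin] om_lin]])
  have "dbrk (dbrk x z) w = dbrk x (dbrk z w) - dbrk z (dbrk x w)" for w
  proof -
    have "dbrk (dbrk w x) z = dbrk z (dbrk x w)"
      by (subst br_anti[of w x]) (simp add: bilin_simps[OF br_bilin] br_anti[of z "dbrk x w"])
    then show ?thesis using br_jacobi[of x z w] br_anti[of "dbrk z w" x] by (simp add: algebra_simps eq_neg_iff_add_eq_0)
  qed
  then have "(\<Sum>k\<in>I. \<omega> (du' k) (dbrk (dbrk x z) (dd k))) =
     (\<Sum>k\<in>I. \<Sum>l\<in>I. \<omega> (du' l) (dbrk z (dd k)) * \<omega> (du' k) (dbrk x (dd l)))
     - (\<Sum>k\<in>I. \<Sum>l\<in>I. \<omega> (du' l) (dbrk x (dd k)) * \<omega> (du' k) (dbrk z (dd l)))"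
    by (simp only: om_simps sum_subtractf tr)
  also have "(\<Sum>k\<in>I. \<Sum>l\<in>I. \<omega> (du' l) (dbrk z (dd k)) * \<omega> (du' k) (dbrk x (dd l))) =
      (\<Sum>k\<in>I. \<Sum>l\<in>I. \<omega> (du' l) (dbrk x (dd k)) * \<omega> (du' k) (dbrk z (dd l)))"
    by (subst sum.swap) (simp only: mult.commute)
  finally show ?thesis by simp
qed

text \<open>The vector to which the sum of the products of \<open>\<partial>\<^sub>k\<close> (with
  bar) and \<open>\<partial>\<^sup>k\<close> collapses in \<open>H\<close>; see
  \<open>kappa\<close>.\<close>

definition w0 :: 'd where "w0 = ds (1 / 2) (\<Sum>k\<in>I. dbrk (dd k) (du' k)) + sv"

lemma chi_w0: "\<chi> w0 = 0"
  by (simp add: w0_def lin_add[OF chi_lin] lin_scale[OF chi_lin] lin_sum[OF chi_lin] chi_sv)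

text \<open>The cocycle condition for \<open>dd k\<close>, \<open>du' k\<close> and the bracket,
  summed over \<open>k\<close>: two terms are traces as in \<open>trace_bracket\<close>, the terms
  with \<open>\<chi>\<close> resum to \<open>\<chi>\<close> of a bracket.\<close>

lemma om_bracket_w0: "\<omega> (dbrk x z) w0 = 0"
proof -
  let ?v = "dbrk x z"
  have "(\<Sum>k\<in>I. \<omega> (dbrk (dd k) (du' k)) ?v) + (\<Sum>k\<in>I. \<omega> (dbrk (du' k) ?v) (dd k)) + (\<Sum>k\<in>I. \<omega> (dbrk ?v (dd k)) (du' k))
     = (\<Sum>k\<in>I. \<chi> (dd k) * \<omega> (du' k) ?v) + (\<Sum>k\<in>I. \<chi> (du' k) * \<omega> ?v (dd k))"
    unfolding sum.distrib[symmetric]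
    by (rule sum.cong[OF refl]) (use om_cocycle[of "dd _" "du' _" ?v] in \<open>simp add: algebra_simps\<close>)
  moreover have "(\<Sum>k\<in>I. \<chi> (dd k) * \<omega> (du' k) ?v) = 0"
    using lin_expand_dd[OF chi_lin, of ?v] by (simp add: mult.commute)
  moreover have "(\<Sum>k\<in>I. \<chi> (du' k) * \<omega> ?v (dd k)) = 0"
    using lin_expand_du[OF chi_lin, of ?v] by (simp add: mult.commute)
  moreover have a: "(\<Sum>k\<in>I. \<omega> (dbrk ?v (dd k)) (du' k)) = 0"
    using trace_bracket[of x z] by (subst om_anti) (simp add: sum_negf)
  moreover have "(\<Sum>k\<in>I. \<omega> (dbrk (du' k) ?v) (dd k)) = 0"
  proof -
    have "bilin ds ds (*) (\<lambda>u w. \<omega> (dbrk ?v u) w)"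
      by (rule bilinI) (use lin_comp[OF bilin_r[OF br_bilin] bilin_l[OF om_bilin]] om_lin in auto)
    from contract_anti[OF this] a have "(\<Sum>k\<in>I. \<omega> (dbrk ?v (du' k)) (dd k)) = 0" by simp
    then show ?thesis by (subst br_anti) (simp add: om_simps sum_negf)
  qed
  ultimately have "(\<Sum>k\<in>I. \<omega> (dbrk (dd k) (du' k)) ?v) = 0" by simp
  then have "\<omega> ?v (\<Sum>k\<in>I. dbrk (dd k) (du' k)) = 0"
    by (subst om_anti) (simp add: om_simps)
  then show ?thesis by (simp add: w0_def om_simps om_sv)
qed

end

section \<open>Commutation rules for \<open>PP\<close> and the coefficients of the
  \<open>sp\<close>-part\<close>

section \<open>Identities in \<open>H \<otimes> H \<otimes> H\<close>\<close>

context sympl_env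
begin

abbreviation bb where "bb \<equiv> bar S E"

lemma bb_lin: "lin ds hs bb"
  unfolding bar_def[abs_def]
  using lin_minus[OF iota_lin[unfolded lie_d_simps] lin_comp[OF chi_lin lin_scale_left[OF vs_H, of 1]]] by simp

lemma iota_bb: "\<iota> a = bb a + hs (\<chi> a) 1"
  by (simp add: bar_def)

lemma bb_br: "bb (dbrk a b) = bb a * bb b - bb b * bb a"
  using iota_br[of a b]
  by (simp add: bar_def algebra_scale[OF H_alg] vs_diff[OF vs_H] vs_mult[OF vs_H] vs_zero_left[OF vs_H] mult.commute algebra_simps)

lemma bb_iota_br: "bb (dbrk a b) = bb a * \<iota> b - \<iota> b * bb a"
  by (simp add: bb_br iota_bb[of b] algebra_scale[OF H_alg] algebra_simps)

definition A1 where "A1 a = s1 (bb a)"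
definition A2 where "A2 a = s2 (bb a)"
definition I1 where "I1 a = s1 (\<iota> a)"
definition I2 where "I2 a = s2 (\<iota> a)"

lemma A_lin: "lin ds hhhs A1" "lin ds hhhs A2" "lin ds hhhs I1" "lin ds hhhs I2"
  unfolding A1_def[abs_def] A2_def[abs_def] I1_def[abs_def] I2_def[abs_def]
  using lin_comp[OF bb_lin s_lin(1)] lin_comp[OF bb_lin s_lin(2)] lin_comp[OF iota_lin s_lin(1)] lin_comp[OF iota_lin s_lin(2)]
  by simp_all

lemma I_A: "I1 a = A1 a + hhhs (\<chi> a) 1" "I2 a = A2 a + hhhs (\<chi> a) 1"
  by (simp_all add: I1_def I2_def A1_def A2_def iota_bb lin_add[OF s_lin(1)] lin_scale[OF s_lin(1)] lin_add[OF s_lin(2)] lin_scale[OF s_lin(2)])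

lemma A_br: "A1 (dbrk a b) = A1 a * A1 b - A1 b * A1 a" "A2 (dbrk a b) = A2 a * A2 b - A2 b * A2 a"
  "A1 (dbrk a b) = A1 a * I1 b - I1 b * A1 a" "A2 (dbrk a b) = A2 a * I2 b - I2 b * A2 a"
proof -
  show "A1 (dbrk a b) = A1 a * A1 b - A1 b * A1 a" "A2 (dbrk a b) = A2 a * A2 b - A2 b * A2 a"
    by (simp_all add: A1_def A2_def bb_br lin_diff[OF s_lin(1)] lin_diff[OF s_lin(2)] s_mult)
  show "A1 (dbrk a b) = A1 a * I1 b - I1 b * A1 a" "A2 (dbrk a b) = A2 a * I2 b - I2 b * A2 a"
    by (simp_all add: A1_def A2_def I1_def I2_def bb_iota_br lin_diff[OF s_lin(1)] lin_diff[OF s_lin(2)] s_mult)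
qed

text \<open>Normal ordering: first slot to the left of the second one.\<close>

lemma A_comm: "A2 a * A1 b = A1 b * A2 a" "I2 a * A1 b = A1 b * I2 a" "A2 a * I1 b = I1 b * A2 a" "I2 a * I1 b = I1 b * I2 a"
  by (simp_all add: A1_def A2_def I1_def I2_def s_comm)

lemma A_comm_l: "A2 a * (A1 b * x) = A1 b * (A2 a * x)" "I2 a * (A1 b * x) = A1 b * (I2 a * x)"
  "A2 a * (I1 b * x) = I1 b * (A2 a * x)" "I2 a * (I1 b * x) = I1 b * (I2 a * x)"
  by (simp_all add: mult.assoc[symmetric] A_comm)

lemmas nord = mult.assoc A_comm A_comm_l
lemmas scal = algebra_scale[OF HHH_alg] vs_mult[OF vs_HHH] vs_one[OF vs_HHH]

text \<open>\<open>PP\<close> is the coefficient of \<open>[e * e]\<close>, placed in the first two slots.\<close>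

definition PP where "PP = (\<Sum>k\<in>I. A1 (dd k) * A2 (du' k))"

abbreviation "YY \<equiv> A1 sv"
abbreviation "ZZ \<equiv> A2 sv"

lemma A1A2_bilin: "bilin ds ds hhhs (\<lambda>x z. A1 x * A2 z)"
  by (intro bilinI lin_comp[OF A_lin(1) algebra_mult_l[OF HHH_alg]] lin_comp[OF A_lin(2) algebra_mult_r[OF HHH_alg]])

lemma PP': "PP = - (\<Sum>k\<in>I. A1 (du' k) * A2 (dd k))"
  unfolding PP_def by (rule contract_anti[OF A1A2_bilin])

definition RR' where "RR' x = (\<Sum>k\<in>I. \<Sum>l\<in>I. hhhs (\<omega> (dbrk (du' k) (du' l)) x) (A1 (dd k) * A2 (dd l)))"

text \<open>\<open>contract_bracket\<close> in the first two slots. \<open>PP\<close> fails to be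
  invariant by the bracket term \<open>RR'\<close> and by terms with the vector \<open>sv\<close> in
  one slot.\<close>

lemma PP_ad: "(A1 x + A2 x) * PP = PP * (A1 x + A2 x) + hhhs (\<chi> x) PP + RR' x - YY * A2 x + A1 x * ZZ"
proof -
  have "(A1 x + A2 x) * (A1 a * A2 b) - A1 a * A2 b * (A1 x + A2 x) = A1 (dbrk x a) * A2 b + A1 a * A2 (dbrk x b)" for a b
    by (simp add: A_br(1,2) algebra_simps nord)
  then have "(A1 x + A2 x) * PP - PP * (A1 x + A2 x) = (\<Sum>k\<in>I. A1 (dbrk x (dd k)) * A2 (du' k)) + (\<Sum>k\<in>I. A1 (dd k) * A2 (dbrk x (du' k)))"
    unfolding PP_def sum_distrib_left sum_distrib_right by (simp add: sum_subtractf[symmetric] sum.distrib[symmetric])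
  also have "\<dots> = hhhs (\<chi> x) PP + RR' x - YY * A2 x + A1 x * ZZ"
    unfolding contract_bracket[OF A1A2_bilin] PP_def RR'_def by simp
  finally show ?thesis by (simp add: algebra_simps)
qed

text \<open>At \<open>sv\<close> the bracket term vanishes because \<open>\<chi>\<close> kills
  brackets, and the two remaining corrections cancel.\<close>

lemma PP_YZ: "PP * (YY + ZZ) = (YY + ZZ) * PP"
  using PP_ad[of sv] by (simp add: chi_sv RR'_def om_sv vs_zero_left[OF vs_HHH])

lemma PP_w0: "PP * (I1 w0 + I2 w0) = (I1 w0 + I2 w0) * PP + I2 w0 * YY - I1 w0 * ZZ"
  using PP_ad[of w0] by (simp add: I_A chi_w0 RR'_def om_bracket_w0 vs_zero_left[OF vs_HHH] A_comm algebra_simps)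

lemma PP_I1: "PP * I1 v = I1 v * PP - (\<Sum>m\<in>I. A1 (dbrk (du' m) v) * A2 (dd m))"
  unfolding PP' by (simp add: A_br(3) sum_distrib_left sum_distrib_right sum_subtractf left_diff_distrib nord)

lemma PP_I2: "PP * I2 v = I2 v * PP + (\<Sum>m\<in>I. A1 (dd m) * A2 (dbrk (du' m) v))"
  unfolding PP_def by (simp add: A_br(4) sum_distrib_left sum_distrib_right sum_subtractf right_diff_distrib nord)

lemma sum_I1_A2: "(\<Sum>k\<in>I. I1 (du' k) * A2 (dd k)) = ZZ - PP"
  using lin_sv[OF A_lin(2)] by (simp add: I_A distrib_right sum.distrib scal PP')

lemma sum_A1_I2: "(\<Sum>k\<in>I. A1 (dd k) * I2 (du' k)) = PP + YY"
  using lin_sv[OF A_lin(1)] by (simp add: I_A distrib_left sum.distrib scal PP_def)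

definition cd where "cd a = A1 a + A2 a + hhhs (\<chi> a) 1"

text \<open>\<open>PP_ad\<close> contracted with a second argument, where the bracket term resums to
  a bracket of dual basis vectors. It serves the \<open>sp\<close>-coefficients, \<open>g0\<close>
  and the \<open>d'\<close>-part, with different \<open>\<psi>\<close>.\<close>

lemma contract_action:
  assumes p: "bilin hhhs ds s \<psi>"
  shows "(\<Sum>k\<in>I. \<psi> (PP * cd (dd k)) (du' k)) =
     (\<Sum>k\<in>I. \<psi> ((A1 (dd k) + A2 (dd k)) * PP) (du' k)) + (\<Sum>k\<in>I. \<psi> (A2 (dd k) * YY - A1 (dd k) * ZZ) (du' k))
     - (\<Sum>k\<in>I. \<Sum>l\<in>I. \<psi> (A1 (dd k) * A2 (dd l)) (dbrk (du' k) (du' l)))"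
proof -
  note s = lin_vs2[OF bilin_l[OF p]] and ps = bilin_simps[OF p]
  have "PP * cd x = (A1 x + A2 x) * PP + (A2 x * YY - A1 x * ZZ) - RR' x" for x
    using PP_ad[of x] by (simp add: cd_def algebra_simps scal A_comm)
  then have "(\<Sum>k\<in>I. \<psi> (PP * cd (dd k)) (du' k)) = (\<Sum>k\<in>I. \<psi> ((A1 (dd k) + A2 (dd k)) * PP) (du' k))
     + (\<Sum>k\<in>I. \<psi> (A2 (dd k) * YY - A1 (dd k) * ZZ) (du' k)) - (\<Sum>m\<in>I. \<psi> (RR' (dd m)) (du' m))"
    by (simp only: ps(1,9) sum.distrib sum_subtractf)
  also have "(\<Sum>m\<in>I. \<psi> (RR' (dd m)) (du' m)) =
      (\<Sum>m\<in>I. \<Sum>k\<in>I. \<Sum>l\<in>I. s (\<omega> (dbrk (du' k) (du' l)) (dd m)) (\<psi> (A1 (dd k) * A2 (dd l)) (du' m)))"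
    unfolding RR'_def by (simp only: ps(3,11))
  also have "\<dots> = (\<Sum>k\<in>I. \<Sum>l\<in>I. \<Sum>m\<in>I. s (\<omega> (dbrk (du' k) (du' l)) (dd m)) (\<psi> (A1 (dd k) * A2 (dd l)) (du' m)))"
    by (rule sum_rotate[symmetric])
  also have "\<dots> = (\<Sum>k\<in>I. \<Sum>l\<in>I. \<psi> (A1 (dd k) * A2 (dd l)) (dbrk (du' k) (du' l)))"
    by (intro sum.cong refl lin_expand_du[OF bilin_r[OF p], symmetric])
  finally show ?thesis .
qed

text \<open>By antisymmetry of the contraction the sum of
  \<open>\<iota> (dd k) * \<iota> (du' k)\<close> is half the sum of brackets; removing the bars
  adds \<open>sv\<close>.\<close>

lemma kappa: "(\<Sum>k\<in>I. bb (dd k) * \<iota> (du' k)) = \<iota> w0"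
proof -
  have b: "bilin ds ds hs (\<lambda>x z. \<iota> x * \<iota> z)"
    using iota_lin by (intro bilinI lin_comp[OF _ algebra_mult_l[OF H_alg]] lin_comp[OF _ algebra_mult_r[OF H_alg]]) simp_all
  have b2: "bilin ds ds hs (\<lambda>x z. hs (\<chi> x) (\<iota> z))"
    using iota_lin by (intro bilinI lin_comp[OF chi_lin lin_scale_left[OF vs_H]] lin_smult) simp
  let ?Q = "\<Sum>k\<in>I. \<iota> (dd k) * \<iota> (du' k)"
  have io: "\<iota> (dbrk a b) = \<iota> a * \<iota> b - \<iota> b * \<iota> a" for a b using iota_br[of a b] by simp
  have il: "lin ds hs \<iota>" using iota_lin by simp
  have "?Q + ?Q = (\<Sum>k\<in>I. \<iota> (dbrk (dd k) (du' k)))"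
    by (subst (2) contract_anti[OF b]) (simp add: io sum_subtractf)
  then have "hs (1 / 2) (?Q + ?Q) = \<iota> (ds (1 / 2) (\<Sum>k\<in>I. dbrk (dd k) (du' k)))"
    by (simp add: lin_scale[OF il] lin_sum[OF il])
  then have 1: "?Q = \<iota> (ds (1 / 2) (\<Sum>k\<in>I. dbrk (dd k) (du' k)))"
    by (simp add: vs_add[OF vs_H] vs_add_left[OF vs_H, symmetric] vs_one[OF vs_H])
  have 2: "(\<Sum>k\<in>I. hs (\<chi> (dd k)) (\<iota> (du' k))) = - \<iota> sv"
    using contract_anti[OF b2] lin_sv[OF il] by simp
  have "(\<Sum>k\<in>I. bb (dd k) * \<iota> (du' k)) = ?Q - (\<Sum>k\<in>I. hs (\<chi> (dd k)) (\<iota> (du' k)))"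
    by (simp add: bar_def left_diff_distrib algebra_scale[OF H_alg] sum_subtractf)
  then show ?thesis unfolding 1 2 by (simp add: w0_def lin_add[OF il])
qed

text \<open>\<open>mm w v\<close> are the coefficients of the \<open>sp\<close>-part of the action, \<open>\<Sum> mm(\<partial>\<^sub>i, \<partial>\<^sub>j) \<otimes> f\<^sup>i\<^sup>j\<close>, before
  symmetrization.\<close>

definition nn where "nn v w = (\<Sum>k\<in>I. ds (\<omega> (dbrk (du' k) v) w) (dd k))"

definition mm where "mm w v = bb w * \<iota> v + bb (nn v w)"

lemma lin_nn: "lin ds s f \<Longrightarrow> f (nn v w) = (\<Sum>k\<in>I. s (\<omega> (dbrk (du' k) v) w) (f (dd k)))"
  unfolding nn_def by (simp add: lin_sum lin_scale)

text \<open>The cocycle condition turns the antisymmetric part of \<open>nn\<close> into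
  \<open>sv\<close>, terms with \<open>\<chi>\<close>, and the bracket of \<open>v\<close> and
  \<open>w\<close>; the last two cancel against the commutator of the products.\<close>

lemma mm_anti: "mm w v - mm v w = hs (\<omega> v w) (bb sv)"
proof -
  have "nn v w - nn w v = ds (\<omega> v w) sv - ds (\<chi> v) w + ds (\<chi> w) v + dbrk v w"
  proof -
    have c: "\<omega> (dbrk (du' k) v) w - \<omega> (dbrk (du' k) w) v =
       \<omega> v w * \<chi> (du' k) - \<chi> v * \<omega> (du' k) w + \<chi> w * \<omega> (du' k) v + \<omega> (du' k) (dbrk v w)" for k
      using om_cocycle[of "du' k" v w] br_anti[of w "du' k"] om_anti[of w "du' k"] om_anti[of "dbrk v w" "du' k"]
      by (simp add: om_simps algebra_simps)
    have "nn v w - nn w v = (\<Sum>k\<in>I. ds (\<omega> (dbrk (du' k) v) w - \<omega> (dbrk (du' k) w) v) (dd k))"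
      by (simp add: nn_def sum_subtractf[symmetric] vs_diff_left[OF vs_d])
    also have "\<dots> = ds (\<omega> v w) sv - ds (\<chi> v) (\<Sum>k\<in>I. ds (\<omega> (du' k) w) (dd k)) + ds (\<chi> w) (\<Sum>k\<in>I. ds (\<omega> (du' k) v) (dd k))
        + (\<Sum>k\<in>I. ds (\<omega> (du' k) (dbrk v w)) (dd k))"
      unfolding c sv_def vs_sum[OF vs_d] vs_mult[OF vs_d] vs_add_left[OF vs_d] vs_diff_left[OF vs_d]
      by (simp only: sum.distrib sum_subtractf)
    finally show ?thesis by (simp only: expand_dd)
  qed
  then have "bb (nn v w) - bb (nn w v) = hs (\<omega> v w) (bb sv) - hs (\<chi> v) (bb w) + hs (\<chi> w) (bb v) + (bb v * bb w - bb w * bb v)"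
    by (simp add: lin_diff[OF bb_lin, symmetric]) (simp add: lin_diff[OF bb_lin] lin_add[OF bb_lin] lin_scale[OF bb_lin] bb_br)
  then show ?thesis
    by (simp add: mm_def iota_bb algebra_simps algebra_scale[OF H_alg])
qed

text \<open>Minus the symmetrization of \<open>mm\<close>: by \<open>mm_anti\<close> the first
  summand removes the antisymmetric part, which is invisible anyway because
  \<open>f\<^sup>i\<^sup>j\<close> is symmetric.\<close>

definition M0 where "M0 v w = hs (\<omega> v w / 2) (bb sv) - mm w v"

end

section \<open>The commutation rule of \<open>PP\<close> with the symmetrized coefficients
  \<open>M0\<close>\<close>

context sympl_env
begin

definition cop where "cop h = hhtens E (\<Delta> h) 1"

lemma cop_hom: "alg_hom hs hhhs cop"
  unfolding cop_def[abs_def] by (rule alg_hom_comp[OF coprod_hom tensor_hom_l[OF HHH]])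

lemmas cop_lin = alg_homD(1)[OF cop_hom] and cop_mult = alg_homD(3)[OF cop_hom]

lemma cop_iota: "cop (\<iota> a) = I1 a + I2 a"
  by (simp add: cop_def hhtens_coprod_iota I1_def I2_def)

lemma cop_bb: "cop (bb a) = cd a"
  using cop_iota[of a]
  by (simp add: cd_def I_A iota_bb lin_add[OF cop_lin] lin_scale[OF cop_lin] alg_homD(2)[OF cop_hom] add.assoc)

lemma cd_lin: "lin ds hhhs cd"
  unfolding cop_bb[symmetric] by (rule lin_comp[OF bb_lin cop_lin])

lemma nn_bilin: "bilin ds ds ds nn"
proof (rule bilinI)
  fix b show "lin ds ds (\<lambda>a. nn a b)"
    unfolding nn_def
    by (intro lin_sumI vs_d lin_comp[OF lin_comp[OF bilin_r[OF br_bilin] bilin_l[OF om_bilin]] lin_scale_left[OF vs_d]])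
next
  fix a show "lin ds ds (nn a)"
    unfolding nn_def[abs_def]
    by (intro lin_sumI vs_d lin_comp[OF om_lin lin_scale_left[OF vs_d]])
qed

lemma mm_bilin: "bilin ds ds hs mm"
  unfolding mm_def[abs_def]
  using iota_lin
  by (intro bilinI lin_plus lin_comp[OF bb_lin algebra_mult_l[OF H_alg]] lin_comp[OF _ algebra_mult_r[OF H_alg]]
      lin_comp[OF bilin_l[OF nn_bilin] bb_lin] lin_comp[OF bilin_r[OF nn_bilin] bb_lin]) simp_all

lemma M0_bilin: "bilin ds ds hs M0"
proof -
  have h: "lin ds (*) (\<lambda>a. f a / 2)" if "lin ds (*) f" for f :: "'d \<Rightarrow> 'k"
    using lin_smult[OF that, of "1 / 2"] by simp
  show ?thesis
    unfolding M0_def[abs_def]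
    by (intro bilinI lin_minus bilin_l[OF mm_bilin] bilin_r[OF mm_bilin] lin_comp[OF h[OF om_lin] lin_scale_left[OF vs_H]]
        lin_comp[OF h[OF bilin_l[OF om_bilin]] lin_scale_left[OF vs_H]])
qed

lemma M0_sym: "M0 v w = M0 w v"
proof -
  have "M0 v w - M0 w v = hs (\<omega> v w / 2 - \<omega> w v / 2) (bb sv) - (mm w v - mm v w)"
    by (simp add: M0_def vs_diff_left[OF vs_H] algebra_simps)
  also have "\<dots> = 0" unfolding mm_anti om_anti[of w v] by simp
  finally show ?thesis by simp
qed

definition m1 where "m1 v w = s1 (mm w v)"
definition m2 where "m2 v w = s2 (mm w v)"

lemma m_eq: "m1 v w = A1 w * I1 v + A1 (nn v w)" "m2 v w = A2 w * I2 v + A2 (nn v w)"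
  by (simp_all add: m1_def m2_def mm_def A1_def A2_def I1_def I2_def s_mult lin_add[OF s_lin(1)] lin_add[OF s_lin(2)])

lemma s_M0: "s1 (M0 v w) = hhhs (\<omega> v w / 2) YY - m1 v w" "s2 (M0 v w) = hhhs (\<omega> v w / 2) ZZ - m2 v w"
  by (simp_all add: M0_def m1_def m2_def lin_diff[OF s_lin(1)] lin_diff[OF s_lin(2)] lin_scale[OF s_lin(1)] lin_scale[OF s_lin(2)] A1_def A2_def)

lemma m_lin: "lin ds hhhs (m1 v)" "lin ds hhhs (\<lambda>v. m1 v w)" "lin ds hhhs (m2 v)" "lin ds hhhs (\<lambda>v. m2 v w)"
  unfolding m1_def[abs_def] m2_def[abs_def]
  by (intro lin_comp[OF bilin_l[OF mm_bilin] s_lin(1)] lin_comp[OF bilin_r[OF mm_bilin] s_lin(1)]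
      lin_comp[OF bilin_l[OF mm_bilin] s_lin(2)] lin_comp[OF bilin_r[OF mm_bilin] s_lin(2)])+

lemma hhhs_lin: "lin hhhs hhhs (hhhs c)"
  using lin_smult[OF lin_id[OF vs_HHH]] by simp

text \<open>The multiples of the identity in \<open>M0\<close> do not contribute to the commutator.\<close>

lemma M0_commutator:
  "(\<Sum>k\<in>I. s1 (M0 (du' k) w) * s2 (M0 v (dd k)) - s1 (M0 v (dd k)) * s2 (M0 (du' k) w)) =
   (\<Sum>k\<in>I. m1 (du' k) w * m2 v (dd k)) - (\<Sum>k\<in>I. m1 v (dd k) * m2 (du' k) w)"
proof -
  have a: "(\<Sum>k\<in>I. hhhs (\<omega> (du' k) w) (YY * m2 v (dd k))) = YY * m2 v w"
    by (rule lin_expand_dd[OF lin_comp[OF m_lin(3) algebra_mult_r[OF HHH_alg]], symmetric])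
  have b: "(\<Sum>k\<in>I. hhhs (\<omega> v (dd k)) (m1 (du' k) w * ZZ)) = m1 v w * ZZ"
    by (rule lin_expand_du[OF lin_comp[OF m_lin(2) algebra_mult_l[OF HHH_alg]], symmetric])
  have c: "(\<Sum>k\<in>I. hhhs (\<omega> v (dd k)) (YY * m2 (du' k) w)) = YY * m2 v w"
    by (rule lin_expand_du[OF lin_comp[OF m_lin(4) algebra_mult_r[OF HHH_alg]], symmetric])
  have d: "(\<Sum>k\<in>I. hhhs (\<omega> (du' k) w) (m1 v (dd k) * ZZ)) = m1 v w * ZZ"
    by (rule lin_expand_dd[OF lin_comp[OF m_lin(1) algebra_mult_l[OF HHH_alg]], symmetric])
  have "s1 (M0 (du' k) w) * s2 (M0 v (dd k)) - s1 (M0 v (dd k)) * s2 (M0 (du' k) w) =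
     (m1 (du' k) w * m2 v (dd k) - m1 v (dd k) * m2 (du' k) w)
     - hhhs (1 / 2) (hhhs (\<omega> (du' k) w) (YY * m2 v (dd k)) + hhhs (\<omega> v (dd k)) (m1 (du' k) w * ZZ)
        - hhhs (\<omega> v (dd k)) (YY * m2 (du' k) w) - hhhs (\<omega> (du' k) w) (m1 v (dd k) * ZZ))" for k
    unfolding s_M0
    by (simp add: left_diff_distrib right_diff_distrib scal vs_add[OF vs_HHH] vs_diff[OF vs_HHH] mult.commute)
  then have "(\<Sum>k\<in>I. s1 (M0 (du' k) w) * s2 (M0 v (dd k)) - s1 (M0 v (dd k)) * s2 (M0 (du' k) w)) =
     (\<Sum>k\<in>I. m1 (du' k) w * m2 v (dd k) - m1 v (dd k) * m2 (du' k) w)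
     - hhhs (1 / 2) (YY * m2 v w + m1 v w * ZZ - YY * m2 v w - m1 v w * ZZ)"
    by (simp only: sum_subtractf sum.distrib vs_sum[OF vs_HHH, symmetric] a b c d)
  then show ?thesis by (simp add: vs_zero[OF vs_HHH] sum_subtractf)
qed

text \<open>The doubly bracketed residues of the two products of \<open>sp\<close>-coefficients. By
  the Jacobi identity of \<open>d\<close> their difference (\<open>W4_diff\<close>) has the shape
  produced by \<open>contract_action\<close>.\<close>

definition W4 where "W4 v w = (\<Sum>k\<in>I. \<Sum>l\<in>I. hhhs (\<omega> (dbrk (du' k) (dbrk (du' l) v)) w) (A1 (dd k) * A2 (dd l)))"
definition W4' where "W4' v w = (\<Sum>k\<in>I. \<Sum>l\<in>I. hhhs (\<omega> (dbrk (du' l) (dbrk (du' k) v)) w) (A1 (dd k) * A2 (dd l)))"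

lemma I_br: "I1 (dbrk a b) = A1 (dbrk a b)" "I2 (dbrk a b) = A2 (dbrk a b)"
  by (simp_all add: I_A vs_zero_left[OF vs_HHH])

lemma sum_m1_m2:
  "(\<Sum>k\<in>I. m1 (du' k) w * m2 v (dd k)) = A1 w * (ZZ - PP) * I2 v + A1 w * (\<Sum>m\<in>I. A1 (dbrk (du' m) v) * A2 (dd m))
     + RR' w * I2 v + W4 v w"
proof -
  have i: "(\<Sum>k\<in>I. A1 w * I1 (du' k) * A2 (dd k) * I2 v) = A1 w * (ZZ - PP) * I2 v"
    unfolding sum_I1_A2[symmetric] by (simp only: sum_distrib_left sum_distrib_right mult.assoc)
  have "(\<Sum>k\<in>I. A1 w * I1 (du' k) * A2 (nn v (dd k))) =
      (\<Sum>k\<in>I. \<Sum>m\<in>I. hhhs (\<omega> (dbrk (du' m) v) (dd k)) (A1 w * I1 (du' k) * A2 (dd m)))"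
    by (simp only: lin_nn[OF A_lin(2)] sum_distrib_left algebra_scale[OF HHH_alg])
  also have "\<dots> = (\<Sum>m\<in>I. \<Sum>k\<in>I. hhhs (\<omega> (dbrk (du' m) v) (dd k)) (A1 w * I1 (du' k) * A2 (dd m)))"
    by (rule sum.swap)
  also have "\<dots> = (\<Sum>m\<in>I. A1 w * I1 (dbrk (du' m) v) * A2 (dd m))"
    by (rule sum.cong[OF refl], rule lin_expand_du[symmetric, of _ "\<lambda>u. A1 w * I1 u * A2 _"])
      (intro lin_comp[OF lin_comp[OF A_lin(3) algebra_mult_r[OF HHH_alg]] algebra_mult_l[OF HHH_alg]])
  finally have ii: "(\<Sum>k\<in>I. A1 w * I1 (du' k) * A2 (nn v (dd k))) = A1 w * (\<Sum>m\<in>I. A1 (dbrk (du' m) v) * A2 (dd m))"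
    by (simp only: I_br sum_distrib_left mult.assoc)
  have "(\<Sum>k\<in>I. A1 (nn (du' k) w) * A2 (dd k)) = RR' w"
    unfolding RR'_def by (subst sum.swap) (simp only: lin_nn[OF A_lin(1)] sum_distrib_right algebra_scale[OF HHH_alg])
  then have iii: "(\<Sum>k\<in>I. A1 (nn (du' k) w) * A2 (dd k) * I2 v) = RR' w * I2 v"
    by (simp only: sum_distrib_right[symmetric])
  have "(\<Sum>k\<in>I. A1 (nn (du' k) w) * A2 (nn v (dd k))) =
      (\<Sum>k\<in>I. \<Sum>l\<in>I. \<Sum>m\<in>I. hhhs (\<omega> (dbrk (du' m) v) (dd k)) (hhhs (\<omega> (dbrk (du' l) (du' k)) w) (A1 (dd l) * A2 (dd m))))"
    by (simp only: lin_nn[OF A_lin(1)] lin_nn[OF A_lin(2)] sum_distrib_left sum_distrib_right algebra_scale[OF HHH_alg] vs_sum[OF vs_HHH])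
      (rule sum.cong[OF refl], rule sum.swap)
  also have "\<dots> = (\<Sum>l\<in>I. \<Sum>m\<in>I. \<Sum>k\<in>I. hhhs (\<omega> (dbrk (du' m) v) (dd k)) (hhhs (\<omega> (dbrk (du' l) (du' k)) w) (A1 (dd l) * A2 (dd m))))"
    by (rule sum_rotate[symmetric])
  also have "\<dots> = W4 v w"
    unfolding W4_def
    by (intro sum.cong refl lin_expand_du[symmetric, of _ "\<lambda>u. hhhs (\<omega> (dbrk _ u) w) _"]
        lin_comp[OF lin_comp[OF bilin_r[OF br_bilin] bilin_l[OF om_bilin]] lin_scale_left[OF vs_HHH]])
  finally have iv: "(\<Sum>k\<in>I. A1 (nn (du' k) w) * A2 (nn v (dd k))) = W4 v w" .
  have "m1 (du' k) w * m2 v (dd k) = A1 w * I1 (du' k) * A2 (dd k) * I2 v + A1 w * I1 (du' k) * A2 (nn v (dd k))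
     + A1 (nn (du' k) w) * A2 (dd k) * I2 v + A1 (nn (du' k) w) * A2 (nn v (dd k))" for k
    by (simp add: m_eq algebra_simps nord)
  then show ?thesis by (simp only: sum.distrib i ii iii iv)
qed

lemma sum_m1_m2':
  "(\<Sum>k\<in>I. m1 v (dd k) * m2 (du' k) w) = A2 w * (PP + YY) * I1 v + A2 w * (\<Sum>m\<in>I. A1 (dd m) * A2 (dbrk (du' m) v))
     - RR' w * I1 v + W4' v w"
proof -
  have i: "(\<Sum>k\<in>I. A2 w * (A1 (dd k) * I2 (du' k)) * I1 v) = A2 w * (PP + YY) * I1 v"
    unfolding sum_A1_I2[symmetric] by (simp only: sum_distrib_left sum_distrib_right mult.assoc)
  have "(\<Sum>k\<in>I. A2 w * (A1 (nn v (dd k)) * I2 (du' k))) =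
      (\<Sum>k\<in>I. \<Sum>m\<in>I. hhhs (\<omega> (dbrk (du' m) v) (dd k)) (A2 w * (A1 (dd m) * I2 (du' k))))"
    by (simp only: lin_nn[OF A_lin(1)] sum_distrib_left sum_distrib_right algebra_scale[OF HHH_alg])
  also have "\<dots> = (\<Sum>m\<in>I. \<Sum>k\<in>I. hhhs (\<omega> (dbrk (du' m) v) (dd k)) (A2 w * (A1 (dd m) * I2 (du' k))))"
    by (rule sum.swap)
  also have "\<dots> = (\<Sum>m\<in>I. A2 w * (A1 (dd m) * I2 (dbrk (du' m) v)))"
    by (rule sum.cong[OF refl], rule lin_expand_du[symmetric, of _ "\<lambda>u. A2 w * (A1 _ * I2 u)"])
      (intro lin_comp[OF lin_comp[OF A_lin(4) algebra_mult_r[OF HHH_alg]] algebra_mult_r[OF HHH_alg]])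
  finally have ii: "(\<Sum>k\<in>I. A2 w * (A1 (nn v (dd k)) * I2 (du' k))) = A2 w * (\<Sum>m\<in>I. A1 (dd m) * A2 (dbrk (du' m) v))"
    by (simp only: I_br sum_distrib_left)
  have "(\<Sum>k\<in>I. A1 (dd k) * A2 (nn (du' k) w)) = (\<Sum>k\<in>I. \<Sum>l\<in>I. hhhs (\<omega> (dbrk (du' l) (du' k)) w) (A1 (dd k) * A2 (dd l)))"
    by (simp only: lin_nn[OF A_lin(2)] sum_distrib_left algebra_scale[OF HHH_alg])
  also have "\<dots> = (\<Sum>k\<in>I. \<Sum>l\<in>I. - hhhs (\<omega> (dbrk (du' k) (du' l)) w) (A1 (dd k) * A2 (dd l)))"
    by (intro sum.cong refl) (subst br_anti, simp add: om_simps vs_minus_left[OF vs_HHH])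
  finally have "(\<Sum>k\<in>I. A1 (dd k) * A2 (nn (du' k) w)) = - RR' w" by (simp add: RR'_def sum_negf)
  then have iii: "(\<Sum>k\<in>I. A1 (dd k) * A2 (nn (du' k) w) * I1 v) = - RR' w * I1 v"
    by (simp only: sum_distrib_right[symmetric])
  have "(\<Sum>k\<in>I. A1 (nn v (dd k)) * A2 (nn (du' k) w)) =
      (\<Sum>k\<in>I. \<Sum>l\<in>I. \<Sum>m\<in>I. hhhs (\<omega> (dbrk (du' l) v) (dd k)) (hhhs (\<omega> (dbrk (du' m) (du' k)) w) (A1 (dd l) * A2 (dd m))))"
    by (simp only: lin_nn[OF A_lin(1)] lin_nn[OF A_lin(2)] sum_distrib_left sum_distrib_right algebra_scale[OF HHH_alg] vs_sum[OF vs_HHH] vs_mult[OF vs_HHH])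
      (subst sum.swap, simp only: mult.commute)
  also have "\<dots> = (\<Sum>l\<in>I. \<Sum>m\<in>I. \<Sum>k\<in>I. hhhs (\<omega> (dbrk (du' l) v) (dd k)) (hhhs (\<omega> (dbrk (du' m) (du' k)) w) (A1 (dd l) * A2 (dd m))))"
    by (rule sum_rotate[symmetric])
  also have "\<dots> = W4' v w"
    unfolding W4'_def
    by (intro sum.cong refl lin_expand_du[symmetric, of _ "\<lambda>u. hhhs (\<omega> (dbrk _ u) w) _"]
        lin_comp[OF lin_comp[OF bilin_r[OF br_bilin] bilin_l[OF om_bilin]] lin_scale_left[OF vs_HHH]])
  finally have iv: "(\<Sum>k\<in>I. A1 (nn v (dd k)) * A2 (nn (du' k) w)) = W4' v w" .
  have "m1 v (dd k) * m2 (du' k) w = A2 w * (A1 (dd k) * I2 (du' k)) * I1 v + A2 w * (A1 (nn v (dd k)) * I2 (du' k))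
     + A1 (dd k) * A2 (nn (du' k) w) * I1 v + A1 (nn v (dd k)) * A2 (nn (du' k) w)" for k
    by (simp add: m_eq algebra_simps nord)
  then show ?thesis by (simp only: sum.distrib i ii iii iv) simp
qed

lemma W4_diff: "W4 v w - W4' v w = (\<Sum>k\<in>I. \<Sum>l\<in>I. hhhs (\<omega> (dbrk (dbrk (du' k) (du' l)) v) w) (A1 (dd k) * A2 (dd l)))"
proof -
  have "dbrk a (dbrk b v) - dbrk b (dbrk a v) = dbrk (dbrk a b) v" for a b
  proof -
    have "dbrk (dbrk v a) b = dbrk b (dbrk a v)"
      by (subst br_anti[of v a]) (simp add: bilin_simps[OF br_bilin] br_anti[of b "dbrk a v"])
    then show ?thesis using br_jacobi[of a b v] br_anti[of "dbrk b v" a] by (simp add: algebra_simps eq_neg_iff_add_eq_0)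
  qed
  then show ?thesis
    by (simp add: W4_def W4'_def sum_subtractf[symmetric] vs_diff_left[OF vs_HHH, symmetric] om_simps(9)[symmetric])
qed

text \<open>\<open>contract_action\<close> moves \<open>PP\<close> past the coproduct of
  \<open>mm w v\<close>, which is linear in the data of a single contraction.\<close>

lemma PP_mm:
  "PP * cop (mm w v) = (A1 w + A2 w) * PP * (I1 v + I2 v) + (A1 (nn v w) + A2 (nn v w)) * PP
     + (A2 w * YY - A1 w * ZZ) * (I1 v + I2 v) + (A2 (nn v w) * YY - A1 (nn v w) * ZZ)
     - RR' w * (I1 v + I2 v) - (W4 v w - W4' v w)"
proof -
  \<comment> \<open>Chosen so that contracting \<open>f (dd k)\<close> with \<open>du' k\<close>
    gives both parts of \<open>mm\<close> at once: \<open>f w\<close> times the letter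
    \<open>v\<close>, and \<open>f (nn v w)\<close>.\<close>
  define \<psi> where "\<psi> x u = hhhs (\<omega> u w) (x * (I1 v + I2 v)) + hhhs (\<omega> (dbrk u v) w) x" for x u
  have p: "bilin hhhs ds hhhs \<psi>"
    unfolding \<psi>_def
    by (intro bilinI lin_plus lin_comp[OF algebra_mult_l[OF HHH_alg] hhhs_lin] hhhs_lin
        lin_comp[OF bilin_l[OF om_bilin] lin_scale_left[OF vs_HHH]]
        lin_comp[OF lin_comp[OF bilin_l[OF br_bilin] bilin_l[OF om_bilin]] lin_scale_left[OF vs_HHH]])
  have s: "(\<Sum>k\<in>I. \<psi> (f (dd k)) (du' k)) = f w * (I1 v + I2 v) + f (nn v w)" if f: "lin ds hhhs f" for f
    unfolding \<psi>_def sum.distrib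
    using lin_expand_dd[OF lin_comp[OF f algebra_mult_l[OF HHH_alg]], of w "I1 v + I2 v"] lin_nn[OF f, of v w] by simp
  have 1: "(\<Sum>k\<in>I. \<psi> (PP * cd (dd k)) (du' k)) = PP * cop (mm w v)"
    using s[OF lin_comp[OF cd_lin algebra_mult_r[OF HHH_alg]], of PP]
    by (simp add: mm_def cop_mult lin_add[OF cop_lin] cop_bb cop_iota distrib_left mult.assoc)
  have 2: "(\<Sum>k\<in>I. \<psi> ((A1 (dd k) + A2 (dd k)) * PP) (du' k)) = (A1 w + A2 w) * PP * (I1 v + I2 v) + (A1 (nn v w) + A2 (nn v w)) * PP"
    by (rule s[of "\<lambda>x. (A1 x + A2 x) * PP"]) (intro lin_comp[OF lin_plus[OF A_lin(1,2)] algebra_mult_l[OF HHH_alg]])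
  have 3: "(\<Sum>k\<in>I. \<psi> (A2 (dd k) * YY - A1 (dd k) * ZZ) (du' k)) =
     (A2 w * YY - A1 w * ZZ) * (I1 v + I2 v) + (A2 (nn v w) * YY - A1 (nn v w) * ZZ)"
    by (rule s[of "\<lambda>x. A2 x * YY - A1 x * ZZ"])
      (intro lin_minus lin_comp[OF A_lin(1) algebra_mult_l[OF HHH_alg]] lin_comp[OF A_lin(2) algebra_mult_l[OF HHH_alg]])
  have 4: "(\<Sum>k\<in>I. \<Sum>l\<in>I. \<psi> (A1 (dd k) * A2 (dd l)) (dbrk (du' k) (du' l))) = RR' w * (I1 v + I2 v) + (W4 v w - W4' v w)"
    unfolding W4_diff RR'_def \<psi>_def
    by (simp only: sum.distrib sum_distrib_right algebra_scale[OF HHH_alg])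
  show ?thesis using contract_action[OF p] unfolding 1 2 3 4 by (simp add: algebra_simps)
qed

text \<open>The \<open>sp\<close>-part of the Jacobi identity as an equation of coefficients. Once
  both sides are in normal order, the residues \<open>RR'\<close> and \<open>W4\<close>
  cancel.\<close>

lemma M0_jacobi:
  "PP * cop (M0 v w) = (\<Sum>k\<in>I. s1 (M0 (du' k) w) * s2 (M0 v (dd k)) - s1 (M0 v (dd k)) * s2 (M0 (du' k) w))
     + (s1 (M0 v w) + s2 (M0 v w)) * PP + s2 (M0 v w) * YY - s1 (M0 v w) * ZZ"
proof -
  let ?X1 = "\<Sum>m\<in>I. A1 (dbrk (du' m) v) * A2 (dd m)" and ?X2 = "\<Sum>m\<in>I. A1 (dd m) * A2 (dbrk (du' m) v)"
  have "cop (bb sv) = YY + ZZ" by (simp add: cop_bb cd_def chi_sv vs_zero_left[OF vs_HHH])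
  then have l: "PP * cop (M0 v w) = hhhs (\<omega> v w / 2) ((YY + ZZ) * PP) - PP * cop (mm w v)"
    using PP_YZ by (simp add: M0_def lin_diff[OF cop_lin] lin_scale[OF cop_lin] right_diff_distrib algebra_scale[OF HHH_alg])
  have a: "(A1 w + A2 w) * PP * (I1 v + I2 v) = (A1 w * I1 v + A2 w * I2 v) * PP + A1 w * PP * I2 v + A2 w * PP * I1 v
      - A1 w * ?X1 + A2 w * ?X2"
  proof -
    have b: "A1 w * PP * I1 v = A1 w * I1 v * PP - A1 w * ?X1" by (simp only: mult.assoc right_diff_distrib PP_I1)
    have c: "A2 w * PP * I2 v = A2 w * I2 v * PP + A2 w * ?X2" by (simp only: mult.assoc distrib_left PP_I2)
    have "(A1 w + A2 w) * PP * (I1 v + I2 v) = A1 w * PP * I1 v + A1 w * PP * I2 v + (A2 w * PP * I1 v + A2 w * PP * I2 v)"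
      by (simp only: distrib_left distrib_right ac_simps)
    then show ?thesis unfolding b c by (simp only: algebra_simps)
  qed
  show ?thesis
    unfolding M0_commutator
    unfolding sum_m1_m2 sum_m1_m2'
    unfolding l PP_mm a s_M0 m_eq
    by (simp add: algebra_simps nord scal vs_add[OF vs_HHH] vs_diff[OF vs_HHH])
qed

end

section \<open>The action of \<open>e\<close> with all coefficients in the left factors\<close>

section \<open>The action of the generator\<close>

lemma sum_apply: "(\<Sum>i\<in>A. f i) x = (\<Sum>i\<in>A. f i x :: 'b::comm_monoid_add)"
  by (induction A rule: infinite_finite_induct) auto

context tmod
begin

abbreviation C where "C \<equiv> rR (cc, 0)"
definition rd where "rd a r = rR ((a, 0), 0) r"
definition ff where "ff p = rsp (f_op S (fst p) (snd p))"
definition mf where "mf p = M0 (dd (snd p)) (dd (fst p))"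
text \<open>The coefficient of \<open>v\<close> itself: the sum over \<open>k\<close> of
  \<open>(bb (dd k) \<otimes> 1) * \<Delta> (\<iota> (du' k))\<close>, whose first part collapses by
  \<open>kappa\<close>.\<close>

definition g0 where "g0 = \<iota> w0 \<otimes> 1 + (\<Sum>k\<in>I. bb (dd k) \<otimes> \<iota> (du' k))"

lemma rd_lin_l: "lin ds sR (\<lambda>a. rd a r)"
proof (rule linI[OF vs_d vs_R])
  show "rd (a + b) r = rd a r + rd b r" for a b
    using rR_add[OF sp_0 sp_0, of a 0 b 0 r] by (simp add: rd_def)
  show "rd (ds c a) r = sR c (rd a r)" for c a
    using rR_scale[OF sp_0, of c a 0 r] by (simp add: rd_def vs_zero[OF vs_d] zero_fun_def)
qed

lemma rd_br: "rd a (rd b r) - rd b (rd a r) = rd (dbrk a b) r + sR (\<omega> a b) (C r)"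
proof -
  have "rR ((dbrk a b, \<omega> a b), 0) r = rd a (rd b r) - rd b (rd a r)"
    using rR_br[OF sp_0 sp_0, of a b 0 0 r] by (simp add: rd_def zero_fun_def)
  moreover have "rR ((dbrk a b, \<omega> a b), 0) r = rd (dbrk a b) r + rR ((0, \<omega> a b), 0) r"
    using rR_add[OF sp_0 sp_0, of "dbrk a b" 0 0 "\<omega> a b" r] by (simp add: rd_def)
  moreover have "rR ((0, \<omega> a b), 0) r = sR (\<omega> a b) (C r)"
    using rR_scale[OF sp_0, of "\<omega> a b" 0 1 r] by (simp add: cc_def vs_zero[OF vs_d] zero_fun_def)
  ultimately show ?thesis by simp
qed

lemma rd_C: "rd a (C r) = C (rd a r) + sR (\<chi> a) (C r)"
proof -
  have "rR ((0, \<chi> a), 0) r = rd a (C r) - C (rd a r)"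
    using rR_br[OF sp_0 sp_0, of a 0 1 0 r] by (simp add: rd_def cc_def zero_fun_def bilin_simps[OF br_bilin] om_simps)
  moreover have "rR ((0, \<chi> a), 0) r = sR (\<chi> a) (C r)"
    using rR_scale[OF sp_0, of "\<chi> a" 0 1 r] by (simp add: cc_def vs_zero[OF vs_d] zero_fun_def)
  ultimately show ?thesis by simp
qed

lemma rsp_comm:
  assumes A: "A \<in> sp S"
  shows "rsp A (rd a r) = rd a (rsp A r)" "rsp A (C r) = C (rsp A r)"
proof -
  have z: "rR ((0, 0), 0) r = 0" using R.rho_0[of r] by (simp add: zero_prod_def)
  have "(\<lambda>v. A (0 v) - 0 (A v)) = (0 :: 'd \<Rightarrow> 'd)" by (simp add: fun_eq_iff lin_zero[OF sp_lin[OF A]])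
  then show "rsp A (rd a r) = rd a (rsp A r)" "rsp A (C r) = C (rsp A r)"
    using rR_br[OF A sp_0, of 0 a 0 0 r] rR_br[OF A sp_0, of 0 0 1 0 r] z
    by (simp_all add: rd_def cc_def zero_prod_def bilin_simps[OF br_bilin] om_simps lin_zero[OF chi_lin])
qed

lemma ff_comm: "p \<in> I \<times> I \<Longrightarrow> ff p (rd a r) = rd a (ff p r)" "p \<in> I \<times> I \<Longrightarrow> ff p (C r) = C (ff p r)"
  unfolding ff_def using rsp_comm[OF f_op_sp] by auto

text \<open>The action of \<open>e\<close> on \<open>1 \<otimes> v\<close>, with \<open>K x r\<close> in place of \<open>x \<otimes>\<^sub>H (1 \<otimes> r)\<close>; the term
  \<open>1 \<otimes>\<^sub>H (\<partial> \<otimes> r)\<close> has been moved to the left factor by means of \<open>\<Delta>\<close>.\<close>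

definition actK :: "('hh \<Rightarrow> 'r \<Rightarrow> 'z::ab_group_add) \<Rightarrow> 'r \<Rightarrow> 'z" where
  "actK K v = - (\<Sum>p\<in>I \<times> I. K (mf p \<otimes> 1) (ff p v)) - (\<Sum>k\<in>I. K (bb (dd k) \<otimes> 1) (rd (du' k) v)) + K g0 v + K 1 (C v)"

lemma f_op_pairs: "(\<Sum>i\<in>I. \<Sum>j\<in>I. g i j (rsp (f_op S i j) v)) = (\<Sum>p\<in>I \<times> I. g (fst p) (snd p) (ff p v))"
  by (simp add: sum.cartesian_product ff_def case_prod_beta)

lemma ff_swap: "ff (prod.swap p) = ff p"
  by (simp add: ff_def f_op_sym[of "snd p"])

lemma sum_swap: "(\<Sum>p\<in>I \<times> I. g (prod.swap p)) = (\<Sum>p\<in>I \<times> I. g p)"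
  by (rule sum.reindex_bij_witness[of _ prod.swap prod.swap]) auto

lemma ad_sp_sum: "ad_sp S a =
    (\<Sum>i\<in>I. \<Sum>j\<in>I. (\<lambda>v. ds (\<omega> (dbrk a (dd j)) (dd i) + \<chi> (dd j) * \<omega> a (dd i)) ((- f_op S i j) v)))"
  by (simp add: ad_sp_def sp_proj_def fun_eq_iff om_simps sum_apply)

lemma ad_sp_sp: "ad_sp S a \<in> sp S"
  unfolding ad_sp_sum by (intro sp_sum sp_scale sp_uminus f_op_sp)

lemma rR_hat_ad: "rR (hat a, ad_sp S a) v = rd a v + rsp (ad_sp S a) v"
  using rR_add[OF sp_0 ad_sp_sp, of a 0 0 0 a v] by (simp add: rd_def hat_def zero_prod_def)

lemma ad_sp_ff: "rsp (ad_sp S a) v =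
   - (\<Sum>p\<in>I \<times> I. sR (\<omega> (dbrk a (dd (snd p))) (dd (fst p)) + \<chi> (dd (snd p)) * \<omega> a (dd (fst p))) (ff p v))"
proof -
  let ?c = "\<lambda>i j. \<omega> (dbrk a (dd j)) (dd i) + \<chi> (dd j) * \<omega> a (dd i)"
  have m: "- f_op S i j \<in> sp S" if "i \<in> I" "j \<in> I" for i j using sp_uminus[OF f_op_sp[OF that]] .
  have "rsp (ad_sp S a) v = (\<Sum>i\<in>I. \<Sum>j\<in>I. sR (?c i j) (rsp (- f_op S i j) v))"
    by (simp only: ad_sp_sum R.rho_sum sp_sum sp_scale m R.rho_scale cong: sum.cong)
  also have "\<dots> = (\<Sum>i\<in>I. \<Sum>j\<in>I. - sR (?c i j) (rsp (f_op S i j) v))"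
    by (intro sum.cong refl) (simp add: R.rho_uminus f_op_sp vs_minus[OF vs_R])
  finally show ?thesis by (simp only: sum_negf f_op_pairs[of "\<lambda>i j. sR (?c i j)"])
qed

text \<open>The part \<open>ad\<^sup>s\<^sup>p\<close> is a combination of the
  \<open>f\<^sup>i\<^sup>j\<close>. Contracted with the first order coefficients it completes the
  second order ones to \<open>mm\<close>: the bracket gives \<open>nn\<close>, and its term with
  \<open>\<chi>\<close> removes one bar.\<close>

lemma act_actK: "act e (t 1 v) = actK (\<lambda>x r. tens2 V x (t 1 r)) v"
proof -
  let ?K = "\<lambda>x r. tens2 V x (t 1 r)"
  have b: "bilin hhs sR V.m2s ?K"
    by (intro bilinI bilin_l[OF V.tens2_bilin] lin_comp[OF bilin_r[OF t_bilin] bilin_r[OF V.tens2_bilin]])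
  note K = bilin_simps[OF b]
  have 1: "tens2 V (bb (dd k) \<otimes> 1) (t (\<iota> (du' k)) v) = ?K ((bb (dd k) * \<iota> (du' k)) \<otimes> 1) v + ?K (bb (dd k) \<otimes> \<iota> (du' k)) v" for k
    using V.tens2_bal[of "bb (dd k) \<otimes> 1" "\<iota> (du' k)" "t 1 v"]
    by (simp add: hact_t coprod_iota distrib_left tns_simps K)
  have 2: "(\<Sum>k\<in>I. ?K ((bb (dd k) * \<iota> (du' k)) \<otimes> 1) v) + (\<Sum>k\<in>I. ?K (bb (dd k) \<otimes> \<iota> (du' k)) v) = ?K g0 v"
    unfolding g0_def by (simp only: K kappa[symmetric] bilin_simps[OF HH_bilin])
  have 4: "(\<Sum>k\<in>I. ?K (bb (dd k) \<otimes> 1) (rsp (ad_sp S (du' k)) v)) =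
     - (\<Sum>p\<in>I \<times> I. ?K ((bb (nn (dd (snd p)) (dd (fst p))) + hs (\<chi> (dd (snd p))) (bb (dd (fst p)))) \<otimes> 1) (ff p v))"
  proof -
    have l: "lin ds V.m2s (\<lambda>x. ?K (bb x \<otimes> 1) r)" for r
      by (rule lin_comp[OF lin_comp[OF bb_lin bilin_l[OF HH_bilin]] bilin_l[OF b]])
    have "?K ((bb (nn x w) + hs c (bb w)) \<otimes> 1) r =
        (\<Sum>k\<in>I. V.m2s (\<omega> (dbrk (du' k) x) w + c * \<omega> (du' k) w) (?K (bb (dd k) \<otimes> 1) r))" for x w c r
      using lin_nn[OF l, of x w r] lin_expand_dd[OF l, of w r]
      by (simp only: K bilin_simps[OF HH_bilin] vs_add_left[OF V.vs_M2] vs_mult[OF V.vs_M2, symmetric] sum.distrib vs_sum[OF V.vs_M2])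
    then show ?thesis
      unfolding ad_sp_ff K sum_negf by (simp only:) (subst sum.swap, rule refl)
  qed
  have "(\<Sum>i\<in>I. \<Sum>j\<in>I. ?K ((bb (dd i) * bb (dd j)) \<otimes> 1) (rsp (f_op S i j) v)) =
      (\<Sum>p\<in>I \<times> I. ?K ((bb (dd (fst p)) * bb (dd (snd p))) \<otimes> 1) (ff p v))"
    by (rule f_op_pairs[of "\<lambda>i j. ?K ((bb (dd i) * bb (dd j)) \<otimes> 1)"])
  then have "(\<Sum>i\<in>I. \<Sum>j\<in>I. ?K ((bb (dd i) * bb (dd j)) \<otimes> 1) (rsp (f_op S i j) v))
     - (\<Sum>k\<in>I. ?K (bb (dd k) \<otimes> 1) (rsp (ad_sp S (du' k)) v)) =
     (\<Sum>p\<in>I \<times> I. ?K (mm (dd (fst p)) (dd (snd p)) \<otimes> 1) (ff p v))"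
    unfolding 4
    by (simp add: sum.distrib[symmetric] mm_def iota_bb distrib_left algebra_scale[OF H_alg] K bilin_simps[OF HH_bilin] ac_simps)
  also have "\<dots> = (\<Sum>p\<in>I \<times> I. ?K ((hs (\<omega> (dd (snd p)) (dd (fst p)) / 2) (bb sv)) \<otimes> 1) (ff p v))
     - (\<Sum>p\<in>I \<times> I. ?K (mf p \<otimes> 1) (ff p v))"
    by (simp add: mf_def M0_def sum_subtractf[symmetric] K bilin_simps[OF HH_bilin])
  also have "(\<Sum>p\<in>I \<times> I. ?K ((hs (\<omega> (dd (snd p)) (dd (fst p)) / 2) (bb sv)) \<otimes> 1) (ff p v)) = 0" (is "?z = 0")
  proof -
    \<comment> \<open>\<open>\<omega>\<close> is antisymmetric and \<open>f\<^sup>i\<^sup>j\<close>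
      symmetric in the indices.\<close>
    have "?z = - ?z"
      by (subst sum_swap[symmetric])
        (simp add: ff_swap om_anti[of "dd (fst _)"] sum_negf bilin_simps[OF HH_bilin] K vs_minus_left[OF V.vs_M2] vs_minus_left[OF vs_H])
    then have "V.m2s 2 ?z = 0" using vs_add_left[OF V.vs_M2, of 1 1 ?z] vs_one[OF V.vs_M2, of ?z] by (simp add: eq_neg_iff_add_eq_0)
    then show ?thesis using vector_space.scale_eq_0_iff[OF V.vs_M2, of 2 ?z] by simp
  qed
  finally have 5: "(\<Sum>i\<in>I. \<Sum>j\<in>I. ?K ((bb (dd i) * bb (dd j)) \<otimes> 1) (rsp (f_op S i j) v))
     - (\<Sum>k\<in>I. ?K (bb (dd k) \<otimes> 1) (rsp (ad_sp S (du' k)) v)) = - (\<Sum>p\<in>I \<times> I. ?K (mf p \<otimes> 1) (ff p v))" by simp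
  show ?thesis
    unfolding act_e actK_def 5[symmetric] 2[symmetric] rR_hat_ad
    by (simp add: bilin_simps[OF V.tens2_bilin] 1 K t_simps sum.distrib sum_subtractf tns_simps)
qed

end

section \<open>The Jacobi identity for the coefficients in three slots\<close>

context tmod
begin

definition G1 where "G1 = I1 w0 + (\<Sum>k\<in>I. A1 (dd k) * s3 (\<iota> (du' k)))"
definition G2 where "G2 = I2 w0 + (\<Sum>k\<in>I. A2 (dd k) * s3 (\<iota> (du' k)))"

lemma one_tens_values: "one_tens E (h \<otimes> 1) = s2 h" "one_tens E g0 = G2" "one_tens E 1 = 1"
proof -
  note l = alg_homD[OF one_tens_hom]
  show "one_tens E (h \<otimes> 1) = s2 h" for h by (simp add: one_tens_tns)
  show "one_tens E g0 = G2" "one_tens E 1 = 1"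
    by (simp_all add: g0_def G2_def lin_add[OF l(1)] lin_sum[OF l(1)] l(2) one_tens_tns I2_def A2_def)
qed

text \<open>The coproduct distributes \<open>\<partial>\<^sup>k\<close> over slots 2 and 3; the part
  in slot 2 is \<open>PP + YY\<close> by \<open>sum_A1_I2\<close>. This is how \<open>PP\<close>
  arises from iterating the action.\<close>

lemma id_coprod_values: "id_coprod E (h \<otimes> 1) = s1 h" "id_coprod E g0 = G1 + PP + YY" "id_coprod E 1 = 1"
proof -
  note l = alg_homD[OF id_coprod_hom]
  show 1: "id_coprod E (h \<otimes> 1) = s1 h" for h by (simp add: id_coprod_tns coprod_1 one_tens_values)
  have "id_coprod E (bb a \<otimes> \<iota> b) = A1 a * I2 b + A1 a * s3 (\<iota> b)" for a b
    by (simp add: id_coprod_tns coprod_iota lin_add[OF alg_homD(1)[OF one_tens_hom]] one_tens_tns A1_def I2_def distrib_left)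
  then show "id_coprod E g0 = G1 + PP + YY" "id_coprod E 1 = 1"
    by (simp_all add: g0_def G1_def lin_add[OF l(1)] lin_sum[OF l(1)] l(2) 1 I1_def sum.distrib sum_A1_I2 del: One_nat_def)
qed

lemma flip_id_A: "flip_id E (A1 a) = A2 a" "flip_id E (A2 a) = A1 a" "flip_id E (I1 a) = I2 a" "flip_id E (I2 a) = I1 a"
  by (simp_all add: A1_def A2_def I1_def I2_def flip_id_s)

lemma flip_values: "flip_id E G1 = G2" "flip_id E G2 = G1" "flip_id E PP = - PP" "flip_id E YY = ZZ" "flip_id E 1 = 1"
proof -
  note l = alg_homD[OF flip_id_hom]
  show "flip_id E G1 = G2" "flip_id E G2 = G1" "flip_id E YY = ZZ" "flip_id E 1 = 1"
    by (simp_all add: G1_def G2_def lin_add[OF l(1)] lin_sum[OF l(1)] l(2,3) flip_id_A flip_id_s)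
  show "flip_id E PP = - PP"
    by (subst PP', subst PP_def) (simp add: lin_sum[OF l(1)] l(3) flip_id_A A_comm)
qed

lemma coprod_id_values: "coprod_id E (h \<otimes> 1) = cop h" "coprod_id E 1 = 1"
  "coprod_id E g0 = I1 w0 + I2 w0 + (\<Sum>k\<in>I. cd (dd k) * s3 (\<iota> (du' k)))"
proof -
  note l = alg_homD[OF coprod_id_hom]
  show 1: "coprod_id E (h \<otimes> 1) = cop h" for h by (simp add: coprod_id_tns cop_def)
  show "coprod_id E 1 = 1" by (rule l)
  show "coprod_id E g0 = I1 w0 + I2 w0 + (\<Sum>k\<in>I. cd (dd k) * s3 (\<iota> (du' k)))"
    by (simp add: g0_def lin_add[OF l(1)] lin_sum[OF l(1)] 1 cop_iota coprod_id_tns cop_bb[symmetric] cop_def[symmetric])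
qed

lemma G_comm: "s2 h * G1 = G1 * s2 h" "G2 * s1 h = s1 h * G2" "A2 a * G1 = G1 * A2 a" "G2 * A1 a = A1 a * G2"
proof -
  show 1: "s2 h * G1 = G1 * s2 h" "G2 * s1 h = s1 h * G2" for h
    by (simp_all add: G1_def G2_def A1_def A2_def I1_def I2_def distrib_left distrib_right sum_distrib_left sum_distrib_right
        mult.assoc s_comm) (simp_all add: mult.assoc[symmetric] s_comm)
  show "A2 a * G1 = G1 * A2 a" "G2 * A1 a = A1 a * G2" by (simp_all add: A1_def A2_def 1)
qed

lemma s3_A: "s3 h * A1 a = A1 a * s3 h" "s3 h * A2 a = A2 a * s3 h" "s3 h * I1 a = I1 a * s3 h" "s3 h * I2 a = I2 a * s3 h"
  "s3 h * PP = PP * s3 h"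
proof -
  show 1: "s3 h * A1 a = A1 a * s3 h" "s3 h * A2 a = A2 a * s3 h" "s3 h * I1 a = I1 a * s3 h" "s3 h * I2 a = I2 a * s3 h" for a
    by (simp_all add: A1_def A2_def I1_def I2_def s_comm)
  have "s3 h * (A1 a * A2 b) = A1 a * A2 b * s3 h" for a b
    by (simp add: mult.assoc[symmetric] 1) (simp add: mult.assoc 1)
  then show "s3 h * PP = PP * s3 h" by (simp add: PP_def sum_distrib_left sum_distrib_right)
qed

lemma s3_iota_lin: "lin ds hhhs (\<lambda>u. s3 (\<iota> u))"
  using lin_comp[OF iota_lin s_lin(3)] by simp

text \<open>The part of the Jacobi identity in which nothing acts on \<open>v\<close>. The
  commutator of \<open>G2\<close> and \<open>G1\<close> consists of brackets in slot 3, which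
  \<open>contract_action\<close> supplies; \<open>PP_w0\<close> handles the rest.\<close>

lemma G_jacobi: "G2 * (G1 + PP + YY) - G1 * (G2 + ZZ - PP) = PP * coprod_id E g0"
proof -
  let ?S1 = "\<Sum>k\<in>I. A1 (dd k) * s3 (\<iota> (du' k))" and ?S2 = "\<Sum>k\<in>I. A2 (dd k) * s3 (\<iota> (du' k))"
  define \<psi> where "\<psi> x u = x * s3 (\<iota> u)" for x u
  have p: "bilin hhhs ds hhhs \<psi>"
    unfolding \<psi>_def by (intro bilinI algebra_mult_l[OF HHH_alg] lin_comp[OF s3_iota_lin algebra_mult_r[OF HHH_alg]])
  have io: "\<iota> (dbrk a b) = \<iota> a * \<iota> b - \<iota> b * \<iota> a" for a b using iota_br[of a b] by simp
  have "A2 a * s3 x * (A1 b * s3 y) = A1 b * A2 a * s3 (x * y)" "A1 b * s3 y * (A2 a * s3 x) = A1 b * A2 a * s3 (y * x)" for a b x y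
  proof -
    have "A2 a * s3 x * (A1 b * s3 y) = A2 a * A1 b * (s3 x * s3 y)"
      by (simp only: mult.assoc) (simp only: mult.assoc[symmetric] s3_A)
    then show "A2 a * s3 x * (A1 b * s3 y) = A1 b * A2 a * s3 (x * y)" by (simp add: A_comm s_mult)
    have "A1 b * s3 y * (A2 a * s3 x) = A1 b * A2 a * (s3 y * s3 x)"
      by (simp only: mult.assoc) (simp only: mult.assoc[symmetric] s3_A)
    then show "A1 b * s3 y * (A2 a * s3 x) = A1 b * A2 a * s3 (y * x)" by (simp add: s_mult)
  qed
  note AA = this
  have "?S2 * ?S1 = (\<Sum>l\<in>I. \<Sum>k\<in>I. A1 (dd l) * A2 (dd k) * s3 (\<iota> (du' k) * \<iota> (du' l)))"
    by (simp only: sum_product AA) (rule sum.swap)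
  moreover have "?S1 * ?S2 = (\<Sum>l\<in>I. \<Sum>k\<in>I. A1 (dd l) * A2 (dd k) * s3 (\<iota> (du' l) * \<iota> (du' k)))"
    by (simp only: sum_product AA)
  ultimately have S: "?S2 * ?S1 = ?S1 * ?S2 - (\<Sum>k\<in>I. \<Sum>l\<in>I. \<psi> (A1 (dd k) * A2 (dd l)) (dbrk (du' k) (du' l)))"
    by (simp add: \<psi>_def io lin_diff[OF s_lin(3)] right_diff_distrib sum_subtractf)
  have IS: "I2 w0 * ?S1 = ?S1 * I2 w0" "?S2 * I1 w0 = I1 w0 * ?S2"
    by (simp_all add: sum_distrib_left sum_distrib_right mult.assoc s3_A A_comm A_comm_l)
  have GG: "G2 * G1 = G1 * G2 - (\<Sum>k\<in>I. \<Sum>l\<in>I. \<psi> (A1 (dd k) * A2 (dd l)) (dbrk (du' k) (du' l)))"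
    unfolding G1_def G2_def distrib_left distrib_right S IS by (simp add: A_comm)
  have q: "(\<Sum>k\<in>I. \<psi> (PP * cd (dd k)) (du' k)) = PP * (\<Sum>k\<in>I. cd (dd k) * s3 (\<iota> (du' k)))"
    "(\<Sum>k\<in>I. \<psi> ((A1 (dd k) + A2 (dd k)) * PP) (du' k)) = (?S1 + ?S2) * PP"
    "(\<Sum>k\<in>I. \<psi> (A2 (dd k) * YY - A1 (dd k) * ZZ) (du' k)) = ?S2 * YY - ?S1 * ZZ"
    by (simp_all add: \<psi>_def sum_distrib_left sum_distrib_right mult.assoc distrib_right left_diff_distrib sum.distrib
        sum_subtractf s3_A)
  have "G2 * (G1 + PP + YY) - G1 * (G2 + ZZ - PP) =
      (G2 * G1 - G1 * G2) + (I1 w0 + I2 w0) * PP + (I2 w0 * YY - I1 w0 * ZZ) + (?S1 + ?S2) * PP + (?S2 * YY - ?S1 * ZZ)"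
    by (simp only: G1_def G2_def algebra_simps)
  also have "\<dots> = PP * coprod_id E g0"
    unfolding GG coprod_id_values distrib_left[of PP "I1 w0 + I2 w0"] PP_w0 contract_action[OF p, unfolded q]
    by (simp only: algebra_simps)
  finally show ?thesis .
qed

text \<open>The bracket of the \<open>sp\<close>-parts: in \<open>[f\<^sup>i\<^sup>j, f\<^sup>k\<^sup>l]\<close> the four terms give equal contributions,
  because the coefficients are symmetric.\<close>

lemma ff_bracket_sum:
  assumes B: "bilin hhhs sR s \<Phi>"
  shows "(\<Sum>p\<in>I \<times> I. \<Sum>p'\<in>I \<times> I. \<Phi> (s1 (mf p) * s2 (mf p')) (ff p (ff p' v) - ff p' (ff p v))) =
    - (\<Sum>p\<in>I \<times> I. \<Phi> (\<Sum>k\<in>I. s1 (M0 (du' k) (dd (fst p))) * s2 (M0 (dd (snd p)) (dd k))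
          - s1 (M0 (dd (snd p)) (dd k)) * s2 (M0 (du' k) (dd (fst p)))) (ff p v))"
proof -
  note Bs = bilin_simps[OF B] and s = lin_vs2[OF bilin_l[OF B]]
  define h where "h = - (1 / 2 :: 'k)"
  define r where "r x z = rsp (q x z) v" for x z
  define F where "F i j k l = \<Phi> (s1 (M0 (dd j) (dd i)) * s2 (M0 (dd l) (dd k)))" for i j k l
  have r: "bilin ds ds sR r" unfolding r_def by (rule R.rho_q_bilin)
  have rs: "r x z = r z x" for x z by (simp add: r_def q_sym)
  have Fs: "F i j k l = F j i k l" "F i j k l = F i j l k" for i j k l
    by (simp_all add: F_def M0_sym)
  have f: "rsp (f_op S i j) (rsp (f_op S k l) v) - rsp (f_op S k l) (rsp (f_op S i j) v) =
      sR (1 / 4) (sR (\<omega> (du' i) (du' k)) (r (du' j) (du' l)) + sR (\<omega> (du' j) (du' k)) (r (du' i) (du' l))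
        + sR (\<omega> (du' i) (du' l)) (r (du' j) (du' k)) + sR (\<omega> (du' j) (du' l)) (r (du' i) (du' k)))"
    if ij: "i \<in> I" "j \<in> I" and kl: "k \<in> I" "l \<in> I" for i j k l
  proof -
    note A = f_op_sp[OF ij]
    have fu: "f_op S i j x = ds h (ds (\<omega> (du' i) x) (du' j) + ds (\<omega> (du' j) x) (du' i))" for x
      by (simp add: f_op_q[OF ij] q_def h_def)
    have "rsp (f_op S i j) (rsp (f_op S k l) v) - rsp (f_op S k l) (rsp (f_op S i j) v) =
       sR h (rsp (f_op S i j) (rsp (q (du' k) (du' l)) v) - rsp (q (du' k) (du' l)) (rsp (f_op S i j) v))"
      by (simp add: R.rho_f_op[OF kl] lin_scale[OF R.rho_lin[OF A]] vs_diff[OF vs_R] h_def)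
    also have "\<dots> = sR h (r (f_op S i j (du' k)) (du' l) + r (du' k) (f_op S i j (du' l)))"
      by (simp only: R.rho_br[OF A q_sp, symmetric] q_bracket[OF A] R.rho_add[OF q_sp q_sp] r_def)
    also have "\<dots> = sR (h * h) (sR (\<omega> (du' i) (du' k)) (r (du' j) (du' l)) + sR (\<omega> (du' j) (du' k)) (r (du' i) (du' l))
        + sR (\<omega> (du' i) (du' l)) (r (du' j) (du' k)) + sR (\<omega> (du' j) (du' l)) (r (du' i) (du' k)))"
      by (simp add: fu bilin_simps[OF r] vs_add[OF vs_R] vs_mult[OF vs_R] rs[of "du' k"] add.assoc mult.assoc)
    finally show ?thesis by (simp add: h_def)
  qed
  define Q where "Q i j k l = s (\<omega> (du' i) (du' k)) (F i j k l (r (du' j) (du' l)))" for i j k l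
  have Fr: "F i j k l (sR c x) = s c (F i j k l x)" "F i j k l (x + x') = F i j k l x + F i j k l x'" for i j k l c x x'
    by (simp_all add: F_def Bs)
  have "(\<Sum>p\<in>I \<times> I. \<Sum>p'\<in>I \<times> I. \<Phi> (s1 (mf p) * s2 (mf p')) (ff p (ff p' v) - ff p' (ff p v))) =
     (\<Sum>i\<in>I. \<Sum>j\<in>I. \<Sum>k\<in>I. \<Sum>l\<in>I. F i j k l (rsp (f_op S i j) (rsp (f_op S k l) v) - rsp (f_op S k l) (rsp (f_op S i j) v)))"
    by (simp add: sum.cartesian_product' F_def mf_def ff_def)
  also have "\<dots> = (\<Sum>i\<in>I. \<Sum>j\<in>I. \<Sum>k\<in>I. \<Sum>l\<in>I. s (1 / 4) (Q i j k l + Q j i k l + Q i j l k + Q j i l k))"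
  proof (intro sum.cong refl)
    fix i j k l assume *: "i \<in> I" "j \<in> I" "k \<in> I" "l \<in> I"
    show "F i j k l (rsp (f_op S i j) (rsp (f_op S k l) v) - rsp (f_op S k l) (rsp (f_op S i j) v)) =
       s (1 / 4) (Q i j k l + Q j i k l + Q i j l k + Q j i l k)"
      unfolding f[OF *] Fr Q_def Fs(1)[of j i] Fs(2)[of _ _ l k] ..
  qed
  also have "\<dots> = (\<Sum>i\<in>I. \<Sum>j\<in>I. \<Sum>k\<in>I. \<Sum>l\<in>I. Q i j k l)"
  proof -
    have sw: "(\<Sum>i\<in>I. \<Sum>j\<in>I. g j i) = (\<Sum>i\<in>I. \<Sum>j\<in>I. g i j)" for g :: "nat \<Rightarrow> nat \<Rightarrow> 'e::comm_monoid_add" by (rule sum.swap)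
    have 1: "(\<Sum>i\<in>I. \<Sum>j\<in>I. \<Sum>k\<in>I. \<Sum>l\<in>I. Q j i k l) = (\<Sum>i\<in>I. \<Sum>j\<in>I. \<Sum>k\<in>I. \<Sum>l\<in>I. Q i j k l)"
      by (rule sw)
    have 2: "(\<Sum>k\<in>I. \<Sum>l\<in>I. Q i j l k) = (\<Sum>k\<in>I. \<Sum>l\<in>I. Q i j k l)" for i j by (rule sw)
    have 3: "(\<Sum>i\<in>I. \<Sum>j\<in>I. \<Sum>k\<in>I. \<Sum>l\<in>I. Q j i l k) = (\<Sum>i\<in>I. \<Sum>j\<in>I. \<Sum>k\<in>I. \<Sum>l\<in>I. Q i j k l)"
      by (subst sw) (simp only: 2)
    show ?thesis
      unfolding vs_sum[OF s, symmetric] sum.distrib 1 2 3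
      unfolding vs_add[OF s] vs_add_left[OF s, symmetric] by (simp add: vs_one[OF s])
  qed
  also have "\<dots> = (\<Sum>j\<in>I. \<Sum>l\<in>I. \<Sum>k\<in>I. \<Phi> (s1 (M0 (dd j) (du' k)) * s2 (M0 (dd l) (dd k))) (r (du' j) (du' l)))"
  proof -
    have l: "lin ds s (\<lambda>x. \<Phi> (s1 (M0 (dd j) x) * s2 m) r')" for j m r'
      by (intro lin_comp[OF lin_comp[OF lin_comp[OF bilin_r[OF M0_bilin] s_lin(1)] algebra_mult_l[OF HHH_alg]] bilin_l[OF B]])
    have "(\<Sum>i\<in>I. \<Sum>j\<in>I. \<Sum>k\<in>I. \<Sum>l\<in>I. Q i j k l) = (\<Sum>j\<in>I. \<Sum>i\<in>I. \<Sum>k\<in>I. \<Sum>l\<in>I. Q i j k l)"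
      by (rule sum.swap)
    also have "\<dots> = (\<Sum>j\<in>I. \<Sum>k\<in>I. \<Sum>l\<in>I. \<Sum>i\<in>I. Q i j k l)"
      by (intro sum.cong refl sum_rotate[symmetric])
    also have "\<dots> = (\<Sum>j\<in>I. \<Sum>k\<in>I. \<Sum>l\<in>I. \<Phi> (s1 (M0 (dd j) (du' k)) * s2 (M0 (dd l) (dd k))) (r (du' j) (du' l)))"
      unfolding Q_def F_def by (intro sum.cong refl lin_expand_dd[OF l, symmetric])
    also have "\<dots> = (\<Sum>j\<in>I. \<Sum>l\<in>I. \<Sum>k\<in>I. \<Phi> (s1 (M0 (dd j) (du' k)) * s2 (M0 (dd l) (dd k))) (r (du' j) (du' l)))"
      by (intro sum.cong refl sum.swap)
    finally show ?thesis .
  qed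
  also have "\<dots> = (\<Sum>j\<in>I. \<Sum>l\<in>I. T j l (r (du' j) (du' l)))" if T: "T = (\<lambda>j l. \<Phi> (\<Sum>k\<in>I. s1 (M0 (dd j) (du' k)) * s2 (M0 (dd l) (dd k))))" for T
    by (simp only: T Bs)
  finally have main: "(\<Sum>p\<in>I \<times> I. \<Sum>p'\<in>I \<times> I. \<Phi> (s1 (mf p) * s2 (mf p')) (ff p (ff p' v) - ff p' (ff p v))) =
     (\<Sum>j\<in>I. \<Sum>l\<in>I. \<Phi> (\<Sum>k\<in>I. s1 (M0 (dd j) (du' k)) * s2 (M0 (dd l) (dd k))) (r (du' j) (du' l)))" by simp
  define T where "T j l = (\<Sum>k\<in>I. s1 (M0 (dd j) (du' k)) * s2 (M0 (dd l) (dd k)))" for j l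
  have rf: "r (du' j) (du' l) = sR (- 2) (rsp (f_op S j l) v)" if "j \<in> I" "l \<in> I" for j l
    by (simp add: R.rho_f_op[OF that] r_def vs_mult[OF vs_R] vs_one[OF vs_R])
  have b2: "bilin ds ds hhhs (\<lambda>x z. s1 (M0 a x) * s2 (M0 b z))" for a b
    by (intro bilinI lin_comp[OF lin_comp[OF bilin_r[OF M0_bilin] s_lin(1)] algebra_mult_l[OF HHH_alg]]
        lin_comp[OF lin_comp[OF bilin_r[OF M0_bilin] s_lin(2)] algebra_mult_r[OF HHH_alg]])
  have Tk: "(\<Sum>k\<in>I. s1 (M0 (du' k) (dd i)) * s2 (M0 (dd j) (dd k)) - s1 (M0 (dd j) (dd k)) * s2 (M0 (du' k) (dd i))) = T i j + T j i" for i j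
    using contract_anti[OF b2, of "dd j" "dd i"] by (simp add: T_def sum_subtractf M0_sym[of "du' _"])
  have "(\<Sum>j\<in>I. \<Sum>l\<in>I. \<Phi> (T j l) (r (du' j) (du' l))) = - (\<Sum>j\<in>I. \<Sum>l\<in>I. \<Phi> (T j l) (rsp (f_op S j l) v)) - (\<Sum>j\<in>I. \<Sum>l\<in>I. \<Phi> (T j l) (rsp (f_op S j l) v))"
    unfolding sum_negf[symmetric] sum_subtractf[symmetric]
    by (intro sum.cong refl) (simp only: rf, simp only: Bs, use vs_add_left[OF s, of "- 1" "- 1"] in \<open>simp add: vs_minus_left[OF s] vs_one[OF s]\<close>)
  moreover have ab: "(\<Sum>j\<in>I. \<Sum>l\<in>I. \<Phi> (T j l) (rsp (f_op S j l) v)) = (\<Sum>j\<in>I. \<Sum>l\<in>I. \<Phi> (T l j) (rsp (f_op S j l) v))" (is "?a = ?b")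
    by (subst sum.swap) (simp only: f_op_sym)
  ultimately have "(\<Sum>j\<in>I. \<Sum>l\<in>I. \<Phi> (T j l) (r (du' j) (du' l))) = - ?a - ?b" by (simp only: ab)
  then show ?thesis
    unfolding main T_def[symmetric] Tk
    by (simp add: sum.cartesian_product' ff_def Bs sum.distrib)
qed

text \<open>\<open>X\<close> and \<open>Y\<close> stay arbitrary so that the iterated action and its
  flip are both instances.\<close>

lemma actK_actK:
  fixes \<Phi> :: "'hhh \<Rightarrow> 'r \<Rightarrow> 'z::ab_group_add"
  shows "actK (\<lambda>x r. actK (\<lambda>x' r'. \<Phi> (X x * Y x') r') r) v =
     (\<Sum>p\<in>I \<times> I. \<Sum>p'\<in>I \<times> I. \<Phi> (X (mf p \<otimes> 1) * Y (mf p' \<otimes> 1)) (ff p' (ff p v)))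
   + (\<Sum>p\<in>I \<times> I. \<Sum>k\<in>I. \<Phi> (X (mf p \<otimes> 1) * Y (bb (dd k) \<otimes> 1)) (rd (du' k) (ff p v)))
   - (\<Sum>p\<in>I \<times> I. \<Phi> (X (mf p \<otimes> 1) * Y g0) (ff p v))
   - (\<Sum>p\<in>I \<times> I. \<Phi> (X (mf p \<otimes> 1) * Y 1) (C (ff p v)))
   + (\<Sum>k\<in>I. \<Sum>p\<in>I \<times> I. \<Phi> (X (bb (dd k) \<otimes> 1) * Y (mf p \<otimes> 1)) (ff p (rd (du' k) v)))
   + (\<Sum>k\<in>I. \<Sum>l\<in>I. \<Phi> (X (bb (dd k) \<otimes> 1) * Y (bb (dd l) \<otimes> 1)) (rd (du' l) (rd (du' k) v)))
   - (\<Sum>k\<in>I. \<Phi> (X (bb (dd k) \<otimes> 1) * Y g0) (rd (du' k) v))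
   - (\<Sum>k\<in>I. \<Phi> (X (bb (dd k) \<otimes> 1) * Y 1) (C (rd (du' k) v)))
   - (\<Sum>p\<in>I \<times> I. \<Phi> (X g0 * Y (mf p \<otimes> 1)) (ff p v))
   - (\<Sum>k\<in>I. \<Phi> (X g0 * Y (bb (dd k) \<otimes> 1)) (rd (du' k) v))
   + \<Phi> (X g0 * Y g0) v + \<Phi> (X g0 * Y 1) (C v)
   - (\<Sum>p\<in>I \<times> I. \<Phi> (X 1 * Y (mf p \<otimes> 1)) (ff p (C v)))
   - (\<Sum>k\<in>I. \<Phi> (X 1 * Y (bb (dd k) \<otimes> 1)) (rd (du' k) (C v)))
   + \<Phi> (X 1 * Y g0) (C v) + \<Phi> (X 1 * Y 1) (C (C v))"
  by (simp add: actK_def sum.distrib sum_subtractf sum_negf algebra_simps)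

text \<open>Mixed products cancel between the two orders, since slots commute and
  \<open>sp d\<close> commutes with \<open>d'\<close>. The rest splits by what acts on
  \<open>v\<close>: \<open>sp d\<close> (\<open>M0_jacobi\<close>), \<open>d'\<close>
  (\<open>contract_action\<close>), nothing (\<open>G_jacobi\<close>), and \<open>C\<close>.\<close>

lemma actK_jacobi:
  assumes B: "bilin hhhs sR s \<Phi>"
  shows "actK (\<lambda>x r. \<Phi> (PP * coprod_id E x) r) v =
    actK (\<lambda>x r. actK (\<lambda>x' r'. \<Phi> (one_tens E x * id_coprod E x') r') r) v
    - actK (\<lambda>x r. actK (\<lambda>x' r'. \<Phi> (flip_id E (one_tens E x * id_coprod E x')) r') r) v"
proof -
  note Bs = bilin_simps[OF B] and s = lin_vs2[OF bilin_l[OF B]]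
  define FFs where "FFs = (\<Sum>p\<in>I \<times> I. \<Sum>p'\<in>I \<times> I. \<Phi> (s2 (mf p) * s1 (mf p')) (ff p' (ff p v)))"
  define FFs' where "FFs' = (\<Sum>p\<in>I \<times> I. \<Sum>p'\<in>I \<times> I. \<Phi> (s1 (mf p) * s2 (mf p')) (ff p' (ff p v)))"
  define FD where "FD = (\<Sum>p\<in>I \<times> I. \<Sum>k\<in>I. \<Phi> (s2 (mf p) * A1 (dd k)) (rd (du' k) (ff p v)))"
  define FD' where "FD' = (\<Sum>p\<in>I \<times> I. \<Sum>k\<in>I. \<Phi> (s1 (mf p) * A2 (dd k)) (rd (du' k) (ff p v)))"
  define F0 where "F0 = (\<Sum>p\<in>I \<times> I. \<Phi> (s2 (mf p) * G1) (ff p v))"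
  define F0' where "F0' = (\<Sum>p\<in>I \<times> I. \<Phi> (s1 (mf p) * G2) (ff p v))"
  define FP where "FP = (\<Sum>p\<in>I \<times> I. \<Phi> (s2 (mf p) * (PP + YY)) (ff p v))"
  define FP' where "FP' = (\<Sum>p\<in>I \<times> I. \<Phi> (s1 (mf p) * (ZZ - PP)) (ff p v))"
  define FC where "FC = (\<Sum>p\<in>I \<times> I. \<Phi> (s2 (mf p)) (C (ff p v)))"
  define FC' where "FC' = (\<Sum>p\<in>I \<times> I. \<Phi> (s1 (mf p)) (C (ff p v)))"
  define DD where "DD = (\<Sum>k\<in>I. \<Sum>l\<in>I. \<Phi> (A2 (dd k) * A1 (dd l)) (rd (du' l) (rd (du' k) v)))"
  define DD' where "DD' = (\<Sum>k\<in>I. \<Sum>l\<in>I. \<Phi> (A1 (dd k) * A2 (dd l)) (rd (du' l) (rd (du' k) v)))"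
  define D0 where "D0 = (\<Sum>k\<in>I. \<Phi> (A2 (dd k) * G1) (rd (du' k) v))"
  define D0' where "D0' = (\<Sum>k\<in>I. \<Phi> (A1 (dd k) * G2) (rd (du' k) v))"
  define DP where "DP = (\<Sum>k\<in>I. \<Phi> (A2 (dd k) * (PP + YY)) (rd (du' k) v))"
  define DP' where "DP' = (\<Sum>k\<in>I. \<Phi> (A1 (dd k) * (ZZ - PP)) (rd (du' k) v))"
  define DC where "DC = (\<Sum>k\<in>I. \<Phi> (A2 (dd k)) (C (rd (du' k) v)))"
  define DC' where "DC' = (\<Sum>k\<in>I. \<Phi> (A1 (dd k)) (C (rd (du' k) v)))"
  have chi_sum: "(\<Sum>k\<in>I. \<Phi> (A (dd k)) (sR (\<chi> (du' k)) r)) = \<Phi> (A sv) r" if A: "lin ds hhhs A" for A r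
    using lin_sv[OF lin_comp[OF A bilin_l[OF B]], of r] by (simp only: Bs)
  have DCv: "(\<Sum>k\<in>I. \<Phi> (A2 (dd k)) (rd (du' k) (C v))) = DC + \<Phi> ZZ (C v)"
    "(\<Sum>k\<in>I. \<Phi> (A1 (dd k)) (rd (du' k) (C v))) = DC' + \<Phi> YY (C v)"
    by (simp_all only: DC_def DC'_def rd_C Bs(2) sum.distrib chi_sum[OF A_lin(1)] chi_sum[OF A_lin(2)])
  have fm: "(\<Sum>k\<in>I. \<Sum>p\<in>I \<times> I. \<Phi> (A2 (dd k) * s1 (mf p)) (ff p (rd (du' k) v))) = FD'"
    "(\<Sum>k\<in>I. \<Sum>p\<in>I \<times> I. \<Phi> (A1 (dd k) * s2 (mf p)) (ff p (rd (du' k) v))) = FD"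
    unfolding FD_def FD'_def
    by (subst sum.swap, intro sum.cong refl, simp only: ff_comm A1_def A2_def s_comm)+
  have fc: "(\<Sum>p\<in>I \<times> I. \<Phi> (s1 (mf p)) (ff p (C v))) = FC'" "(\<Sum>p\<in>I \<times> I. \<Phi> (s2 (mf p)) (ff p (C v))) = FC"
    unfolding FC_def FC'_def by (intro sum.cong refl, simp only: ff_comm)+
  have 1: "actK (\<lambda>x r. actK (\<lambda>x' r'. \<Phi> (one_tens E x * id_coprod E x') r') r) v =
     FFs + FD - (F0 + FP) - FC + FD' + DD - (D0 + DP) - DC - F0' - D0' + \<Phi> (G2 * (G1 + PP + YY)) v + \<Phi> G2 (C v)
     - FC' - (DC' + \<Phi> YY (C v)) + \<Phi> (G1 + PP + YY) (C v) + \<Phi> 1 (C (C v))"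
    unfolding actK_actK one_tens_values id_coprod_values mult_1_left mult_1_right A1_def[symmetric] A2_def[symmetric]
      DCv fm fc G_comm(2,4)
    by (simp only: FFs_def FD_def F0_def FP_def FC_def DD_def D0_def DP_def DC_def F0'_def D0'_def add.assoc[of G1]
        distrib_left[of _ G1] Bs(1) sum.distrib)
  have 2: "actK (\<lambda>x r. actK (\<lambda>x' r'. \<Phi> (flip_id E (one_tens E x * id_coprod E x')) r') r) v =
     FFs' + FD' - (F0' + FP') - FC' + FD + DD' - (D0' + DP') - DC' - F0 - D0 + \<Phi> (G1 * (G2 + ZZ - PP)) v + \<Phi> G1 (C v)
     - FC - (DC + \<Phi> ZZ (C v)) + \<Phi> (G2 + ZZ - PP) (C v) + \<Phi> 1 (C (C v))"
  proof -
    note l = alg_homD[OF flip_id_hom]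
    have g: "G2 + - PP + ZZ = G2 + (ZZ - PP)" by simp
    have G: "G1 * A2 a = A2 a * G1" "G1 * s2 h = s2 h * G1" for a h by (simp_all only: G_comm)
    show ?thesis
      unfolding l(3) actK_actK[of \<Phi> "\<lambda>x. flip_id E (one_tens E x)" "\<lambda>x. flip_id E (id_coprod E x)"] one_tens_values id_coprod_values
        lin_add[OF l(1)] flip_values flip_id_s
      unfolding mult_1_left mult_1_right A1_def[symmetric] A2_def[symmetric] DCv fm fc G g
      by (simp only: FFs'_def FD'_def F0'_def FP'_def FC'_def DD'_def D0'_def DP'_def DC'_def F0_def D0_def add_diff_eq[of G2, symmetric]
          distrib_left[of _ G2] Bs(1) sum.distrib)
  qed
  \<comment> \<open>Commutators of two \<open>f\<^sup>i\<^sup>j\<close> become single ones by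
    \<open>ff_bracket_sum\<close>, with exactly the coefficients in
    \<open>M0_jacobi\<close>.\<close>
  have F: "FFs - FFs' = - (\<Sum>p\<in>I \<times> I. \<Phi> (PP * cop (mf p)) (ff p v)) + FP - FP'"
  proof -
    have "FFs = (\<Sum>p\<in>I \<times> I. \<Sum>p'\<in>I \<times> I. \<Phi> (s1 (mf p) * s2 (mf p')) (ff p (ff p' v)))"
      unfolding FFs_def by (subst sum.swap) (simp only: s_comm)
    then have "FFs - FFs' = (\<Sum>p\<in>I \<times> I. \<Sum>p'\<in>I \<times> I. \<Phi> (s1 (mf p) * s2 (mf p')) (ff p (ff p' v) - ff p' (ff p v)))"
      by (simp only: FFs'_def Bs(10) sum_subtractf)
    moreover have "FP - FP' = (\<Sum>p\<in>I \<times> I. \<Phi> ((s1 (mf p) + s2 (mf p)) * PP + s2 (mf p) * YY - s1 (mf p) * ZZ) (ff p v))"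
      unfolding FP_def FP'_def sum_subtractf[symmetric] Bs(9)[symmetric]
      by (intro sum.cong refl arg_cong[where f = "\<lambda>x. \<Phi> x _"]) (simp only: algebra_simps)
    moreover have "(\<Sum>p\<in>I \<times> I. \<Phi> (PP * cop (mf p)) (ff p v)) =
        (\<Sum>p\<in>I \<times> I. \<Phi> (\<Sum>k\<in>I. s1 (M0 (du' k) (dd (fst p))) * s2 (M0 (dd (snd p)) (dd k))
          - s1 (M0 (dd (snd p)) (dd k)) * s2 (M0 (du' k) (dd (fst p)))) (ff p v))
        + (\<Sum>p\<in>I \<times> I. \<Phi> ((s1 (mf p) + s2 (mf p)) * PP + s2 (mf p) * YY - s1 (mf p) * ZZ) (ff p v))"
      unfolding sum.distrib[symmetric] Bs(1)[symmetric]
      by (intro sum.cong refl arg_cong[where f = "\<lambda>x. \<Phi> x _"]) (simp only: mf_def M0_jacobi, simp only: algebra_simps)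
    ultimately show ?thesis unfolding ff_bracket_sum[OF B] add_diff_eq[symmetric] by (simp only: minus_add_distrib) simp
  qed
  define PD where "PD = (\<Sum>k\<in>I. \<Phi> (PP * cd (dd k)) (rd (du' k) v))"
  \<comment> \<open>The bracket of \<open>d'\<close> gives the bracket terms of
    \<open>contract_action\<close>; its central part \<open>\<omega> c\<close> contracts to
    \<open>- \<Phi> PP (C v)\<close>.\<close>
  have D: "DD - DD' = - PD + DP - DP' - \<Phi> PP (C v)"
  proof -
    define \<psi> where "\<psi> x u = \<Phi> x (rd u v)" for x u
    have p: "bilin hhhs ds s \<psi>"
      unfolding \<psi>_def by (intro bilinI bilin_l[OF B] lin_comp[OF rd_lin_l bilin_r[OF B]])
    have "DD = (\<Sum>k\<in>I. \<Sum>l\<in>I. \<Phi> (A1 (dd k) * A2 (dd l)) (rd (du' k) (rd (du' l) v)))"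
      unfolding DD_def by (subst sum.swap) (simp only: A_comm)
    then have "DD - DD' = (\<Sum>k\<in>I. \<Sum>l\<in>I. \<psi> (A1 (dd k) * A2 (dd l)) (dbrk (du' k) (du' l)))
       + (\<Sum>k\<in>I. \<Sum>l\<in>I. \<Phi> (A1 (dd k) * A2 (dd l)) (sR (\<omega> (du' k) (du' l)) (C v)))"
      by (simp only: DD'_def sum_subtractf[symmetric] Bs(10)[symmetric] rd_br \<psi>_def Bs(2) sum.distrib)
    also have "(\<Sum>k\<in>I. \<Sum>l\<in>I. \<Phi> (A1 (dd k) * A2 (dd l)) (sR (\<omega> (du' k) (du' l)) (C v))) = - \<Phi> PP (C v)"
    proof -
      have AB: "A1 a * A2 b = - (\<Sum>l\<in>I. hhhs (\<omega> b (du' l)) (A1 a * A2 (dd l)))" for a b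
        using lin_expand_dd[OF lin_comp[OF A_lin(2) algebra_mult_r[OF HHH_alg]], of "A1 a" b]
        by (subst om_anti) (simp add: vs_minus_left[OF vs_HHH] sum_negf)
      have "\<Phi> (A1 (dd k) * A2 (du' k)) r = - (\<Sum>l\<in>I. \<Phi> (A1 (dd k) * A2 (dd l)) (sR (\<omega> (du' k) (du' l)) r))" for k r
        by (subst AB) (simp only: Bs(3,4,7,11))
      then show ?thesis by (simp add: PP_def Bs(11) sum_negf)
    qed
    finally have a: "DD - DD' = (\<Sum>k\<in>I. \<Sum>l\<in>I. \<psi> (A1 (dd k) * A2 (dd l)) (dbrk (du' k) (du' l))) - \<Phi> PP (C v)" by simp
    have "DP - DP' = (\<Sum>k\<in>I. \<psi> ((A1 (dd k) + A2 (dd k)) * PP) (du' k)) + (\<Sum>k\<in>I. \<psi> (A2 (dd k) * YY - A1 (dd k) * ZZ) (du' k))"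
      unfolding DP_def DP'_def \<psi>_def sum_subtractf[symmetric] sum.distrib[symmetric] Bs(1,9)[symmetric]
      by (intro sum.cong refl arg_cong[where f = "\<lambda>x. \<Phi> x _"]) (simp only: algebra_simps)
    moreover have "PD = (\<Sum>k\<in>I. \<psi> (PP * cd (dd k)) (du' k))" by (simp add: PD_def \<psi>_def)
    ultimately show ?thesis unfolding a contract_action[OF p] add_diff_eq[symmetric] by (simp only:) simp
  qed
  have Z: "\<Phi> (G2 * (G1 + PP + YY)) v - \<Phi> (G1 * (G2 + ZZ - PP)) v = \<Phi> (PP * coprod_id E g0) v"
    unfolding G_jacobi[symmetric] by (simp only: Bs)
  have "actK (\<lambda>x r. \<Phi> (PP * coprod_id E x) r) v =
     - (\<Sum>p\<in>I \<times> I. \<Phi> (PP * cop (mf p)) (ff p v)) - PD + \<Phi> (PP * coprod_id E g0) v + \<Phi> PP (C v)"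
    unfolding actK_def coprod_id_values(1,2) cop_bb PD_def by simp
  \<comment> \<open>Of the two copies of \<open>\<Phi> PP (C v)\<close>, which come from
    \<open>g0\<close> and \<open>C\<close> in either order, one offsets the central term in
    \<open>D\<close>.\<close>
  also have "\<dots> = (FFs - FFs' - FP + FP') + (DD - DD' - DP + DP' + \<Phi> PP (C v))
      + (\<Phi> (G2 * (G1 + PP + YY)) v - \<Phi> (G1 * (G2 + ZZ - PP)) v) + \<Phi> PP (C v)"
    unfolding F D Z by simp
  finally show ?thesis unfolding 1 2 by (simp add: Bs(1,9))
qed

end

section \<open>Iterated pseudoactions on triple products and their trilinearity over
  \<open>H\<close>\<close>

section \<open>The Jacobi identity of the pseudoaction\<close>

context hmodule
begin

text \<open>\<open>iL\<close> and \<open>iR\<close> are the inner lifts in \<open>act_left\<close>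
  and \<open>act_right\<close>. Their balancing rules \<open>iL_bal\<close> and
  \<open>iR_bal\<close> are what makes the outer lifts well defined.\<close>

definition iL where "iL h = tensor_lift m2s m3s (tens2 M) (\<lambda>g m. tens3 M (hhtens E h 1 * coprod_id E g) m)"
definition iR where "iR h = tensor_lift m2s m3s (tens2 M) (\<lambda>g m. tens3 M (one_tens E h * id_coprod E g) m)"
definition lmult3 where "lmult3 z = tensor_lift m3s m3s (tens3 M) (\<lambda>x m. tens3 M (z * x) m)"

lemma tens3_mult_lin: "lin hhhs m3s (\<lambda>x. tens3 M (z * x) m)"
  by (rule lin_comp[OF algebra_mult_r[OF HHH_alg] bilin_l[OF tens3_bilin]])

lemma iL_lin: "lin m2s m3s (iL h)" and iL_tens2: "iL h (tens2 M g m) = tens3 M (hhtens E h 1 * coprod_id E g) m"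
proof -
  have b: "bilin hhs ms m3s (\<lambda>g m. tens3 M (hhtens E h 1 * coprod_id E g) m)"
    by (intro bilinI lin_comp[OF alg_homD(1)[OF coprod_id_hom] tens3_mult_lin] bilin_r[OF tens3_bilin])
  have bal: "tens3 M (hhtens E h 1 * coprod_id E (g * \<Delta> k)) m = tens3 M (hhtens E h 1 * coprod_id E g) (hact M k m)" for g k m
    using tens3_bal[of "hhtens E h 1 * coprod_id E g" k m] by (simp add: alg_homD(3)[OF coprod_id_hom] mult.assoc)
  show "lin m2s m3s (iL h)" unfolding iL_def by (rule balanced_lift_lin[OF tp2 b]) (rule bal)
  show "iL h (tens2 M g m) = tens3 M (hhtens E h 1 * coprod_id E g) m" unfolding iL_def
    by (rule balanced_lift_eq[OF tp2 b]) (rule bal)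
qed

lemma iR_lin: "lin m2s m3s (iR h)" and iR_tens2: "iR h (tens2 M g m) = tens3 M (one_tens E h * id_coprod E g) m"
proof -
  have b: "bilin hhs ms m3s (\<lambda>g m. tens3 M (one_tens E h * id_coprod E g) m)"
    by (intro bilinI lin_comp[OF alg_homD(1)[OF id_coprod_hom] tens3_mult_lin] bilin_r[OF tens3_bilin])
  have bal: "tens3 M (one_tens E h * id_coprod E (g * \<Delta> k)) m = tens3 M (one_tens E h * id_coprod E g) (hact M k m)" for g k m
    using tens3_bal[of "one_tens E h * id_coprod E g" k m] by (simp add: alg_homD(3)[OF id_coprod_hom] mult.assoc coassoc)
  show "lin m2s m3s (iR h)" unfolding iR_def by (rule balanced_lift_lin[OF tp2 b]) (rule bal)
  show "iR h (tens2 M g m) = tens3 M (one_tens E h * id_coprod E g) m" unfolding iR_def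
    by (rule balanced_lift_eq[OF tp2 b]) (rule bal)
qed

lemma lmult3_lin: "lin m3s m3s (lmult3 z)" and lmult3_tens3: "lmult3 z (tens3 M x m) = tens3 M (z * x) m"
proof -
  have b: "bilin hhhs ms m3s (\<lambda>x m. tens3 M (z * x) m)"
    by (intro bilinI tens3_mult_lin bilin_r[OF tens3_bilin])
  have bal: "tens3 M (z * (x * coprod_id E (\<Delta> k))) m = tens3 M (z * x) (hact M k m)" for x k m
    using tens3_bal[of "z * x" k m] by (simp add: mult.assoc)
  show "lin m3s m3s (lmult3 z)" unfolding lmult3_def by (rule balanced_lift_lin[OF tp3 b]) (rule bal)
  show "lmult3 z (tens3 M x m) = tens3 M (z * x) m" unfolding lmult3_def by (rule balanced_lift_eq[OF tp3 b]) (rule bal)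
qed

lemma flip3_lin: "lin m3s m3s (flip3 E M)" and flip3_tens3: "flip3 E M (tens3 M x m) = tens3 M (flip_id E x) m"
proof -
  have b: "bilin hhhs ms m3s (\<lambda>x m. tens3 M (flip_id E x) m)"
    by (intro bilinI lin_comp[OF alg_homD(1)[OF flip_id_hom] bilin_l[OF tens3_bilin]] bilin_r[OF tens3_bilin])
  have bal: "tens3 M (flip_id E (x * coprod_id E (\<Delta> k))) m = tens3 M (flip_id E x) (hact M k m)" for x k m
    by (simp add: alg_homD(3)[OF flip_id_hom] flip_coprod_id tens3_bal)
  show "lin m3s m3s (flip3 E M)" unfolding flip3_def by (rule balanced_lift_lin[OF tp3 b]) (rule bal)
  show "flip3 E M (tens3 M x m) = tens3 M (flip_id E x) m" unfolding flip3_def by (rule balanced_lift_eq[OF tp3 b]) (rule bal)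
qed

lemma m2_eqI: "lin m2s s F \<Longrightarrow> lin m2s s F' \<Longrightarrow> (\<And>x m. F (tens2 M x m) = F' (tens2 M x m)) \<Longrightarrow> F X = F' X"
  by (rule balanced_eqI[OF tp2])

lemma m3_eqI: "lin m3s s F \<Longrightarrow> lin m3s s F' \<Longrightarrow> (\<And>x m. F (tens3 M x m) = F' (tens3 M x m)) \<Longrightarrow> F X = F' X"
  by (rule balanced_eqI[OF tp3])

lemma flip3_lmult3: "flip3 E M (lmult3 z X) = lmult3 (flip_id E z) (flip3 E M X)"
  by (rule m3_eqI[OF lin_comp[OF lmult3_lin flip3_lin] lin_comp[OF flip3_lin lmult3_lin]])
    (simp add: lmult3_tens3 flip3_tens3 alg_homD(3)[OF flip_id_hom])

lemma iL_lin_l: "lin hhs m3s (\<lambda>h. iL h Y)"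
proof (rule linI[OF vs_HH vs_M3])
  show "iL (h + h') Y = iL h Y + iL h' Y" for h h'
    by (rule m2_eqI[OF iL_lin lin_plus[OF iL_lin iL_lin]])
      (simp add: iL_tens2 bilin_simps[OF HHH_bilin] distrib_right bilin_simps[OF tens3_bilin])
  show "iL (hhs c h) Y = m3s c (iL h Y)" for c h
    by (rule m2_eqI[OF iL_lin lin_smult[OF iL_lin]])
      (simp add: iL_tens2 bilin_simps[OF HHH_bilin] algebra_scale[OF HHH_alg] bilin_simps[OF tens3_bilin])
qed

lemma iR_lin_l: "lin hhs m3s (\<lambda>h. iR h Y)"
proof (rule linI[OF vs_HH vs_M3])
  note l = alg_homD(1)[OF one_tens_hom]
  show "iR (h + h') Y = iR h Y + iR h' Y" for h h'
    by (rule m2_eqI[OF iR_lin lin_plus[OF iR_lin iR_lin]])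
      (simp add: iR_tens2 lin_add[OF l] distrib_right bilin_simps[OF tens3_bilin])
  show "iR (hhs c h) Y = m3s c (iR h Y)" for c h
    by (rule m2_eqI[OF iR_lin lin_smult[OF iR_lin]])
      (simp add: iR_tens2 lin_scale[OF l] algebra_scale[OF HHH_alg] bilin_simps[OF tens3_bilin])
qed

lemma coprod_id_s: "coprod_id E (k \<otimes> 1) = hhtens E (\<Delta> k) 1" "coprod_id E (1 \<otimes> k) = s3 k"
  by (simp_all add: coprod_id_tns coprod_1 tns_simps)

lemma id_coprod_s: "id_coprod E (k \<otimes> 1) = s1 k" "id_coprod E (1 \<otimes> k) = one_tens E (\<Delta> k)"
  by (simp_all add: id_coprod_tns coprod_1 alg_homD(2)[OF one_tens_hom])

lemma iL_bal: "iL h (lmult2 M (k \<otimes> 1) Y) = iL (h * \<Delta> k) Y"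
  by (rule m2_eqI[OF lin_comp[OF lmult2_lin iL_lin] iL_lin])
    (simp add: lmult2_tens2 iL_tens2 alg_homD(3)[OF coprod_id_hom] coprod_id_s mult.assoc[symmetric] tns_simps)

lemma iR_bal: "iR h (lmult2 M (1 \<otimes> k) Y) = iR (h * \<Delta> k) Y"
  by (rule m2_eqI[OF lin_comp[OF lmult2_lin iR_lin] iR_lin])
    (simp add: lmult2_tens2 iR_tens2 alg_homD(3)[OF id_coprod_hom] alg_homD(3)[OF one_tens_hom] id_coprod_s mult.assoc)

lemma iL_lmult: "iL (z * h) (lmult2 M (1 \<otimes> k) Y) = lmult3 (hhtens E z k) (iL h Y)"
proof (rule m2_eqI[OF lin_comp[OF lmult2_lin iL_lin] lin_comp[OF iL_lin lmult3_lin]])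
  fix x m
  have "hhtens E (z * h) 1 * s3 k = hhtens E z k * hhtens E h 1" by (simp add: s3_def tns_simps)
  then show "iL (z * h) (lmult2 M (1 \<otimes> k) (tens2 M x m)) = lmult3 (hhtens E z k) (iL h (tens2 M x m))"
    by (simp add: lmult2_tens2 iL_tens2 lmult3_tens3 alg_homD(3)[OF coprod_id_hom] coprod_id_s mult.assoc[symmetric])
qed

lemma iR_lmult: "iR ((g \<otimes> k) * h) (lmult2 M (f \<otimes> 1) Y) = lmult3 (hhtens E (f \<otimes> g) k) (iR h Y)"
proof (rule m2_eqI[OF lin_comp[OF lmult2_lin iR_lin] lin_comp[OF iR_lin lmult3_lin]])
  fix x m
  have "s2 g * s3 k * one_tens E h * s1 f = s2 g * (s3 k * s1 f) * one_tens E h"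
    by (simp only: mult.assoc one_tens_comm)
  also have "\<dots> = s1 f * s2 g * s3 k * one_tens E h"
    by (simp only: s_comm mult.assoc[symmetric])
  finally have "one_tens E ((g \<otimes> k) * h) * s1 f = hhtens E (f \<otimes> g) k * one_tens E h"
    by (simp add: alg_homD(3)[OF one_tens_hom] one_tens_tns hhtens_s)
  then show "iR ((g \<otimes> k) * h) (lmult2 M (f \<otimes> 1) (tens2 M x m)) = lmult3 (hhtens E (f \<otimes> g) k) (iR h (tens2 M x m))"
    by (simp add: lmult2_tens2 iR_tens2 lmult3_tens3 alg_homD(3)[OF id_coprod_hom] id_coprod_s mult.assoc[symmetric])
qed

end

context tmod
begin

lemma act_left_lin: "lin L.m2s V.m3s (\<lambda>X. act_left E L V act X m)"
  and act_left_tens2: "act_left E L V act (tens2 L h a) m = V.iL h (act a m)"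
proof -
  have b: "bilin hhs L.ms V.m3s (\<lambda>h a. V.iL h (act a m))"
    by (intro bilinI V.iL_lin_l lin_comp[OF act_lin_l V.iL_lin])
  have bal: "V.iL (h * \<Delta> k) (act a m) = V.iL h (act (hact L k a) m)" for h k a
    using act_hact[of k a 1 m] by (simp add: V.hact_1 V.iL_bal)
  show "lin L.m2s V.m3s (\<lambda>X. act_left E L V act X m)"
    unfolding act_left_def V.iL_def[symmetric] by (rule balanced_lift_lin[OF L.tp2 b]) (rule bal)
  show "act_left E L V act (tens2 L h a) m = V.iL h (act a m)"
    unfolding act_left_def V.iL_def[symmetric] by (rule balanced_lift_eq[OF L.tp2 b]) (rule bal)
qed

lemma act_right_lin: "lin V.m2s V.m3s (act_right E V act b)"
  and act_right_tens2: "act_right E V act b (tens2 V h m) = V.iR h (act b m)"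
proof -
  have b: "bilin hhs V.ms V.m3s (\<lambda>h m. V.iR h (act b m))"
    by (intro bilinI V.iR_lin_l lin_comp[OF act_lin V.iR_lin])
  have bal: "V.iR (h * \<Delta> k) (act b m) = V.iR h (act b (hact V k m))" for h k m
    by (simp add: act_mult V.iR_bal)
  show "lin V.m2s V.m3s (act_right E V act b)"
    unfolding act_right_def[abs_def] V.iR_def[symmetric] by (rule balanced_lift_lin[OF V.tp2 b]) (rule bal)
  show "act_right E V act b (tens2 V h m) = V.iR h (act b m)"
    unfolding act_right_def V.iR_def[symmetric] by (rule balanced_lift_eq[OF V.tp2 b]) (rule bal)
qed

lemma br_bil: "h_bilinear E L L br" and L_free: "free_generator L e"
  and br_e: "br e e = (\<Sum>k\<in>I. tens2 L (bb (dd k) \<otimes> bb (du' k)) e)"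
  using psL by (auto simp: pseudoalgebra_H_def)

text \<open>With \<open>act_right_hact\<close> and \<open>flip3_lmult3\<close> this is trilinearity
  over \<open>H\<close>, which reduces the Jacobi identity to free generators.\<close>

lemma act_left_hact:
  "act_left E L V act (br (hact L f a) (hact L g b)) (hact V h m) = V.lmult3 (hhtens E (f \<otimes> g) h) (act_left E L V act (br a b) m)"
proof -
  have "br (hact L f a) (hact L g b) = lmult2 L (f \<otimes> g) (br a b)" using br_bil by (simp add: h_bilinear_def)
  moreover have "act_left E L V act (lmult2 L (f \<otimes> g) X) (hact V h m) = V.lmult3 (hhtens E (f \<otimes> g) h) (act_left E L V act X m)" for X
    by (rule L.m2_eqI[OF lin_comp[OF L.lmult2_lin act_left_lin] lin_comp[OF act_left_lin V.lmult3_lin]])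
      (simp add: L.lmult2_tens2 act_left_tens2 act_mult V.iL_lmult)
  ultimately show ?thesis by simp
qed

lemma act_right_hact:
  "act_right E V act (hact L f a) (act (hact L g b) (hact V h m)) = V.lmult3 (hhtens E (f \<otimes> g) h) (act_right E V act a (act b m))"
proof -
  have 1: "act (hact L f a) m = lmult2 V (f \<otimes> 1) (act a m)" for m
    using act_hact[of f a 1 m] by (simp add: V.hact_1)
  have "act_right E V act (hact L f a) (lmult2 V (g \<otimes> h) Y) = V.lmult3 (hhtens E (f \<otimes> g) h) (act_right E V act a Y)" for Y
    by (rule V.m2_eqI[OF lin_comp[OF V.lmult2_lin act_right_lin] lin_comp[OF act_right_lin V.lmult3_lin]])
      (simp add: V.lmult2_tens2 act_right_tens2 1 V.iR_lmult)
  then show ?thesis by (simp add: act_hact)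
qed

lemma actK_lin: "lin s s' F \<Longrightarrow> F (actK K v) = actK (\<lambda>x r. F (K x r)) v"
  unfolding actK_def by (simp only: lin_add lin_diff lin_neg lin_sum)

lemma act_jacobi_e:
  "act_left E L V act (br e e) (t 1 v) =
     act_right E V act e (act e (t 1 v)) - flip3 E V (act_right E V act e (act e (t 1 v)))"
proof -
  let ?\<Phi> = "\<lambda>x r. tens3 V x (t 1 r)"
  have B: "bilin hhhs sR V.m3s ?\<Phi>"
    by (intro bilinI bilin_l[OF V.tens3_bilin] lin_comp[OF bilin_r[OF t_bilin] bilin_r[OF V.tens3_bilin]])
  have P: "hhtens E (\<Sum>k\<in>I. bb (dd k) \<otimes> bb (du' k)) 1 = PP"
    by (simp add: bilin_simps[OF HHH_bilin] PP_def A1_def A2_def s1_def s2_def tns_simps)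
  have "act_left E L V act (br e e) (t 1 v) = V.iL (\<Sum>k\<in>I. bb (dd k) \<otimes> bb (du' k)) (act e (t 1 v))"
    by (simp only: br_e lin_sum[OF act_left_lin] act_left_tens2 lin_sum[OF V.iL_lin_l])
  also have "\<dots> = actK (\<lambda>x r. ?\<Phi> (PP * coprod_id E x) r) v"
    by (simp only: act_actK actK_lin[OF V.iL_lin] V.iL_tens2 P)
  finally have 1: "act_left E L V act (br e e) (t 1 v) = actK (\<lambda>x r. ?\<Phi> (PP * coprod_id E x) r) v" .
  have 2: "act_right E V act e (act e (t 1 v)) = actK (\<lambda>x r. actK (\<lambda>x' r'. ?\<Phi> (one_tens E x * id_coprod E x') r') r) v"
    by (simp only: act_actK actK_lin[OF act_right_lin] act_right_tens2 actK_lin[OF V.iR_lin] V.iR_tens2)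
  show ?thesis
    unfolding 1 2 actK_lin[OF V.flip3_lin] V.flip3_tens3 by (rule actK_jacobi[OF B])
qed

lemma t_span: "m \<in> module.span V.ms {t h v | h v. True}"
  by (rule tensor_span[OF tpV])

lemma act_left_lin_r: "lin V.ms V.m3s (act_left E L V act X)"
proof (rule linI[OF V.vs_M V.vs_M3])
  show "act_left E L V act X (m + m') = act_left E L V act X m + act_left E L V act X m'" for m m'
    by (rule L.m2_eqI[OF act_left_lin lin_plus[OF act_left_lin act_left_lin]])
      (simp add: act_left_tens2 lin_add[OF act_lin] lin_add[OF V.iL_lin])
  show "act_left E L V act X (V.ms c m) = V.m3s c (act_left E L V act X m)" for c m
    by (rule L.m2_eqI[OF act_left_lin lin_smult[OF act_left_lin]])
      (simp add: act_left_tens2 lin_scale[OF act_lin] lin_scale[OF V.iL_lin])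
qed

text \<open>In the flipped term \<open>f\<close> and \<open>g\<close> occur in the opposite order,
  and \<open>flip_id\<close> restores it; so one multiplier can be taken out of all three
  terms.\<close>

lemma pseudo_module: "pseudo_module E L br V act"
proof -
  have "act_left E L V act (br a b) m = act_right E V act a (act b m) - flip3 E V (act_right E V act b (act a m))" for a b m
  proof -
    obtain f where f: "a = hact L f e" using L_free unfolding free_generator_def by blast
    obtain g where g: "b = hact L g e" using L_free unfolding free_generator_def by blast
    show ?thesis
    proof (rule tensor_eqI[OF tpV act_left_lin_r])
      show "lin V.ms V.m3s (\<lambda>m. act_right E V act a (act b m) - flip3 E V (act_right E V act b (act a m)))"
        by (intro lin_minus lin_comp[OF act_lin act_right_lin] lin_comp[OF lin_comp[OF act_lin act_right_lin] V.flip3_lin])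
      fix h v
      have h: "t h v = hact V h (t 1 v)" by (simp add: hact_t)
      have "flip_id E (hhtens E (g \<otimes> f) h) = hhtens E (f \<otimes> g) h"
        by (simp add: flip_id_tns flip_tns s3_def tns_simps)
      then show "act_left E L V act (br a b) (t h v) =
          act_right E V act a (act b (t h v)) - flip3 E V (act_right E V act b (act a (t h v)))"
        unfolding f g h act_left_hact act_right_hact V.flip3_lmult3
        by (simp add: act_jacobi_e lin_diff[OF V.lmult3_lin])
    qed
  qed
  then show ?thesis using act_bil V.hm by (simp add: pseudo_module_def)
qed

end

section \<open>Submodules containing some \<open>1 \<otimes> v\<close>, and nontriviality of the
  action\<close>

section \<open>Submodules\<close>

context sympl
begin

text \<open>The two halves of \<open>q\<close> give two expansions of \<open>A w\<close>: along
  \<open>du'\<close>, by skewness of \<open>A\<close>, and along the images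
  \<open>A (dd k)\<close>.\<close>

lemma sp_q_sum: assumes A: "A \<in> sp S" shows "(\<lambda>v. ds 2 (A v)) = (\<Sum>k\<in>I. q (du' k) (A (dd k)))"
proof
  fix w
  have "A w = (\<Sum>k\<in>I. ds (\<omega> (A (dd k)) w) (du' k))"
    using expand_du[of "A w"] by (simp add: sp_om[OF A] om_anti[of w])
  moreover have "A w = (\<Sum>k\<in>I. ds (\<omega> (du' k) w) (A (dd k)))"
    by (rule lin_expand_dd[OF sp_lin[OF A]])
  ultimately have "A w + A w = (\<Sum>k\<in>I. q (du' k) (A (dd k))) w"
    by (simp add: q_def sum_apply sum.distrib)
  then show "ds 2 (A w) = (\<Sum>k\<in>I. q (du' k) (A (dd k))) w"
    using vs_add_left[OF vs_d, of 1 1 "A w"] by (simp add: vs_one[OF vs_d])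
qed

end

context sp_module
begin

lemma rho_q_sum: "A \<in> sp S \<Longrightarrow> s 2 (\<rho> A u) = (\<Sum>k\<in>I. \<rho> (q (du' k) (A (dd k))) u)"
  by (simp only: rho_scale[symmetric] sp_q_sum rho_sum q_sp)

end

context tmod
begin

lemma t1_eq_0: "t 1 v = 0 \<Longrightarrow> v = 0"
  using sym_word[of "[]" 0 1 0 0 0 v] lin_zero[OF sym_lin] by (simp add: vs_one[OF vs_R])

lemma efc_q: "\<exists>\<phi>. efc \<phi> (t 1 v) = t 1 (- rsp (q x z) v)"
  using efc_top[of _ "[]" 0 1 x z v] sfun[of 2 0 1 x z]
  by (auto simp: vs_zero_left[OF vs_R] vs_mult[OF vs_R] vs_minus_left[OF vs_R] vs_one[OF vs_R] numeral_2_eq_2)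

lemma rR_split: "A \<in> sp S \<Longrightarrow> rR ((a, z), A) v = rd a v + sR z (C v) + rsp A v"
proof -
  assume A: "A \<in> sp S"
  have "rR ((0, z), 0) v = sR z (C v)"
    using rR_scale[OF sp_0, of z 0 1 v] by (simp add: cc_def vs_zero[OF vs_d] zero_fun_def)
  then show ?thesis
    using rR_add[OF sp_0 sp_0, of a 0 0 z v] rR_add[OF sp_0 A, of a z 0 0 v] by (simp add: rd_def zero_prod_def)
qed

text \<open>Triangular elimination: order 2 functionals give \<open>sp d\<close>, order 1 gives
  \<open>d\<close> after subtracting the \<open>sp\<close>-terms and letters acting on
  \<open>v\<close>, and order 0 gives \<open>c\<close>.\<close>

lemma submodule_stable:
  assumes W: "pseudo_submodule V act W" and A: "A \<in> sp S" and v: "t 1 v \<in> W"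
  shows "t 1 (rR ((a, z), A) v) \<in> W"
proof -
  interpret V': vector_space V.ms by (rule V.vs_M)
  have sW: "V'.subspace W" and hW: "\<And>h w. w \<in> W \<Longrightarrow> hact V h w \<in> W"
    using W by (auto simp: pseudo_submodule_def)
  note cl = V'.subspace_add[OF sW] V'.subspace_diff[OF sW] V'.subspace_neg[OF sW] V'.subspace_sum[OF sW] V'.subspace_scale[OF sW]
  have q: "t 1 (rsp (q x z) v) \<in> W" for x z
  proof -
    obtain \<phi> where "efc \<phi> (t 1 v) = t 1 (- rsp (q x z) v)" using efc_q by blast
    then have "- t 1 (rsp (q x z) v) \<in> W" using efc_W[OF W v, of \<phi>] by (simp add: t_simps)
    then show ?thesis using cl(3) by fastforce
  qed
  have r: "t 1 (rsp B v) \<in> W" if B: "B \<in> sp S" for B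
  proof -
    have "V.ms 2 (t 1 (rsp B v)) \<in> W"
      unfolding t_simps(4)[symmetric] R.rho_q_sum[OF B] t_simps(12) by (intro cl q)
    from cl(5)[OF this, of "1 / 2"] show ?thesis by (simp add: vs_mult[OF V.vs_M] vs_one[OF V.vs_M])
  qed
  have io: "t (\<iota> a) v \<in> W" for a using hW[OF v, of "\<iota> a"] by (simp add: hact_t)
  have f: "t 1 (\<Sum>i\<in>I. \<Sum>j\<in>I. sR (\<phi> (y i * y j)) (rsp (f_op S i j) v)) \<in> W" for \<phi>
    unfolding t_simps(12,4) by (intro cl r f_op_sp)
  have d: "t 1 (rd x v) \<in> W" for x
  proof -
    let ?\<phi> = "sfun 1 1 0 x x"
    note p = symbol_functionalD[OF sfun[of 1 1 0 x x]]
    have k: "?\<phi> 1 = 0" "?\<phi> (y k) = \<omega> x (dd k)" for k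
      using kills_bar(1,4)[OF p(1,2)] p(3)[of "[dd k]"] by simp_all
    have "(\<Sum>k\<in>I. V.ms (\<omega> x (dd k)) (t 1 (rd (du' k) v))) = t 1 (rd x v)"
      unfolding lin_expand_du[OF rd_lin_l, of x v] by (simp only: t_simps)
    then have "t 1 (rd x v) = t 1 (\<Sum>i\<in>I. \<Sum>j\<in>I. sR (?\<phi> (y i * y j)) (rsp (f_op S i j) v))
       - (\<Sum>k\<in>I. V.ms (\<omega> x (dd k)) (t 1 (rsp (ad_sp S (du' k)) v) - t (\<iota> (du' k)) v)) - efc ?\<phi> (t 1 v)"
      unfolding efc_1[OF p(1)] k rR_hat_ad
      by (simp add: t_simps vs_zero_left[OF vs_R] vs_add[OF V.vs_M] vs_diff[OF V.vs_M] sum.distrib sum_subtractf)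
    then show ?thesis by (simp only:) (intro cl f r io ad_sp_sp efc_W[OF W v])
  qed
  have c: "t 1 (C v) \<in> W"
  proof -
    let ?\<phi> = "sfun 0 1 0 0 0"
    note p = symbol_functionalD[OF sfun[of 0 1 0 0 0]]
    have "?\<phi> 1 = 1" using p(3)[of "[]"] by simp
    then have "t 1 (C v) = efc ?\<phi> (t 1 v) - t 1 (\<Sum>i\<in>I. \<Sum>j\<in>I. sR (?\<phi> (y i * y j)) (rsp (f_op S i j) v))
       + (\<Sum>k\<in>I. V.ms (?\<phi> (y k)) (t 1 (rd (du' k) v) + t 1 (rsp (ad_sp S (du' k)) v) - t (\<iota> (du' k)) v))"
      unfolding efc_1[OF p(1)] rR_hat_ad by (simp add: vs_one[OF vs_R] t_simps)
    then show ?thesis by (simp only:) (intro cl f r io d ad_sp_sp efc_W[OF W v])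
  qed
  show ?thesis unfolding rR_split[OF A] t_simps(2,4) by (intro cl c d r A)
qed

lemma submodule_full:
  assumes irr: "irreducible_lie_module (lie_d'_sp S) sR rR"
    and W: "pseudo_submodule V act W" and v: "t 1 v \<in> W" "v \<noteq> 0"
  shows "W = UNIV"
proof -
  interpret V': vector_space V.ms by (rule V.vs_M)
  interpret R': vector_space sR by (rule vs_R)
  have sW: "V'.subspace W" and hW: "\<And>h w. w \<in> W \<Longrightarrow> hact V h w \<in> W"
    using W by (auto simp: pseudo_submodule_def)
  let ?R = "{v. t 1 v \<in> W}"
  have "R'.subspace ?R"
    by (rule R'.subspaceI) (auto simp: t_simps V'.subspace_0[OF sW] V'.subspace_add[OF sW] V'.subspace_scale[OF sW])
  moreover have "\<forall>x\<in>lcarr (lie_d'_sp S). \<forall>v\<in>?R. rR x v \<in> ?R"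
    using submodule_stable[OF W] by (auto simp: lie_sum_def lie_sp_def)
  ultimately have "?R = {0} \<or> ?R = UNIV" using irr unfolding irreducible_lie_module_def by blast
  then have R: "t 1 u \<in> W" for u using v by auto
  have "t h u \<in> W" for h u using hW[OF R[of u], of h] by (simp add: hact_t)
  then have "{t h v | h v. True} \<subseteq> W" by auto
  from V'.span_minimal[OF this sW] t_span show ?thesis by auto
qed

lemma rsp_zero_if_act_zero:
  assumes "\<And>m. act e m = 0" and A: "A \<in> sp S"
  shows "rsp A v = 0"
proof -
  have "efc \<phi> m = 0" for \<phi> m
    using lin_zero[OF V.Psi_lin] by (simp add: efc_def assms(1))
  then have "rsp (q x z) v = 0" for x z
    using efc_q[of v x z] t1_eq_0[of "- rsp (q x z) v"] by auto
  then have "sR 2 (rsp A v) = 0" by (simp add: R.rho_q_sum[OF A])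
  then show ?thesis using vector_space.scale_eq_0_iff[OF vs_R, of 2] by simp
qed

end

section \<open>Passage from \<open>R\<close> to its factor \<open>U\<close>, and the theorem\<close>

section \<open>Outer tensor products\<close>

locale box =
  fixes G :: "('k::field, 'g::ab_group_add) lie" and F :: "('k, 'f::ab_group_add) lie"
    and sP :: "'k \<Rightarrow> 'p::ab_group_add \<Rightarrow> 'p" and \<pi>
    and sU :: "'k \<Rightarrow> 'u::ab_group_add \<Rightarrow> 'u" and \<rho>
    and sR :: "'k \<Rightarrow> 'r::ab_group_add \<Rightarrow> 'r" and tR :: "'p \<Rightarrow> 'u \<Rightarrow> 'r"
  assumes P: "lie_module G sP \<pi>" and U: "lie_module F sU \<rho>" and T: "tensor_product sP sU sR tR"
    and carr0: "0 \<in> lcarr G" "0 \<in> lcarr F"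
    and irrR: "irreducible_lie_module (lie_sum G F) sR (box_action sR tR \<pi> \<rho>)"
begin

abbreviation "sl \<equiv> slice sP sU sR tR"

lemma vs: "vector_space sP" "vector_space sU" "vector_space sR"
  and pi_lin: "x \<in> lcarr G \<Longrightarrow> lin sP sP (\<pi> x)" and rho_lin: "A \<in> lcarr F \<Longrightarrow> lin sU sU (\<rho> A)"
  using P U irrR by (auto simp: lie_module_def irreducible_lie_module_def)

lemma pi_0: "\<pi> 0 p = 0"
  using P carr0(1) unfolding lie_module_def by (metis add_0 add_cancel_right_left)

lemma box_bilin:
  assumes x: "x \<in> lcarr G" and A: "A \<in> lcarr F"
  shows "bilin sP sU sR (\<lambda>p u. tR (\<pi> x p) u + tR p (\<rho> A u))"
  using lin_plus[OF lin_comp[OF pi_lin[OF x] bilin_l[OF tensor_bilin[OF T]]] bilin_l[OF tensor_bilin[OF T]]]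
    lin_plus[OF bilin_r[OF tensor_bilin[OF T]] lin_comp[OF rho_lin[OF A] bilin_r[OF tensor_bilin[OF T]]]]
  by (rule bilinI)

lemma box: assumes "x \<in> lcarr G" "A \<in> lcarr F"
  shows box_lin: "lin sR sR (box_action sR tR \<pi> \<rho> (x, A))"
    and box_eq: "box_action sR tR \<pi> \<rho> (x, A) (tR p u) = tR (\<pi> x p) u + tR p (\<rho> A u)"
  using tensor_lift_lin[OF T box_bilin[OF assms]] tensor_lift_eq[OF T box_bilin[OF assms]] by (auto simp: box_action_def)

lemma slice_box:
  assumes f: "lin sP (*) f" and x: "x \<in> lcarr G" and A: "A \<in> lcarr F"
  shows "sl f (box_action sR tR \<pi> \<rho> (x, A) r) = sl (\<lambda>p. f (\<pi> x p)) r + \<rho> A (sl f r)"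
proof (rule tensor_eqI[OF T])
  note fx = lin_comp[OF pi_lin[OF x] f]
  show "lin sR sU (\<lambda>r. sl f (box_action sR tR \<pi> \<rho> (x, A) r))"
    by (rule lin_comp[OF box_lin[OF x A] slice_lin[OF T f]])
  show "lin sR sU (\<lambda>r. sl (\<lambda>p. f (\<pi> x p)) r + \<rho> A (sl f r))"
    by (intro lin_plus slice_lin[OF T fx] lin_comp[OF slice_lin[OF T f] rho_lin[OF A]])
  show "sl f (box_action sR tR \<pi> \<rho> (x, A) (tR p u)) = sl (\<lambda>p. f (\<pi> x p)) (tR p u) + \<rho> A (sl f (tR p u))" for p u
    by (simp add: box_eq[OF x A] lin_add[OF slice_lin[OF T f]] slice_eq[OF T f] slice_eq[OF T fx] lin_scale[OF rho_lin[OF A]])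
qed

text \<open>So \<open>f \<otimes> id\<close> is a homomorphism of modules from \<open>R\<close> to
  \<open>U\<close>; it transports the conditions found on \<open>R\<close>.\<close>

lemma slice_rho: "lin sP (*) f \<Longrightarrow> A \<in> lcarr F \<Longrightarrow> sl f (box_action sR tR \<pi> \<rho> (0, A) r) = \<rho> A (sl f r)"
proof -
  assume f: "lin sP (*) f" and A: "A \<in> lcarr F"
  have z: "lin sP (*) (\<lambda>p. 0 :: 'k)" using lin_const0[OF vs(1) vs_field] .
  have "sl (\<lambda>p. f (\<pi> 0 p)) r = 0"
    unfolding pi_0 lin_zero[OF f]
    by (rule tensor_eqI[OF T slice_lin[OF T z] lin_const0[OF vs(3,2)]]) (simp add: slice_eq[OF T z] vs_zero_left[OF vs(2)])
  then show ?thesis using slice_box[OF f carr0(1) A] by simp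
qed

text \<open>As \<open>R\<close> is nonzero, some slice is, hence so is \<open>f\<close>; scaling
  gives \<open>f p = 1\<close>, and \<open>u \<mapsto> tR p u\<close> is then a right inverse of the
  slice.\<close>

lemma section_exists: obtains f p where "lin sP (*) f" "f p = 1" "\<And>u. sl f (tR p u) = u"
proof -
  obtain r :: 'r where "r \<noteq> 0" using irrR unfolding irreducible_lie_module_def by blast
  then obtain f where f: "lin sP (*) f" "sl f r \<noteq> 0" using slice_separates[OF T] by blast
  have "\<exists>p. f p \<noteq> 0"
  proof (rule ccontr)
    assume n: "\<not> ?thesis"
    have "sl f r = 0"
      by (rule tensor_eqI[OF T slice_lin[OF T f(1)] lin_const0[OF vs(3,2)]])
        (use n in \<open>simp add: slice_eq[OF T f(1)] vs_zero_left[OF vs(2)]\<close>)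
    with f show False by simp
  qed
  then obtain p where p: "f p \<noteq> 0" by blast
  have 1: "f (sP (1 / f p) p) = 1" using p by (simp add: lin_scale[OF f(1)])
  then show ?thesis using that[OF f(1) 1] by (simp add: slice_eq[OF T f(1)] vs_one[OF vs(2)])
qed

text \<open>To a submodule \<open>W\<close> of \<open>U\<close> corresponds the set
  \<open>?Z\<close> of elements of \<open>R\<close> with all slices in \<open>W\<close>. It is
  stable under both algebras, because the action of the first only replaces \<open>f\<close> by
  another functional.\<close>

lemma irreducible_right: "irreducible_lie_module F sU \<rho>"
  unfolding irreducible_lie_module_def
proof (intro conjI allI impI)
  show "lie_module F sU \<rho>" by (rule U)
  obtain f p where f: "lin sP (*) f" "f p = 1" "\<And>u. sl f (tR p u) = u" by (rule section_exists) (rule that)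
  obtain r :: 'r where "r \<noteq> 0" using irrR unfolding irreducible_lie_module_def by blast
  then show "\<exists>u::'u. u \<noteq> 0" using slice_separates[OF T] by blast
  fix W assume W: "module.subspace sU W \<and> (\<forall>x\<in>lcarr F. \<forall>m\<in>W. \<rho> x m \<in> W)"
  interpret sU: vector_space sU by (rule vs)
  interpret sR: vector_space sR by (rule vs)
  let ?Z = "{r. \<forall>f. lin sP (*) f \<longrightarrow> sl f r \<in> W}"
  have "sR.subspace ?Z"
    using W by (intro sR.subspaceI)
      (auto simp: lin_zero[OF slice_lin[OF T]] lin_add[OF slice_lin[OF T]] lin_scale[OF slice_lin[OF T]]
        sU.subspace_0 sU.subspace_add sU.subspace_scale)
  moreover have "\<forall>x\<in>lcarr (lie_sum G F). \<forall>r\<in>?Z. box_action sR tR \<pi> \<rho> x r \<in> ?Z"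
  proof (intro ballI CollectI allI impI)
    fix x r f assume x: "x \<in> lcarr (lie_sum G F)" and r: "r \<in> ?Z" and f: "lin sP (*) f"
    obtain a A where a: "x = (a, A)" "a \<in> lcarr G" "A \<in> lcarr F" using x by (auto simp: lie_sum_def)
    show "sl f (box_action sR tR \<pi> \<rho> x r) \<in> W"
      unfolding a slice_box[OF f a(2,3)]
      using W r f lin_comp[OF pi_lin[OF a(2)] f] a(3) by (auto intro!: sU.subspace_add)
  qed
  ultimately have "?Z = {0} \<or> ?Z = UNIV"
    using irrR unfolding irreducible_lie_module_def by blast
  then show "W = {0} \<or> W = UNIV"
  proof
    assume Z: "?Z = {0}"
    have "u = 0" if "u \<in> W" for u
    proof -
      have "tR p u \<in> ?Z" using W that by (auto simp: slice_eq[OF T] sU.subspace_scale)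
      then have "tR p u = 0" using Z by auto
      then show ?thesis using f(3)[of u] lin_zero[OF slice_lin[OF T f(1)]] by simp
    qed
    then show ?thesis using W sU.subspace_0 by auto
  next
    assume Z: "?Z = UNIV"
    have "u \<in> W" for u
    proof -
      have "tR p u \<in> ?Z" using Z by simp
      then have "sl f (tR p u) \<in> W" using f(1) by simp
      then show ?thesis by (simp add: f)
    qed
    then show ?thesis by auto
  qed
qed

lemma finite_dim_right: assumes "finite_dim sR" shows "finite_dim sU"
proof -
  obtain f p where f: "lin sP (*) f" "f p = 1" "\<And>u. sl f (tR p u) = u" by (rule section_exists) (rule that)
  obtain B where B: "finite B" "module.span sR B = UNIV" using assms by (auto simp: finite_dim_def)
  interpret l: Vector_Spaces.linear sR sU "sl f" by (rule slice_lin[OF T f(1)])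
  have "u \<in> module.span sU (sl f ` B)" for u
  proof -
    have "sl f (tR p u) \<in> sl f ` module.span sR B" using B(2) by simp
    then show ?thesis by (simp add: l.span_image f)
  qed
  then have "module.span sU (sl f ` B) = UNIV" by blast
  then show ?thesis using B(1) vs by (auto simp: finite_dim_def)
qed

end

theorem theorem7p1:
  fixes S :: "('k::{alg_closed_field, field_char_0}, 'd::ab_group_add) symplectic"
    and E :: "('k, 'd, 'h::ring_1, 'hh::ring_1, 'hhh::ring_1) env"
    and L :: "('k, 'h, 'hh, 'hhh, 'l::ab_group_add, 'l2::ab_group_add, 'l3::ab_group_add) hmod"
    and e :: 'l and br :: "'l \<Rightarrow> 'l \<Rightarrow> 'l2"
    and sP :: "'k \<Rightarrow> 'p::ab_group_add \<Rightarrow> 'p" and \<pi> :: "'d \<times> 'k \<Rightarrow> 'p \<Rightarrow> 'p"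
    and sU :: "'k \<Rightarrow> 'u::ab_group_add \<Rightarrow> 'u" and \<rho> :: "('d \<Rightarrow> 'd) \<Rightarrow> 'u \<Rightarrow> 'u"
    and sR :: "'k \<Rightarrow> 'r::ab_group_add \<Rightarrow> 'r" and tR :: "'p \<Rightarrow> 'u \<Rightarrow> 'r"
    and V :: "('k, 'h, 'hh, 'hhh, 'm::ab_group_add, 'm2::ab_group_add, 'm3::ab_group_add) hmod"
    and tV :: "'h \<Rightarrow> 'r \<Rightarrow> 'm" and act :: "'l \<Rightarrow> 'm \<Rightarrow> 'm2"
  assumes "symplectic_data S"
    and "enveloping_algebra (lie_d S) E"
    and "pseudoalgebra_H S E L e br"
    and "lie_module (lie_d' S) sP \<pi>"
    and "lie_module (lie_sp S) sU \<rho>"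
    and "tensor_product sP sU sR tR"
    and "finite_dim sR"
    and "irreducible_lie_module (lie_d'_sp S) sR (box_action sR tR \<pi> \<rho>)"
    and "\<not> trivial_lie_module (lie_sp S) \<rho>"
    and "\<forall>i\<in>{1..half S}. \<not> fundamental_representation S i sU \<rho>"
    and "tensor_module S E L e sR (box_action sR tR \<pi> \<rho>) V tV act"
  shows "irreducible_pseudo_module E L br V act"
proof -
  interpret sympl S using assms(1) by unfold_locales
  interpret sympl_env S E
    by (intro sympl_env.intro sympl_axioms enveloping.intro) (use assms(2) vs_d in \<open>simp_all add: lie_d_def\<close>)
  let ?R = "box_action sR tR \<pi> \<rho>"
  interpret M: tmod S E L V e br sR ?R tV act
    by (intro tmod.intro sympl_env_axioms hmodule.intro enveloping_axioms hmodule_axioms.intro tmod_axioms.intro)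
      (use assms(3,8,11) in \<open>simp_all add: pseudoalgebra_H_def tensor_module_def irreducible_lie_module_def\<close>)
  interpret B: box "lie_d' S" "lie_sp S" sP \<pi> sU \<rho> sR tR
    by (rule box.intro) (use assms(4-6,8) sp_0 in \<open>simp_all add: lie_d'_def lie_sp_def\<close>)
  interpret U: sp_module_ac S sU \<rho>
    using assms(5) B.irreducible_right B.finite_dim_right[OF assms(7)]
    by (intro sp_module_ac.intro sympl_ac.intro sympl_axioms sp_module.intro sp_module_axioms.intro sp_module_ac_axioms.intro)
  have slice: "B.sl f (?R (0, A) r) = \<rho> A (B.sl f r)" if "lin sP (*) f" "A \<in> sp S" for f A r
    using B.slice_rho[OF that(1)] that(2) by (simp add: lie_sp_def)
  have "W = {0} \<or> W = UNIV" if W: "pseudo_submodule V act W" for W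
  proof (cases "\<exists>v. tV 1 v \<in> W \<and> v \<noteq> 0")
    case True
    then show ?thesis using M.submodule_full[OF assms(8) W] by blast
  next
    case False
    have "\<not> (\<exists>x r. x \<noteq> 0 \<and> r \<noteq> 0 \<and> (\<forall>z. ?R (0, q x z) r = sR (\<omega> z x) r))"
    proof
      assume "\<exists>x r. x \<noteq> 0 \<and> r \<noteq> 0 \<and> (\<forall>z. ?R (0, q x z) r = sR (\<omega> z x) r)"
      then obtain x r where x: "x \<noteq> 0" and r: "r \<noteq> 0" and xr: "\<And>z. ?R (0, q x z) r = sR (\<omega> z x) r" by blast
      \<comment> \<open>A functional with nonzero slice keeps the vector nonzero in
        \<open>U\<close>, where the classification applies.\<close>
      obtain f where f: "lin sP (*) f" and u: "B.sl f r \<noteq> 0" using slice_separates[OF assms(6) r] by blast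
      have "\<rho> (q x z) (B.sl f r) = sU (\<omega> z x) (B.sl f r)" for z
        using slice[OF f q_sp, of x z r] by (simp add: xr lin_scale[OF slice_lin[OF assms(6) f]])
      from U.fundamental_if_stabilised[OF x u this] assms(10) show False by blast
    qed
    moreover have "\<not> (\<exists>P. lin ds sR P \<and> (\<exists>x. P x \<noteq> 0) \<and> (\<forall>x z. ?R (0, q x x) (P z) + sR 2 (?R (0, q x z) (P x)) = 0))"
    proof
      assume "\<exists>P. lin ds sR P \<and> (\<exists>x. P x \<noteq> 0) \<and> (\<forall>x z. ?R (0, q x x) (P z) + sR 2 (?R (0, q x z) (P x)) = 0)"
      then obtain P x0 where P: "lin ds sR P" "P x0 \<noteq> 0"
        and eq: "\<And>x z. ?R (0, q x x) (P z) + sR 2 (?R (0, q x z) (P x)) = 0" by blast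
      obtain f where f: "lin sP (*) f" and u: "B.sl f (P x0) \<noteq> 0" using slice_separates[OF assms(6) P(2)] by blast
      note l = slice_lin[OF assms(6) f]
      have "\<rho> (q x x) (B.sl f (P z)) + sU 2 (\<rho> (q x z) (B.sl f (P x))) = 0" for x z
        using arg_cong[OF eq[of x z], of "B.sl f"]
        by (simp add: lin_add[OF l] lin_scale[OF l] lin_zero[OF l] slice[OF f q_sp])
      from U.fundamental_or_trivial_if_linear[OF lin_comp[OF P(1) l] u this] assms(9,10) show False by blast
    qed
    ultimately show ?thesis using M.symbol_dichotomy[OF W] False by blast
  qed
  moreover have "\<exists>a m. act a m \<noteq> 0"
  proof (rule ccontr)
    assume "\<not> ?thesis"
    \<comment> \<open>If \<open>e\<close> acted by zero, so would \<open>sp d\<close> on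
      \<open>R\<close>, and by a slice with right inverse on \<open>U\<close>, which is not
      trivial.\<close>
    then have z: "?R (0, A) r = 0" if "A \<in> sp S" for A r
      using M.rsp_zero_if_act_zero[OF _ that] by blast
    obtain f p where f: "lin sP (*) f" "f p = 1" "\<And>u. B.sl f (tR p u) = u"
      by (rule B.section_exists) (rule that)
    have "\<rho> A u = 0" if "A \<in> sp S" for A u
      using slice[OF f(1) that, of "tR p u"] z[OF that] f(3) lin_zero[OF slice_lin[OF assms(6) f(1)]] by simp
    then show False using assms(9) by (simp add: trivial_lie_module_def lie_sp_def)
  qed
  ultimately show ?thesis using M.pseudo_module by (simp add: irreducible_pseudo_module_def)
qed

end
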